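(* Let $\lambda$ be a cardinal and suppose $\mathrm{FA}_{\lambda^+}$ holds. Then there exists a $\lambda^+$-complete $\lambda^{++}$-super-Souslin tree.
   Context: Let $\kappa=\lambda^+$. A c.o.i. is an order-preserving injective continuous map $\pi$ from a set of ordinals $y$, closed in its supremum, into the ordinals. $\binom{\mu}{\theta}$ is the set of images of c.o.i.'s $\pi:\theta\to\mu$. $\mathrm{ssup}(x)=\sup\{\alpha+1\mid\alpha\in x\}$, $\mathrm{cl}(x)=x\cup\{\alpha<\mathrm{ssup}(x)\mid\sup(x\cap\alpha)=\alpha>0\}$. $\mathcal P_\kappa$ is the class of triples $(\mathbb P,\le,\mathbb Q)$, $(\mathbb P,\le)$ a forcing notion with top element $1$, $1\in\mathbb Q\subseteq\mathbb P$, such that: (1) each $p$ has $x_p\in[\kappa^+]^{<\kappa}$, $x_1=\emptyset$, $q\le p\Rightarrow x_q\supseteq x_p$, and for $x\in[\kappa^+]^{<\kappa}$ with $x\supseteq x_p$ there is $q\le p$ with $x_q=x$; (2) with $\mathbb P_y=\{p\mid x_p\subseteq y\}$, $\mathbb Q_y=\mathbb Q\cap\mathbb P_y$: $\mathbb P_\emptyset=\{1\}$, $\mathbb P_\kappa\subseteq H_\kappa$; (3) every c.o.i. $\pi:y\to\kappa^+$ ($y\subseteq\kappa^+$) acts on $\mathbb P_y$ by $p\mapsto\pi.p$ so that $\pi.p\in\mathbb P$, $x_{\pi.p}=\pi[x_p]$, $\mathbb Q$ is preserved, $\pi.q\le\pi.p\iff q\le p$, the identity acts trivially, $\pi'.(\pi.p)=(\pi'\circ\pi).p$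 when $\mathrm{im}(\pi)\subseteq\mathrm{dom}(\pi')$, and $\pi.p=\pi'.p$ whenever $x_p\subseteq\mathrm{dom}(\pi')$ and $\pi\restriction x_p=\pi'\restriction x_p$; (4) for $p$ and $\alpha<\kappa^+$ there is a unique strongest $r$ with $x_r=x_p\cap\alpha$ and $p\le r$, written $p\restriction\alpha$, with $p\in\mathbb Q\Rightarrow p\restriction\alpha\in\mathbb Q$ and $q\le p\Rightarrow q\restriction\alpha\le p\restriction\alpha$; (5) if $\xi<\kappa$ and $p_\eta=p_{\eta'}\restriction\mathrm{ssup}(x_{p_\eta})$ for $\eta<\eta'<\xi$, there is a unique $p$ with $x_p=\bigcup_\eta x_{p_\eta}$ and $p_\eta=p\restriction\mathrm{ssup}(x_{p_\eta})$, lying in $\mathbb Q$ if all $p_\eta$ do; (6) $x_q$ is closed in its supremum for $q\in\mathbb Q$, and every $p$ has $q\le p$ in $\mathbb Q$ with $x_q=\mathrm{cl}(x_p)$; (7) if $\xi<\kappa$, $\langle q_\eta\mid\eta<\xi\rangle$ is decreasing in $\mathbb Q$, $x=\bigcup_\eta x_{q_\eta}$, $\alpha<\mathrm{ssup}(x)$, $r\in\mathbb Q_{\mathrm{ssup}(x\cap\alpha)}$ is a lower bound of $\langle q_\eta\restriction\alpha\rangle$, then some $q\in\mathbb Q$ is a lower bound of $\langle q_\eta\rangle$ with $q\restriction\mathrm{ssup}(x\cap\alpha)=r$ and $x_q=\mathrm{cl}(x_r\cup x)$; (8) if $p\in\mathbb Q$, $\alpha<\mathrm{ssup}(x_p)$,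 $q\in\mathbb P_\alpha$, $q\le p\restriction\alpha$, then $p,q$ have a unique greatest lower bound $r$, with $x_r=x_q\cup x_p$ and $r\restriction\alpha=q$. A nonempty $D\subseteq\mathbb P$ is sharply dense if, with $x_D=\bigcap_{p\in D}x_p$, each $p$ has $q\in D$, $q\le p$, $x_q=\mathrm{cl}(x_p\cup x_D)$. A sharply dense system is $\{D_x\mid x\in\binom{\kappa^+}{\theta}\}$ for some $\theta<\kappa$ with each $D_x$ sharply dense, $x_{D_x}=x$, and $p\in D_x\iff\pi.p\in D_{\pi[x]}$ for every c.o.i. $\pi:y\to\kappa^+$ with $x\subseteq x_p\subseteq y$. $\mathrm{FA}_\kappa$: for every triple in $\mathcal P_\kappa$ and sharply dense systems $\{\mathcal D_i\mid i<\kappa\}$ there is a filter $G$ on $\mathbb P$ with $G\cap D\ne\emptyset$ for every $D\in\bigcup_i\mathcal D_i$. Trees: a tree $(T,<_T)$ is a partial order in which each downward cone is well-ordered; $T_\alpha$ is its $\alpha$-th level. A $\lambda^{++}$-tree has every level $T_\alpha$ ($\alpha<\lambda^{++}$) nonempty of size $<\lambda^{++}$ and $T_{\lambda^{++}}=\emptyset$. It is splitting if every node has at least two immediate successors, normal if for $\alpha<\beta<\lambda^{++}$ each $u\in T_\alpha$ has some $v\in T_\beta$ above it, and $\lambda^+$-complete if every chain of size $<\lambda^+$ has an element $x$ with every member of the chain $\le_T x$. $T^\lambda$ is the set of all injections $a:\lambda\to T_\alpha$ for some $\alpha<\lambda^{++}$; for $a,b\in T^\lambda$, $a<_T b$ means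 $a(i)<_T b(i)$ for all $i<\lambda$; $[T^\lambda]^2=\{(a,b)\mid a<_T b\}$. A $\lambda^{++}$-super-Souslin tree is a normal splitting $\lambda^{++}$-tree for which there is $F:[T^\lambda]^2\to\lambda^+$ such that for all $a,b,c\in T^\lambda$ with $a<_T b$ and $a<_T c$, if $F(a,b)=F(a,c)$ then $b(i)$ and $c(i)$ are $<_T$-comparable for some $i<\lambda$. *)

theory Defs
  imports "HOL-Library.Equipollence"
begin

section \<open>Ordinals below \<open>\<kappa>\<^sup>+\<close>\<close>

text \<open>
  Throughout, the cardinal \<open>\<kappa>\<^sup>+\<close> is rendered as a well-ordered type \<open>'i\<close> of that order type
  (see \<open>card_succ\<close>): its elements are the ordinals below \<open>\<kappa>\<^sup>+\<close>, and the ordinal \<open>\<alpha> < \<kappa>\<^sup>+\<close>,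
  viewed as the set of its predecessors, is \<open>{..<\<alpha>}\<close>, while \<open>\<kappa>\<^sup>+\<close> itself is \<open>UNIV\<close>.
\<close>

definition infinite_cardinal :: "'i::wellorder \<Rightarrow> bool" where
  "infinite_cardinal \<mu> \<longleftrightarrow> infinite {..<\<mu>} \<and> (\<forall>\<alpha><\<mu>. {..<\<alpha>} \<prec> {..<\<mu>})"

text \<open>For initial segments \<open>A\<close>, \<open>B\<close>: \<open>B\<close> is the least ordinal of cardinality greater than that of \<open>A\<close>.\<close>

definition card_succ :: "'i::wellorder set \<Rightarrow> 'i set \<Rightarrow> bool" where
  "card_succ A B \<longleftrightarrow> A \<prec> B \<and> (\<forall>\<alpha>. {..<\<alpha>} \<subset> B \<longrightarrow> {..<\<alpha>} \<lesssim> A)"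

text \<open>
  \<open>osup\<close> and \<open>ssup\<close> are meaningful for sets that are bounded in \<open>'i\<close>, in particular (by regularity)
  for all sets of fewer than \<open>\<kappa>\<^sup>+\<close> ordinals, and they are only applied to such sets below.
  The supremum of the empty set is \<open>0\<close>.
\<close>

definition ozero :: "'i::wellorder" where
  "ozero = (LEAST \<alpha>. True)"

definition osup :: "'i::wellorder set \<Rightarrow> 'i" where
  "osup x = (LEAST \<beta>. \<forall>\<alpha>\<in>x. \<alpha> \<le> \<beta>)"

definition ssup :: "'i::wellorder set \<Rightarrow> 'i" where
  "ssup x = (LEAST \<beta>. \<forall>\<alpha>\<in>x. \<alpha> < \<beta>)"

definition is_limit_of :: "'i::wellorder \<Rightarrow> 'i set \<Rightarrow> bool" where
  "is_limit_of \<alpha> x \<longleftrightarrow> osup (x \<inter> {..<\<alpha>}) = \<alpha> \<and> ozero < \<alpha>"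

definition cl :: "'i::wellorder set \<Rightarrow> 'i set" where
  "cl x = x \<union> {\<alpha>. \<alpha> < ssup x \<and> is_limit_of \<alpha> x}"

text \<open>Possibly unbounded sets, such as \<open>UNIV\<close>, are allowed here, so \<open>\<alpha> < sup x\<close> is unfolded.\<close>

definition closed_in_sup :: "'i::wellorder set \<Rightarrow> bool" where
  "closed_in_sup x \<longleftrightarrow> (\<forall>\<alpha>. (\<exists>\<beta>\<in>x. \<alpha> < \<beta>) \<and> is_limit_of \<alpha> x \<longrightarrow> \<alpha> \<in> x)"

text \<open>
  Closed, order-preserving, injective, continuous maps \<open>\<pi> : y \<rightarrow> \<kappa>\<^sup>+\<close>.  The domain \<open>y\<close> is given
  explicitly and the values of \<open>\<pi>\<close> outside \<open>y\<close> play no role.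
\<close>

definition coi :: "'i::wellorder set \<Rightarrow> ('i \<Rightarrow> 'i) \<Rightarrow> bool" where
  "coi y \<pi> \<longleftrightarrow> closed_in_sup y \<and> strict_mono_on y \<pi> \<and>
     (\<forall>\<alpha>\<in>y. is_limit_of \<alpha> y \<longrightarrow> \<pi> \<alpha> = osup (\<pi> ` (y \<inter> {..<\<alpha>})))"

text \<open>The images in \<open>\<kappa>\<^sup>+\<close> of the c.o.i.'s with domain \<open>\<theta>\<close>.\<close>

definition coi_images :: "'i::wellorder \<Rightarrow> 'i set set" where
  "coi_images \<theta> = {\<pi> ` {..<\<theta>} | \<pi>. coi {..<\<theta>} \<pi>}"


section \<open>A universe of sets\<close>

text \<open>
  \<open>'i hset\<close> is the type of all sets that are hereditarily of size at most \<open>|'i|\<close>, obtained from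
  well-founded trees by identifying trees that describe the same set.  It comes with its
  membership relation \<open>u \<in> elts v\<close>; it is extensional and well-founded and has every
  collection of at most \<open>|'i|\<close> members as an element (see the three lemmas at the end of this
  section).
\<close>

datatype 'i pre_set = Pre (sub: "'i \<Rightarrow> 'i pre_set option")

definition branches :: "'i pre_set \<Rightarrow> 'i pre_set set" where
  "branches s = {t. Some t \<in> range (sub s)}"

inductive same_set :: "'i pre_set \<Rightarrow> 'i pre_set \<Rightarrow> bool" where
  "\<forall>a\<in>branches s. \<exists>b\<in>branches t. same_set a b \<Longrightarrow>
   \<forall>b\<in>branches t. \<exists>a\<in>branches s. same_set a b \<Longrightarrow> same_set s t"

lemma pre_set_induct:
  assumes "\<And>s. (\<And>t. t \<in> branches s \<Longrightarrow> P t) \<Longrightarrow> P s"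
  shows "P s"
proof (induction s)
  case (Pre f)
  show ?case
  proof (rule assms)
    fix t
    assume "t \<in> branches (Pre f)"
    then have "Some t \<in> range f"
      by (simp add: branches_def)
    then show "P t"
      by (rule Pre.IH) simp
  qed
qed

lemma same_set_iff:
  "same_set s t \<longleftrightarrow> (\<forall>a\<in>branches s. \<exists>b\<in>branches t. same_set a b) \<and>
                   (\<forall>b\<in>branches t. \<exists>a\<in>branches s. same_set a b)"
  by (subst same_set.simps) blast

lemma same_set_refl: "same_set s s"
proof (induction s rule: pre_set_induct)
  case (1 s)
  then show ?case
    by (subst same_set_iff) blast
qed

lemma same_set_sym: "same_set s t \<Longrightarrow> same_set t s"
proof (induction s arbitrary: t rule: pre_set_induct)
  case (1 s)
  from \<open>same_set s t\<close> have
    "\<forall>a\<in>branches s. \<exists>b\<in>branches t. same_set a b"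
    "\<forall>b\<in>branches t. \<exists>a\<in>branches s. same_set a b"
    by (subst (asm) same_set_iff, simp)+
  then show ?case
    using "1.IH" by (subst same_set_iff) blast
qed

lemma same_set_trans: "same_set s t \<Longrightarrow> same_set t u \<Longrightarrow> same_set s u"
proof (induction s arbitrary: t u rule: pre_set_induct)
  case (1 s)
  have st: "\<forall>a\<in>branches s. \<exists>b\<in>branches t. same_set a b"
    "\<forall>b\<in>branches t. \<exists>a\<in>branches s. same_set a b"
    using \<open>same_set s t\<close> by (subst (asm) same_set_iff, simp)+
  have tu: "\<forall>a\<in>branches t. \<exists>b\<in>branches u. same_set a b"
    "\<forall>b\<in>branches u. \<exists>a\<in>branches t. same_set a b"
    using \<open>same_set t u\<close> by (subst (asm) same_set_iff, simp)+
  show ?case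
    by (subst same_set_iff) (meson st tu "1.IH")
qed

quotient_type 'i hset = "'i pre_set" / same_set
  by (intro equivpI reflpI sympI transpI) (blast intro: same_set_refl same_set_sym same_set_trans)+

definition elts :: "'i hset \<Rightarrow> 'i hset set" where
  "elts u = abs_hset ` branches (rep_hset u)"

lemma abs_hset_eq_iff: "abs_hset s = abs_hset t \<longleftrightarrow> same_set s t"
  using Quotient_rel[OF Quotient_hset] by (auto intro: same_set_refl)

lemma elts_abs: "elts (abs_hset s) = abs_hset ` branches s"
proof -
  have "same_set (rep_hset (abs_hset s)) s"
    using Quotient_rep_abs[OF Quotient_hset] same_set_refl by blast
  then have "\<forall>a\<in>branches (rep_hset (abs_hset s)). \<exists>b\<in>branches s. abs_hset a = abs_hset b"
    "\<forall>b\<in>branches s. \<exists>a\<in>branches (rep_hset (abs_hset s)). abs_hset a = abs_hset b"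
    unfolding abs_hset_eq_iff by (subst (asm) same_set_iff, simp)+
  then show ?thesis
    unfolding elts_def image_def by (metis (no_types, lifting))
qed

lemma elts_inject: "elts u = elts v \<longleftrightarrow> u = v"
proof
  assume eq: "elts u = elts v"
  have "same_set (rep_hset u) (rep_hset v)"
    using eq unfolding elts_def
    by (subst same_set_iff) (metis (no_types, lifting) abs_hset_eq_iff image_iff)
  then show "u = v"
    by (metis Quotient_abs_rep[OF Quotient_hset] abs_hset_eq_iff)
qed simp

lemma wfp_elts: "wfp (\<lambda>u v :: 'i hset. u \<in> elts v)"
proof (rule wfpUNIVI)
  fix P :: "'i hset \<Rightarrow> bool" and v
  assume step: "\<forall>v. (\<forall>u. u \<in> elts v \<longrightarrow> P u) \<longrightarrow> P v"
  have "P (abs_hset s)" for s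
  proof (induction s rule: pre_set_induct)
    case (1 s)
    have "P u" if "u \<in> elts (abs_hset s)" for u
      using that 1 unfolding elts_abs by blast
    then show ?case
      using step by blast
  qed
  then show "P v"
    by (metis Quotient_abs_rep[OF Quotient_hset])
qed

lemma ex_elts:
  fixes A :: "'i hset set"
  shows "(\<exists>u. elts u = A) \<longleftrightarrow> A \<lesssim> (UNIV :: 'i set)"
proof
  assume "\<exists>u. elts u = A"
  then obtain u where u: "elts u = A" ..
  have "branches (rep_hset u) \<subseteq> (the \<circ> sub (rep_hset u)) ` UNIV"
    by (auto simp: branches_def image_iff) (metis option.sel)
  then have "A \<subseteq> (\<lambda>i. abs_hset (the (sub (rep_hset u) i))) ` UNIV"
    unfolding u[symmetric] elts_def by auto
  then show "A \<lesssim> (UNIV :: 'i set)"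
    by (meson image_lepoll lepoll_trans subset_imp_lepoll)
next
  assume "A \<lesssim> (UNIV :: 'i set)"
  then obtain f :: "'i hset \<Rightarrow> 'i" where f: "inj_on f A"
    by (auto simp: lepoll_def)
  define s where "s = Pre (\<lambda>i. if i \<in> f ` A then Some (rep_hset (inv_into A f i)) else None)"
  have "branches s = rep_hset ` A"
  proof (intro equalityI subsetI)
    fix t
    assume "t \<in> branches s"
    then obtain i where "(if i \<in> f ` A then Some (rep_hset (inv_into A f i)) else None) = Some t"
      unfolding s_def branches_def by force
    then show "t \<in> rep_hset ` A"
      by (metis imageI inv_into_into option.distinct(1) option.inject)
  next
    fix t
    assume "t \<in> rep_hset ` A"
    then obtain u where "u \<in> A" "t = rep_hset u" by blast
    with f have "sub s (f u) = Some t"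
      by (simp add: s_def)
    then show "t \<in> branches s"
      unfolding branches_def by (metis mem_Collect_eq rangeI)
  qed
  then have "elts (abs_hset s) = A"
    by (simp add: elts_abs image_image Quotient_abs_rep[OF Quotient_hset])
  then show "\<exists>u. elts u = A" ..
qed

text \<open>\<open>H\<^sub>\<kappa>\<close>: the sets whose transitive closure has size less than \<open>\<kappa>\<close>.\<close>

definition trcl_set :: "'i hset \<Rightarrow> 'i hset set" where
  "trcl_set u = {v. (\<lambda>v w. v \<in> elts w)\<^sup>+\<^sup>+ v u}"

definition H :: "'i::wellorder \<Rightarrow> 'i hset set" where
  "H \<kappa> = {u. trcl_set u \<prec> {..<\<kappa>}}"


section \<open>The class of forcing notions\<close>

text \<open>
  A triple \<open>(\<P>, \<le>, \<Q>)\<close> bundled with the data it carries: the top element, the map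
  \<open>p \<mapsto> x\<^sub>p\<close> (\<open>supp\<close>) and the action \<open>p \<mapsto> \<pi>.p\<close> of the c.o.i.'s \<open>\<pi> : y \<rightarrow> \<kappa>\<^sup>+\<close>
  (\<open>act y \<pi>\<close>).  The relation \<open>leq q p\<close> means that \<open>q\<close> is stronger than \<open>p\<close>.
\<close>

record ('i, 'p) forcing =
  conds :: "'p set"
  leq :: "'p \<Rightarrow> 'p \<Rightarrow> bool"
  core :: "'p set"
  one :: "'p"
  supp :: "'p \<Rightarrow> 'i set"
  act :: "'i set \<Rightarrow> ('i \<Rightarrow> 'i) \<Rightarrow> 'p \<Rightarrow> 'p"

definition forcing_notion :: "('i, 'p) forcing \<Rightarrow> bool" where
  "forcing_notion F \<longleftrightarrow>
     reflp_on (conds F) (leq F) \<and> transp_on (conds F) (leq F) \<and>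
     one F \<in> conds F \<and> (\<forall>p\<in>conds F. leq F p (one F))"

definition conds_on :: "('i, 'p) forcing \<Rightarrow> 'i set \<Rightarrow> 'p set" where
  "conds_on F y = {p \<in> conds F. supp F p \<subseteq> y}"

definition core_on :: "('i, 'p) forcing \<Rightarrow> 'i set \<Rightarrow> 'p set" where
  "core_on F y = core F \<inter> conds_on F y"

definition is_restr :: "('i::wellorder, 'p) forcing \<Rightarrow> 'p \<Rightarrow> 'i \<Rightarrow> 'p \<Rightarrow> bool" where
  "is_restr F p \<alpha> r \<longleftrightarrow>
     r \<in> conds F \<and> supp F r = supp F p \<inter> {..<\<alpha>} \<and> leq F p r \<and>
     (\<forall>r'\<in>conds F. supp F r' = supp F p \<inter> {..<\<alpha>} \<and> leq F p r' \<longrightarrow> leq F r r')"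

definition restr :: "('i::wellorder, 'p) forcing \<Rightarrow> 'p \<Rightarrow> 'i \<Rightarrow> 'p" where
  "restr F p \<alpha> = (THE r. is_restr F p \<alpha> r)"

definition is_glb :: "('i, 'p) forcing \<Rightarrow> 'p \<Rightarrow> 'p \<Rightarrow> 'p \<Rightarrow> bool" where
  "is_glb F p q r \<longleftrightarrow>
     r \<in> conds F \<and> leq F r p \<and> leq F r q \<and>
     (\<forall>r'\<in>conds F. leq F r' p \<and> leq F r' q \<longrightarrow> leq F r' r)"

definition axiom_supp :: "'i::wellorder \<Rightarrow> ('i, 'p) forcing \<Rightarrow> bool" where
  "axiom_supp \<kappa> F \<longleftrightarrow>
     (\<forall>p\<in>conds F. supp F p \<prec> {..<\<kappa>}) \<and>
     supp F (one F) = {} \<and>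
     (\<forall>p\<in>conds F. \<forall>q\<in>conds F. leq F q p \<longrightarrow> supp F p \<subseteq> supp F q) \<and>
     (\<forall>p\<in>conds F. \<forall>x. x \<prec> {..<\<kappa>} \<and> supp F p \<subseteq> x \<longrightarrow>
        (\<exists>q\<in>conds F. leq F q p \<and> supp F q = x))"

definition axiom_small :: "'i::wellorder \<Rightarrow> ('i, 'i hset) forcing \<Rightarrow> bool" where
  "axiom_small \<kappa> F \<longleftrightarrow> conds_on F {} = {one F} \<and> conds_on F {..<\<kappa>} \<subseteq> H \<kappa>"

definition axiom_act :: "('i::wellorder, 'p) forcing \<Rightarrow> bool" where
  "axiom_act F \<longleftrightarrow>
     (\<forall>y \<pi>. coi y \<pi> \<longrightarrow>
        (\<forall>p\<in>conds_on F y.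
           act F y \<pi> p \<in> conds F \<and>
           supp F (act F y \<pi> p) = \<pi> ` supp F p \<and>
           (p \<in> core F \<longrightarrow> act F y \<pi> p \<in> core F) \<and>
           ((\<forall>\<alpha>\<in>y. \<pi> \<alpha> = \<alpha>) \<longrightarrow> act F y \<pi> p = p)) \<and>
        (\<forall>p\<in>conds_on F y. \<forall>q\<in>conds_on F y.
           leq F (act F y \<pi> q) (act F y \<pi> p) \<longleftrightarrow> leq F q p)) \<and>
     (\<forall>y \<pi> y' \<pi>'. coi y \<pi> \<and> coi y' \<pi>' \<longrightarrow>
        (\<pi> ` y \<subseteq> y' \<longrightarrow>
           (\<forall>p\<in>conds_on F y. act F y' \<pi>' (act F y \<pi> p) = act F y (\<pi>' \<circ> \<pi>) p)) \<and>
        (\<forall>p\<in>conds_on F y. supp F p \<subseteq> y' \<and> (\<forall>\<alpha>\<in>supp F p. \<pi> \<alpha> = \<pi>' \<alpha>) \<longrightarrow>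
           act F y \<pi> p = act F y' \<pi>' p))"

definition axiom_restr :: "('i::wellorder, 'p) forcing \<Rightarrow> bool" where
  "axiom_restr F \<longleftrightarrow>
     (\<forall>p\<in>conds F. \<forall>\<alpha>.
        (\<exists>!r. is_restr F p \<alpha> r) \<and>
        (p \<in> core F \<longrightarrow> restr F p \<alpha> \<in> core F) \<and>
        (\<forall>q\<in>conds F. leq F q p \<longrightarrow> leq F (restr F q \<alpha>) (restr F p \<alpha>)))"

definition is_amalgam ::
  "('i::wellorder, 'p) forcing \<Rightarrow> 'i \<Rightarrow> ('i \<Rightarrow> 'p) \<Rightarrow> 'p \<Rightarrow> bool" where
  "is_amalgam F \<xi> s p \<longleftrightarrow>
     p \<in> conds F \<and> supp F p = (\<Union>\<eta><\<xi>. supp F (s \<eta>)) \<and>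
     (\<forall>\<eta><\<xi>. s \<eta> = restr F p (ssup (supp F (s \<eta>))))"

definition axiom_amalgam :: "'i::wellorder \<Rightarrow> ('i, 'p) forcing \<Rightarrow> bool" where
  "axiom_amalgam \<kappa> F \<longleftrightarrow>
     (\<forall>\<xi><\<kappa>. \<forall>s.
        (\<forall>\<eta><\<xi>. s \<eta> \<in> conds F) \<and>
        (\<forall>\<eta> \<eta>'. \<eta> < \<eta>' \<and> \<eta>' < \<xi> \<longrightarrow> s \<eta> = restr F (s \<eta>') (ssup (supp F (s \<eta>)))) \<longrightarrow>
        (\<exists>!p. is_amalgam F \<xi> s p) \<and>
        ((\<forall>\<eta><\<xi>. s \<eta> \<in> core F) \<longrightarrow> (\<forall>p. is_amalgam F \<xi> s p \<longrightarrow> p \<in> core F)))"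

definition axiom_core :: "('i::wellorder, 'p) forcing \<Rightarrow> bool" where
  "axiom_core F \<longleftrightarrow>
     (\<forall>q\<in>core F. closed_in_sup (supp F q)) \<and>
     (\<forall>p\<in>conds F. \<exists>q\<in>core F. leq F q p \<and> supp F q = cl (supp F p))"

definition axiom_closure :: "'i::wellorder \<Rightarrow> ('i, 'p) forcing \<Rightarrow> bool" where
  "axiom_closure \<kappa> F \<longleftrightarrow>
     (\<forall>\<xi><\<kappa>. \<forall>s x \<alpha> r.
        (\<forall>\<eta><\<xi>. s \<eta> \<in> core F) \<and>
        (\<forall>\<eta> \<eta>'. \<eta> < \<eta>' \<and> \<eta>' < \<xi> \<longrightarrow> leq F (s \<eta>') (s \<eta>)) \<and>
        x = (\<Union>\<eta><\<xi>. supp F (s \<eta>)) \<and>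
        \<alpha> < ssup x \<and>
        r \<in> core_on F {..<ssup (x \<inter> {..<\<alpha>})} \<and>
        (\<forall>\<eta><\<xi>. leq F r (restr F (s \<eta>) \<alpha>)) \<longrightarrow>
        (\<exists>q\<in>core F. (\<forall>\<eta><\<xi>. leq F q (s \<eta>)) \<and>
           restr F q (ssup (x \<inter> {..<\<alpha>})) = r \<and>
           supp F q = cl (supp F r \<union> x)))"

definition axiom_glb :: "('i::wellorder, 'p) forcing \<Rightarrow> bool" where
  "axiom_glb F \<longleftrightarrow>
     (\<forall>p\<in>core F. \<forall>\<alpha><ssup (supp F p). \<forall>q\<in>conds_on F {..<\<alpha>}.
        leq F q (restr F p \<alpha>) \<longrightarrow>
        (\<exists>!r. is_glb F p q r) \<and>
        (\<forall>r. is_glb F p q r \<longrightarrow> supp F r = supp F q \<union> supp F p \<and> restr F r \<alpha> = q))"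

text \<open>
  The class \<open>\<P>\<^sub>\<kappa>\<close>, for conditions taken from the universe \<open>'i hset\<close>, i.e. from \<open>H\<^sub>\<mu>\<close> with
  \<open>\<mu> = \<kappa>\<^sup>+\<^sup>+\<close>.  Up to an isomorphism that fixes all conditions in \<open>\<P>\<^sub>\<kappa>\<close> (those with support
  inside \<open>\<kappa>\<close>) these are all the members of the class: every condition is of the form \<open>\<pi>.p\<close>
  with \<open>\<pi>\<close> a c.o.i. from an ordinal below \<open>\<kappa>\<close> and \<open>p\<close> in \<open>\<P>\<^sub>\<kappa> \<subseteq> H\<^sub>\<kappa>\<close>, so there are at most
  \<open>|H\<^sub>\<kappa>| \<cdot> |[\<kappa>\<^sup>+]\<^bsup><\<kappa>\<^esup>|\<close> conditions.  This is bounded by the cardinality \<open>2\<close> to the \<open>\<kappa>\<^sup>+\<close> of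
  the part of \<open>H\<^sub>\<mu>\<close> outside \<open>H\<^sub>\<kappa>\<close>.
\<close>

definition forcing_class :: "'i::wellorder \<Rightarrow> ('i, 'i hset) forcing set" where
  "forcing_class \<kappa> =
     {F. forcing_notion F \<and> one F \<in> core F \<and> core F \<subseteq> conds F \<and>
         axiom_supp \<kappa> F \<and> axiom_small \<kappa> F \<and> axiom_act F \<and> axiom_restr F \<and>
         axiom_amalgam \<kappa> F \<and> axiom_core F \<and> axiom_closure \<kappa> F \<and> axiom_glb F}"


section \<open>The forcing axiom\<close>

definition common_supp :: "('i, 'p) forcing \<Rightarrow> 'p set \<Rightarrow> 'i set" where
  "common_supp F D = (\<Inter>p\<in>D. supp F p)"

definition sharply_dense :: "('i::wellorder, 'p) forcing \<Rightarrow> 'p set \<Rightarrow> bool" where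
  "sharply_dense F D \<longleftrightarrow>
     D \<noteq> {} \<and> D \<subseteq> conds F \<and>
     (\<forall>p\<in>conds F. \<exists>q\<in>D. leq F q p \<and> supp F q = cl (supp F p \<union> common_supp F D))"

definition sharply_dense_system ::
  "'i::wellorder \<Rightarrow> ('i, 'p) forcing \<Rightarrow> 'p set set \<Rightarrow> bool" where
  "sharply_dense_system \<kappa> F S \<longleftrightarrow>
     (\<exists>\<theta><\<kappa>. \<exists>D. S = D ` coi_images \<theta> \<and>
        (\<forall>x\<in>coi_images \<theta>. sharply_dense F (D x) \<and> common_supp F (D x) = x) \<and>
        (\<forall>x\<in>coi_images \<theta>. \<forall>p\<in>conds F. \<forall>y \<pi>.
           coi y \<pi> \<and> x \<subseteq> supp F p \<and> supp F p \<subseteq> y \<longrightarrow>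
           (p \<in> D x \<longleftrightarrow> act F y \<pi> p \<in> D (\<pi> ` x))))"

definition is_filter :: "('i, 'p) forcing \<Rightarrow> 'p set \<Rightarrow> bool" where
  "is_filter F G \<longleftrightarrow>
     G \<noteq> {} \<and> G \<subseteq> conds F \<and>
     (\<forall>q\<in>G. \<forall>p\<in>conds F. leq F q p \<longrightarrow> p \<in> G) \<and>
     (\<forall>p\<in>G. \<forall>q\<in>G. \<exists>r\<in>G. leq F r p \<and> leq F r q)"

definition FA :: "'i::wellorder \<Rightarrow> bool" where
  "FA \<kappa> \<longleftrightarrow>
     (\<forall>F\<in>forcing_class \<kappa>. \<forall>S :: 'i \<Rightarrow> 'i hset set set.
        (\<forall>i<\<kappa>. sharply_dense_system \<kappa> F (S i)) \<longrightarrow>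
        (\<exists>G. is_filter F G \<and> (\<forall>i<\<kappa>. \<forall>D\<in>S i. G \<inter> D \<noteq> {})))"


section \<open>Trees\<close>

definition cone :: "'n set \<Rightarrow> ('n \<Rightarrow> 'n \<Rightarrow> bool) \<Rightarrow> 'n \<Rightarrow> 'n set" where
  "cone T lt u = {v\<in>T. lt v u}"

definition is_tree :: "'n set \<Rightarrow> ('n \<Rightarrow> 'n \<Rightarrow> bool) \<Rightarrow> bool" where
  "is_tree T lt \<longleftrightarrow>
     irreflp_on T lt \<and> transp_on T lt \<and>
     (\<forall>u\<in>T. \<forall>A. A \<subseteq> cone T lt u \<and> A \<noteq> {} \<longrightarrow> (\<exists>m\<in>A. \<forall>v\<in>A. v = m \<or> lt m v))"

text \<open>
  The nodes whose cone has the order type of the initial segment \<open>S\<close>: for \<open>S = {..<\<alpha>}\<close> this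
  is the \<open>\<alpha>\<close>-th level, and for \<open>S = UNIV\<close> it is the level indexed by the order type of \<open>'i\<close>.
\<close>

definition level_of :: "'n set \<Rightarrow> ('n \<Rightarrow> 'n \<Rightarrow> bool) \<Rightarrow> 'i::wellorder set \<Rightarrow> 'n set" where
  "level_of T lt S =
     {u\<in>T. \<exists>f. bij_betw f (cone T lt u) S \<and>
        (\<forall>v\<in>cone T lt u. \<forall>w\<in>cone T lt u. lt v w \<longleftrightarrow> f v < f w)}"

abbreviation level :: "'n set \<Rightarrow> ('n \<Rightarrow> 'n \<Rightarrow> bool) \<Rightarrow> 'i::wellorder \<Rightarrow> 'n set" where
  "level T lt \<alpha> \<equiv> level_of T lt {..<\<alpha>}"

text \<open>For \<open>'i\<close> of order type a cardinal \<open>\<mu>\<close>, a \<open>\<mu>\<close>-tree.\<close>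

definition is_card_tree :: "'i::wellorder itself \<Rightarrow> 'n set \<Rightarrow> ('n \<Rightarrow> 'n \<Rightarrow> bool) \<Rightarrow> bool" where
  "is_card_tree _ T lt \<longleftrightarrow>
     is_tree T lt \<and>
     (\<forall>\<alpha>::'i. level T lt \<alpha> \<noteq> {} \<and> level T lt \<alpha> \<prec> (UNIV :: 'i set)) \<and>
     level_of T lt (UNIV :: 'i set) = {}"

definition splitting :: "'n set \<Rightarrow> ('n \<Rightarrow> 'n \<Rightarrow> bool) \<Rightarrow> bool" where
  "splitting T lt \<longleftrightarrow>
     (\<forall>u\<in>T. \<exists>v\<in>T. \<exists>w\<in>T. v \<noteq> w \<and>
        lt u v \<and> \<not> (\<exists>z\<in>T. lt u z \<and> lt z v) \<and>
        lt u w \<and> \<not> (\<exists>z\<in>T. lt u z \<and> lt z w))"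

definition normal_tree :: "'i::wellorder itself \<Rightarrow> 'n set \<Rightarrow> ('n \<Rightarrow> 'n \<Rightarrow> bool) \<Rightarrow> bool" where
  "normal_tree _ T lt \<longleftrightarrow>
     (\<forall>\<alpha> \<beta>::'i. \<alpha> < \<beta> \<longrightarrow> (\<forall>u\<in>level T lt \<alpha>. \<exists>v\<in>level T lt \<beta>. lt u v))"

definition complete_tree :: "'i::wellorder \<Rightarrow> 'n set \<Rightarrow> ('n \<Rightarrow> 'n \<Rightarrow> bool) \<Rightarrow> bool" where
  "complete_tree \<kappa> T lt \<longleftrightarrow>
     (\<forall>C\<subseteq>T. (\<forall>u\<in>C. \<forall>v\<in>C. u = v \<or> lt u v \<or> lt v u) \<and> C \<prec> {..<\<kappa>} \<longrightarrow>
        (\<exists>x\<in>T. \<forall>u\<in>C. u = x \<or> lt u x))"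

definition tree_pow ::
  "'i::wellorder \<Rightarrow> 'n set \<Rightarrow> ('n \<Rightarrow> 'n \<Rightarrow> bool) \<Rightarrow> ('i \<Rightarrow> 'n) set" where
  "tree_pow lam T lt =
     {a. \<exists>\<alpha>::'i. a \<in> {..<lam} \<rightarrow>\<^sub>E level T lt \<alpha> \<and> inj_on a {..<lam}}"

definition less_pow ::
  "'i::wellorder \<Rightarrow> ('n \<Rightarrow> 'n \<Rightarrow> bool) \<Rightarrow> ('i \<Rightarrow> 'n) \<Rightarrow> ('i \<Rightarrow> 'n) \<Rightarrow> bool" where
  "less_pow lam lt a b \<longleftrightarrow> (\<forall>i<lam. lt (a i) (b i))"

text \<open>
  Super-Souslin trees, for \<open>\<kappa>\<close> the successor cardinal of \<open>lam\<close> and \<open>'i\<close> of order type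
  \<open>\<kappa>\<^sup>+\<close>.  Comparability includes equality, as the case \<open>b = c\<close> requires.
\<close>

definition super_souslin ::
  "'i::wellorder \<Rightarrow> 'i \<Rightarrow> 'n set \<Rightarrow> ('n \<Rightarrow> 'n \<Rightarrow> bool) \<Rightarrow> bool" where
  "super_souslin lam \<kappa> T lt \<longleftrightarrow>
     is_card_tree TYPE('i) T lt \<and> normal_tree TYPE('i) T lt \<and> splitting T lt \<and>
     (\<exists>f :: ('i \<Rightarrow> 'n) \<Rightarrow> ('i \<Rightarrow> 'n) \<Rightarrow> 'i.
        (\<forall>a\<in>tree_pow lam T lt. \<forall>b\<in>tree_pow lam T lt.
           less_pow lam lt a b \<longrightarrow> f a b < \<kappa>) \<and>
        (\<forall>a\<in>tree_pow lam T lt. \<forall>b\<in>tree_pow lam T lt. \<forall>c\<in>tree_pow lam T lt.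
           less_pow lam lt a b \<and> less_pow lam lt a c \<and> f a b = f a c \<longrightarrow>
           (\<exists>i<lam. b i = c i \<or> lt (b i) (c i) \<or> lt (c i) (b i))))"

end

theory Submission
  imports Defs
begin

text \<open>
  Conditions are pairs of a set of at most \<open>\<lambda>\<close> levels and a set of at most \<open>\<lambda>\<close> atoms, each of
  which relates two of the levels.  A class \<open>W\<close> of such pairs that is closed under restriction,
  order isomorphism and unions of chains, and has enough amalgamation, yields a member of
  \<open>\<P>\<^sub>\<kappa>\<close>: the conditions are the approximations that cannot be obstructed by any extension of an
  initial segment of them, even after moving their levels by a c.o.i., and \<open>\<Q>\<close> consists of the
  members of \<open>W\<close> whose set of levels is closed.

  This is used twice.  When each level carries \<open>\<kappa>\<close> many partial enumerations of the levels below
  it, genericity makes one of those at the level \<open>\<lambda> + 1\<close> list the closure of \<open>{\<xi> + 1 | \<xi> \<in> X}\<close> for any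
  given \<open>X \<subseteq> \<lambda>\<close>, whence \<open>2\<^sup>\<lambda> = \<kappa>\<close> and the vectors at a level can be numbered by \<open>\<kappa>\<close>.  When the atoms describe a tree together with a colouring of pairs \<open>a < b\<close>
  of vectors, where vectors with the same colour over a given level must be comparable at \<open>\<lambda>\<close> many
  coordinates, the generic object is the required tree and the colour of \<open>(a, b)\<close> is \<open>F(a, b)\<close>:
  for fixed \<open>a\<close> there is always an unused colour below \<open>\<kappa>\<close>, and the surplus of comparable coordinates
  is what is spent when a new level is inserted between given ones.
\<close>

text \<open>Members of \<open>W\<close> alone would not do as conditions. By
  \<open>axiom_glb\<close> a greatest lower bound has no levels beyond the two supports and must be
  unique; but when \<open>q\<close> brings levels below an old level of \<open>p\<close>, a tree
  leaves open which new nodes lie below the old ones, and any choice of branches spoils uniqueness.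
  So conditions are partial records and greatest lower bounds are unions of atoms. Filling a gap is
  possible when the old levels are closed: then there is a largest one below the gap, where the old
  colours still give comparable coordinates. There up to \<lambda> many pairs of vectors compete for
  branches of the same nodes; the \<lambda> many comparable coordinates let each pair keep \<lambda>
  many nodes of its own. That \<open>2^\<lambda> = \<kappa>\<close> is used twice: names of vectors
  are labels below \<kappa> that c.o.i.'s leave fixed, so that conditions over \<kappa> lie in
  \<open>H \<kappa>\<close>, and the branches of length below \<kappa>, each with a dense
  requirement of its own, number only \<kappa>.\<close>

lemma lepoll_iff_ordLeq: "A \<lesssim> B \<longleftrightarrow> (card_of A, card_of B) \<in> ordLeq"
  unfolding lepoll_def card_of_ordLeq by blast

lemma lepoll_linear: "A \<lesssim> B \<or> B \<lesssim> A"
  unfolding lepoll_iff_ordLeq by (rule ordLeq_total) (rule card_of_Well_order)+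

lemma not_lepoll_iff_lesspoll: "\<not> A \<lesssim> B \<longleftrightarrow> B \<prec> A"
  unfolding lesspoll_def using lepoll_linear
  by (metis eqpoll_imp_lepoll eqpoll_sym lepoll_antisym)

lemma UN_lepoll_infinite:
  assumes "infinite B" "I \<lesssim> B" "\<And>i. i \<in> I \<Longrightarrow> F i \<lesssim> B"
  shows "(\<Union>i\<in>I. F i) \<lesssim> B"
  using assms card_of_UNION_ordLeq_infinite[of B I F] unfolding lepoll_iff_ordLeq by blast

lemma times_lepoll_infinite:
  assumes "infinite B" "A \<lesssim> B" "A' \<lesssim> B"
  shows "A \<times> A' \<lesssim> B"
  using assms card_of_Sigma_ordLeq_infinite[of B A "\<lambda>_. A'"] unfolding lepoll_iff_ordLeq by blast

lemma Sigma_lepoll_infinite: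
  assumes "infinite B" "I \<lesssim> B" "\<And>i. i \<in> I \<Longrightarrow> F i \<lesssim> B"
  shows "(SIGMA i:I. F i) \<lesssim> B"
  using assms card_of_Sigma_ordLeq_infinite[of B I F] unfolding lepoll_iff_ordLeq by blast

lemma Un_lepoll_infinite:
  assumes "infinite B" "A \<lesssim> B" "A' \<lesssim> B"
  shows "A \<union> A' \<lesssim> B"
proof -
  have "{True, False} \<lesssim> B"
    using assms(1) by (simp add: finite_lepoll_infinite)
  then have "(\<Union>b\<in>{True, False}. if b then A else A') \<lesssim> B"
    using assms by (intro UN_lepoll_infinite) auto
  then show ?thesis by (simp add: Un_commute)
qed

section \<open>Suprema and limit points\<close>

lemma ozero_le [simp]: "ozero \<le> (\<alpha>::'i::wellorder)"
  unfolding ozero_def by (simp add: Least_le)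

lemma ozero_less_iff: "ozero < (\<alpha>::'i::wellorder) \<longleftrightarrow> (\<exists>\<beta>. \<beta> < \<alpha>)"
  by (metis le_less_trans ozero_le)

lemma lessThan_ozero [simp]: "{..<ozero} = ({} :: 'i::wellorder set)"
  using ozero_le leD by blast

lemma less_ssup:
  fixes X :: "'i::wellorder set"
  assumes "\<exists>\<beta>. \<forall>\<xi>\<in>X. \<xi> < \<beta>" "\<xi> \<in> X"
  shows "\<xi> < ssup X"
  using LeastI_ex[OF assms(1)] assms(2) unfolding ssup_def by blast

lemma ssup_le:
  fixes X :: "'i::wellorder set"
  assumes "\<And>\<xi>. \<xi> \<in> X \<Longrightarrow> \<xi> < \<beta>"
  shows "ssup X \<le> \<beta>"
  unfolding ssup_def using assms by (auto intro: Least_le)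

lemma less_ssup_iff:
  fixes X :: "'i::wellorder set"
  assumes "\<exists>\<beta>. \<forall>\<xi>\<in>X. \<xi> < \<beta>"
  shows "\<xi> < ssup X \<longleftrightarrow> (\<exists>\<eta>\<in>X. \<xi> \<le> \<eta>)"
proof
  assume "\<xi> < ssup X"
  then have "\<not> (\<forall>\<eta>\<in>X. \<eta> < \<xi>)"
    unfolding ssup_def using not_less_Least by blast
  then show "\<exists>\<eta>\<in>X. \<xi> \<le> \<eta>" by (metis not_le)
next
  assume "\<exists>\<eta>\<in>X. \<xi> \<le> \<eta>"
  then show "\<xi> < ssup X" using less_ssup[OF assms] by force
qed

lemma ssup_empty [simp]: "ssup {} = (ozero :: 'i::wellorder)"
  unfolding ssup_def ozero_def by simp

lemma osup_ub:
  fixes X :: "'i::wellorder set"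
  assumes "\<exists>\<beta>. \<forall>\<xi>\<in>X. \<xi> \<le> \<beta>" "\<xi> \<in> X"
  shows "\<xi> \<le> osup X"
  using LeastI_ex[OF assms(1)] assms(2) unfolding osup_def by blast

lemma osup_le:
  fixes X :: "'i::wellorder set"
  assumes "\<And>\<xi>. \<xi> \<in> X \<Longrightarrow> \<xi> \<le> \<beta>"
  shows "osup X \<le> \<beta>"
  unfolding osup_def using assms by (auto intro: Least_le)

lemma osup_eqI:
  fixes X :: "'i::wellorder set"
  assumes "\<And>\<xi>. \<xi> \<in> X \<Longrightarrow> \<xi> \<le> \<beta>" "\<And>\<gamma>. \<gamma> < \<beta> \<Longrightarrow> \<exists>\<xi>\<in>X. \<gamma> < \<xi>"
  shows "osup X = \<beta>"
proof (rule antisym)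
  show "osup X \<le> \<beta>" using assms(1) by (rule osup_le)
  show "\<beta> \<le> osup X"
  proof (rule ccontr)
    assume "\<not> \<beta> \<le> osup X"
    then obtain \<xi> where "\<xi> \<in> X" "osup X < \<xi>" using assms(2) by (meson not_le)
    with osup_ub[of X \<xi>] assms(1) show False by (metis leD)
  qed
qed

lemma less_osup:
  fixes X :: "'i::wellorder set"
  assumes "\<gamma> < osup X"
  shows "\<exists>\<xi>\<in>X. \<gamma> < \<xi>"
  using assms osup_le[of X \<gamma>] by (metis leD not_le)

text \<open>Cofinality of \<open>x\<close> below \<alpha>, without suprema: the form in which limit
  points are used from here on. Successors are excluded automatically, since nothing lies strictly
  between a predecessor and its successor.\<close>

lemma is_limit_of_iff:
  "is_limit_of \<alpha> x \<longleftrightarrow> (\<exists>\<beta>. \<beta> < \<alpha>) \<and> (\<forall>\<beta><\<alpha>. \<exists>\<xi>\<in>x. \<beta> < \<xi> \<and> \<xi> < \<alpha>)"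
proof -
  have "osup (x \<inter> {..<\<alpha>}) = \<alpha> \<longleftrightarrow> (\<forall>\<beta><\<alpha>. \<exists>\<xi>\<in>x. \<beta> < \<xi> \<and> \<xi> < \<alpha>)"
  proof
    assume eq: "osup (x \<inter> {..<\<alpha>}) = \<alpha>"
    show "\<forall>\<beta><\<alpha>. \<exists>\<xi>\<in>x. \<beta> < \<xi> \<and> \<xi> < \<alpha>"
      using less_osup[of _ "x \<inter> {..<\<alpha>}"] unfolding eq by blast
  next
    assume "\<forall>\<beta><\<alpha>. \<exists>\<xi>\<in>x. \<beta> < \<xi> \<and> \<xi> < \<alpha>"
    then show "osup (x \<inter> {..<\<alpha>}) = \<alpha>"
      by (intro osup_eqI) auto
  qed
  then show ?thesis unfolding is_limit_of_def ozero_less_iff by blast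
qed

lemma is_limit_of_mono: "is_limit_of \<alpha> x \<Longrightarrow> x \<inter> {..<\<alpha>} \<subseteq> y \<Longrightarrow> is_limit_of \<alpha> y"
  unfolding is_limit_of_iff by (meson IntI lessThan_iff subsetD)

lemma cl_superset: "x \<subseteq> cl x"
  unfolding cl_def by blast

text \<open>Below \<open>ssup x\<close> means at or below an element of \<open>x\<close>, and
  equality puts \<alpha> into \<open>x\<close> already. So the strict bound that occurs in
  \<open>closed_in_sup\<close> gives the same closure.\<close>

lemma mem_cl_iff:
  fixes x :: "'i::wellorder set"
  assumes "\<exists>\<beta>. \<forall>\<xi>\<in>x. \<xi> < \<beta>"
  shows "\<alpha> \<in> cl x \<longleftrightarrow> \<alpha> \<in> x \<or> (is_limit_of \<alpha> x \<and> (\<exists>\<beta>\<in>x. \<alpha> < \<beta>))"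
  unfolding cl_def using less_ssup_iff[OF assms, of \<alpha>] by (auto simp: order.order_iff_strict)

lemma cl_le:
  fixes x :: "'i::wellorder set"
  assumes "\<exists>\<beta>. \<forall>\<xi>\<in>x. \<xi> < \<beta>" "\<alpha> \<in> cl x"
  shows "\<exists>\<beta>\<in>x. \<alpha> \<le> \<beta>"
  using assms(2) unfolding mem_cl_iff[OF assms(1)] by (auto simp: order.order_iff_strict)

lemma cl_between:
  fixes x :: "'i::wellorder set"
  assumes "\<exists>\<beta>. \<forall>\<xi>\<in>x. \<xi> < \<beta>" "\<alpha> \<in> cl x" "\<gamma> < \<alpha>"
  shows "\<exists>\<beta>\<in>x. \<gamma> < \<beta> \<and> \<beta> \<le> \<alpha>"
  using assms(2,3) unfolding mem_cl_iff[OF assms(1)] is_limit_of_iff by (meson less_imp_le order_refl)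

lemma is_limit_of_cl:
  fixes x :: "'i::wellorder set"
  assumes b: "\<exists>\<beta>. \<forall>\<xi>\<in>x. \<xi> < \<beta>" and l: "is_limit_of \<alpha> (cl x)"
  shows "is_limit_of \<alpha> x"
  unfolding is_limit_of_iff
proof (intro conjI allI impI)
  show "\<exists>\<beta>. \<beta> < \<alpha>" using l unfolding is_limit_of_iff by blast
  fix \<beta> assume "\<beta> < \<alpha>"
  then obtain \<xi> where "\<xi> \<in> cl x" "\<beta> < \<xi>" "\<xi> < \<alpha>" using l unfolding is_limit_of_iff by blast
  then show "\<exists>\<xi>\<in>x. \<beta> < \<xi> \<and> \<xi> < \<alpha>" using cl_between[OF b] by (meson le_less_trans)
qed

lemma closed_cl:
  fixes x :: "'i::wellorder set"
  assumes b: "\<exists>\<beta>. \<forall>\<xi>\<in>x. \<xi> < \<beta>"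
  shows "closed_in_sup (cl x)"
  unfolding closed_in_sup_def
proof (intro allI impI)
  fix \<alpha> assume "(\<exists>\<beta>\<in>cl x. \<alpha> < \<beta>) \<and> is_limit_of \<alpha> (cl x)"
  then show "\<alpha> \<in> cl x"
    using is_limit_of_cl[OF b, of \<alpha>] cl_le[OF b] mem_cl_iff[OF b, of \<alpha>] by (meson less_le_trans)
qed

lemma cl_subset_closed:
  fixes x :: "'i::wellorder set"
  assumes b: "\<exists>\<beta>. \<forall>\<xi>\<in>x. \<xi> < \<beta>" and "x \<subseteq> y" "closed_in_sup y"
  shows "cl x \<subseteq> y"
proof
  fix \<alpha> assume "\<alpha> \<in> cl x"
  then consider "\<alpha> \<in> x" | "is_limit_of \<alpha> x" "\<exists>\<beta>\<in>x. \<alpha> < \<beta>" unfolding mem_cl_iff[OF b] by blast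
  then show "\<alpha> \<in> y"
  proof cases
    case 2
    then have "is_limit_of \<alpha> y" using assms(2) is_limit_of_mono by blast
    then show ?thesis using 2 assms(2,3) unfolding closed_in_sup_def by blast
  qed (use assms in blast)
qed

lemma cl_closed:
  fixes x :: "'i::wellorder set"
  assumes "\<exists>\<beta>. \<forall>\<xi>\<in>x. \<xi> < \<beta>" "closed_in_sup x"
  shows "cl x = x"
  using cl_subset_closed[OF assms(1) _ assms(2)] cl_superset by blast

lemma cl_mono:
  fixes x :: "'i::wellorder set"
  assumes b: "\<exists>\<beta>. \<forall>\<xi>\<in>y. \<xi> < \<beta>" and "x \<subseteq> y"
  shows "cl x \<subseteq> cl y"
proof -
  have b': "\<exists>\<beta>. \<forall>\<xi>\<in>x. \<xi> < \<beta>" using assms by blast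
  show ?thesis
    using assms(2) cl_superset closed_cl[OF b] by (intro cl_subset_closed[OF b']) blast
qed

text \<open>Between two limit points outside \<open>x\<close> there is an element of
  \<open>x\<close>, so sending each new point to the least element of \<open>x\<close> above it is
  injective.\<close>

lemma cl_lepoll:
  fixes x :: "'i::wellorder set" and B :: "'b set"
  assumes b: "\<exists>\<beta>. \<forall>\<xi>\<in>x. \<xi> < \<beta>" and B: "infinite B" "x \<lesssim> B"
  shows "cl x \<lesssim> B"
proof -
  define f where "f \<alpha> = (LEAST \<beta>. \<beta> \<in> x \<and> \<alpha> \<le> \<beta>)" for \<alpha>
  have f: "f \<alpha> \<in> x \<and> \<alpha> \<le> f \<alpha>" if "\<alpha> \<in> cl x" for \<alpha>
    unfolding f_def using LeastI_ex[of "\<lambda>\<beta>. \<beta> \<in> x \<and> \<alpha> \<le> \<beta>"] cl_le[OF b that] by blast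
  have less: "f \<alpha> < f \<alpha>'" if A: "\<alpha> < \<alpha>'" "\<alpha> \<in> cl x - x" "\<alpha>' \<in> cl x - x" for \<alpha> \<alpha>'
  proof -
    obtain \<beta> where \<beta>: "\<beta> \<in> x" "\<alpha> < \<beta>" "\<beta> \<le> \<alpha>'" using cl_between[OF b, of \<alpha>' \<alpha>] A by blast
    have "f \<alpha> \<le> \<beta>" unfolding f_def using \<beta> by (auto intro: Least_le)
    moreover have "\<beta> < \<alpha>'" using \<beta> that(3) by (auto simp: order.order_iff_strict)
    ultimately show ?thesis using f[of \<alpha>'] that(3) by (meson DiffD1 le_less_trans less_le_trans)
  qed
  have "inj_on f (cl x - x)"
    by (rule inj_onI) (metis less less_irrefl linorder_neqE)
  moreover have "f ` (cl x - x) \<subseteq> x" using f by blast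
  ultimately have "cl x - x \<lesssim> x" unfolding lepoll_def by blast
  then have "cl x - x \<lesssim> B" using B(2) by (rule lepoll_trans)
  then have "(cl x - x) \<union> x \<lesssim> B" using B by (intro Un_lepoll_infinite)
  then show ?thesis using cl_superset[of x] by (simp add: Un_absorb2)
qed

section \<open>Enumerations and c.o.i.'s\<close>

text \<open>Recursion: \<open>h \<xi>\<close> is the least element of \<open>Y\<close> not yet
  listed. If \<open>Y\<close> were never exhausted, \<open>h\<close> would inject the whole type
  into \<open>Y\<close>.\<close>

lemma ex_enumeration:
  fixes Y :: "'i::wellorder set"
  assumes "Y \<prec> (UNIV :: 'i set)"
  obtains \<theta> :: 'i and h where "strict_mono_on {..<\<theta>} h" "h ` {..<\<theta>} = Y"
proof -
  have "\<exists>h :: 'i \<Rightarrow> 'i. \<forall>\<xi>. h \<xi> = (LEAST y. y \<in> Y - h ` {..<\<xi>})"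
  proof (rule dependent_wellorder_choice)
    fix r :: 'i and f g :: "'i \<Rightarrow> 'i" and x :: 'i
    assume "\<And>y. y < x \<Longrightarrow> f y = g y"
    then have "f ` {..<x} = g ` {..<x}" by (intro image_cong) auto
    then show "(r = (LEAST y. y \<in> Y - f ` {..<x})) = (r = (LEAST y. y \<in> Y - g ` {..<x}))"
      by simp
  qed (rule exI, rule refl)
  then obtain h :: "'i \<Rightarrow> 'i" where h: "h \<xi> = (LEAST y. y \<in> Y - h ` {..<\<xi>})" for \<xi>
    by blast
  have mem: "h \<xi> \<in> Y - h ` {..<\<xi>}" if "\<not> Y \<subseteq> h ` {..<\<xi>}" for \<xi>
    unfolding h[of \<xi>] by (rule LeastI_ex) (use that in blast)
  have "\<exists>\<xi>. Y \<subseteq> h ` {..<\<xi>}"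
  proof (rule ccontr)
    assume "\<not> ?thesis"
    then have *: "h \<xi> \<in> Y - h ` {..<\<xi>}" for \<xi> using mem by blast
    have "inj h"
    proof (rule injI, rule ccontr)
      fix a b assume "h a = h b" "a \<noteq> b"
      then show False using *[of a] *[of b]
        by (metis DiffD2 imageI lessThan_iff neq_iff)
    qed
    then have "(UNIV::'i set) \<lesssim> Y" using * unfolding lepoll_def by blast
    then show False using assms not_lepoll_iff_lesspoll by blast
  qed
  define \<theta> where "\<theta> = (LEAST \<xi>. Y \<subseteq> h ` {..<\<xi>})"
  have sup: "Y \<subseteq> h ` {..<\<theta>}" unfolding \<theta>_def by (rule LeastI_ex) fact
  have *: "h \<xi> \<in> Y - h ` {..<\<xi>}" if "\<xi> < \<theta>" for \<xi>
    using mem not_less_Least[OF that[unfolded \<theta>_def]] by blast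
  show ?thesis
  proof
    show "strict_mono_on {..<\<theta>} h"
    proof (rule strict_mono_onI)
      fix a b assume ab: "a \<in> {..<\<theta>}" "b \<in> {..<\<theta>}" "a < b"
      then have b: "h b \<in> Y - h ` {..<b}" using * by blast
      then have "h b \<in> Y - h ` {..<a}" using ab(3) by (auto dest: less_trans)
      then have "h a \<le> h b" unfolding h[of a] by (rule Least_le)
      moreover have "h a \<noteq> h b" using b ab(3) by (metis DiffD2 imageI lessThan_iff)
      ultimately show "h a < h b" by simp
    qed
    show "h ` {..<\<theta>} = Y" using sup * by blast
  qed
qed

text \<open>Continuity in the form that no \<gamma> below \<open>\<pi> \<alpha>\<close> bounds the
  earlier values; monotonicity supplies the other half of the supremum.\<close>

lemma coi_iff:
  "coi y \<pi> \<longleftrightarrow> closed_in_sup y \<and> strict_mono_on y \<pi> \<and>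
     (\<forall>\<alpha>\<in>y. is_limit_of \<alpha> y \<longrightarrow> (\<forall>\<gamma><\<pi> \<alpha>. \<exists>\<xi>\<in>y. \<xi> < \<alpha> \<and> \<gamma> < \<pi> \<xi>))"
proof -
  have "\<pi> \<alpha> = osup (\<pi> ` (y \<inter> {..<\<alpha>})) \<longleftrightarrow> (\<forall>\<gamma><\<pi> \<alpha>. \<exists>\<xi>\<in>y. \<xi> < \<alpha> \<and> \<gamma> < \<pi> \<xi>)"
    if "strict_mono_on y \<pi>" "\<alpha> \<in> y" for \<alpha>
  proof
    assume eq: "\<pi> \<alpha> = osup (\<pi> ` (y \<inter> {..<\<alpha>}))"
    show "\<forall>\<gamma><\<pi> \<alpha>. \<exists>\<xi>\<in>y. \<xi> < \<alpha> \<and> \<gamma> < \<pi> \<xi>"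
    proof (intro allI impI)
      fix \<gamma> assume "\<gamma> < \<pi> \<alpha>"
      then have "\<gamma> < osup (\<pi> ` (y \<inter> {..<\<alpha>}))" using eq by simp
      from less_osup[OF this] show "\<exists>\<xi>\<in>y. \<xi> < \<alpha> \<and> \<gamma> < \<pi> \<xi>" by blast
    qed
  next
    assume *: "\<forall>\<gamma><\<pi> \<alpha>. \<exists>\<xi>\<in>y. \<xi> < \<alpha> \<and> \<gamma> < \<pi> \<xi>"
    have "osup (\<pi> ` (y \<inter> {..<\<alpha>})) = \<pi> \<alpha>"
    proof (rule osup_eqI)
      fix \<xi> assume "\<xi> \<in> \<pi> ` (y \<inter> {..<\<alpha>})"
      then show "\<xi> \<le> \<pi> \<alpha>" using that strict_mono_onD[OF that(1)] by (auto intro!: less_imp_le)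
    qed (use * in blast)
    then show "\<pi> \<alpha> = osup (\<pi> ` (y \<inter> {..<\<alpha>}))" by simp
  qed
  then show ?thesis unfolding coi_def by blast
qed

lemma coi_strict_mono: "coi y \<pi> \<Longrightarrow> strict_mono_on y \<pi>"
  unfolding coi_def by blast

lemma coi_inj: "coi y \<pi> \<Longrightarrow> inj_on \<pi> y"
  using coi_strict_mono strict_mono_on_imp_inj_on by blast

lemma coi_less_iff: "coi y \<pi> \<Longrightarrow> a \<in> y \<Longrightarrow> b \<in> y \<Longrightarrow> \<pi> a < \<pi> b \<longleftrightarrow> a < b"
  using coi_strict_mono strict_mono_on_less by blast

lemma coi_closed: "coi y \<pi> \<Longrightarrow> closed_in_sup y"
  unfolding coi_def by blast

text \<open>A limit point of \<open>z\<close> is one of \<open>y\<close>, and \<open>z\<close> is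
  cofinal below it, so continuity is inherited; closedness of the domain is the only thing to be
  added by hand.\<close>

lemma coi_subset:
  assumes "coi y \<pi>" "z \<subseteq> y" "closed_in_sup z"
  shows "coi z \<pi>"
  unfolding coi_iff
proof (intro conjI ballI impI allI)
  show "strict_mono_on z \<pi>" using coi_strict_mono[OF assms(1)] assms(2) by (rule monotone_on_subset)
next
  fix \<alpha> \<gamma> assume \<alpha>: "\<alpha> \<in> z" "is_limit_of \<alpha> z" "\<gamma> < \<pi> \<alpha>"
  then have "is_limit_of \<alpha> y" using assms(2) is_limit_of_mono by blast
  then obtain \<xi> where \<xi>: "\<xi> \<in> y" "\<xi> < \<alpha>" "\<gamma> < \<pi> \<xi>" using assms \<alpha> unfolding coi_iff by blast
  then obtain \<xi>' where "\<xi>' \<in> z" "\<xi> < \<xi>'" "\<xi>' < \<alpha>" using \<alpha>(2) unfolding is_limit_of_iff by blast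
  moreover have "\<pi> \<xi> < \<pi> \<xi>'" using coi_less_iff[OF assms(1)] \<xi>(1) assms(2) calculation by blast
  ultimately show "\<exists>\<xi>\<in>z. \<xi> < \<alpha> \<and> \<gamma> < \<pi> \<xi>" using \<xi> less_trans by blast
qed (use assms in blast)

lemma coi_limit_image:
  assumes "coi y \<pi>" "\<alpha> \<in> y" "x \<subseteq> y" "is_limit_of \<alpha> x"
  shows "is_limit_of (\<pi> \<alpha>) (\<pi> ` x)"
  unfolding is_limit_of_iff
proof (intro conjI allI impI)
  obtain \<beta> where "\<beta> < \<alpha>" using assms(4) unfolding is_limit_of_iff by blast
  then obtain \<xi> where "\<xi> \<in> x" "\<xi> < \<alpha>" using assms(4) unfolding is_limit_of_iff by blast
  then show "\<exists>\<beta>. \<beta> < \<pi> \<alpha>" using coi_less_iff[OF assms(1), of \<xi> \<alpha>] assms by blast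
next
  fix \<gamma> assume "\<gamma> < \<pi> \<alpha>"
  moreover have "is_limit_of \<alpha> y" using assms(3,4) is_limit_of_mono by blast
  ultimately obtain \<xi> where \<xi>: "\<xi> \<in> y" "\<xi> < \<alpha>" "\<gamma> < \<pi> \<xi>" using assms unfolding coi_iff by blast
  then obtain \<xi>' where \<xi>': "\<xi>' \<in> x" "\<xi> < \<xi>'" "\<xi>' < \<alpha>" using assms(4) unfolding is_limit_of_iff by blast
  then have "\<pi> \<xi> < \<pi> \<xi>'" "\<pi> \<xi>' < \<pi> \<alpha>" using coi_less_iff[OF assms(1)] \<xi>(1) assms(2,3) by blast+
  then show "\<exists>\<xi>\<in>\<pi> ` x. \<gamma> < \<xi> \<and> \<xi> < \<pi> \<alpha>" using \<xi> \<xi>' less_trans by blast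
qed

text \<open>For a limit point \<alpha> of the image below some value, \<open>\<mu>\<close> is the
  first argument with value at least \<alpha>. The values below \<open>\<mu>\<close> are cofinal in
  \<alpha>, so the arguments below \<open>\<mu>\<close> have \<open>\<mu>\<close> itself as
  supremum, and continuity at \<open>\<mu>\<close> leaves no room between \<alpha> and
  \<open>\<pi> \<mu>\<close>.\<close>

lemma coi_image_closed:
  assumes "coi y \<pi>"
  shows "closed_in_sup (\<pi> ` y)"
  unfolding closed_in_sup_def
proof (intro allI impI)
  fix \<alpha> assume \<alpha>: "(\<exists>\<beta>\<in>\<pi> ` y. \<alpha> < \<beta>) \<and> is_limit_of \<alpha> (\<pi> ` y)"
  define \<mu> where "\<mu> = (LEAST \<xi>. \<xi> \<in> y \<and> \<alpha> \<le> \<pi> \<xi>)"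
  have \<mu>: "\<mu> \<in> y \<and> \<alpha> \<le> \<pi> \<mu>"
    unfolding \<mu>_def by (rule LeastI_ex) (use \<alpha> in \<open>auto intro: less_imp_le\<close>)
  have below: "\<pi> \<xi> < \<alpha>" if "\<xi> \<in> y" "\<xi> < \<mu>" for \<xi>
    using not_less_Least[OF that(2)[unfolded \<mu>_def]] that(1) by auto
  have less_mu: "\<xi> < \<mu>" if "\<xi> \<in> y" "\<pi> \<xi> < \<alpha>" for \<xi>
    using that \<mu> coi_less_iff[OF assms, of \<xi> \<mu>] less_le_trans by blast
  have up: "\<exists>\<xi>'\<in>y. \<xi>' < \<mu> \<and> \<gamma> < \<pi> \<xi>'" if "\<gamma> < \<alpha>" for \<gamma>
    using \<alpha> that less_mu unfolding is_limit_of_iff by blast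
  define \<nu> where "\<nu> = osup (y \<inter> {..<\<mu>})"
  have "is_limit_of \<nu> y" and le: "\<nu> \<le> \<mu>"
  proof -
    have ub: "\<exists>\<beta>. \<forall>\<xi>\<in>y \<inter> {..<\<mu>}. \<xi> \<le> \<beta>" by (auto intro: less_imp_le)
    have lt: "\<xi> < \<nu>" if \<xi>: "\<xi> \<in> y" "\<xi> < \<mu>" for \<xi>
    proof -
      obtain \<xi>' where "\<xi>' \<in> y" "\<xi>' < \<mu>" "\<pi> \<xi> < \<pi> \<xi>'" using up[OF below[OF \<xi>]] by blast
      then have "\<xi> < \<xi>'" using coi_less_iff[OF assms] \<xi> by blast
      moreover have "\<xi>' \<le> \<nu>" unfolding \<nu>_def using osup_ub[OF ub] \<open>\<xi>' \<in> y\<close> \<open>\<xi>' < \<mu>\<close> by blast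
      ultimately show ?thesis by simp
    qed
    show "\<nu> \<le> \<mu>" unfolding \<nu>_def by (rule osup_le) auto
    show "is_limit_of \<nu> y" unfolding is_limit_of_iff
    proof (intro conjI allI impI)
      show "\<exists>\<beta>. \<beta> < \<nu>" using lt up \<alpha> unfolding is_limit_of_iff by blast
      fix \<beta> assume "\<beta> < \<nu>"
      then obtain \<xi> where "\<xi> \<in> y \<inter> {..<\<mu>}" "\<beta> < \<xi>" unfolding \<nu>_def using less_osup by blast
      then show "\<exists>\<xi>\<in>y. \<beta> < \<xi> \<and> \<xi> < \<nu>" using lt by blast
    qed
  qed
  have "\<nu> \<in> y"
    using le \<mu> coi_closed[OF assms] \<open>is_limit_of \<nu> y\<close> unfolding closed_in_sup_def
    by (auto simp: order.order_iff_strict)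
  have "\<nu> = \<mu>"
  proof (rule ccontr)
    assume "\<nu> \<noteq> \<mu>"
    then have "\<nu> < \<mu>" using le by simp
    then obtain \<xi> where \<xi>: "\<xi> \<in> y" "\<xi> < \<mu>" "\<pi> \<nu> < \<pi> \<xi>" using up[OF below[OF \<open>\<nu> \<in> y\<close>]] by blast
    then have "\<nu> < \<xi>" using coi_less_iff[OF assms] \<open>\<nu> \<in> y\<close> by blast
    moreover have "\<xi> \<le> \<nu>" unfolding \<nu>_def using \<xi> by (intro osup_ub) (auto intro: less_imp_le)
    ultimately show False by simp
  qed
  have "\<not> \<alpha> < \<pi> \<mu>"
  proof
    assume "\<alpha> < \<pi> \<mu>"
    then obtain \<xi> where "\<xi> \<in> y" "\<xi> < \<mu>" "\<alpha> < \<pi> \<xi>"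
      using assms \<mu> \<open>is_limit_of \<nu> y\<close> \<open>\<nu> = \<mu>\<close> unfolding coi_iff by blast
    then show False using below by (meson less_asym)
  qed
  then show "\<alpha> \<in> \<pi> ` y" using \<mu> by (metis image_eqI order.order_iff_strict)
qed

lemma coi_comp:
  assumes "coi z \<pi>" "coi y j" "\<pi> ` z \<subseteq> y"
  shows "coi z (j \<circ> \<pi>)"
  unfolding coi_iff
proof (intro conjI ballI impI allI)
  show "closed_in_sup z" using assms(1) by (rule coi_closed)
  show "strict_mono_on z (j \<circ> \<pi>)"
    using coi_less_iff[OF assms(1)] coi_less_iff[OF assms(2)] assms(3)
    by (auto intro!: strict_mono_onI simp: image_subset_iff)
next
  fix \<alpha> \<gamma> assume \<alpha>: "\<alpha> \<in> z" "is_limit_of \<alpha> z" "\<gamma> < (j \<circ> \<pi>) \<alpha>"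
  have lim: "is_limit_of (\<pi> \<alpha>) (\<pi> ` z)"
    using coi_limit_image[OF assms(1) \<alpha>(1) _ \<alpha>(2)] by blast
  then have "is_limit_of (\<pi> \<alpha>) y" using assms(3) is_limit_of_mono by blast
  then obtain \<xi> where \<xi>: "\<xi> \<in> y" "\<xi> < \<pi> \<alpha>" "\<gamma> < j \<xi>" using assms \<alpha> unfolding coi_iff by force
  then obtain \<zeta> where \<zeta>: "\<zeta> \<in> z" "\<xi> < \<pi> \<zeta>" "\<pi> \<zeta> < \<pi> \<alpha>" using lim unfolding is_limit_of_iff by blast
  then have "j \<xi> < j (\<pi> \<zeta>)" using coi_less_iff[OF assms(2)] \<xi>(1) assms(3) by blast
  moreover have "\<zeta> < \<alpha>" using \<zeta> coi_less_iff[OF assms(1)] \<alpha>(1) by blast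
  ultimately show "\<exists>\<xi>\<in>z. \<xi> < \<alpha> \<and> \<gamma> < (j \<circ> \<pi>) \<xi>" using \<zeta>(1) \<xi>(3) by (auto intro: less_trans)
qed

lemma coi_image_cl:
  assumes "coi y \<pi>" "x \<subseteq> y" "\<exists>\<beta>. \<forall>\<xi>\<in>x. \<xi> < \<beta>" "\<exists>\<beta>. \<forall>\<xi>\<in>\<pi> ` x. \<xi> < \<beta>"
  shows "\<pi> ` cl x \<subseteq> cl (\<pi> ` x)"
proof (rule image_subsetI)
  fix \<alpha> assume \<alpha>: "\<alpha> \<in> cl x"
  have "cl x \<subseteq> y" using cl_subset_closed[OF assms(3,2) coi_closed[OF assms(1)]] .
  then have "\<alpha> \<in> y" using \<alpha> by blast
  consider "\<alpha> \<in> x" | "is_limit_of \<alpha> x" "\<exists>\<beta>\<in>x. \<alpha> < \<beta>" using \<alpha> mem_cl_iff[OF assms(3)] by blast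
  then show "\<pi> \<alpha> \<in> cl (\<pi> ` x)"
  proof cases
    case 2
    moreover have "\<exists>\<beta>\<in>\<pi> ` x. \<pi> \<alpha> < \<beta>"
      using 2 coi_less_iff[OF assms(1) \<open>\<alpha> \<in> y\<close>] assms(2) by blast
    ultimately show ?thesis
      using coi_limit_image[OF assms(1) \<open>\<alpha> \<in> y\<close> assms(2)] mem_cl_iff[OF assms(4)] by blast
  qed (use cl_superset in blast)
qed

lemma closed_lessThan: "closed_in_sup {..<\<theta>}"
  unfolding closed_in_sup_def by auto

lemma closed_initial:
  assumes "closed_in_sup x" "z \<subseteq> x" "\<And>\<alpha> \<beta>. \<alpha> \<in> x \<Longrightarrow> \<beta> \<in> z \<Longrightarrow> \<alpha> < \<beta> \<Longrightarrow> \<alpha> \<in> z"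
  shows "closed_in_sup z"
  unfolding closed_in_sup_def
proof (intro allI impI)
  fix \<alpha> assume \<alpha>: "(\<exists>\<beta>\<in>z. \<alpha> < \<beta>) \<and> is_limit_of \<alpha> z"
  then have "is_limit_of \<alpha> x" using assms(2) is_limit_of_mono by blast
  then have "\<alpha> \<in> x" using \<alpha> assms(1,2) unfolding closed_in_sup_def by blast
  then show "\<alpha> \<in> z" using \<alpha> assms(3) by blast
qed

text \<open>The increasing enumeration of a closed set is continuous: the supremum of the values
  listed before a limit index is a limit point of \<open>X\<close>, hence in \<open>X\<close>, and
  cannot be skipped.\<close>

lemma coi_enumeration:
  fixes X :: "'i::wellorder set"
  assumes "X \<prec> (UNIV :: 'i set)" "closed_in_sup X"
  obtains \<theta> h where "coi {..<\<theta>} h" "h ` {..<\<theta>} = X"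
proof -
  obtain \<theta> :: 'i and h where h: "strict_mono_on {..<\<theta>} h" "h ` {..<\<theta>} = X"
    using ex_enumeration[OF assms(1)] by blast
  have less: "h a < h b \<longleftrightarrow> a < b" if "a < \<theta>" "b < \<theta>" for a b
    using strict_mono_onD[OF h(1), of a b] strict_mono_onD[OF h(1), of b a] that
    by (cases a b rule: linorder_cases) auto
  have "coi {..<\<theta>} h" unfolding coi_iff
  proof (intro conjI ballI impI allI closed_lessThan h(1))
    fix \<alpha> \<gamma> assume \<alpha>: "\<alpha> \<in> {..<\<theta>}" "is_limit_of \<alpha> {..<\<theta>}" "\<gamma> < h \<alpha>"
    define S where "S = h ` {..<\<alpha>}"
    define \<mu> where "\<mu> = osup S"
    have ub: "\<exists>\<beta>. \<forall>\<xi>\<in>S. \<xi> \<le> \<beta>" using less \<alpha>(1) unfolding S_def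
      by (auto intro!: exI[of _ "h \<alpha>"] less_imp_le)
    have "\<mu> \<le> h \<alpha>" unfolding \<mu>_def S_def using less \<alpha>(1) by (intro osup_le) (auto intro!: less_imp_le)
    have lt: "h \<xi> < \<mu>" if A: "\<xi> < \<alpha>" for \<xi>
    proof -
      obtain \<xi>' where \<xi>': "\<xi> < \<xi>'" "\<xi>' < \<alpha>" using \<alpha>(2) A unfolding is_limit_of_iff by blast
      then have "h \<xi> < h \<xi>'" using less \<alpha>(1) that by simp
      also have "h \<xi>' \<le> \<mu>" unfolding \<mu>_def using \<xi>' by (intro osup_ub[OF ub]) (simp add: S_def)
      finally show ?thesis .
    qed
    have lim: "is_limit_of \<mu> X" unfolding is_limit_of_iff
    proof (intro conjI allI impI)
      show "\<exists>\<beta>. \<beta> < \<mu>" using lt \<alpha>(2) unfolding is_limit_of_iff by blast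
      fix \<beta> assume "\<beta> < \<mu>"
      then obtain \<xi> where "\<xi> \<in> S" "\<beta> < \<xi>" unfolding \<mu>_def using less_osup by blast
      then show "\<exists>\<xi>\<in>X. \<beta> < \<xi> \<and> \<xi> < \<mu>" using lt h(2) \<alpha>(1) unfolding S_def by auto
    qed
    have "\<mu> = h \<alpha>"
    proof (rule ccontr)
      assume "\<mu> \<noteq> h \<alpha>"
      then have *: "\<mu> < h \<alpha>" using \<open>\<mu> \<le> h \<alpha>\<close> by simp
      then have "\<mu> \<in> X" using lim assms(2) h(2) \<alpha>(1) unfolding closed_in_sup_def by blast
      then obtain \<xi> where "\<xi> < \<theta>" "\<mu> = h \<xi>" using h(2) by auto
      then show False using * less[of \<xi> \<alpha>] lt[of \<xi>] \<alpha>(1) by simp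
    qed
    then have "\<gamma> < osup S" using \<alpha>(3) \<mu>_def by simp
    then show "\<exists>\<xi>\<in>{..<\<theta>}. \<xi> < \<alpha> \<and> \<gamma> < h \<xi>" using less_osup \<alpha>(1) unfolding S_def by fastforce
  qed
  then show ?thesis using that h(2) by blast
qed

section \<open>Successor cardinals\<close>

locale successor_cardinals =
  fixes lam \<kappa> :: "'i::wellorder"
  assumes inf_card_lam: "infinite_cardinal lam"
    and succ_lam: "card_succ {..<lam} {..<\<kappa>}"
    and succ_kappa: "card_succ {..<\<kappa>} (UNIV :: 'i set)"
begin

text \<open>The same as size less than \<kappa> (\<open>small_iff\<close>), put in the form to which
  the arithmetic of the infinite cardinal \<lambda> applies.\<close>

definition small :: "'b set \<Rightarrow> bool" where
  "small X \<longleftrightarrow> X \<lesssim> {..<lam}"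

lemma infinite_lam: "infinite {..<lam}"
  using inf_card_lam unfolding infinite_cardinal_def by blast

lemma less_lam: "\<nu> < lam \<Longrightarrow> {..<\<nu>} \<prec> {..<lam}"
  using inf_card_lam unfolding infinite_cardinal_def by blast

lemma lam_lesspoll_kappa: "{..<lam} \<prec> {..<\<kappa>}"
  using succ_lam unfolding card_succ_def by blast

lemma infinite_kappa: "infinite {..<\<kappa>}"
  using lam_lesspoll_kappa infinite_lam lesspoll_imp_lepoll
  by (metis lepoll_def finite_imageD finite_subset)

lemma kappa_lesspoll_UNIV: "{..<\<kappa>} \<prec> (UNIV :: 'i set)"
  using succ_kappa unfolding card_succ_def by blast

lemma lam_less_kappa: "lam < \<kappa>"
proof (rule ccontr)
  assume "\<not> lam < \<kappa>"
  then have "{..<\<kappa>} \<lesssim> {..<lam}" by (intro subset_imp_lepoll) auto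
  then show False using lam_lesspoll_kappa not_lepoll_iff_lesspoll by blast
qed

lemma small_lessThan: "\<alpha> < \<kappa> \<Longrightarrow> small {..<\<alpha>}"
  using succ_lam unfolding card_succ_def small_def
  by (metis lessThan_strict_subset_iff)

lemma lessThan_lepoll_kappa: "{..<\<alpha> :: 'i} \<lesssim> {..<\<kappa>}"
  proof -
  have "\<alpha> \<notin> {..<\<alpha>}" by simp
  then have "{..<\<alpha>} \<subset> UNIV" by (metis UNIV_I psubsetI subset_UNIV)
  then show ?thesis by (rule succ_kappa[unfolded card_succ_def, THEN conjunct2, THEN spec, THEN mp])
qed

lemma small_lepoll: "small X \<Longrightarrow> Y \<lesssim> X \<Longrightarrow> small Y"
  unfolding small_def using lepoll_trans by blast

lemma small_subset: "small X \<Longrightarrow> Y \<subseteq> X \<Longrightarrow> small Y"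
  using small_lepoll subset_imp_lepoll by blast

lemma small_image: "small X \<Longrightarrow> small (f ` X)"
  using small_lepoll image_lepoll by blast

lemma small_finite: "finite X \<Longrightarrow> small X"
  unfolding small_def using infinite_lam finite_lepoll_infinite by blast

lemma small_UN: "small I \<Longrightarrow> (\<And>i. i \<in> I \<Longrightarrow> small (F i)) \<Longrightarrow> small (\<Union>i\<in>I. F i)"
  unfolding small_def using infinite_lam UN_lepoll_infinite by blast

lemma small_Un: "small X \<Longrightarrow> small Y \<Longrightarrow> small (X \<union> Y)"
  unfolding small_def using infinite_lam Un_lepoll_infinite by blast

lemma small_times: "small X \<Longrightarrow> small Y \<Longrightarrow> small (X \<times> Y)"
  unfolding small_def using infinite_lam times_lepoll_infinite by blast

lemma small_empty [simp]: "small {}"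
  by (simp add: small_finite)

lemma small_insert: "small X \<Longrightarrow> small (insert a X)"
  using small_Un[of "{a}" X] small_finite[of "{a}"] by simp

lemma small_lesspoll_kappa: "small X \<Longrightarrow> X \<prec> {..<\<kappa>}"
  unfolding small_def using lam_lesspoll_kappa lesspoll_trans1 by blast

lemma small_lepoll_kappa: "small X \<Longrightarrow> X \<lesssim> {..<\<kappa>}"
  using small_lesspoll_kappa lesspoll_imp_lepoll by blast

text \<open>Regularity of \<open>\<kappa>^+\<close>: an unbounded set of size \<kappa> would make
  the whole type a union of \<kappa> many initial segments, each of size at most \<kappa>.\<close>

lemma lepoll_kappa_bounded:
  fixes X :: "'i set"
  assumes "X \<lesssim> {..<\<kappa>}"
  shows "\<exists>\<beta>. \<forall>\<xi>\<in>X. \<xi> < \<beta>"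
proof (rule ccontr)
  assume "\<not> ?thesis"
  then have "(UNIV::'i set) \<subseteq> (\<Union>\<xi>\<in>X. insert \<xi> {..<\<xi>})" by (auto simp: not_less order.order_iff_strict)
  moreover have "(\<Union>\<xi>\<in>X. insert \<xi> {..<\<xi>}) \<lesssim> {..<\<kappa>}"
  proof (rule UN_lepoll_infinite[OF infinite_kappa assms])
    fix \<xi> :: 'i
    have "{\<xi>} \<union> {..<\<xi>} \<lesssim> {..<\<kappa>}"
      by (intro Un_lepoll_infinite infinite_kappa lessThan_lepoll_kappa finite_lepoll_infinite) auto
    then show "insert \<xi> {..<\<xi>} \<lesssim> {..<\<kappa>}" by simp
  qed
  ultimately show False
    using kappa_lesspoll_UNIV not_lepoll_iff_lesspoll subset_imp_lepoll lepoll_trans by blast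
qed

lemma small_bounded: "small (X :: 'i set) \<Longrightarrow> \<exists>\<beta>. \<forall>\<xi>\<in>X. \<xi> < \<beta>"
  using lepoll_kappa_bounded small_lepoll_kappa by blast

text \<open>Regularity of \<kappa>: an unbounded small set would make \<kappa> a union of at most
  \<lambda> many small initial segments.\<close>

lemma small_bounded_kappa:
  fixes X :: "'i set"
  assumes "small X" "X \<subseteq> {..<\<kappa>}"
  shows "\<exists>\<beta><\<kappa>. \<forall>\<xi>\<in>X. \<xi> < \<beta>"
proof (rule ccontr)
  assume "\<not> ?thesis"
  then have "\<exists>\<xi>\<in>X. \<beta> \<le> \<xi>" if "\<beta> < \<kappa>" for \<beta> using that by (meson not_less)
  then have "{..<\<kappa>} \<subseteq> (\<Union>\<xi>\<in>X. insert \<xi> {..<\<xi>})" by (fastforce simp: order.order_iff_strict)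
  moreover have "small (\<Union>\<xi>\<in>X. insert \<xi> {..<\<xi>})"
    using assms by (intro small_UN small_insert small_lessThan) auto
  ultimately show False
    using small_subset small_lesspoll_kappa by blast
qed

text \<open>\<open>card_succ\<close> speaks of ordinals only, so an arbitrary set of size less than
  \<kappa> is first moved into the ordinals and then replaced by its order type, which is below
  \<kappa>.\<close>

lemma lesspoll_kappa_imp_small:
  assumes "X \<prec> {..<\<kappa>}"
  shows "small X"
proof -
  obtain f where f: "inj_on f X" "f ` X \<subseteq> {..<\<kappa>}"
    using assms unfolding lesspoll_def lepoll_def by blast
  have "f ` X \<prec> {..<\<kappa>}" using assms f(1) by simp
  then have "f ` X \<prec> (UNIV :: 'i set)" using kappa_lesspoll_UNIV lesspoll_trans by blast
  then obtain \<theta> :: 'i and h where h: "strict_mono_on {..<\<theta>} h" "h ` {..<\<theta>} = f ` X"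
    using ex_enumeration by blast
  have eq: "f ` X \<approx> {..<\<theta>}"
    using inj_on_image_eqpoll_self[OF strict_mono_on_imp_inj_on[OF h(1)]] h(2) by simp
  have "\<theta> < \<kappa>"
  proof (rule ccontr)
    assume "\<not> \<theta> < \<kappa>"
    then have "{..<\<kappa>} \<lesssim> {..<\<theta>}" by (intro subset_imp_lepoll) auto
    then have "{..<\<kappa>} \<lesssim> f ` X" using eq by (meson eqpoll_sym lepoll_trans2)
    then show False using \<open>f ` X \<prec> {..<\<kappa>}\<close> not_lepoll_iff_lesspoll by blast
  qed
  then have "small (f ` X)" using small_lessThan eq small_lepoll eqpoll_imp_lepoll by blast
  then show ?thesis using f(1) unfolding small_def by simp
qed

lemma small_iff: "small X \<longleftrightarrow> X \<prec> {..<\<kappa>}"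
  using lesspoll_kappa_imp_small small_lesspoll_kappa by blast

lemma small_cl: "small (X :: 'i set) \<Longrightarrow> small (cl X)"
  unfolding small_def by (rule cl_lepoll[OF _ infinite_lam]) (simp_all add: small_bounded small_def)

lemma ex_greater: "\<exists>\<beta>::'i. \<alpha> < \<beta>"
  using small_bounded[of "{\<alpha>}"] by (simp add: small_finite)

definition osuc :: "'i \<Rightarrow> 'i" where
  "osuc \<alpha> = ssup {\<alpha>}"

lemma less_osuc_iff: "\<xi> < osuc \<alpha> \<longleftrightarrow> \<xi> \<le> \<alpha>"
  unfolding osuc_def using less_ssup_iff[of "{\<alpha>}" \<xi>] ex_greater[of \<alpha>] by simp

lemma osuc_le_iff: "osuc \<alpha> \<le> \<beta> \<longleftrightarrow> \<alpha> < \<beta>"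
  using less_osuc_iff[of \<beta> \<alpha>] by (simp flip: not_less)

lemma lessThan_osuc: "{..<osuc \<alpha>} = insert \<alpha> {..<\<alpha>}"
  by (auto simp: less_osuc_iff order.order_iff_strict)

lemma less_osuc [simp]: "\<alpha> < osuc \<alpha>"
  by (simp add: less_osuc_iff)

lemma osuc_less_kappa: "\<alpha> < \<kappa> \<Longrightarrow> osuc \<alpha> < \<kappa>"
proof -
  assume "\<alpha> < \<kappa>"
  then have "small {..<osuc \<alpha>}" by (simp add: small_insert small_lessThan lessThan_osuc)
  then have "osuc \<alpha> \<noteq> \<kappa>" using small_iff[of "{..<\<kappa>}"] by auto
  then show ?thesis using \<open>\<alpha> < \<kappa>\<close> osuc_le_iff[of \<alpha> \<kappa>] by simp
qed

lemma coi_small_enumeration: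
  fixes X :: "'i set"
  assumes "small X" "closed_in_sup X"
  obtains \<theta> h where "\<theta> < \<kappa>" "coi {..<\<theta>} h" "h ` {..<\<theta>} = X"
proof -
  have "X \<prec> (UNIV :: 'i set)"
    using assms(1) small_lesspoll_kappa kappa_lesspoll_UNIV lesspoll_trans by blast
  then obtain \<theta> h where h: "coi {..<\<theta>} h" "h ` {..<\<theta>} = X" using coi_enumeration assms(2) by blast
  have "X \<approx> {..<\<theta>}" using inj_on_image_eqpoll_self[OF coi_inj[OF h(1)]] h(2) by simp
  then have "small {..<\<theta>}" using assms(1) small_lepoll eqpoll_imp_lepoll eqpoll_sym by blast
  have "\<theta> < \<kappa>"
  proof (rule ccontr)
    assume "\<not> \<theta> < \<kappa>"
    then have "small {..<\<kappa>}" using \<open>small {..<\<theta>}\<close> small_subset[of "{..<\<theta>}" "{..<\<kappa>}"] by auto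
    then show False using small_iff[of "{..<\<kappa>}"] by auto
  qed
  then show ?thesis using that h by blast
qed

end

section \<open>Conditions made of atoms\<close>

type_synonym ('i, 'c) cond = "'i set \<times> ('i \<times> 'i \<times> 'c) set"

text \<open>The order by information content. It is converse to \<open>leq\<close>, where the
  stronger condition comes first.\<close>

definition weaker :: "('i, 'c) cond \<Rightarrow> ('i, 'c) cond \<Rightarrow> bool" (infix "\<sqsubseteq>" 50) where
  "p \<sqsubseteq> q \<longleftrightarrow> fst p \<subseteq> fst q \<and> snd p \<subseteq> snd q"

definition cut :: "('i, 'c) cond \<Rightarrow> 'i set \<Rightarrow> ('i, 'c) cond" where
  "cut p Z = (fst p \<inter> Z, snd p \<inter> (Z \<times> Z \<times> UNIV))"

text \<open>Only the two level coordinates move; the third one is a label that no c.o.i.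
  touches.\<close>

definition mv :: "('i \<Rightarrow> 'i) \<Rightarrow> 'i \<times> 'i \<times> 'c \<Rightarrow> 'i \<times> 'i \<times> 'c" where
  "mv j = (\<lambda>(a, b, c). (j a, j b, c))"

definition move :: "('i \<Rightarrow> 'i) \<Rightarrow> ('i, 'c) cond \<Rightarrow> ('i, 'c) cond" where
  "move j p = (j ` fst p, mv j ` snd p)"

definition join :: "('i, 'c) cond set \<Rightarrow> ('i, 'c) cond" where
  "join \<C> = (\<Union>(fst ` \<C>), \<Union>(snd ` \<C>))"

definition supported :: "('i, 'c) cond \<Rightarrow> bool" where
  "supported p \<longleftrightarrow> snd p \<subseteq> fst p \<times> fst p \<times> UNIV"

definition initial_in :: "'i::wellorder set \<Rightarrow> 'i set \<Rightarrow> bool" where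
  "initial_in Z x \<longleftrightarrow> Z \<subseteq> x \<and> (\<forall>\<alpha>\<in>x. \<forall>\<beta>\<in>Z. \<alpha> < \<beta> \<longrightarrow> \<alpha> \<in> Z)"

lemma fst_cut [simp]: "fst (cut p Z) = fst p \<inter> Z"
  and snd_cut: "snd (cut p Z) = snd p \<inter> (Z \<times> Z \<times> UNIV)"
  and fst_move [simp]: "fst (move j p) = j ` fst p"
  and snd_move: "snd (move j p) = mv j ` snd p"
  and fst_join: "fst (join \<C>) = \<Union>(fst ` \<C>)"
  and snd_join: "snd (join \<C>) = \<Union>(snd ` \<C>)"
  by (simp_all add: cut_def move_def join_def)

lemma weaker_refl [simp]: "p \<sqsubseteq> p"
  by (simp add: weaker_def)

lemma weaker_trans [trans]: "p \<sqsubseteq> q \<Longrightarrow> q \<sqsubseteq> r \<Longrightarrow> p \<sqsubseteq> r"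
  by (auto simp: weaker_def)

lemma weaker_antisym: "p \<sqsubseteq> q \<Longrightarrow> q \<sqsubseteq> p \<Longrightarrow> p = q"
  by (auto simp: weaker_def prod_eq_iff)

lemma cut_weaker: "cut p Z \<sqsubseteq> p"
  by (auto simp: weaker_def snd_cut)

lemma cut_cut: "cut (cut p Z) Z' = cut p (Z \<inter> Z')"
  by (auto simp: cut_def)

lemma cut_mono: "p \<sqsubseteq> q \<Longrightarrow> cut p Z \<sqsubseteq> cut q Z"
  by (auto simp: weaker_def snd_cut)

lemma cut_mono_set: "Z \<subseteq> Z' \<Longrightarrow> cut p Z \<sqsubseteq> cut p Z'"
  by (auto simp: weaker_def snd_cut)

lemma cut_id: "supported p \<Longrightarrow> fst p \<subseteq> Z \<Longrightarrow> cut p Z = p"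
  by (auto simp: cut_def supported_def prod_eq_iff)

lemma weaker_cut: "p \<sqsubseteq> q \<Longrightarrow> supported p \<Longrightarrow> fst p \<subseteq> Z \<Longrightarrow> p \<sqsubseteq> cut q Z"
  using cut_mono cut_id by metis

lemma cut_Int_fst: "supported p \<Longrightarrow> cut p (fst p \<inter> Z) = cut p Z"
  by (auto simp: cut_def supported_def)

lemma supported_cut: "supported p \<Longrightarrow> supported (cut p Z)"
  by (auto simp: supported_def snd_cut)

lemma supported_move: "supported p \<Longrightarrow> supported (move j p)"
proof -
  assume "supported p"
  then have "mv j t \<in> j ` fst p \<times> j ` fst p \<times> UNIV" if "t \<in> snd p" for t
    using that by (cases t) (auto simp: supported_def mv_def)
  then show ?thesis unfolding supported_def snd_move fst_move by blast
qed

lemma supported_join: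
  assumes "\<And>p. p \<in> \<C> \<Longrightarrow> supported p"
  shows "supported (join \<C>)"
proof -
  have "snd p \<subseteq> fst (join \<C>) \<times> fst (join \<C>) \<times> UNIV" if p: "p \<in> \<C>" for p
  proof -
    have "fst p \<subseteq> fst (join \<C>)" using p by (auto simp: fst_join)
    then have "fst p \<times> fst p \<times> UNIV \<subseteq> fst (join \<C>) \<times> fst (join \<C>) \<times> (UNIV :: _ set)" by auto
    then show ?thesis using assms[OF p] unfolding supported_def by (rule subset_trans[rotated])
  qed
  then show ?thesis unfolding supported_def snd_join by (rule UN_least)
qed

lemma join_upper: "p \<in> \<C> \<Longrightarrow> p \<sqsubseteq> join \<C>"
  by (auto simp: weaker_def fst_join snd_join)

lemma join_least: "(\<And>p. p \<in> \<C> \<Longrightarrow> p \<sqsubseteq> q) \<Longrightarrow> join \<C> \<sqsubseteq> q"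
  unfolding weaker_def fst_join snd_join by blast

lemma move_mono: "p \<sqsubseteq> q \<Longrightarrow> move j p \<sqsubseteq> move j q"
  by (auto simp: weaker_def snd_move)

lemma move_move: "move j (move \<pi> p) = move (j \<circ> \<pi>) p"
  by (auto simp: move_def image_image mv_def case_prod_unfold)

lemma move_join: "move j (join \<C>) = join (move j ` \<C>)"
  by (auto simp: move_def join_def)

lemma move_cong:
  assumes "supported p" "\<And>\<alpha>. \<alpha> \<in> fst p \<Longrightarrow> j \<alpha> = j' \<alpha>"
  shows "move j p = move j' p"
proof -
  have "mv j ` snd p = mv j' ` snd p"
    using assms by (intro image_cong) (auto simp: mv_def supported_def)
  then show ?thesis using assms(2) by (auto simp: move_def)
qed

lemma move_ident:
  assumes "supported p" "\<And>\<alpha>. \<alpha> \<in> fst p \<Longrightarrow> j \<alpha> = \<alpha>"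
  shows "move j p = p"
proof -
  have "move j p = move (\<lambda>a. a) p" using assms by (intro move_cong)
  then show ?thesis by (simp add: move_def mv_def case_prod_unfold)
qed

lemma image_Int_eq:
  assumes "\<And>t. t \<in> S \<Longrightarrow> f t \<in> X \<longleftrightarrow> t \<in> Y"
  shows "f ` S \<inter> X = f ` (S \<inter> Y)"
  using assms by blast

lemma cut_move:
  assumes "supported p" "inj_on j (fst p)" "Z \<subseteq> fst p"
  shows "cut (move j p) (j ` Z) = move j (cut p Z)"
proof -
  have mem: "j a \<in> j ` Z \<longleftrightarrow> a \<in> Z" if "a \<in> fst p" for a
    using assms(2,3) that by (metis inj_on_image_mem_iff)
  have "mv j t \<in> j ` Z \<times> j ` Z \<times> UNIV \<longleftrightarrow> t \<in> Z \<times> Z \<times> UNIV" if t: "t \<in> snd p" for t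
  proof -
    obtain a b c where abc: "t = (a, b, c)" by (cases t)
    then have "a \<in> fst p" "b \<in> fst p" using t assms(1) unfolding supported_def by blast+
    then show ?thesis using mem by (simp add: abc mv_def)
  qed
  then have "mv j ` snd p \<inter> (j ` Z \<times> j ` Z \<times> UNIV) = mv j ` (snd p \<inter> (Z \<times> Z \<times> UNIV))"
    by (rule image_Int_eq)
  moreover have "j ` fst p \<inter> j ` Z = j ` (fst p \<inter> Z)" using assms(3) by blast
  ultimately show ?thesis by (simp add: cut_def move_def)
qed

lemma move_weaker_iff:
  assumes "supported p" "supported q" "inj_on j (fst p \<union> fst q)"
  shows "move j p \<sqsubseteq> move j q \<longleftrightarrow> p \<sqsubseteq> q"
proof
  assume *: "move j p \<sqsubseteq> move j q"
  have inj: "j a = j b \<longleftrightarrow> a = b" if "a \<in> fst p" "b \<in> fst q" for a b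
    using assms(3) that by (meson UnI1 UnI2 inj_onD)
  have "fst p \<subseteq> fst q" using * inj by (fastforce simp: weaker_def)
  moreover have "t \<in> snd q" if t: "t \<in> snd p" for t
  proof -
    obtain a b c where abc: "t = (a, b, c)" by (cases t)
    have "mv j t \<in> mv j ` snd q" using * t by (auto simp: weaker_def snd_move)
    then obtain a' b' where "(a', b', c) \<in> snd q" "j a = j a'" "j b = j b'"
      by (auto simp: mv_def abc)
    moreover have "a \<in> fst p" "b \<in> fst p" "a' \<in> fst q" "b' \<in> fst q"
      using assms(1,2) t abc calculation unfolding supported_def by blast+
    ultimately show ?thesis using inj abc by metis
  qed
  ultimately show "p \<sqsubseteq> q" by (auto simp: weaker_def)
qed (rule move_mono)

section \<open>Amalgamation classes\<close>

text \<open>\<open>W_amalgam\<close> and \<open>W_gap\<close> are two ways to let \<open>u\<close>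
  follow when its part below a bound has been extended. If the old levels are cofinal among those of
  the extension \<open>r\<close>, then \<open>r\<close> must be kept exactly as it is. Otherwise
  something has to be invented between the last old levels and the next one; this is asked for only
  if the levels of \<open>u\<close> are closed, and then the given extension \<open>s\<close> may be
  strengthened as well. \<open>C_lepoll\<close> is what allows conditions with levels below \<kappa>
  to be coded in \<open>H \<kappa>\<close>.\<close>

locale amalgamation_class = successor_cardinals lam \<kappa>
  for lam \<kappa> :: "'i::wellorder" +
  fixes W :: "('i, 'c) cond \<Rightarrow> bool" and C :: "'c set"
  assumes C_lepoll: "C \<lesssim> {..<\<kappa>}"
    and W_small: "W p \<Longrightarrow> small (fst p) \<and> small (snd p)"
    and W_atoms: "W p \<Longrightarrow> snd p \<subseteq> fst p \<times> fst p \<times> C"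
    and W_empty: "W ({}, {})"
    and W_move: "W p \<Longrightarrow> strict_mono_on (fst p) j \<Longrightarrow> W (move j p)"
    and W_cut: "W p \<Longrightarrow> W (cut p Z)"
    and W_join: "\<C> \<noteq> {} \<Longrightarrow> small \<C> \<Longrightarrow> (\<And>p. p \<in> \<C> \<Longrightarrow> W p) \<Longrightarrow>
        (\<And>p q. p \<in> \<C> \<Longrightarrow> q \<in> \<C> \<Longrightarrow> p \<sqsubseteq> q \<or> q \<sqsubseteq> p) \<Longrightarrow> W (join \<C>)"
    and W_amalgam: "W u \<Longrightarrow> W r \<Longrightarrow> fst r \<subseteq> {..<\<sigma>} \<Longrightarrow> cut u {..<\<sigma>} \<sqsubseteq> r \<Longrightarrow>
        (\<And>\<xi>. \<xi> \<in> fst r \<Longrightarrow> \<exists>\<eta>\<in>fst u. \<eta> < \<sigma> \<and> \<xi> \<le> \<eta>) \<Longrightarrow>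
        small y \<Longrightarrow> fst u \<subseteq> y \<Longrightarrow> y \<inter> {..<\<sigma>} = fst r \<Longrightarrow>
        \<exists>q. W q \<and> fst q = y \<and> u \<sqsubseteq> q \<and> cut q {..<\<sigma>} = r"
    and W_gap: "W u \<Longrightarrow> closed_in_sup (fst u) \<Longrightarrow> W s \<Longrightarrow> fst s \<subseteq> {..<\<alpha>} \<Longrightarrow>
        cut u {..<\<alpha>} \<sqsubseteq> s \<Longrightarrow> \<exists>q. W q \<and> u \<sqsubseteq> q \<and> s \<sqsubseteq> q"
begin

lemma W_supported: "W p \<Longrightarrow> supported p"
  using W_atoms unfolding supported_def by blast

text \<open>The core of the forcing: closed level sets make extendibility automatic, by
  \<open>W_gap\<close>.\<close>

definition Wc :: "('i, 'c) cond \<Rightarrow> bool" where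
  "Wc p \<longleftrightarrow> W p \<and> closed_in_sup (fst p)"

text \<open>No extension \<open>s\<close> of the part below some \<beta> rules out the rest of
  \<open>p\<close>. The common extension may have more levels than \<open>p\<close> and
  \<open>s\<close> together.\<close>

definition extendible :: "('i, 'c) cond \<Rightarrow> bool" where
  "extendible p \<longleftrightarrow> (\<forall>s \<beta>. W s \<and> fst s \<subseteq> {..<\<beta>} \<and> cut p {..<\<beta>} \<sqsubseteq> s \<longrightarrow>
     (\<exists>q. W q \<and> p \<sqsubseteq> q \<and> s \<sqsubseteq> q))"

text \<open>The quantification over \<open>j\<close> is what makes this invariant under c.o.i.'s: \<open>\<pi>.p\<close> may have
  room for new levels where \<open>p\<close> has none.\<close>

definition PP :: "('i, 'c) cond \<Rightarrow> bool" where
  "PP p \<longleftrightarrow> supported p \<and> small (fst p) \<and>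
     (\<forall>Z j. initial_in Z (fst p) \<and> coi (cl Z) j \<longrightarrow> extendible (move j (cut p Z)))"

section \<open>Conditions under restriction, enlargement of levels, c.o.i.'s and unions\<close>

lemma W_levels:
  assumes "W u" "small y" "fst u \<subseteq> y"
  shows "\<exists>q. W q \<and> fst q = y \<and> u \<sqsubseteq> q"
  \<comment> \<open>Over the empty condition at the bound 0 the cofinality requirement of
    \<open>W_amalgam\<close> is vacuous.\<close>
  using W_amalgam[OF assms(1) W_empty, of ozero y] assms(2,3)
  by (auto simp: weaker_def snd_cut)

lemma PP_small: "PP p \<Longrightarrow> small (fst p)"
  unfolding PP_def by blast

lemma PP_supported: "PP p \<Longrightarrow> supported p"
  unfolding PP_def by blast

lemma PP_bounded: "PP p \<Longrightarrow> \<exists>\<beta>. \<forall>\<xi>\<in>fst p. \<xi> < \<beta>"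
  using PP_small small_bounded by blast

lemma initial_in_refl [simp]: "initial_in x x"
  unfolding initial_in_def by blast

lemma coi_ident: "closed_in_sup y \<Longrightarrow> coi y (\<lambda>a. a)"
  unfolding coi_iff by (auto simp: is_limit_of_iff strict_mono_on_ident)

lemma PP_extendible:
  assumes "PP p" "coi y j" "fst p \<subseteq> y"
  shows "extendible (move j p)"
proof -
  have "coi (cl (fst p)) j"
    using assms PP_bounded[OF assms(1)] by (meson closed_cl cl_subset_closed coi_closed coi_subset)
  then have "extendible (move j (cut p (fst p)))"
    using assms(1) unfolding PP_def by auto
  then show ?thesis using cut_id[OF PP_supported[OF assms(1)]] by simp
qed

lemma PP_imp_extendible:
  assumes "PP p"
  shows "extendible p"
proof -
  have "extendible (move (\<lambda>a. a) p)"
    using PP_extendible[OF assms coi_ident[of UNIV]] closed_cl by (simp add: closed_in_sup_def)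
  then show ?thesis using move_ident[OF PP_supported[OF assms], of "\<lambda>a. a"] by simp
qed

lemma PP_W:
  assumes "PP p"
  shows "\<exists>q. W q \<and> p \<sqsubseteq> q"
proof -
  have "cut p {..<ozero} \<sqsubseteq> ({}, {})" by (auto simp: weaker_def snd_cut)
  then show ?thesis using PP_imp_extendible[OF assms] W_empty unfolding extendible_def
    by (metis empty_subsetI fst_conv)
qed

lemma W_between:
  assumes "W q" "p \<sqsubseteq> q" "supported p" "small y" "fst p \<subseteq> y"
  shows "\<exists>q'. W q' \<and> fst q' = y \<and> p \<sqsubseteq> q'"
proof -
  have "small (fst q \<union> y)" using W_small[OF assms(1)] assms(4) small_Un by blast
  then obtain r where r: "W r" "fst r = fst q \<union> y" "q \<sqsubseteq> r" using W_levels[OF assms(1)] by blast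
  show ?thesis
  proof (intro exI conjI)
    show "W (cut r y)" using W_cut[OF r(1)] .
    show "fst (cut r y) = y" using r(2) by auto
    show "p \<sqsubseteq> cut r y" using weaker_cut[OF weaker_trans[OF assms(2) r(3)] assms(3,5)] .
  qed
qed

lemma PP_completion:
  assumes "PP p"
  shows "\<exists>q. Wc q \<and> p \<sqsubseteq> q \<and> fst q = cl (fst p)"
proof -
  obtain q where "W q" "p \<sqsubseteq> q" using PP_W[OF assms] by blast
  then obtain q' where "W q'" "fst q' = cl (fst p)" "p \<sqsubseteq> q'"
    using W_between[of q p "cl (fst p)"] PP_supported[OF assms] PP_small[OF assms] small_cl cl_superset
    by metis
  then show ?thesis unfolding Wc_def using closed_cl[OF PP_bounded[OF assms]] by metis
qed

lemma Wc_W: "Wc p \<Longrightarrow> W p"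
  unfolding Wc_def by blast

lemma Wc_extendible: "Wc p \<Longrightarrow> extendible p"
  unfolding extendible_def Wc_def using W_gap by blast

lemma Wc_move:
  assumes "Wc p" "coi y j" "fst p \<subseteq> y"
  shows "Wc (move j p)"
proof -
  have "coi (fst p) j" using assms coi_subset unfolding Wc_def by blast
  then show ?thesis using W_move[of p j] coi_strict_mono coi_image_closed assms(1)
    unfolding Wc_def by auto
qed

lemma Wc_cut_initial:
  assumes "Wc p" "initial_in Z (fst p)"
  shows "Wc (cut p Z)"
proof -
  have "closed_in_sup Z"
    using closed_initial[of "fst p" Z] assms unfolding Wc_def initial_in_def by blast
  moreover have "fst (cut p Z) = Z" using assms(2) by (auto simp: initial_in_def)
  ultimately show ?thesis using W_cut assms(1) unfolding Wc_def by simp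
qed

lemma initial_in_lessThan: "initial_in (x \<inter> {..<\<alpha>}) x"
  unfolding initial_in_def by auto

lemma Wc_cut: "Wc p \<Longrightarrow> Wc (cut p {..<\<alpha>})"
  using Wc_cut_initial[OF _ initial_in_lessThan] cut_Int_fst[OF W_supported] Wc_W by metis

text \<open>Initial segments of a closed set are closed and c.o.i.'s preserve closedness, so
  \<open>W_gap\<close> settles every instance of the definition.\<close>

lemma Wc_imp_PP:
  assumes "Wc p"
  shows "PP p"
  unfolding PP_def
proof (intro conjI allI impI)
  show "supported p" "small (fst p)" using assms W_supported W_small Wc_W by blast+
  fix Z j assume Z: "initial_in Z (fst p) \<and> coi (cl Z) j"
  then have "Wc (cut p Z)" using Wc_cut_initial assms by blast
  moreover have "fst (cut p Z) \<subseteq> cl Z" using cl_superset by auto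
  ultimately show "extendible (move j (cut p Z))" using Wc_move Wc_extendible Z by blast
qed

lemma PP_cut_initial:
  assumes "PP p" "initial_in Z (fst p)"
  shows "PP (cut p Z)"
  unfolding PP_def
proof (intro conjI allI impI)
  show "supported (cut p Z)" using PP_supported[OF assms(1)] supported_cut by blast
  show "small (fst (cut p Z))" by (rule small_subset[OF PP_small[OF assms(1)]]) auto
  fix Z' j assume Z': "initial_in Z' (fst (cut p Z)) \<and> coi (cl Z') j"
  then have "Z' \<subseteq> fst p \<inter> Z" "\<forall>\<alpha>\<in>fst p \<inter> Z. \<forall>\<beta>\<in>Z'. \<alpha> < \<beta> \<longrightarrow> \<alpha> \<in> Z'" unfolding initial_in_def by simp_all
  then have "initial_in Z' (fst p)" "Z \<inter> Z' = Z'" using assms(2) unfolding initial_in_def by blast+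
  then show "extendible (move j (cut (cut p Z) Z'))"
    using Z' assms(1) unfolding PP_def cut_cut by simp
qed

lemma PP_cut: "PP p \<Longrightarrow> PP (cut p {..<\<alpha>})"
  using PP_cut_initial[OF _ initial_in_lessThan] cut_Int_fst[OF PP_supported] by metis

text \<open>A level without atoms makes no demand that \<open>W_levels\<close> could not meet after
  the extension has been found.\<close>

lemma extendible_levels:
  assumes "extendible (x, A)" "supported (x, A)" "small y" "x \<subseteq> y"
  shows "extendible (y, A)"
  unfolding extendible_def
proof (intro allI impI)
  fix s \<beta> assume s: "W s \<and> fst s \<subseteq> {..<\<beta>} \<and> cut (y, A) {..<\<beta>} \<sqsubseteq> s"
  then have "cut (x, A) {..<\<beta>} \<sqsubseteq> s" using assms(4) by (auto simp: weaker_def snd_cut)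
  then obtain q where q: "W q" "(x, A) \<sqsubseteq> q" "s \<sqsubseteq> q" using assms(1) s unfolding extendible_def by blast
  then obtain q' where "W q'" "fst q' = fst q \<union> y" "q \<sqsubseteq> q'"
    using W_levels[OF q(1), of "fst q \<union> y"] W_small[OF q(1)] assms(3) small_Un by blast
  then show "\<exists>q. W q \<and> (y, A) \<sqsubseteq> q \<and> s \<sqsubseteq> q"
    using q by (intro exI[of _ q']) (auto simp: weaker_def)
qed

text \<open>Supplies the enlargement of supports demanded by \<open>axiom_supp\<close>. No atoms are
  added, and an initial segment of the larger level set meets the old one in an initial
  segment.\<close>

lemma PP_levels:
  assumes "PP p" "small x" "fst p \<subseteq> x"
  shows "PP (x, snd p)"
  unfolding PP_def
proof (intro conjI allI impI)
  show sup: "supported (x, snd p)" using PP_supported[OF assms(1)] assms(3) unfolding supported_def by auto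
  show "small (fst (x, snd p))" using assms by simp
  fix Z j assume Z: "initial_in Z (fst (x, snd p)) \<and> coi (cl Z) j"
  have b: "\<exists>\<beta>. \<forall>\<xi>\<in>Z. \<xi> < \<beta>"
    using Z small_bounded[OF assms(2)] unfolding initial_in_def by auto
  have ini: "initial_in (fst p \<inter> Z) (fst p)" using Z assms(3) unfolding initial_in_def by auto
  moreover have "coi (cl (fst p \<inter> Z)) j"
    using Z cl_mono[OF b, of "fst p \<inter> Z"] closed_cl[of "fst p \<inter> Z"] b
    by (meson IntE coi_subset inf_le2)
  ultimately have e: "extendible (move j (cut p (fst p \<inter> Z)))" using assms(1) unfolding PP_def by blast
  have eq: "cut p (fst p \<inter> Z) = cut p Z" using cut_Int_fst[OF PP_supported[OF assms(1)]] .
  have "extendible (j ` Z, snd (move j (cut p Z)))"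
  proof (rule extendible_levels)
    show "extendible (j ` (fst p \<inter> Z), snd (move j (cut p Z)))"
      using e unfolding eq by (simp add: move_def)
    show "supported (j ` (fst p \<inter> Z), snd (move j (cut p Z)))"
      using supported_move[OF supported_cut[OF PP_supported[OF assms(1)]], of j Z] by (simp add: move_def)
    show "small (j ` Z)"
      using assms(2) Z small_subset[OF assms(2)] small_image unfolding initial_in_def by auto
  qed auto
  moreover have "(j ` Z, snd (move j (cut p Z))) = move j (cut (x, snd p) Z)"
    using Z by (auto simp: move_def cut_def initial_in_def)
  ultimately show "extendible (move j (cut (x, snd p) Z))" by simp
qed

text \<open>An initial segment of the image is the image of an initial segment, and
  \<open>j \<circ> \<pi>\<close> is again a c.o.i.; so the instance for \<open>j\<close> at the
  image is the instance for \<open>j \<circ> \<pi>\<close> at \<open>p\<close>.\<close>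

lemma PP_move:
  assumes "PP p" "coi y \<pi>" "fst p \<subseteq> y"
  shows "PP (move \<pi> p)"
  unfolding PP_def
proof (intro conjI allI impI)
  show "supported (move \<pi> p)" using PP_supported[OF assms(1)] supported_move by blast
  show "small (fst (move \<pi> p))" using PP_small[OF assms(1)] small_image by auto
  fix Z j assume Z: "initial_in Z (fst (move \<pi> p)) \<and> coi (cl Z) j"
  define Z' where "Z' = {\<xi> \<in> fst p. \<pi> \<xi> \<in> Z}"
  have eq: "Z = \<pi> ` Z'" using Z unfolding Z'_def initial_in_def by auto
  have sm: "small Z'" unfolding Z'_def by (rule small_subset[OF PP_small[OF assms(1)]]) auto
  have "small Z" using eq sm small_image by blast
  have "initial_in Z' (fst p)"
    unfolding initial_in_def
  proof (intro conjI ballI impI)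
    fix \<alpha> \<beta> assume *: "\<alpha> \<in> fst p" "\<beta> \<in> Z'" "\<alpha> < \<beta>"
    then have "\<pi> \<alpha> < \<pi> \<beta>" "\<pi> \<beta> \<in> Z" using coi_less_iff[OF assms(2)] assms(3) unfolding Z'_def by blast+
    then have "\<pi> \<alpha> \<in> Z" using Z *(1) unfolding initial_in_def fst_move by blast
    then show "\<alpha> \<in> Z'" using *(1) unfolding Z'_def by blast
  qed (auto simp: Z'_def)
  moreover have "coi (cl Z') (j \<circ> \<pi>)"
  proof (rule coi_comp)
    show "coi (cl Z') \<pi>"
    proof (rule coi_subset[OF assms(2)])
      have "Z' \<subseteq> y" using assms(3) unfolding Z'_def by blast
      then show "cl Z' \<subseteq> y" using cl_subset_closed[OF small_bounded[OF sm]] coi_closed[OF assms(2)] by blast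
      show "closed_in_sup (cl Z')" using closed_cl[OF small_bounded[OF sm]] .
    qed
    show "coi (cl Z) j" using Z by blast
    show "\<pi> ` cl Z' \<subseteq> cl Z"
    proof -
      have "Z' \<subseteq> y" using assms(3) unfolding Z'_def by blast
      moreover have "\<exists>\<beta>. \<forall>\<xi>\<in>\<pi> ` Z'. \<xi> < \<beta>" using small_bounded[OF \<open>small Z\<close>] eq by simp
      ultimately have "\<pi> ` cl Z' \<subseteq> cl (\<pi> ` Z')" by (intro coi_image_cl[OF assms(2)] small_bounded[OF sm])
      then show ?thesis using eq by simp
    qed
  qed
  ultimately have "extendible (move (j \<circ> \<pi>) (cut p Z'))" using assms(1) unfolding PP_def by blast
  moreover have "cut (move \<pi> p) Z = move \<pi> (cut p Z')"
    unfolding eq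
  proof (rule cut_move[OF PP_supported[OF assms(1)]])
    show "inj_on \<pi> (fst p)" using coi_inj[OF assms(2)] assms(3) inj_on_subset by blast
  qed (auto simp: Z'_def)
  ultimately show "extendible (move j (cut (move \<pi> p) Z))" by (simp add: move_move)
qed

text \<open>If the bound is at most \<alpha>, \<open>V\<close> is extended first and
  \<open>U\<close>, whose levels are closed, follows by \<open>W_gap\<close>. If it is larger,
  \<open>V\<close> already lies inside \<open>s\<close> and only \<open>U\<close> has to
  follow.\<close>

lemma extendible_Un:
  assumes U: "Wc U" and V: "extendible V" "supported V" "fst V \<subseteq> {..<\<alpha>}" and UV: "cut U {..<\<alpha>} \<sqsubseteq> V"
  shows "extendible (join {U, V})"
  unfolding extendible_def
proof (intro allI impI)
  fix s \<beta> assume s: "W s \<and> fst s \<subseteq> {..<\<beta>} \<and> cut (join {U, V}) {..<\<beta>} \<sqsubseteq> s"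
  then have s': "cut U {..<\<beta>} \<sqsubseteq> s" "cut V {..<\<beta>} \<sqsubseteq> s"
    using cut_mono[OF join_upper] weaker_trans by (metis insertCI)+
  show "\<exists>q. W q \<and> join {U, V} \<sqsubseteq> q \<and> s \<sqsubseteq> q"
  proof (cases "\<beta> \<le> \<alpha>")
    case True
    obtain q1 where q1: "W q1" "V \<sqsubseteq> q1" "s \<sqsubseteq> q1"
      using V(1) s s'(2) unfolding extendible_def by blast
    define q2 where "q2 = cut q1 {..<\<alpha>}"
    have "s \<sqsubseteq> q2" unfolding q2_def using True s
      by (intro weaker_cut[OF q1(3) W_supported]) auto
    have "V \<sqsubseteq> q2" unfolding q2_def by (rule weaker_cut[OF q1(2) V(2,3)])
    then have "cut U {..<\<alpha>} \<sqsubseteq> q2" using UV weaker_trans by blast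
    moreover have "W q2" "fst q2 \<subseteq> {..<\<alpha>}" unfolding q2_def using W_cut[OF q1(1)] by auto
    ultimately obtain q where "W q" "U \<sqsubseteq> q" "q2 \<sqsubseteq> q"
      using W_gap[of U q2 \<alpha>] U unfolding Wc_def by blast
    then show ?thesis using \<open>V \<sqsubseteq> q2\<close> \<open>s \<sqsubseteq> q2\<close> weaker_trans join_least[of "{U, V}" q] by blast
  next
    case False
    then have "{..<\<alpha>} \<subseteq> {..<\<beta>}" by auto
    then have "cut V {..<\<beta>} = V" using V by (intro cut_id) auto
    obtain q where q: "W q" "U \<sqsubseteq> q" "s \<sqsubseteq> q" using W_gap[of U s \<beta>] U s s'(1) unfolding Wc_def by blast
    moreover have "V \<sqsubseteq> q" using s'(2) q(3) \<open>cut V {..<\<beta>} = V\<close> weaker_trans by metis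
    ultimately show ?thesis using join_least[of "{U, V}" q] by blast
  qed
qed

text \<open>Provides the greatest lower bounds of \<open>axiom_glb\<close>. An initial segment that
  stays below \<alpha> sees only \<open>q\<close>; one that goes beyond contains all of
  \<open>q\<close>, and then \<open>extendible_Un\<close> applies to the images.\<close>

lemma PP_Un:
  assumes p: "Wc p" and q: "PP q" "fst q \<subseteq> {..<\<alpha>}" and pq: "cut p {..<\<alpha>} \<sqsubseteq> q"
  shows "PP (join {p, q})"
  unfolding PP_def
proof (intro conjI allI impI)
  have W: "W p" using p Wc_W by blast
  show "supported (join {p, q})" using W_supported[OF W] PP_supported[OF q(1)] by (intro supported_join) auto
  show "small (fst (join {p, q}))" using W_small[OF W] PP_small[OF q(1)] by (simp add: fst_join small_Un)
  fix Z j assume Z: "initial_in Z (fst (join {p, q})) \<and> coi (cl Z) j"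
  then have Zsub: "Z \<subseteq> fst p \<union> fst q" by (auto simp: initial_in_def fst_join)
  then have "small Z" using W_small[OF W] PP_small[OF q(1)] small_Un small_subset by blast
  then have bZ: "\<exists>\<beta>. \<forall>\<xi>\<in>Z. \<xi> < \<beta>" by (rule small_bounded)
  show "extendible (move j (cut (join {p, q}) Z))"
  proof (cases "Z \<subseteq> {..<\<alpha>}")
    case True
    have "fst p \<inter> {..<\<alpha>} \<subseteq> fst q" using pq by (auto simp: weaker_def)
    then have "initial_in Z (fst q)" using Z True Zsub unfolding initial_in_def by (auto simp: fst_join)
    moreover have "cut (join {p, q}) Z = cut q Z"
      using pq True Zsub by (fastforce simp: cut_def join_def weaker_def)
    ultimately show ?thesis using q(1) Z unfolding PP_def by simp
  next
    case False
    then obtain z where z: "z \<in> Z" "\<alpha> \<le> z" using not_less by blast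
    \<comment> \<open>The ordinal \<alpha> need not be in the domain of \<open>j\<close>; the first
      level of \<open>Z\<close> at or above it takes its place.\<close>
    define \<mu> where "\<mu> = (LEAST z. z \<in> Z \<and> \<alpha> \<le> z)"
    have \<mu>: "\<mu> \<in> Z" "\<alpha> \<le> \<mu>" unfolding \<mu>_def using LeastI[of "\<lambda>z. z \<in> Z \<and> \<alpha> \<le> z" z] z by auto
    have \<mu>_least: "\<mu> \<le> z" if "z \<in> Z" "\<alpha> \<le> z" for z
      unfolding \<mu>_def using that by (auto intro: Least_le)
    have qZ: "fst q \<subseteq> Z"
    proof
      fix \<xi> assume \<xi>: "\<xi> \<in> fst q"
      then have "\<xi> < z" using q(2) z(2) by auto
      then show "\<xi> \<in> Z" using Z z(1) \<xi> unfolding initial_in_def by (auto simp: fst_join)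
    qed
    define P where "P = cut p (fst p \<inter> Z)"
    have P: "Wc P" unfolding P_def
      by (rule Wc_cut_initial[OF p]) (use Z in \<open>auto simp: initial_in_def fst_join\<close>)
    have PZ: "fst P \<subseteq> cl Z" unfolding P_def using cl_superset by auto
    have less: "j a < j b \<longleftrightarrow> a < b" if "a \<in> Z" "b \<in> Z" for a b
      using Z coi_less_iff[of "cl Z" j] cl_superset[of Z] that by blast
    have cj: "coi (cl Z) j" using Z by blast
    have jinj: "inj_on j Z" using inj_on_subset[OF coi_inj[OF cj] cl_superset] .
    have "extendible (join {move j P, move j q})"
    proof (rule extendible_Un)
      show "Wc (move j P)" using Wc_move[OF P cj PZ] .
      have "coi (cl (fst q)) j"
        using coi_subset[OF cj cl_mono[OF bZ qZ] closed_cl[OF PP_bounded[OF q(1)]]] .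
      then show "extendible (move j q)" using PP_extendible[OF q(1) _ cl_superset] by blast
      show "supported (move j q)" using PP_supported[OF q(1)] supported_move by blast
      show "fst (move j q) \<subseteq> {..<j \<mu>}" using less qZ q(2) \<mu> by fastforce
      have jP: "fst P \<inter> {..<\<alpha>} \<subseteq> fst P" by blast
      have lt: "j a < j \<mu> \<longleftrightarrow> a < \<alpha>" if "a \<in> fst P" for a
        using less[of a \<mu>] \<mu> \<mu>_least[of a] that unfolding P_def
        by (metis IntD2 fst_cut less_le_trans not_less Int_iff)
      have "cut (move j P) {..<j \<mu>} = cut (move j P) (j ` (fst P \<inter> {..<\<alpha>}))"
        by (subst cut_Int_fst[OF supported_move[OF W_supported[OF Wc_W[OF P]]], symmetric])
          (rule arg_cong[of _ _ "cut (move j P)"], use lt in auto)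
      also have "\<dots> = move j (cut P (fst P \<inter> {..<\<alpha>}))"
        using jinj inj_on_subset[OF jinj, of "fst P"]
        by (intro cut_move W_supported Wc_W P jP) (auto simp: P_def)
      also have "\<dots> \<sqsubseteq> move j q"
      proof (rule move_mono)
        have "cut P (fst P \<inter> {..<\<alpha>}) \<sqsubseteq> cut p {..<\<alpha>}"
          by (auto simp: P_def cut_def weaker_def)
        then show "cut P (fst P \<inter> {..<\<alpha>}) \<sqsubseteq> q" using pq weaker_trans by blast
      qed
      finally show "cut (move j P) {..<j \<mu>} \<sqsubseteq> move j q" .
    qed
    moreover have "cut (join {p, q}) Z = join {cut p Z, cut q Z}"
      by (auto simp: cut_def join_def)
    then have "cut (join {p, q}) Z = join {P, q}"
      using cut_id[OF PP_supported[OF q(1)] qZ] cut_Int_fst[OF W_supported[OF W]] unfolding P_def by simp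
    ultimately show ?thesis by (simp add: move_join)
  qed
qed

text \<open>An increasing chain in \<open>W\<close> is built whose \<eta>-th member extends
  \<open>U \<eta>\<close> and \<open>s\<close>. It must not run ahead: the \<eta>-th member keeps to
  levels below \<beta> or below the end of \<open>U \<eta>\<close>, so that every later
  \<open>U \<eta>'\<close> sees it as an extension of an initial segment of its own.\<close>

lemma extendible_join:
  fixes U :: "'i \<Rightarrow> ('i, 'c) cond"
  assumes \<xi>: "\<xi> < \<kappa>"
    and U: "\<And>\<eta>. \<eta> < \<xi> \<Longrightarrow> extendible (U \<eta>)" "\<And>\<eta>. \<eta> < \<xi> \<Longrightarrow> supported (U \<eta>)"
      "\<And>\<eta>. \<eta> < \<xi> \<Longrightarrow> small (fst (U \<eta>))"
    and mono: "\<And>\<eta> \<eta>'. \<eta> < \<eta>' \<Longrightarrow> \<eta>' < \<xi> \<Longrightarrow> U \<eta> \<sqsubseteq> U \<eta>'"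
    and ini: "\<And>\<eta> \<eta>' a b. \<eta> < \<eta>' \<Longrightarrow> \<eta>' < \<xi> \<Longrightarrow> a \<in> fst (U \<eta>') \<Longrightarrow> b \<in> fst (U \<eta>) \<Longrightarrow> a \<le> b \<Longrightarrow> a \<in> fst (U \<eta>)"
    and at: "\<And>\<eta> \<eta>'. \<eta> < \<eta>' \<Longrightarrow> \<eta>' < \<xi> \<Longrightarrow> cut (U \<eta>') (fst (U \<eta>)) \<sqsubseteq> U \<eta>"
  shows "extendible (join (U ` {..<\<xi>}))"
  unfolding extendible_def
proof (intro allI impI)
  fix s \<beta> assume s: "W s \<and> fst s \<subseteq> {..<\<beta>} \<and> cut (join (U ` {..<\<xi>})) {..<\<beta>} \<sqsubseteq> s"
  then have Us: "cut (U \<eta>) {..<\<beta>} \<sqsubseteq> s" if "\<eta> < \<xi>" for \<eta>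
    using cut_mono[OF join_upper, of "U \<eta>" "U ` {..<\<xi>}"] that weaker_trans by blast
  define \<tau> where "\<tau> \<eta> = ssup (fst (U \<eta>))" for \<eta>
  have less_\<tau>: "a < \<tau> \<eta> \<longleftrightarrow> (\<exists>b\<in>fst (U \<eta>). a \<le> b)" if "\<eta> < \<xi>" for a \<eta>
    unfolding \<tau>_def using less_ssup_iff[OF small_bounded[OF U(3)[OF that]]] .
  have \<tau>_mono: "\<tau> \<eta> \<le> \<tau> \<eta>'" if "\<eta> < \<eta>'" "\<eta>' < \<xi>" for \<eta> \<eta>'
    using mono[OF that] less_\<tau>[OF less_trans[OF that]] less_\<tau>[OF that(2)]
    by (metis (no_types) leI less_irrefl subsetD weaker_def)
  define P where "P S \<eta> r \<longleftrightarrow> (\<eta> < \<xi> \<longrightarrow> W r \<and> U \<eta> \<sqsubseteq> r \<and> s \<sqsubseteq> r \<and> fst r \<subseteq> {..<max \<beta> (\<tau> \<eta>)} \<and>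
    (\<forall>\<eta>'<\<eta>. S \<eta>' \<sqsubseteq> r))" for S :: "'i \<Rightarrow> ('i, 'c) cond" and \<eta> r
  have "\<exists>S. \<forall>\<eta>. P S \<eta> (S \<eta>)"
  proof (rule dependent_wellorder_choice)
    show "P f x r = P g x r" if "\<And>y. y < x \<Longrightarrow> f y = g y" for r x f g
      using that unfolding P_def by simp
  next
    fix \<eta> and S :: "'i \<Rightarrow> ('i, 'c) cond" assume IH: "\<And>\<zeta>. \<zeta> < \<eta> \<Longrightarrow> P S \<zeta> (S \<zeta>)"
    show "\<exists>r. P S \<eta> r"
    proof (cases "\<eta> < \<xi>")
      case True
      have S: "W (S \<zeta>)" "U \<zeta> \<sqsubseteq> S \<zeta>" "s \<sqsubseteq> S \<zeta>" "fst (S \<zeta>) \<subseteq> {..<max \<beta> (\<tau> \<zeta>)}"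
        "\<And>\<zeta>'. \<zeta>' < \<zeta> \<Longrightarrow> S \<zeta>' \<sqsubseteq> S \<zeta>" if "\<zeta> < \<eta>" for \<zeta>
        using IH[OF that] True less_trans[OF that True] unfolding P_def by blast+
      define s' where "s' = join (insert s (S ` {..<\<eta>}))"
      have "W s'" unfolding s'_def
      proof (rule W_join)
        have "small {..<\<eta>}" using True \<xi> by (intro small_lessThan) simp
        then show "small (insert s (S ` {..<\<eta>}))" by (intro small_insert small_image)
        show "W p" if "p \<in> insert s (S ` {..<\<eta>})" for p using that s S(1) by blast
        have "S a \<sqsubseteq> S b \<or> S b \<sqsubseteq> S a" if "a < \<eta>" "b < \<eta>" for a b
          using S(5)[OF that(1), of b] S(5)[OF that(2), of a] by (cases a b rule: linorder_cases) auto
        then show "p \<sqsubseteq> q \<or> q \<sqsubseteq> p" if "p \<in> insert s (S ` {..<\<eta>})" "q \<in> insert s (S ` {..<\<eta>})" for p q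
          using that S(3) by auto
      qed simp
      \<comment> \<open>The least bound for all that has been constructed. Below it
        \<open>U \<eta>\<close> has only levels below \<beta> and levels of earlier
        \<open>U \<zeta>\<close>, all of which are present in \<open>s'\<close>.\<close>
      define \<beta>' where "\<beta>' = (LEAST b. \<beta> \<le> b \<and> (\<forall>\<zeta><\<eta>. \<tau> \<zeta> \<le> b))"
      have max: "\<beta> \<le> max \<beta> (\<tau> \<eta>) \<and> (\<forall>\<zeta><\<eta>. \<tau> \<zeta> \<le> max \<beta> (\<tau> \<eta>))"
        using \<tau>_mono[OF _ True] by (auto intro: le_max_iff_disj[THEN iffD2])
      have \<beta>': "\<beta> \<le> \<beta>'" "\<And>\<zeta>. \<zeta> < \<eta> \<Longrightarrow> \<tau> \<zeta> \<le> \<beta>'"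
        using LeastI[of "\<lambda>b. \<beta> \<le> b \<and> (\<forall>\<zeta><\<eta>. \<tau> \<zeta> \<le> b)", OF max] unfolding \<beta>'_def by blast+
      have \<beta>'_le: "\<beta>' \<le> max \<beta> (\<tau> \<eta>)" unfolding \<beta>'_def using max by (rule Least_le)
      have below: "a < \<beta> \<or> (\<exists>\<zeta><\<eta>. a < \<tau> \<zeta>)" if "a < \<beta>'" for a
        using not_less_Least[OF that[unfolded \<beta>'_def]] by (auto simp: not_le)
      have "fst s' \<subseteq> {..<\<beta>'}"
      proof -
        have "fst (S \<zeta>) \<subseteq> {..<\<beta>'}" if "\<zeta> < \<eta>" for \<zeta>
          using S(4)[OF that] \<beta>'(1) \<beta>'(2)[OF that] by (auto dest!: subsetD simp: less_max_iff_disj)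
        then show ?thesis using s \<beta>'(1) unfolding s'_def fst_join by fastforce
      qed
      have US: "U \<zeta> \<sqsubseteq> s'" if "\<zeta> < \<eta>" for \<zeta>
        using S(2)[OF that] join_upper[of "S \<zeta>" "insert s (S ` {..<\<eta>})"] that weaker_trans
        unfolding s'_def by blast
      have ss': "s \<sqsubseteq> s'" unfolding s'_def by (rule join_upper) simp
      have "cut (U \<eta>) {..<\<beta>'} \<sqsubseteq> s'"
        unfolding weaker_def
      proof (intro conjI subsetI)
        fix a assume a: "a \<in> fst (cut (U \<eta>) {..<\<beta>'})"
        then consider "a < \<beta>" | \<zeta> b where "\<zeta> < \<eta>" "b \<in> fst (U \<zeta>)" "a \<le> b"
          using below[of a] less_\<tau> True less_trans by (metis IntD2 fst_cut lessThan_iff)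
        then show "a \<in> fst s'"
        proof cases
          case 1
          then have "a \<in> fst (cut (U \<eta>) {..<\<beta>})" using a by simp
          then show ?thesis using Us[OF True] ss' unfolding weaker_def by blast
        next
          case 2
          then have "a \<in> fst (U \<zeta>)" using ini[OF _ True] a by auto
          then show ?thesis using US 2 unfolding weaker_def by blast
        qed
      next
        fix t assume t: "t \<in> snd (cut (U \<eta>) {..<\<beta>'})"
        obtain a b c where abc: "t = (a, b, c)" by (cases t)
        have ab: "a \<in> fst (U \<eta>)" "b \<in> fst (U \<eta>)" "t \<in> snd (U \<eta>)" "a < \<beta>'" "b < \<beta>'"
          using t U(2)[OF True] unfolding abc supported_def snd_cut by blast+
        then have "max a b < \<beta>'" by simp
        then consider "max a b < \<beta>" | \<zeta> d where "\<zeta> < \<eta>" "d \<in> fst (U \<zeta>)" "max a b \<le> d"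
          using below[of "max a b"] less_\<tau> True less_trans by metis
        then show "t \<in> snd s'"
        proof cases
          case 1
          then have "t \<in> snd (cut (U \<eta>) {..<\<beta>})" using ab unfolding snd_cut abc by auto
          then show ?thesis using Us[OF True] ss' unfolding weaker_def by blast
        next
          case 2
          then have "a \<in> fst (U \<zeta>)" "b \<in> fst (U \<zeta>)" using ini[OF _ True] ab by auto
          then have "t \<in> snd (cut (U \<eta>) (fst (U \<zeta>)))" using ab unfolding snd_cut abc by auto
          then show ?thesis using at[OF 2(1) True] US[OF 2(1)] unfolding weaker_def by blast
        qed
      qed
      then obtain q where q: "W q" "U \<eta> \<sqsubseteq> q" "s' \<sqsubseteq> q"
        using U(1)[OF True] \<open>W s'\<close> \<open>fst s' \<subseteq> {..<\<beta>'}\<close> unfolding extendible_def by blast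
      \<comment> \<open>Extendibility of \<open>U \<eta>\<close> may add levels anywhere; cutting
        restores the bound and loses nothing of \<open>U \<eta>\<close> and
        \<open>s'\<close>.\<close>
      define r where "r = cut q {..<max \<beta> (\<tau> \<eta>)}"
      have "fst (U \<eta>) \<subseteq> {..<max \<beta> (\<tau> \<eta>)}" using less_\<tau>[OF True] by (auto simp: less_max_iff_disj)
      then have "U \<eta> \<sqsubseteq> r" unfolding r_def using weaker_cut[OF q(2) U(2)[OF True]] by blast
      moreover have "s' \<sqsubseteq> r" unfolding r_def
        using \<open>fst s' \<subseteq> {..<\<beta>'}\<close> \<beta>'_le by (intro weaker_cut[OF q(3) W_supported[OF \<open>W s'\<close>]]) auto
      moreover have "S \<zeta> \<sqsubseteq> s'" if "\<zeta> < \<eta>" for \<zeta> unfolding s'_def using that by (intro join_upper) simp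
      moreover have "W r" "fst r \<subseteq> {..<max \<beta> (\<tau> \<eta>)}" unfolding r_def using W_cut[OF q(1)] by auto
      ultimately have "P S \<eta> r" unfolding P_def using ss' weaker_trans by blast
      then show ?thesis by blast
    qed (simp add: P_def)
  qed
  then obtain S where "\<And>\<eta>. P S \<eta> (S \<eta>)" by blast
  then have S: "W (S \<zeta>)" "U \<zeta> \<sqsubseteq> S \<zeta>" "s \<sqsubseteq> S \<zeta>" "\<And>\<zeta>'. \<zeta>' < \<zeta> \<Longrightarrow> S \<zeta>' \<sqsubseteq> S \<zeta>" if "\<zeta> < \<xi>" for \<zeta>
    using that unfolding P_def by blast+
  define q where "q = join (insert s (S ` {..<\<xi>}))"
  have "W q" unfolding q_def
  proof (rule W_join)
    show "small (insert s (S ` {..<\<xi>}))" using \<xi> by (intro small_insert small_image small_lessThan)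
    show "W p" if "p \<in> insert s (S ` {..<\<xi>})" for p using that s S(1) by blast
    have "S a \<sqsubseteq> S b \<or> S b \<sqsubseteq> S a" if "a < \<xi>" "b < \<xi>" for a b
      using S(4)[OF that(1), of b] S(4)[OF that(2), of a] by (cases a b rule: linorder_cases) auto
    then show "p \<sqsubseteq> q \<or> q \<sqsubseteq> p" if "p \<in> insert s (S ` {..<\<xi>})" "q \<in> insert s (S ` {..<\<xi>})" for p q
      using that S(3) by auto
  qed simp
  moreover have "join (U ` {..<\<xi>}) \<sqsubseteq> q"
  proof (rule join_least)
    fix p assume "p \<in> U ` {..<\<xi>}"
    then obtain \<zeta> where "\<zeta> < \<xi>" "p = U \<zeta>" by blast
    then show "p \<sqsubseteq> q" using S(2)[of \<zeta>] join_upper[of "S \<zeta>" "insert s (S ` {..<\<xi>})"] weaker_trans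
      unfolding q_def by blast
  qed
  moreover have "s \<sqsubseteq> q" unfolding q_def by (rule join_upper) simp
  ultimately show "\<exists>q. W q \<and> join (U ` {..<\<xi>}) \<sqsubseteq> q \<and> s \<sqsubseteq> q" by blast
qed

text \<open>By coherence the \<open>V \<eta>\<close> are end-extensions of one another, so an
  initial segment of the union is inside some \<open>V \<eta>\<close> or is everything. Only the
  second case needs \<open>extendible_join\<close>.\<close>

lemma PP_join:
  fixes V :: "'i \<Rightarrow> ('i, 'c) cond"
  assumes \<xi>: "\<xi> < \<kappa>" and V: "\<And>\<eta>. \<eta> < \<xi> \<Longrightarrow> PP (V \<eta>)"
    and coh: "\<And>\<eta> \<eta>'. \<eta> < \<eta>' \<Longrightarrow> \<eta>' < \<xi> \<Longrightarrow> V \<eta> = cut (V \<eta>') {..<ssup (fst (V \<eta>))}"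
  shows "PP (join (V ` {..<\<xi>}))"
    and "\<eta> < \<xi> \<Longrightarrow> cut (join (V ` {..<\<xi>})) {..<ssup (fst (V \<eta>))} = V \<eta>"
proof -
  let ?p = "join (V ` {..<\<xi>})"
  have less_ssup: "a < ssup (fst (V \<eta>)) \<longleftrightarrow> (\<exists>b\<in>fst (V \<eta>). a \<le> b)" if "\<eta> < \<xi>" for a \<eta>
    using less_ssup_iff[OF PP_bounded[OF V[OF that]]] .
  have self: "cut (V \<eta>) {..<ssup (fst (V \<eta>))} = V \<eta>" if "\<eta> < \<xi>" for \<eta>
    using less_ssup[OF that] by (intro cut_id PP_supported V that) auto
  have mono: "V \<eta> \<sqsubseteq> V \<eta>'" if "\<eta> < \<eta>'" "\<eta>' < \<xi>" for \<eta> \<eta>'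
    using coh[OF that] cut_weaker by metis
  have cut_V: "cut (V \<eta>') {..<ssup (fst (V \<eta>))} \<sqsubseteq> V \<eta>" if "\<eta> < \<xi>" "\<eta>' < \<xi>" for \<eta> \<eta>'
  proof (cases \<eta> \<eta>' rule: linorder_cases)
    case greater
    then show ?thesis using mono[OF greater that(1)] cut_weaker weaker_trans by blast
  qed (use coh[of \<eta> \<eta>'] self that in auto)
  have cut_p: "cut ?p {..<ssup (fst (V \<eta>))} = V \<eta>" if "\<eta> < \<xi>" for \<eta>
  proof (rule weaker_antisym)
    have "cut ?p {..<ssup (fst (V \<eta>))} = join ((\<lambda>\<eta>'. cut (V \<eta>') {..<ssup (fst (V \<eta>))}) ` {..<\<xi>})"
      by (auto simp: cut_def join_def)
    also have "\<dots> \<sqsubseteq> V \<eta>" using cut_V[OF that] by (intro join_least) auto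
    finally show "cut ?p {..<ssup (fst (V \<eta>))} \<sqsubseteq> V \<eta>" .
    show "V \<eta> \<sqsubseteq> cut ?p {..<ssup (fst (V \<eta>))}"
      using cut_mono[OF join_upper, of "V \<eta>" "V ` {..<\<xi>}"] self[OF that] that by (metis imageI lessThan_iff)
  qed
  then show "\<eta> < \<xi> \<Longrightarrow> cut ?p {..<ssup (fst (V \<eta>))} = V \<eta>" .
  have ini: "a \<in> fst (V \<eta>)" if "\<eta> < \<xi>" "a \<in> fst ?p" "b \<in> fst (V \<eta>)" "a \<le> b" for a b \<eta>
  proof -
    have "a \<in> fst (cut ?p {..<ssup (fst (V \<eta>))})" using that less_ssup by auto
    then show ?thesis using cut_p[OF that(1)] by simp
  qed
  have Vp: "V \<eta> \<sqsubseteq> ?p" if "\<eta> < \<xi>" for \<eta> using that by (intro join_upper) simp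
  show "PP ?p"
    unfolding PP_def
  proof (intro conjI allI impI)
    show sup: "supported ?p" using V PP_supported by (intro supported_join) blast
    show sm: "small (fst ?p)" unfolding fst_join image_image
      using \<xi> V PP_small by (intro small_UN small_lessThan) auto
    fix Z j assume Z: "initial_in Z (fst ?p) \<and> coi (cl Z) j"
    show "extendible (move j (cut ?p Z))"
    proof (cases "\<exists>\<eta><\<xi>. Z \<subseteq> fst (V \<eta>)")
      case True
      then obtain \<eta> where \<eta>: "\<eta> < \<xi>" "Z \<subseteq> fst (V \<eta>)" by blast
      have "Z \<subseteq> {..<ssup (fst (V \<eta>))}" using \<eta> less_ssup[OF \<eta>(1)] by auto
      then have "cut ?p Z = cut (cut ?p {..<ssup (fst (V \<eta>))}) Z" by (simp add: cut_cut Int_absorb1)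
      then have "cut ?p Z = cut (V \<eta>) Z" using cut_p[OF \<eta>(1)] by simp
      moreover have "initial_in Z (fst (V \<eta>))"
        using Z \<eta> Vp[OF \<eta>(1)] unfolding initial_in_def weaker_def by blast
      ultimately show ?thesis using V[OF \<eta>(1)] Z unfolding PP_def by simp
    next
      case False
      have "fst (V \<eta>) \<subseteq> Z" if "\<eta> < \<xi>" for \<eta>
      proof
        fix a assume a: "a \<in> fst (V \<eta>)"
        obtain z where z: "z \<in> Z" "z \<notin> fst (V \<eta>)" using False \<open>\<eta> < \<xi>\<close> by blast
        then have "\<not> z \<le> a" using ini[OF \<open>\<eta> < \<xi>\<close> _ a] Z unfolding initial_in_def by blast
        moreover have "a \<in> fst ?p" using a Vp[OF \<open>\<eta> < \<xi>\<close>] unfolding weaker_def by blast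
        ultimately show "a \<in> Z" using Z z(1) unfolding initial_in_def not_le by blast
      qed
      then have "Z = fst ?p" using Z unfolding initial_in_def by (auto simp: fst_join)
      then have cj: "coi (cl (fst ?p)) j" and cutp: "cut ?p Z = ?p"
        using Z cut_id[OF sup] by auto
      have less: "j a < j b \<longleftrightarrow> a < b" if "a \<in> fst ?p" "b \<in> fst ?p" for a b
        using coi_less_iff[OF cj] that cl_superset by blast
      have inj: "inj_on j (fst ?p)" using inj_on_subset[OF coi_inj[OF cj] cl_superset] .
      have Vsub: "fst (V \<eta>) \<subseteq> fst ?p" if "\<eta> < \<xi>" for \<eta> using Vp[OF that] unfolding weaker_def by blast
      have "extendible (join ((\<lambda>\<eta>. move j (V \<eta>)) ` {..<\<xi>}))"
      proof (rule extendible_join[OF \<xi>])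
        fix \<eta> assume \<eta>: "\<eta> < \<xi>"
        show "extendible (move j (V \<eta>))"
          using PP_extendible[OF V[OF \<eta>] cj] Vsub[OF \<eta>] cl_superset by blast
        show "supported (move j (V \<eta>))" using PP_supported[OF V[OF \<eta>]] supported_move by blast
        show "small (fst (move j (V \<eta>)))" using PP_small[OF V[OF \<eta>]] small_image by simp
      next
        fix \<eta> \<eta>' assume \<eta>: "\<eta> < \<eta>'" "\<eta>' < \<xi>"
        then have \<eta>\<xi>: "\<eta> < \<xi>" by simp
        show "move j (V \<eta>) \<sqsubseteq> move j (V \<eta>')" using mono[OF \<eta>] by (rule move_mono)
        show "a \<in> fst (move j (V \<eta>))"
          if ab: "a \<in> fst (move j (V \<eta>'))" "b \<in> fst (move j (V \<eta>))" "a \<le> b" for a b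
        proof -
          obtain a' b' where ab': "a = j a'" "a' \<in> fst (V \<eta>')" "b = j b'" "b' \<in> fst (V \<eta>)" using ab by auto
          then have "a' \<le> b'" using less[of b' a'] ab(3) Vsub[OF \<eta>(2)] Vsub[OF \<eta>\<xi>] by (metis leD leI subsetD)
          then have "a' \<in> fst (V \<eta>)" using ini[OF \<eta>\<xi> _ ab'(4)] ab'(2) Vsub[OF \<eta>(2)] by blast
          then show ?thesis using ab' by simp
        qed
        have sub: "fst (V \<eta>) \<subseteq> fst (V \<eta>')" using mono[OF \<eta>] unfolding weaker_def by blast
        have "cut (move j (V \<eta>')) (fst (move j (V \<eta>))) = move j (cut (V \<eta>') (fst (V \<eta>)))"
          using cut_move[OF PP_supported[OF V[OF \<eta>(2)]] inj_on_subset[OF inj Vsub[OF \<eta>(2)]] sub] by simp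
        also have "cut (V \<eta>') (fst (V \<eta>)) \<sqsubseteq> V \<eta>"
          using cut_mono_set[of "fst (V \<eta>)" "{..<ssup (fst (V \<eta>))}" "V \<eta>'"] cut_V[OF \<eta>\<xi> \<eta>(2)]
            less_ssup[OF \<eta>\<xi>] weaker_trans by (metis lessThan_iff order_refl subsetI)
        then have "move j (cut (V \<eta>') (fst (V \<eta>))) \<sqsubseteq> move j (V \<eta>)" by (rule move_mono)
        finally show "cut (move j (V \<eta>')) (fst (move j (V \<eta>))) \<sqsubseteq> move j (V \<eta>)" .
      qed
      then show ?thesis unfolding cutp by (simp add: move_join image_image)
    qed
  qed
qed

end

section \<open>Coding of conditions by hereditarily small sets\<close>

lemma ex_von_neumann: "\<exists>v :: 'i::wellorder \<Rightarrow> 'i hset. \<forall>\<alpha>. elts (v \<alpha>) = v ` {..<\<alpha>}"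
proof (rule dependent_wellorder_choice)
  fix r :: "'i hset" and f g :: "'i \<Rightarrow> 'i hset" and x :: 'i
  assume "\<And>y. y < x \<Longrightarrow> f y = g y"
  then have "f ` {..<x} = g ` {..<x}" by (intro image_cong) auto
  then show "(elts r = f ` {..<x}) = (elts r = g ` {..<x})" by simp
next
  fix x :: 'i and f :: "'i \<Rightarrow> 'i hset"
  have "f ` {..<x} \<lesssim> (UNIV :: 'i set)"
    by (rule lepoll_trans[OF image_lepoll]) (simp add: subset_imp_lepoll)
  then show "\<exists>r. elts r = f ` {..<x}" using ex_elts by blast
qed

definition von_neumann :: "'i::wellorder \<Rightarrow> 'i hset" where
  "von_neumann = (SOME v. \<forall>\<alpha>. elts (v \<alpha>) = v ` {..<\<alpha>})"

lemma elts_von_neumann: "elts (von_neumann \<alpha>) = von_neumann ` {..<\<alpha>}"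
  using someI_ex[OF ex_von_neumann] unfolding von_neumann_def by blast

lemma not_mem_elts_self: "u \<notin> elts u"
  using wfp_elts by (metis wfp_on_def wfp_imp_irreflp irreflpD)

lemma inj_von_neumann: "inj von_neumann"
proof (rule injI, rule ccontr)
  fix a b :: 'a assume eq: "von_neumann a = von_neumann b" and "a \<noteq> b"
  then consider "a < b" | "b < a" by (meson neq_iff)
  then have "von_neumann a \<in> elts (von_neumann a)"
    by cases (use eq elts_von_neumann in \<open>metis imageI lessThan_iff\<close>)+
  then show False using not_mem_elts_self by blast
qed

lemma trcl_von_neumann: "trcl_set (von_neumann \<alpha>) \<subseteq> von_neumann ` {..<\<alpha>}"
proof (induction \<alpha> rule: less_induct)
  case (less \<alpha>)
  show ?case
  proof
    fix u assume "u \<in> trcl_set (von_neumann \<alpha>)"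
    then have "(\<lambda>v w. v \<in> elts w)\<^sup>+\<^sup>+ u (von_neumann \<alpha>)" unfolding trcl_set_def by simp
    then consider "u \<in> elts (von_neumann \<alpha>)"
      | w where "(\<lambda>v w. v \<in> elts w)\<^sup>+\<^sup>+ u w" "w \<in> elts (von_neumann \<alpha>)"
      by (cases rule: tranclp.cases) auto
    then show "u \<in> von_neumann ` {..<\<alpha>}"
    proof cases
      case 1
      then show ?thesis unfolding elts_von_neumann .
    next
      case 2
      then obtain \<beta> where "\<beta> < \<alpha>" "w = von_neumann \<beta>" unfolding elts_von_neumann by blast
      then have "u \<in> von_neumann ` {..<\<beta>}" using less[of \<beta>] 2(1) unfolding trcl_set_def by blast
      then show ?thesis using \<open>\<beta> < \<alpha>\<close> by (auto intro: less_trans)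
    qed
  qed
qed

text \<open>Levels become tagged atoms, so that there is one kind of object to number and levels
  without atoms are not lost.\<close>

definition items :: "('i, 'c) cond \<Rightarrow> ('i \<times> 'i \<times> 'c option) set" where
  "items p = (\<lambda>a. (a, a, None)) ` fst p \<union> (\<lambda>(a, b, c). (a, b, Some c)) ` snd p"

lemma items_inject: "items p = items q \<longleftrightarrow> p = q"
proof
  assume eq: "items p = items q"
  have f: "fst p = {a. (a, a, None) \<in> items p}" for p :: "('a, 'b) cond"
    unfolding items_def by auto
  have s: "snd p = {(a, b, c). (a, b, Some c) \<in> items p}" for p :: "('a, 'b) cond"
    unfolding items_def by force
  show "p = q" using eq f[of p] f[of q] s[of p] s[of q] by (simp add: prod_eq_iff)
qed simp

text \<open>The atoms on the levels listed by \<open>h\<close>, written with indices in place of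
  levels. Since moving a condition does not change them (\<open>pull_move\<close>), one predicate on
  pulled back atoms yields a whole sharply dense system.\<close>

definition pull :: "'i::wellorder \<Rightarrow> ('i \<Rightarrow> 'i) \<Rightarrow> ('i \<times> 'i \<times> 'c) set \<Rightarrow> ('i \<times> 'i \<times> 'c) set" where
  "pull \<theta> h A = {(a, b, c). a < \<theta> \<and> b < \<theta> \<and> (h a, h b, c) \<in> A}"

lemma pull_cong:
  assumes "\<And>\<xi>. \<xi> < \<theta> \<Longrightarrow> h \<xi> = h' \<xi>"
  shows "pull \<theta> h A = pull \<theta> h' A"
  unfolding pull_def using assms by auto

lemma pull_move:
  assumes "supported p" "inj_on \<pi> (fst p)" "h ` {..<\<theta>} \<subseteq> fst p"
  shows "pull \<theta> (\<pi> \<circ> h) (snd (move \<pi> p)) = pull \<theta> h (snd p)"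
proof -
  have "(\<pi> (h a), \<pi> (h b), c) \<in> mv \<pi> ` snd p \<longleftrightarrow> (h a, h b, c) \<in> snd p" if ab: "a < \<theta>" "b < \<theta>" for a b c
  proof
    assume "(\<pi> (h a), \<pi> (h b), c) \<in> mv \<pi> ` snd p"
    then obtain a' b' where *: "(a', b', c) \<in> snd p" "\<pi> (h a) = \<pi> a'" "\<pi> (h b) = \<pi> b'"
      unfolding mv_def by auto
    moreover have "a' \<in> fst p" "b' \<in> fst p" using * assms(1) unfolding supported_def by blast+
    moreover have "h a \<in> fst p" "h b \<in> fst p" using assms(3) ab by blast+
    ultimately show "(h a, h b, c) \<in> snd p" using assms(2) by (metis inj_onD)
  qed (auto simp: mv_def intro!: image_eqI)
  then show ?thesis unfolding pull_def snd_move by auto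
qed

text \<open>Makes the enumeration \<open>h\<close> in \<open>dense_at\<close> a function of the set
  that it lists.\<close>

lemma strict_mono_image_unique:
  fixes f h :: "'i::wellorder \<Rightarrow> 'i"
  assumes f: "strict_mono_on {..<\<theta>} f" and h: "strict_mono_on {..<\<theta>} h"
    and eq: "f ` {..<\<theta>} = h ` {..<\<theta>}"
  shows "\<xi> < \<theta> \<Longrightarrow> f \<xi> = h \<xi>"
proof (induction \<xi> rule: less_induct)
  case (less \<xi>)
  have aux: "\<not> f' \<xi> < h' \<xi>"
    if f': "strict_mono_on {..<\<theta>} f'" and h': "strict_mono_on {..<\<theta>} h'"
      and eq': "f' ` {..<\<theta>} = h' ` {..<\<theta>}" and IH: "\<And>\<zeta>. \<zeta> < \<xi> \<Longrightarrow> f' \<zeta> = h' \<zeta>" for f' h' :: "'i \<Rightarrow> 'i"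
  proof
    assume lt: "f' \<xi> < h' \<xi>"
    have "f' \<xi> \<in> f' ` {..<\<theta>}" using less.prems by simp
    then obtain \<zeta> where \<zeta>: "\<zeta> < \<theta>" "f' \<xi> = h' \<zeta>" unfolding eq' by auto
    have "\<zeta> < \<xi>"
    proof (rule ccontr)
      assume "\<not> \<zeta> < \<xi>"
      then consider "\<zeta> = \<xi>" | "\<xi> < \<zeta>" by (meson linorder_neqE)
      then have "h' \<xi> \<le> h' \<zeta>"
        by cases (use strict_mono_onD[OF h', of \<xi> \<zeta>] \<zeta>(1) less.prems in auto)
      then show False using lt \<zeta>(2) by simp
    qed
    then have "f' \<zeta> < f' \<xi>" using strict_mono_onD[OF f', of \<zeta> \<xi>] less.prems by auto
    then show False using IH[OF \<open>\<zeta> < \<xi>\<close>] \<zeta>(2) by simp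
  qed
  have IH: "f \<zeta> = h \<zeta>" if "\<zeta> < \<xi>" for \<zeta> using less.IH[OF that] that less.prems by simp
  show ?case using aux[OF f h eq IH] aux[OF h f eq[symmetric] IH[symmetric]] by (meson neq_iff)
qed

section \<open>Codes of conditions\<close>

context amalgamation_class
begin

lemma PP_indices: "PP p \<Longrightarrow> (a, b, c) \<in> snd p \<Longrightarrow> a \<in> fst p \<and> b \<in> fst p \<and> c \<in> C"
  using PP_W[of p] PP_supported[of p] W_atoms unfolding weaker_def supported_def by blast

lemma PP_small_snd: "PP p \<Longrightarrow> small (snd p)"
  using PP_W[of p] W_small small_subset unfolding weaker_def by metis

definition codes :: "'i set \<Rightarrow> ('i \<times> 'i \<times> 'c option) set" where
  "codes X = X \<times> X \<times> insert None (Some ` C)"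

text \<open>Room for the codes of those atoms that involve levels from \<kappa> on, away from the
  codes below \<kappa>.\<close>

lemma UNIV_lepoll_atLeast: "(UNIV :: 'i set) \<lesssim> {\<kappa>..}"
proof -
  have U: "(UNIV :: 'i set) = {..<\<kappa>} \<union> {\<kappa>..}" by auto
  have n: "\<not> {\<kappa>..} \<lesssim> {..<\<kappa>}"
  proof
    assume "{\<kappa>..} \<lesssim> {..<\<kappa>}"
    then have "(UNIV :: 'i set) \<lesssim> {..<\<kappa>}"
      by (subst U) (intro Un_lepoll_infinite infinite_kappa lepoll_refl)
    then show False using kappa_lesspoll_UNIV not_lepoll_iff_lesspoll by blast
  qed
  then have le: "{..<\<kappa>} \<lesssim> {\<kappa>..}" using lepoll_linear by blast
  have "infinite {\<kappa>..}" using n infinite_kappa finite_lepoll_infinite by blast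
  then show ?thesis by (subst U) (intro Un_lepoll_infinite le lepoll_refl)
qed

text \<open>Injective everywhere and yet with the atoms over \<kappa> coded below \<kappa>: two
  injections with ranges on either side of \<kappa> are pasted together.\<close>

lemma ex_code:
  "\<exists>g :: 'i \<times> 'i \<times> 'c option \<Rightarrow> 'i. inj_on g (codes UNIV) \<and> g ` codes {..<\<kappa>} \<subseteq> {..<\<kappa>}"
proof -
  have S: "Some ` C \<lesssim> {..<\<kappa>}" by (rule lepoll_trans[OF image_lepoll C_lepoll])
  have "{None} \<lesssim> {..<\<kappa>}" by (rule finite_lepoll_infinite[OF infinite_kappa]) simp
  then have "{None} \<union> Some ` C \<lesssim> {..<\<kappa>}" using S by (rule Un_lepoll_infinite[OF infinite_kappa])
  then have C': "insert None (Some ` C) \<lesssim> {..<\<kappa>}" by simp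
  have "codes {..<\<kappa>} \<lesssim> {..<\<kappa>}"
    unfolding codes_def by (intro times_lepoll_infinite infinite_kappa lepoll_refl C')
  then obtain g1 where g1: "inj_on g1 (codes {..<\<kappa>})" "g1 ` codes {..<\<kappa>} \<subseteq> {..<\<kappa>}"
    unfolding lepoll_def by blast
  have inf: "infinite (UNIV :: 'i set)" using infinite_super[OF subset_UNIV infinite_kappa] .
  have "{..<\<kappa>} \<lesssim> (UNIV :: 'i set)" by (simp add: subset_imp_lepoll)
  then have "codes UNIV \<lesssim> (UNIV :: 'i set)"
    unfolding codes_def by (intro times_lepoll_infinite[OF inf] lepoll_refl lepoll_trans[OF C'])
  then have "codes UNIV \<lesssim> {\<kappa>..}" using UNIV_lepoll_atLeast by (rule lepoll_trans)
  then obtain g2 where g2: "inj_on g2 (codes UNIV)" "g2 ` codes UNIV \<subseteq> {\<kappa>..}"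
    unfolding lepoll_def by blast
  define g where "g t = (if t \<in> codes {..<\<kappa>} then g1 t else g2 t)" for t
  have "inj_on g (codes UNIV)"
  proof (rule inj_onI)
    fix s t assume st: "s \<in> codes UNIV" "t \<in> codes UNIV" "g s = g t"
    have "g r < \<kappa> \<longleftrightarrow> r \<in> codes {..<\<kappa>}" if "r \<in> codes UNIV" for r
    proof (cases "r \<in> codes {..<\<kappa>}")
      case True
      then show ?thesis using g1(2) unfolding g_def by auto
    next
      case False
      then show ?thesis using g2(2) that unfolding g_def by fastforce
    qed
    then have "s \<in> codes {..<\<kappa>} \<longleftrightarrow> t \<in> codes {..<\<kappa>}" using st by metis
    then show "s = t" using st g1(1) g2(1) unfolding g_def by (metis inj_onD)
  qed
  moreover have "g ` codes {..<\<kappa>} \<subseteq> {..<\<kappa>}" using g1(2) unfolding g_def by auto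
  ultimately show ?thesis by blast
qed

definition code :: "'i \<times> 'i \<times> 'c option \<Rightarrow> 'i" where
  "code = (SOME g. inj_on g (codes UNIV) \<and> g ` codes {..<\<kappa>} \<subseteq> {..<\<kappa>})"

lemma code: "inj_on code (codes UNIV)" "code ` codes {..<\<kappa>} \<subseteq> {..<\<kappa>}"
  using someI_ex[OF ex_code] unfolding code_def by blast+

definition enc :: "('i, 'c) cond \<Rightarrow> 'i hset" where
  "enc p = (SOME u. elts u = von_neumann ` code ` items p)"

lemma items_codes: "PP p \<Longrightarrow> fst p \<subseteq> X \<Longrightarrow> items p \<subseteq> codes X"
  unfolding items_def codes_def using PP_indices by fastforce

lemma small_items: "PP p \<Longrightarrow> small (items p)"
  unfolding items_def by (intro small_Un small_image PP_small PP_small_snd)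

lemma elts_enc:
  assumes "PP p"
  shows "elts (enc p) = von_neumann ` code ` items p"
proof -
  have "small (von_neumann ` code ` items p)" by (intro small_image small_items assms)
  then have "von_neumann ` code ` items p \<lesssim> (UNIV :: 'i set)"
    unfolding small_def by (rule lepoll_trans) (simp add: subset_imp_lepoll)
  then show ?thesis unfolding enc_def using ex_elts by (metis (mono_tags, lifting) someI_ex)
qed

lemma enc_inject:
  assumes "PP p" "PP q"
  shows "enc p = enc q \<longleftrightarrow> p = q"
proof
  assume "enc p = enc q"
  then have "von_neumann ` code ` items p = von_neumann ` code ` items q"
    using elts_enc assms by metis
  then have "code ` items p = code ` items q" by (rule inj_image_eq_iff[OF inj_von_neumann, THEN iffD1])
  then have "items p = items q"
    using inj_on_image_eq_iff[OF code(1) items_codes[OF assms(1) subset_UNIV] items_codes[OF assms(2) subset_UNIV]]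
    by simp
  then show "p = q" by (simp add: items_inject)
qed simp

text \<open>Regularity of \<kappa> bounds the codes by some \<open>\<mu> < \<kappa>\<close>. As the
  elements of \<open>enc p\<close> are von Neumann ordinals, its transitive closure stays among the
  ordinals below \<open>\<mu>\<close>.\<close>

lemma enc_H:
  assumes "PP p" "fst p \<subseteq> {..<\<kappa>}"
  shows "enc p \<in> H \<kappa>"
proof -
  have "code ` items p \<subseteq> {..<\<kappa>}" using items_codes[OF assms] code(2) by blast
  then obtain \<mu> where \<mu>: "\<mu> < \<kappa>" "\<forall>\<xi>\<in>code ` items p. \<xi> < \<mu>"
    using small_bounded_kappa[OF small_image[OF small_items[OF assms(1)]]] by blast
  have "trcl_set (enc p) \<subseteq> von_neumann ` {..<\<mu>}"
  proof
    fix u assume "u \<in> trcl_set (enc p)"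
    then have "(\<lambda>v w. v \<in> elts w)\<^sup>+\<^sup>+ u (enc p)" unfolding trcl_set_def by simp
    then consider "u \<in> elts (enc p)" | w where "(\<lambda>v w. v \<in> elts w)\<^sup>+\<^sup>+ u w" "w \<in> elts (enc p)"
      by (cases rule: tranclp.cases) auto
    then show "u \<in> von_neumann ` {..<\<mu>}"
    proof cases
      case 1
      then show ?thesis using \<mu>(2) unfolding elts_enc[OF assms(1)] by auto
    next
      case 2
      then obtain \<beta> where \<beta>: "\<beta> < \<mu>" "w = von_neumann \<beta>"
        using \<mu>(2) unfolding elts_enc[OF assms(1)] by auto
      then have "u \<in> von_neumann ` {..<\<beta>}" using trcl_von_neumann[of \<beta>] 2(1) unfolding trcl_set_def by blast
      then show ?thesis using \<beta>(1) by (auto intro: less_trans)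
    qed
  qed
  then have "small (trcl_set (enc p))" using small_subset[OF small_image[OF small_lessThan[OF \<mu>(1)]]] by blast
  then show ?thesis unfolding H_def using small_iff by blast
qed

definition dec :: "'i hset \<Rightarrow> ('i, 'c) cond" where
  "dec = inv_into {p. PP p} enc"

lemma dec_enc [simp]: "PP p \<Longrightarrow> dec (enc p) = p"
  unfolding dec_def by (rule inv_into_f_f) (auto intro!: inj_onI simp: enc_inject)

definition FF :: "('i, 'i hset) forcing" where
  "FF = \<lparr>conds = enc ` {p. PP p}, leq = (\<lambda>u v. dec v \<sqsubseteq> dec u), core = enc ` {p. Wc p},
     one = enc ({}, {}), supp = (\<lambda>u. fst (dec u)), act = (\<lambda>y \<pi> u. enc (move \<pi> (dec u)))\<rparr>"

lemma conds_FF: "conds FF = enc ` {p. PP p}"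
  and core_FF: "core FF = enc ` {p. Wc p}"
  and one_FF: "one FF = enc ({}, {})"
  and leq_FF: "leq FF u v \<longleftrightarrow> dec v \<sqsubseteq> dec u"
  and supp_FF: "supp FF u = fst (dec u)"
  and act_FF: "act FF y \<pi> u = enc (move \<pi> (dec u))"
  by (simp_all add: FF_def)

section \<open>Verification of the axioms of the forcing class\<close>

lemma Wc_empty: "Wc ({}, {})"
  unfolding Wc_def using W_empty by (simp add: closed_in_sup_def)

lemma PP_empty: "PP ({}, {})"
  by (rule Wc_imp_PP[OF Wc_empty])

lemma FF_forcing_notion: "forcing_notion FF"
  unfolding forcing_notion_def
proof (intro conjI ballI)
  show "reflp_on (conds FF) (leq FF)" by (auto intro!: reflp_onI simp: leq_FF)
  show "transp_on (conds FF) (leq FF)"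
  proof (rule transp_onI)
    fix u v w assume "leq FF u v" "leq FF v w"
    then show "leq FF u w" using weaker_trans[of "dec w" "dec v" "dec u"] by (simp add: leq_FF)
  qed
  show "one FF \<in> conds FF" using PP_empty by (simp add: one_FF conds_FF)
  show "leq FF p (one FF)" for p using PP_empty by (simp add: leq_FF one_FF weaker_def)
qed

lemma FF_supp: "axiom_supp \<kappa> FF"
  unfolding axiom_supp_def
proof (intro conjI ballI impI allI)
  show "supp FF (one FF) = {}" using PP_empty by (simp add: supp_FF one_FF)
next
  fix u assume "u \<in> conds FF"
  then obtain p where p: "u = enc p" "PP p" unfolding conds_FF by blast
  show "supp FF u \<prec> {..<\<kappa>}" using PP_small[OF p(2)] p by (simp add: supp_FF small_iff)
  show "supp FF u \<subseteq> supp FF v" if "v \<in> conds FF" "leq FF v u" for v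
    using that by (simp add: supp_FF leq_FF weaker_def)
  fix x assume x: "x \<prec> {..<\<kappa>} \<and> supp FF u \<subseteq> x"
  then have q: "PP (x, snd p)" using PP_levels[OF p(2)] p by (simp add: supp_FF small_iff)
  show "\<exists>q\<in>conds FF. leq FF q u \<and> supp FF q = x"
  proof (rule bexI)
    show "leq FF (enc (x, snd p)) u \<and> supp FF (enc (x, snd p)) = x"
      using x p q by (simp add: leq_FF supp_FF weaker_def)
    show "enc (x, snd p) \<in> conds FF" using q by (simp add: conds_FF)
  qed
qed

lemma conds_on_FF: "conds_on FF y = enc ` {p. PP p \<and> fst p \<subseteq> y}"
proof (intro equalityI subsetI)
  fix u assume u: "u \<in> conds_on FF y"
  then obtain p where "u = enc p" "PP p" unfolding conds_on_def conds_FF by blast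
  then show "u \<in> enc ` {p. PP p \<and> fst p \<subseteq> y}" using u by (simp add: conds_on_def supp_FF)
next
  fix u assume "u \<in> enc ` {p. PP p \<and> fst p \<subseteq> y}"
  then obtain p where "u = enc p" "PP p" "fst p \<subseteq> y" by blast
  then show "u \<in> conds_on FF y" by (simp add: conds_on_def supp_FF conds_FF)
qed

lemma FF_small: "axiom_small \<kappa> FF"
  unfolding axiom_small_def conds_on_FF
proof (intro conjI)
  have *: "p = ({}, {})" if "PP p" "fst p \<subseteq> {}" for p
    using PP_supported[OF that(1)] that(2) by (auto simp: supported_def prod_eq_iff)
  have "{p. PP p \<and> fst p \<subseteq> {}} = {({}, {})}"
  proof (intro equalityI subsetI)
    fix p assume "p \<in> {p. PP p \<and> fst p \<subseteq> {}}"
    then have "p = ({}, {})" by (intro *) blast+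
    then show "p \<in> {({}, {})}" by blast
  next
    fix p :: "('i, 'c) cond" assume "p \<in> {({}, {})}"
    then have "p = ({}, {})" by blast
    then show "p \<in> {p. PP p \<and> fst p \<subseteq> {}}" using PP_empty by simp
  qed
  then show "enc ` {p. PP p \<and> fst p \<subseteq> {}} = {one FF}" by (simp add: one_FF)
  show "enc ` {p. PP p \<and> fst p \<subseteq> {..<\<kappa>}} \<subseteq> H \<kappa>"
  proof (rule image_subsetI)
    fix p assume "p \<in> {p. PP p \<and> fst p \<subseteq> {..<\<kappa>}}"
    then show "enc p \<in> H \<kappa>" using enc_H by simp
  qed
qed

lemma FF_act: "axiom_act FF"
  unfolding axiom_act_def
proof (intro conjI allI impI ballI)
  fix y \<pi> u assume c: "coi y \<pi>" and "u \<in> conds_on FF y"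
  then obtain p where p: "u = enc p" "PP p" "fst p \<subseteq> y" unfolding conds_on_FF by blast
  note m = PP_move[OF p(2) c p(3)]
  show "act FF y \<pi> u \<in> conds FF" using m p by (simp add: act_FF conds_FF)
  show "supp FF (act FF y \<pi> u) = \<pi> ` supp FF u" using m p by (simp add: act_FF supp_FF)
  show "act FF y \<pi> u \<in> core FF" if "u \<in> core FF"
  proof -
    obtain q where "u = enc q" "Wc q" using \<open>u \<in> core FF\<close> unfolding core_FF by blast
    then have "Wc p" using p enc_inject[OF p(2) Wc_imp_PP] by metis
    then show ?thesis using Wc_move[OF _ c p(3)] p by (simp add: act_FF core_FF)
  qed
  show "act FF y \<pi> u = u" if "\<forall>\<alpha>\<in>y. \<pi> \<alpha> = \<alpha>"
  proof -
    have "move \<pi> p = p" by (rule move_ident[OF PP_supported[OF p(2)]]) (use p that in blast)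
    then show ?thesis using p by (simp add: act_FF)
  qed
  fix v assume "v \<in> conds_on FF y"
  then obtain q where q: "v = enc q" "PP q" "fst q \<subseteq> y" unfolding conds_on_FF by blast
  have "inj_on \<pi> (fst p \<union> fst q)" using inj_on_subset[OF coi_inj[OF c]] p(3) q(3) by simp
  then show "leq FF (act FF y \<pi> v) (act FF y \<pi> u) \<longleftrightarrow> leq FF v u"
    using move_weaker_iff[OF PP_supported[OF p(2)] PP_supported[OF q(2)]] m PP_move[OF q(2) c q(3)] p q
    by (simp add: leq_FF act_FF)
next
  fix y y' :: "'i set" and \<pi> \<pi>' u assume c: "coi y \<pi> \<and> coi y' \<pi>'" and "u \<in> conds_on FF y"
  then obtain p where p: "u = enc p" "PP p" "fst p \<subseteq> y" unfolding conds_on_FF by blast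
  have m: "PP (move \<pi> p)" using PP_move[OF p(2) _ p(3)] c by blast
  then show "act FF y' \<pi>' (act FF y \<pi> u) = act FF y (\<pi>' \<circ> \<pi>) u" using p by (simp add: act_FF move_move)
  show "act FF y \<pi> u = act FF y' \<pi>' u"
    if "supp FF u \<subseteq> y' \<and> (\<forall>\<alpha>\<in>supp FF u. \<pi> \<alpha> = \<pi>' \<alpha>)"
    using move_cong[OF PP_supported[OF p(2)], of \<pi> \<pi>'] that p by (simp add: act_FF supp_FF)
qed

lemma is_restr_FF:
  assumes p: "PP p"
  shows "is_restr FF (enc p) \<alpha> r \<longleftrightarrow> r = enc (cut p {..<\<alpha>})"
proof
  assume r: "is_restr FF (enc p) \<alpha> r"
  then obtain r' where r': "r = enc r'" "PP r'" unfolding is_restr_def conds_FF by blast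
  have le: "fst r' = fst p \<inter> {..<\<alpha>}" "r' \<sqsubseteq> p"
    using r r' p unfolding is_restr_def by (simp_all add: supp_FF leq_FF)
  have "cut p {..<\<alpha>} \<sqsubseteq> r'"
  proof -
    have "enc (cut p {..<\<alpha>}) \<in> conds FF" using PP_cut[OF p] by (simp add: conds_FF)
    moreover have "supp FF (enc (cut p {..<\<alpha>})) = supp FF (enc p) \<inter> {..<\<alpha>}"
      using PP_cut[OF p] p by (simp add: supp_FF)
    moreover have "leq FF (enc p) (enc (cut p {..<\<alpha>}))"
      using PP_cut[OF p] p cut_weaker[of p "{..<\<alpha>}"] by (simp add: leq_FF)
    ultimately have "leq FF r (enc (cut p {..<\<alpha>}))" using r unfolding is_restr_def by blast
    then show ?thesis using PP_cut[OF p] r' by (simp add: leq_FF)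
  qed
  moreover have "r' \<sqsubseteq> cut p {..<\<alpha>}"
    using weaker_cut[OF le(2) PP_supported[OF r'(2)]] le(1) by auto
  ultimately show "r = enc (cut p {..<\<alpha>})" using r'(1) weaker_antisym by blast
next
  assume r: "r = enc (cut p {..<\<alpha>})"
  have "s \<sqsubseteq> cut p {..<\<alpha>}" if "PP s" "fst s = fst p \<inter> {..<\<alpha>}" "s \<sqsubseteq> p" for s
    using weaker_cut[OF that(3) PP_supported[OF that(1)]] that(2) by auto
  then show "is_restr FF (enc p) \<alpha> r"
    unfolding is_restr_def r conds_FF using PP_cut[OF p, of \<alpha>] p cut_weaker[of p "{..<\<alpha>}"]
    by (simp add: supp_FF leq_FF)
qed

lemma restr_FF: "PP p \<Longrightarrow> restr FF (enc p) \<alpha> = enc (cut p {..<\<alpha>})"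
  unfolding restr_def by (rule the_equality) (simp_all add: is_restr_FF)

lemma FF_restr: "axiom_restr FF"
  unfolding axiom_restr_def
proof (intro ballI allI conjI impI)
  fix u \<alpha> assume "u \<in> conds FF"
  then obtain p where p: "u = enc p" "PP p" unfolding conds_FF by blast
  show "\<exists>!r. is_restr FF u \<alpha> r" using p by (simp add: is_restr_FF)
  show "restr FF u \<alpha> \<in> core FF" if "u \<in> core FF"
  proof -
    obtain q where "u = enc q" "Wc q" using \<open>u \<in> core FF\<close> unfolding core_FF by blast
    then have "Wc p" using p enc_inject[OF p(2) Wc_imp_PP] by metis
    then show ?thesis using p Wc_cut by (simp add: restr_FF core_FF)
  qed
  fix v assume v: "v \<in> conds FF" "leq FF v u"
  then obtain q where q: "v = enc q" "PP q" unfolding conds_FF by blast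
  then show "leq FF (restr FF v \<alpha>) (restr FF u \<alpha>)"
    using v p cut_mono PP_cut by (simp add: restr_FF leq_FF)
qed

lemma enc_core_iff: "PP p \<Longrightarrow> enc p \<in> core FF \<longleftrightarrow> Wc p"
  unfolding core_FF using enc_inject[of p] Wc_imp_PP by (metis (no_types, lifting) image_iff mem_Collect_eq)

lemma FF_amalgam: "axiom_amalgam \<kappa> FF"
  unfolding axiom_amalgam_def
proof (intro allI impI)
  fix \<xi> s
  assume \<xi>: "\<xi> < \<kappa>" and s: "(\<forall>\<eta><\<xi>. s \<eta> \<in> conds FF) \<and>
    (\<forall>\<eta> \<eta>'. \<eta> < \<eta>' \<and> \<eta>' < \<xi> \<longrightarrow> s \<eta> = restr FF (s \<eta>') (ssup (supp FF (s \<eta>))))"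
  define V where "V \<eta> = dec (s \<eta>)" for \<eta>
  have V: "PP (V \<eta>)" "s \<eta> = enc (V \<eta>)" if "\<eta> < \<xi>" for \<eta>
    using s that unfolding V_def conds_FF by auto
  have coh: "V \<eta> = cut (V \<eta>') {..<ssup (fst (V \<eta>))}" if "\<eta> < \<eta>'" "\<eta>' < \<xi>" for \<eta> \<eta>'
  proof -
    have "\<eta> < \<xi>" using that by simp
    have "enc (V \<eta>) = restr FF (enc (V \<eta>')) (ssup (supp FF (enc (V \<eta>))))"
      using s that V(2)[OF that(2)] V(2)[OF \<open>\<eta> < \<xi>\<close>] by metis
    then have "enc (V \<eta>) = enc (cut (V \<eta>') {..<ssup (fst (V \<eta>))})"
      using restr_FF[OF V(1)[OF that(2)]] V(1)[OF \<open>\<eta> < \<xi>\<close>] by (simp add: supp_FF)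
    then show ?thesis using enc_inject[OF V(1)[OF \<open>\<eta> < \<xi>\<close>] PP_cut[OF V(1)[OF that(2)]]] by blast
  qed
  define P where "P = join (V ` {..<\<xi>})"
  have PP: "PP P" unfolding P_def using \<xi> V(1) coh by (rule PP_join(1))
  have cutP: "cut P {..<ssup (fst (V \<eta>))} = V \<eta>" if "\<eta> < \<xi>" for \<eta>
    unfolding P_def using \<xi> V(1) coh that by (rule PP_join(2))
  have mono: "V \<eta> \<sqsubseteq> V \<eta>'" if "\<eta> \<le> \<eta>'" "\<eta>' < \<xi>" for \<eta> \<eta>'
    using coh[of \<eta> \<eta>'] cut_weaker[of "V \<eta>'"] that by (metis order.order_iff_strict weaker_refl)
  have sub: "fst (V \<eta>) \<subseteq> {..<ssup (fst (V \<eta>))}" if "\<eta> < \<xi>" for \<eta>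
    using less_ssup[OF PP_bounded[OF V(1)[OF that]]] by blast
  have iff: "is_amalgam FF \<xi> s u \<longleftrightarrow> u = enc P" for u
  proof
    assume u: "u = enc P"
    have "s \<eta> = restr FF (enc P) (ssup (supp FF (s \<eta>)))" if "\<eta> < \<xi>" for \<eta>
      using cutP[OF that] V[OF that] PP by (simp add: restr_FF supp_FF)
    moreover have "fst P = (\<Union>\<eta><\<xi>. supp FF (s \<eta>))"
      using V by (simp add: P_def fst_join image_image supp_FF)
    ultimately show "is_amalgam FF \<xi> s u"
      unfolding is_amalgam_def u using PP by (simp add: conds_FF supp_FF)
  next
    assume am: "is_amalgam FF \<xi> s u"
    then obtain Q where Q: "u = enc Q" "PP Q" unfolding is_amalgam_def conds_FF by blast
    have fQ: "fst Q = fst P"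
      using am Q V unfolding is_amalgam_def by (simp add: P_def fst_join image_image supp_FF)
    have cQ: "V \<eta> = cut Q {..<ssup (fst (V \<eta>))}" if "\<eta> < \<xi>" for \<eta>
    proof -
      have "enc (V \<eta>) = restr FF u (ssup (supp FF (s \<eta>)))"
        using am that V(2)[OF that] unfolding is_amalgam_def by metis
      then have "enc (V \<eta>) = enc (cut Q {..<ssup (fst (V \<eta>))})"
        using Q V[OF that] by (simp add: restr_FF supp_FF)
      then show ?thesis using enc_inject[OF V(1)[OF that] PP_cut[OF Q(2)]] by blast
    qed
    have "P \<sqsubseteq> Q" unfolding P_def
    proof (rule join_least)
      fix p assume "p \<in> V ` {..<\<xi>}"
      then show "p \<sqsubseteq> Q" using cQ cut_weaker by (metis imageE lessThan_iff)
    qed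
    \<comment> \<open>An atom relates only two levels, so both of them occur in a single
      \<open>V m\<close> of the chain, where \<open>Q\<close> and \<open>P\<close> agree.\<close>
    moreover have "snd Q \<subseteq> snd P"
    proof
      fix t assume t: "t \<in> snd Q"
      obtain a b c where abc: "t = (a, b, c)" by (cases t)
      have "a \<in> fst P" "b \<in> fst P" using t PP_supported[OF Q(2)] fQ unfolding abc supported_def by auto
      then obtain \<eta> \<eta>' where \<eta>: "\<eta> < \<xi>" "a \<in> fst (V \<eta>)" "\<eta>' < \<xi>" "b \<in> fst (V \<eta>')"
        unfolding P_def fst_join by blast
      define m where "m = max \<eta> \<eta>'"
      have m: "m < \<xi>" "\<eta> \<le> m" "\<eta>' \<le> m" using \<eta> unfolding m_def by auto
      then have "a \<in> fst (V m)" "b \<in> fst (V m)" using \<eta> mono[of _ m] unfolding weaker_def by blast+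
      then have "t \<in> snd (cut Q {..<ssup (fst (V m))})" using sub[OF m(1)] t unfolding abc snd_cut by blast
      then have "t \<in> snd (V m)" using cQ[OF m(1)] by simp
      then show "t \<in> snd P" unfolding P_def snd_join using m(1) by blast
    qed
    ultimately have "Q = P" using fQ by (simp add: weaker_def prod_eq_iff subset_antisym)
    then show "u = enc P" using Q by simp
  qed
  have core: "enc P \<in> core FF" if c: "\<forall>\<eta><\<xi>. s \<eta> \<in> core FF"
  proof (cases "\<xi> = ozero")
    case True
    then have "P = ({}, {})" unfolding P_def by (simp add: join_def)
    then show ?thesis using Wc_empty by (simp add: core_FF)
  next
    case False
    have Wc: "Wc (V \<eta>)" if "\<eta> < \<xi>" for \<eta> using c V[OF that] enc_core_iff[OF V(1)[OF that]] that by metis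
    have "W P" unfolding P_def
    proof (rule W_join)
      have "ozero < \<xi>" using False ozero_le[of \<xi>] by (simp add: order.order_iff_strict)
      then show "V ` {..<\<xi>} \<noteq> {}" by blast
      show "small (V ` {..<\<xi>})" using \<xi> by (intro small_image small_lessThan)
      show "W p" if "p \<in> V ` {..<\<xi>}" for p using that Wc unfolding Wc_def by blast
      show "p \<sqsubseteq> q \<or> q \<sqsubseteq> p" if pq: "p \<in> V ` {..<\<xi>}" "q \<in> V ` {..<\<xi>}" for p q
      proof -
        obtain a b where "a < \<xi>" "b < \<xi>" "p = V a" "q = V b" using pq by blast
        then show ?thesis using mono[of a b] mono[of b a] linear by blast
      qed
    qed
    \<comment> \<open>The union has no further levels below the end of \<open>V \<eta>\<close>, so a
      limit point with a level above it is one of some \<open>V \<eta>\<close>.\<close>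
    moreover have "closed_in_sup (fst P)"
      unfolding closed_in_sup_def
    proof (intro allI impI)
      fix \<alpha> assume \<alpha>: "(\<exists>\<beta>\<in>fst P. \<alpha> < \<beta>) \<and> is_limit_of \<alpha> (fst P)"
      then obtain \<eta> \<beta> where \<eta>: "\<eta> < \<xi>" "\<beta> \<in> fst (V \<eta>)" "\<alpha> < \<beta>" unfolding P_def fst_join by blast
      have "fst P \<inter> {..<\<alpha>} \<subseteq> fst (V \<eta>)"
      proof
        fix a assume "a \<in> fst P \<inter> {..<\<alpha>}"
        then have "a \<in> fst (cut P {..<ssup (fst (V \<eta>))})" using \<eta> sub[OF \<eta>(1)] by auto
        then show "a \<in> fst (V \<eta>)" using cutP[OF \<eta>(1)] by simp
      qed
      then have "is_limit_of \<alpha> (fst (V \<eta>))" using \<alpha> is_limit_of_mono by blast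
      then have "\<alpha> \<in> fst (V \<eta>)" using Wc[OF \<eta>(1)] \<eta> unfolding Wc_def closed_in_sup_def by blast
      then show "\<alpha> \<in> fst P" unfolding P_def fst_join using \<eta>(1) by blast
    qed
    ultimately show ?thesis using enc_core_iff[OF PP] unfolding Wc_def by blast
  qed
  show "(\<exists>!p. is_amalgam FF \<xi> s p) \<and>
    ((\<forall>\<eta><\<xi>. s \<eta> \<in> core FF) \<longrightarrow> (\<forall>p. is_amalgam FF \<xi> s p \<longrightarrow> p \<in> core FF))"
    unfolding iff using core by simp
qed

lemma FF_core: "axiom_core FF"
  unfolding axiom_core_def
proof (intro conjI ballI)
  fix u assume "u \<in> core FF"
  then obtain p where "u = enc p" "Wc p" unfolding core_FF by blast
  then show "closed_in_sup (supp FF u)" using Wc_imp_PP[of p] unfolding Wc_def by (simp add: supp_FF)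
next
  fix u assume "u \<in> conds FF"
  then obtain p where p: "u = enc p" "PP p" unfolding conds_FF by blast
  then obtain q where q: "Wc q" "p \<sqsubseteq> q" "fst q = cl (fst p)" using PP_completion by blast
  show "\<exists>q\<in>core FF. leq FF q u \<and> supp FF q = cl (supp FF u)"
  proof (rule bexI)
    show "leq FF (enc q) u \<and> supp FF (enc q) = cl (supp FF u)"
      using p q Wc_imp_PP[OF q(1)] by (simp add: leq_FF supp_FF)
    show "enc q \<in> core FF" using q by (simp add: core_FF)
  qed
qed

text \<open>The union of the chain is in \<open>W\<close>, and its levels below \<sigma> are cofinal
  among those of \<open>r\<close>, because the support of \<open>r\<close> is bounded by the strict
  supremum of \<open>x \<inter> \<alpha>\<close>. This is the situation of \<open>W_amalgam\<close>,
  where \<open>r\<close> is kept as it is.\<close>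

lemma FF_closure: "axiom_closure \<kappa> FF"
  unfolding axiom_closure_def
proof (intro allI impI)
  fix \<xi> s x \<alpha> r
  assume \<xi>: "\<xi> < \<kappa>" and A: "(\<forall>\<eta><\<xi>. s \<eta> \<in> core FF) \<and>
    (\<forall>\<eta> \<eta>'. \<eta> < \<eta>' \<and> \<eta>' < \<xi> \<longrightarrow> leq FF (s \<eta>') (s \<eta>)) \<and>
    x = (\<Union>\<eta><\<xi>. supp FF (s \<eta>)) \<and> \<alpha> < ssup x \<and>
    r \<in> core_on FF {..<ssup (x \<inter> {..<\<alpha>})} \<and> (\<forall>\<eta><\<xi>. leq FF r (restr FF (s \<eta>) \<alpha>))"
  define V where "V \<eta> = dec (s \<eta>)" for \<eta>
  have V: "Wc (V \<eta>)" "s \<eta> = enc (V \<eta>)" if \<eta>: "\<eta> < \<xi>" for \<eta>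
  proof -
    obtain p where "s \<eta> = enc p" "Wc p" using A \<eta> unfolding core_FF by blast
    then show "Wc (V \<eta>)" "s \<eta> = enc (V \<eta>)" using Wc_imp_PP[of p] unfolding V_def by simp_all
  qed
  have VPP: "PP (V \<eta>)" if "\<eta> < \<xi>" for \<eta> using Wc_imp_PP[OF V(1)[OF that]] .
  have mono: "V \<eta> \<sqsubseteq> V \<eta>'" if "\<eta> < \<eta>'" "\<eta>' < \<xi>" for \<eta> \<eta>'
    using A that unfolding V_def leq_FF by blast
  have x: "x = (\<Union>\<eta><\<xi>. fst (V \<eta>))" using A unfolding V_def supp_FF by blast
  \<comment> \<open>The chain is nonempty, as \<open>W_join\<close> requires: the strict supremum of
    the empty set is 0, and \<alpha> would have to be below it.\<close>
  have "\<xi> \<noteq> ozero"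
  proof
    assume "\<xi> = ozero"
    then have "x = {}" using x by simp
    moreover have "\<alpha> < ssup x" using A by blast
    ultimately have "\<alpha> < ozero" by simp
    then show False using leD ozero_le by blast
  qed
  define u where "u = join (V ` {..<\<xi>})"
  have fu: "fst u = x" unfolding u_def fst_join x by (simp add: image_image)
  have "W u" unfolding u_def
  proof (rule W_join)
    have "ozero < \<xi>" using \<open>\<xi> \<noteq> ozero\<close> ozero_le[of \<xi>] by (simp add: order.order_iff_strict)
    then show "V ` {..<\<xi>} \<noteq> {}" by blast
    show "small (V ` {..<\<xi>})" using \<xi> by (intro small_image small_lessThan)
    show "W p" if "p \<in> V ` {..<\<xi>}" for p using that V(1) unfolding Wc_def by blast
    show "p \<sqsubseteq> q \<or> q \<sqsubseteq> p" if pq: "p \<in> V ` {..<\<xi>}" "q \<in> V ` {..<\<xi>}" for p q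
    proof -
      obtain a b where "a < \<xi>" "b < \<xi>" "p = V a" "q = V b" using pq by blast
      then show ?thesis using mono[of a b] mono[of b a] by (cases a b rule: linorder_cases) auto
    qed
  qed
  have sx: "small x" using W_small[OF \<open>W u\<close>] fu by simp
  define \<sigma> where "\<sigma> = ssup (x \<inter> {..<\<alpha>})"
  have \<sigma>_le: "\<sigma> \<le> \<alpha>" unfolding \<sigma>_def by (rule ssup_le) simp
  have less_\<sigma>: "a < \<sigma> \<longleftrightarrow> (\<exists>b\<in>x. b < \<alpha> \<and> a \<le> b)" for a
  proof -
    have "\<exists>\<beta>. \<forall>\<xi>\<in>x \<inter> {..<\<alpha>}. \<xi> < \<beta>" by auto
    from less_ssup_iff[OF this, of a] show ?thesis unfolding \<sigma>_def by auto
  qed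
  have "r \<in> core FF" using A unfolding core_on_def by blast
  then obtain R where R: "r = enc R" "Wc R" unfolding core_FF by blast
  have RPP: "PP R" using Wc_imp_PP[OF R(2)] .
  have "r \<in> core_on FF {..<\<sigma>}" using A unfolding \<sigma>_def by blast
  then have "supp FF r \<subseteq> {..<\<sigma>}" unfolding core_on_def conds_on_def by blast
  then have R\<sigma>: "fst R \<subseteq> {..<\<sigma>}" using R(1) RPP by (simp add: supp_FF)
  have VR: "cut (V \<eta>) {..<\<alpha>} \<sqsubseteq> R" if "\<eta> < \<xi>" for \<eta>
  proof -
    have "leq FF (enc R) (restr FF (enc (V \<eta>)) \<alpha>)" using A R(1) V(2)[OF that] that by metis
    then show ?thesis using RPP VPP[OF that] PP_cut[OF VPP[OF that]] by (simp add: leq_FF restr_FF)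
  qed
  have uR: "cut u {..<\<alpha>} \<sqsubseteq> R"
  proof -
    have "cut u {..<\<alpha>} = join ((\<lambda>\<eta>. cut (V \<eta>) {..<\<alpha>}) ` {..<\<xi>})"
      unfolding u_def by (auto simp: cut_def join_def)
    moreover have "join ((\<lambda>\<eta>. cut (V \<eta>) {..<\<alpha>}) ` {..<\<xi>}) \<sqsubseteq> R"
      by (rule join_least) (use VR in blast)
    ultimately show ?thesis by simp
  qed
  have xR: "x \<inter> {..<\<alpha>} \<subseteq> fst R" using uR fu unfolding weaker_def by simp
  define y where "y = cl (fst R \<union> x)"
  have sy: "small (fst R \<union> x)" using W_small[OF Wc_W[OF R(2)]] sx small_Un by blast
  note bnd = small_bounded[OF sy]
  \<comment> \<open>Closing off adds no level below \<sigma>, for there the levels are those of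
    \<open>R\<close>, which are closed and reach past every ordinal below \<sigma>.\<close>
  have y\<sigma>: "y \<inter> {..<\<sigma>} = fst R"
  proof
    show "fst R \<subseteq> y \<inter> {..<\<sigma>}" using R\<sigma> cl_superset[of "fst R \<union> x"] unfolding y_def by blast
    show "y \<inter> {..<\<sigma>} \<subseteq> fst R"
    proof
      fix a assume a: "a \<in> y \<inter> {..<\<sigma>}"
      have low: "b \<in> fst R" if "b \<in> fst R \<union> x" "b < \<sigma>" for b
        using that xR \<sigma>_le by (auto intro: less_le_trans)
      obtain b where b: "b \<in> x" "b < \<alpha>" "a \<le> b" using a less_\<sigma> by auto
      then have bR: "b \<in> fst R" using xR by blast
      consider "a \<in> fst R \<union> x" | "is_limit_of a (fst R \<union> x)"
        using a mem_cl_iff[OF bnd, of a] unfolding y_def by blast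
      then show "a \<in> fst R"
      proof cases
        case 1
        moreover have "a < \<sigma>" using a by simp
        ultimately show ?thesis by (rule low)
      next
        case 2
        have "(fst R \<union> x) \<inter> {..<a} \<subseteq> fst R"
        proof
          fix d assume d: "d \<in> (fst R \<union> x) \<inter> {..<a}"
          then have "d < \<sigma>" using a by auto
          then show "d \<in> fst R" using low[of d] d by blast
        qed
        then have "is_limit_of a (fst R)" using 2 is_limit_of_mono by blast
        then show ?thesis using R(2) bR b(3) unfolding Wc_def closed_in_sup_def
          by (metis order.order_iff_strict)
      qed
    qed
  qed
  have ex: "\<exists>q. W q \<and> fst q = y \<and> u \<sqsubseteq> q \<and> cut q {..<\<sigma>} = R"
  proof (rule W_amalgam[OF \<open>W u\<close> Wc_W[OF R(2)] R\<sigma>])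
    have "cut u {..<\<sigma>} \<sqsubseteq> cut u {..<\<alpha>}" using \<sigma>_le by (intro cut_mono_set) auto
    then show "cut u {..<\<sigma>} \<sqsubseteq> R" using uR weaker_trans by blast
    show "small y" unfolding y_def by (rule small_cl[OF sy])
    show "fst u \<subseteq> y" using cl_superset[of "fst R \<union> x"] unfolding y_def fu by blast
    show "y \<inter> {..<\<sigma>} = fst R" by fact
    fix a assume "a \<in> fst R"
    then have "a < \<sigma>" using R\<sigma> by blast
    then obtain b where "b \<in> x" "b < \<alpha>" "a \<le> b" using less_\<sigma> by blast
    moreover have "b < \<sigma>" using less_\<sigma>[of b] \<open>b \<in> x\<close> \<open>b < \<alpha>\<close> by blast
    ultimately show "\<exists>\<eta>\<in>fst u. \<eta> < \<sigma> \<and> a \<le> \<eta>" using fu by blast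
  qed
  then obtain q where q: "W q" "fst q = y" "u \<sqsubseteq> q" "cut q {..<\<sigma>} = R" by blast
  have qc: "Wc q" unfolding Wc_def q(2) y_def using q(1) closed_cl[OF bnd] by blast
  have qPP: "PP q" using Wc_imp_PP[OF qc] .
  have "V \<eta> \<sqsubseteq> q" if "\<eta> < \<xi>" for \<eta>
    using weaker_trans[OF join_upper q(3)[unfolded u_def], of "V \<eta>"] that by blast
  then have "\<forall>\<eta><\<xi>. leq FF (enc q) (s \<eta>)" using V(2) VPP qPP by (simp add: leq_FF)
  moreover have "restr FF (enc q) (ssup (x \<inter> {..<\<alpha>})) = r"
    using restr_FF[OF qPP] q(4) R(1) unfolding \<sigma>_def by simp
  moreover have "supp FF (enc q) = cl (supp FF r \<union> x)"
    using q(2) qPP RPP R(1) unfolding y_def by (simp add: supp_FF)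
  moreover have "enc q \<in> core FF" using qc unfolding core_FF by blast
  ultimately show "\<exists>q\<in>core FF. (\<forall>\<eta><\<xi>. leq FF q (s \<eta>)) \<and>
    restr FF q (ssup (x \<inter> {..<\<alpha>})) = r \<and> supp FF q = cl (supp FF r \<union> x)" by blast
qed

lemma FF_glb: "axiom_glb FF"
  unfolding axiom_glb_def
proof (intro ballI allI impI)
  fix u \<alpha> v
  assume u: "u \<in> core FF" and v: "v \<in> conds_on FF {..<\<alpha>}" and le: "leq FF v (restr FF u \<alpha>)"
  obtain p where p: "u = enc p" "Wc p" using u unfolding core_FF by blast
  obtain q where q: "v = enc q" "PP q" "fst q \<subseteq> {..<\<alpha>}" using v unfolding conds_on_FF by blast
  have pPP: "PP p" using Wc_imp_PP[OF p(2)] .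
  have pq: "cut p {..<\<alpha>} \<sqsubseteq> q" using le p q pPP PP_cut[OF pPP] by (simp add: leq_FF restr_FF)
  define r where "r = join {p, q}"
  have rPP: "PP r" unfolding r_def by (rule PP_Un[OF p(2) q(2,3) pq])
  have up: "p \<sqsubseteq> r" "q \<sqsubseteq> r" unfolding r_def by (simp_all add: join_upper)
  have least: "r \<sqsubseteq> s" if "p \<sqsubseteq> s" "q \<sqsubseteq> s" for s
    unfolding r_def using that by (intro join_least) auto
  have iff: "is_glb FF u v w \<longleftrightarrow> w = enc r" for w
  proof
    assume w: "is_glb FF u v w"
    then obtain s where s: "w = enc s" "PP s" unfolding is_glb_def conds_FF by blast
    have "p \<sqsubseteq> s" "q \<sqsubseteq> s" using w s p q pPP unfolding is_glb_def by (simp_all add: leq_FF)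
    moreover have "leq FF (enc r) w"
    proof -
      have "enc r \<in> conds FF" using rPP unfolding conds_FF by blast
      moreover have "leq FF (enc r) u" "leq FF (enc r) v" using up p q pPP rPP by (simp_all add: leq_FF)
      ultimately show ?thesis using w unfolding is_glb_def by blast
    qed
    then have "s \<sqsubseteq> r" using s rPP by (simp add: leq_FF)
    ultimately show "w = enc r" using least s weaker_antisym by blast
  next
    assume w: "w = enc r"
    show "is_glb FF u v w"
      unfolding is_glb_def w
    proof (intro conjI ballI impI)
      show "enc r \<in> conds FF" using rPP by (simp add: conds_FF)
      show "leq FF (enc r) u" "leq FF (enc r) v" using up p q pPP rPP by (simp_all add: leq_FF)
      fix w' assume "w' \<in> conds FF" and le: "leq FF w' u \<and> leq FF w' v"
      then show "leq FF w' (enc r)" using least[of "dec w'"] p q pPP rPP by (simp add: leq_FF)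
    qed
  qed
  have "supp FF (enc r) = supp FF v \<union> supp FF u"
    using p q pPP rPP unfolding r_def by (simp add: supp_FF fst_join Un_commute)
  moreover have "restr FF (enc r) \<alpha> = v"
  proof -
    have "cut r {..<\<alpha>} = join {cut p {..<\<alpha>}, cut q {..<\<alpha>}}" unfolding r_def by (auto simp: cut_def join_def)
    also have "cut q {..<\<alpha>} = q" by (rule cut_id[OF PP_supported[OF q(2)] q(3)])
    also have "join {cut p {..<\<alpha>}, q} = q"
      using pq by (auto simp: join_def weaker_def prod_eq_iff)
    finally show ?thesis using restr_FF[OF rPP] q(1) by simp
  qed
  ultimately show "(\<exists>!r. is_glb FF u v r) \<and>
    (\<forall>r. is_glb FF u v r \<longrightarrow> supp FF r = supp FF v \<union> supp FF u \<and> restr FF r \<alpha> = v)"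
    unfolding iff by simp
qed

theorem FF_forcing_class: "FF \<in> forcing_class \<kappa>"
proof -
  have "one FF \<in> core FF" using Wc_empty by (simp add: one_FF core_FF)
  moreover have "core FF \<subseteq> conds FF" unfolding core_FF conds_FF using Wc_imp_PP by blast
  ultimately show ?thesis
    unfolding forcing_class_def
    using FF_forcing_notion FF_supp FF_small FF_act FF_restr FF_amalgam FF_core FF_closure FF_glb
    by simp
qed

section \<open>Generic filters\<close>

text \<open>The witness keeps the level set \<open>x\<close>. So a condition whose levels have been
  closed off together with the target set reaches the dense set by adding atoms only, with exactly
  the support that sharp density allows.\<close>

definition dense_property :: "'i \<Rightarrow> (('i \<times> 'i \<times> 'c) set \<Rightarrow> bool) \<Rightarrow> bool" where
  "dense_property \<theta> \<Psi> \<longleftrightarrow> \<theta> < \<kappa> \<and>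
     (\<forall>x A h. Wc (x, A) \<and> coi {..<\<theta>} h \<and> h ` {..<\<theta>} \<subseteq> x \<longrightarrow>
        (\<exists>A'. A \<subseteq> A' \<and> W (x, A') \<and> \<Psi> (pull \<theta> h A')))"

definition dense_at :: "'i \<Rightarrow> (('i \<times> 'i \<times> 'c) set \<Rightarrow> bool) \<Rightarrow> 'i set \<Rightarrow> 'i hset set" where
  "dense_at \<theta> \<Psi> x = enc ` {p. PP p \<and> x \<subseteq> fst p \<and>
     (\<exists>h. coi {..<\<theta>} h \<and> h ` {..<\<theta>} = x \<and> \<Psi> (pull \<theta> h (snd p)))}"

lemma mem_dense_at:
  assumes "coi {..<\<theta>} h" "PP p"
  shows "enc p \<in> dense_at \<theta> \<Psi> (h ` {..<\<theta>}) \<longleftrightarrow> h ` {..<\<theta>} \<subseteq> fst p \<and> \<Psi> (pull \<theta> h (snd p))"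
proof
  assume "enc p \<in> dense_at \<theta> \<Psi> (h ` {..<\<theta>})"
  then obtain q h' where q: "enc p = enc q" "PP q" "h ` {..<\<theta>} \<subseteq> fst q" "coi {..<\<theta>} h'"
    "h' ` {..<\<theta>} = h ` {..<\<theta>}" "\<Psi> (pull \<theta> h' (snd q))" unfolding dense_at_def by blast
  have "p = q" using q(1,2) assms(2) enc_inject by blast
  moreover have "pull \<theta> h' (snd q) = pull \<theta> h (snd q)"
    using strict_mono_image_unique[OF coi_strict_mono[OF q(4)] coi_strict_mono[OF assms(1)] q(5)]
    by (intro pull_cong)
  ultimately show "h ` {..<\<theta>} \<subseteq> fst p \<and> \<Psi> (pull \<theta> h (snd p))" using q by simp
next
  assume "h ` {..<\<theta>} \<subseteq> fst p \<and> \<Psi> (pull \<theta> h (snd p))"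
  then show "enc p \<in> dense_at \<theta> \<Psi> (h ` {..<\<theta>})" unfolding dense_at_def using assms by blast
qed

lemma sharply_dense_at:
  assumes D: "dense_property \<theta> \<Psi>" and h: "coi {..<\<theta>} h" and x: "x = h ` {..<\<theta>}"
  shows "sharply_dense FF (dense_at \<theta> \<Psi> x) \<and> common_supp FF (dense_at \<theta> \<Psi> x) = x"
proof -
  have \<theta>: "\<theta> < \<kappa>" using D unfolding dense_property_def by blast
  have sx: "small x" unfolding x by (intro small_image small_lessThan \<theta>)
  have ex: "\<exists>q. enc q \<in> dense_at \<theta> \<Psi> x \<and> PP q \<and> p \<sqsubseteq> q \<and> fst q = cl (fst p \<union> x)" if p: "PP p" for p
  proof -
    define y where "y = cl (fst p \<union> x)"
    have s: "small (fst p \<union> x)" using PP_small[OF p] sx small_Un by blast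
    have sub: "fst p \<subseteq> y" "x \<subseteq> y" using cl_superset[of "fst p \<union> x"] unfolding y_def by blast+
    obtain q where q: "W q" "p \<sqsubseteq> q" using PP_W[OF p] by blast
    obtain q' where q': "W q'" "fst q' = y" "p \<sqsubseteq> q'"
      using W_between[OF q PP_supported[OF p] _ sub(1)] small_cl[OF s] unfolding y_def by blast
    then have "Wc (y, snd q')" unfolding Wc_def y_def using closed_cl[OF small_bounded[OF s]]
      by (metis fst_conv prod.collapse)
    moreover have "h ` {..<\<theta>} \<subseteq> y" using sub(2) x by simp
    ultimately obtain A' where A': "snd q' \<subseteq> A'" "W (y, A')" "\<Psi> (pull \<theta> h A')"
      using D h unfolding dense_property_def by blast
    have PA: "PP (y, A')"
      using A'(2) closed_cl[OF small_bounded[OF s]] unfolding y_def by (intro Wc_imp_PP) (simp add: Wc_def)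
    have "enc (y, A') \<in> dense_at \<theta> \<Psi> x"
      using mem_dense_at[OF h PA] A'(3) sub(2) x by simp
    moreover have "p \<sqsubseteq> (y, A')" using q'(2,3) A'(1) unfolding weaker_def by auto
    ultimately show ?thesis using PA unfolding y_def by (intro exI[of _ "(y, A')"]) (simp add: y_def)
  qed
  \<comment> \<open>A member with the least possible support: over the empty condition the levels
    are \<open>cl x\<close>, which is \<open>x\<close> because the image of a c.o.i. is closed. It
    cuts the common support down to \<open>x\<close>.\<close>
  obtain q0 where q0: "enc q0 \<in> dense_at \<theta> \<Psi> x" "PP q0" "fst q0 = cl x"
    using ex[OF PP_empty] by auto
  have "closed_in_sup x" unfolding x by (rule coi_image_closed[OF h])
  then have fq0: "fst q0 = x" using q0(3) cl_closed[OF small_bounded[OF sx]] by simp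
  have common: "common_supp FF (dense_at \<theta> \<Psi> x) = x"
    unfolding common_supp_def
  proof (intro equalityI subsetI INT_I)
    fix a assume "a \<in> (\<Inter>p\<in>dense_at \<theta> \<Psi> x. supp FF p)"
    then have "a \<in> supp FF (enc q0)" using q0(1) by blast
    then show "a \<in> x" using fq0 q0(2) by (simp add: supp_FF)
  next
    fix a u assume a: "a \<in> x" and "u \<in> dense_at \<theta> \<Psi> x"
    then obtain p where "u = enc p" "PP p" "x \<subseteq> fst p" unfolding dense_at_def by blast
    then show "a \<in> supp FF u" using a by (auto simp: supp_FF)
  qed
  moreover have "sharply_dense FF (dense_at \<theta> \<Psi> x)"
    unfolding sharply_dense_def common
  proof (intro conjI ballI)
    show "dense_at \<theta> \<Psi> x \<noteq> {}" using q0 by blast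
    show "dense_at \<theta> \<Psi> x \<subseteq> conds FF" unfolding dense_at_def conds_FF by blast
    fix u assume "u \<in> conds FF"
    then obtain p where p: "u = enc p" "PP p" unfolding conds_FF by blast
    then obtain q where q: "enc q \<in> dense_at \<theta> \<Psi> x" "PP q" "p \<sqsubseteq> q" "fst q = cl (fst p \<union> x)"
      using ex by blast
    have "leq FF (enc q) u \<and> supp FF (enc q) = cl (supp FF u \<union> x)"
      using p q by (simp add: leq_FF supp_FF)
    then show "\<exists>q\<in>dense_at \<theta> \<Psi> x. leq FF q u \<and> supp FF q = cl (supp FF u \<union> x)" using q(1) by blast
  qed
  ultimately show ?thesis by blast
qed

text \<open>Membership in \<open>dense_at\<close> depends on the levels listed by \<open>h\<close>
  and on the pulled back atoms, and by \<open>pull_move\<close> a c.o.i. carries the former along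
  and fixes the latter.\<close>

lemma sharply_dense_system_at:
  assumes D: "dense_property \<theta> \<Psi>"
  shows "sharply_dense_system \<kappa> FF (dense_at \<theta> \<Psi> ` coi_images \<theta>)"
  unfolding sharply_dense_system_def
proof (intro exI[of _ \<theta>] conjI exI[of _ "dense_at \<theta> \<Psi>"] ballI refl allI impI)
  show "\<theta> < \<kappa>" using D unfolding dense_property_def by blast
next
  fix x assume "x \<in> coi_images \<theta>"
  then obtain h where "coi {..<\<theta>} h" "x = h ` {..<\<theta>}" unfolding coi_images_def by blast
  then show "sharply_dense FF (dense_at \<theta> \<Psi> x)" "common_supp FF (dense_at \<theta> \<Psi> x) = x"
    using sharply_dense_at[OF D] by blast+
next
  fix x u y \<pi>
  assume "x \<in> coi_images \<theta>" and "u \<in> conds FF"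
    and A: "coi y \<pi> \<and> x \<subseteq> supp FF u \<and> supp FF u \<subseteq> y"
  then obtain h p where h: "coi {..<\<theta>} h" "x = h ` {..<\<theta>}" and p: "u = enc p" "PP p"
    unfolding coi_images_def conds_FF by blast
  have xp: "h ` {..<\<theta>} \<subseteq> fst p" and py: "fst p \<subseteq> y" using A p h by (simp_all add: supp_FF)
  have c: "coi y \<pi>" using A by blast
  have c': "coi {..<\<theta>} (\<pi> \<circ> h)" by (rule coi_comp[OF h(1) c]) (use xp py in blast)
  have im: "\<pi> ` x = (\<pi> \<circ> h) ` {..<\<theta>}" using h(2) by (simp add: image_comp)
  have m: "PP (move \<pi> p)" by (rule PP_move[OF p(2) c py])
  have "pull \<theta> (\<pi> \<circ> h) (snd (move \<pi> p)) = pull \<theta> h (snd p)"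
    by (rule pull_move[OF PP_supported[OF p(2)] inj_on_subset[OF coi_inj[OF c] py] xp])
  moreover have "(\<pi> \<circ> h) ` {..<\<theta>} \<subseteq> fst (move \<pi> p)" using xp by auto
  ultimately have "enc (move \<pi> p) \<in> dense_at \<theta> \<Psi> ((\<pi> \<circ> h) ` {..<\<theta>}) \<longleftrightarrow>
      enc p \<in> dense_at \<theta> \<Psi> (h ` {..<\<theta>})"
    unfolding mem_dense_at[OF c' m] mem_dense_at[OF h(1) p(2)] using xp by (simp only:)
  then have "enc (move \<pi> p) \<in> dense_at \<theta> \<Psi> (\<pi> ` x) \<longleftrightarrow> enc p \<in> dense_at \<theta> \<Psi> x"
    using im h(2) by metis
  then show "u \<in> dense_at \<theta> \<Psi> x \<longleftrightarrow> act FF y \<pi> u \<in> dense_at \<theta> \<Psi> (\<pi> ` x)"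
    using p by (simp add: act_FF)
qed

theorem ex_generic:
  assumes FA: "FA \<kappa>" and \<Delta>: "\<Delta> \<lesssim> {..<\<kappa>}"
    and dense: "\<And>\<theta> \<Psi>. (\<theta>, \<Psi>) \<in> \<Delta> \<Longrightarrow> dense_property \<theta> \<Psi>"
  obtains \<G> :: "('i, 'c) cond set"
  where "\<And>p. p \<in> \<G> \<Longrightarrow> PP p"
    and "\<And>p q. p \<in> \<G> \<Longrightarrow> q \<in> \<G> \<Longrightarrow> \<exists>r\<in>\<G>. p \<sqsubseteq> r \<and> q \<sqsubseteq> r"
    and "\<And>\<theta> \<Psi> h. (\<theta>, \<Psi>) \<in> \<Delta> \<Longrightarrow> coi {..<\<theta>} h \<Longrightarrow> \<exists>p\<in>\<G>. \<Psi> (pull \<theta> h (snd p))"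
proof -
  \<comment> \<open>The trivial requirement serves as a default for the indices
    \<open>i < \<kappa>\<close> that number no requirement.\<close>
  define \<Delta>' where "\<Delta>' = insert (ozero, \<lambda>_. True) \<Delta>"
  have "{(ozero, \<lambda>_. True)} \<lesssim> {..<\<kappa>}"
    by (rule finite_lepoll_infinite[OF infinite_kappa]) simp
  then have "{(ozero, \<lambda>_. True)} \<union> \<Delta> \<lesssim> {..<\<kappa>}" using \<Delta> by (rule Un_lepoll_infinite[OF infinite_kappa])
  then have "\<Delta>' \<lesssim> {..<\<kappa>}" unfolding \<Delta>'_def by simp
  then obtain f where f: "inj_on f \<Delta>'" "f ` \<Delta>' \<subseteq> {..<\<kappa>}" unfolding lepoll_def by blast
  have "ozero < \<kappa>" using lam_less_kappa ozero_le[of lam] by (rule le_less_trans[rotated])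
  then have zero: "dense_property ozero (\<lambda>_. True)"
    unfolding dense_property_def Wc_def by blast
  define d where "d i = (if i \<in> f ` \<Delta>' then inv_into \<Delta>' f i else (ozero, \<lambda>_. True))" for i
  have d: "d i \<in> \<Delta>'" for i unfolding d_def using inv_into_into[of i f \<Delta>'] by (simp add: \<Delta>'_def)
  have fd: "d (f t) = t" if "t \<in> \<Delta>'" for t unfolding d_def using that f(1) by simp
  define S where "S i = dense_at (fst (d i)) (snd (d i)) ` coi_images (fst (d i))" for i
  have sys: "sharply_dense_system \<kappa> FF (S i)" for i
  proof -
    have "dense_property (fst (d i)) (snd (d i))"
      using d[of i] zero dense[of "fst (d i)" "snd (d i)"] unfolding \<Delta>'_def by (cases "d i") auto
    then show ?thesis unfolding S_def by (rule sharply_dense_system_at)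
  qed
  have "\<exists>G. is_filter FF G \<and> (\<forall>i<\<kappa>. \<forall>D\<in>S i. G \<inter> D \<noteq> {})"
    by (rule FA[unfolded FA_def, THEN bspec, OF FF_forcing_class, THEN spec, THEN mp]) (simp add: sys)
  then obtain G where G: "is_filter FF G" "\<And>i D. i < \<kappa> \<Longrightarrow> D \<in> S i \<Longrightarrow> G \<inter> D \<noteq> {}" by blast
  have GP: "\<exists>p. u = enc p \<and> PP p" if "u \<in> G" for u
    using G(1) that unfolding is_filter_def conds_FF by blast
  show ?thesis
  proof
    show "PP p" if "p \<in> dec ` G" for p using that GP by force
    show "\<exists>r\<in>dec ` G. p \<sqsubseteq> r \<and> q \<sqsubseteq> r" if pq: "p \<in> dec ` G" "q \<in> dec ` G" for p q
    proof -
      obtain u v where "u \<in> G" "v \<in> G" "p = dec u" "q = dec v" using pq by blast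
      moreover then obtain w where "w \<in> G" "leq FF w u" "leq FF w v"
        using G(1) unfolding is_filter_def by blast
      ultimately show ?thesis unfolding leq_FF by blast
    qed
    fix \<theta> \<Psi> h assume t: "(\<theta>, \<Psi>) \<in> \<Delta>" and h: "coi {..<\<theta>} h"
    then have t': "(\<theta>, \<Psi>) \<in> \<Delta>'" unfolding \<Delta>'_def by blast
    have "dense_at \<theta> \<Psi> (h ` {..<\<theta>}) \<in> S (f (\<theta>, \<Psi>))"
      unfolding S_def fd[OF t'] coi_images_def using h by auto
    moreover have "f (\<theta>, \<Psi>) < \<kappa>" using f(2) t' by blast
    ultimately obtain u where u: "u \<in> G" "u \<in> dense_at \<theta> \<Psi> (h ` {..<\<theta>})" using G(2) by blast
    obtain p where p: "u = enc p" "PP p" using GP[OF u(1)] by blast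
    have "\<Psi> (pull \<theta> h (snd p))" using mem_dense_at[OF h p(2)] u(2) p(1) by blast
    then show "\<exists>p\<in>dec ` G. \<Psi> (pull \<theta> h (snd p))" using u(1) p by force
  qed
qed

end

section \<open>The forcing axiom implies \<open>2\<^sup>\<lambda> = \<kappa>\<close>\<close>

context successor_cardinals
begin

text \<open>Separates the level at which a requirement asks for something new, index
  \<open>\<tau>\<close>, from the levels that it speaks about, the indices below
  \<open>\<tau>\<close>.\<close>

lemma coi_enumeration_max:
  fixes X :: "'i set"
  assumes "small X" "closed_in_sup X" "\<beta> \<in> X" "\<And>\<xi>. \<xi> \<in> X \<Longrightarrow> \<xi> \<le> \<beta>"
  obtains \<tau> h where "\<tau> < \<kappa>" "coi {..<osuc \<tau>} h" "h ` {..<\<tau>} = X - {\<beta>}" "h \<tau> = \<beta>"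
proof -
  obtain \<theta> h where h: "\<theta> < \<kappa>" "coi {..<\<theta>} h" "h ` {..<\<theta>} = X"
    using coi_small_enumeration[OF assms(1,2)] by blast
  obtain \<tau> where \<tau>: "\<tau> < \<theta>" "h \<tau> = \<beta>" using assms(3) h(3) by auto
  have "\<zeta> \<le> \<tau>" if "\<zeta> < \<theta>" for \<zeta>
  proof (rule ccontr)
    assume "\<not> \<zeta> \<le> \<tau>"
    then have "h \<tau> < h \<zeta>" using coi_less_iff[OF h(2), of \<tau> \<zeta>] \<tau> that by auto
    moreover have "h \<zeta> \<in> X" using h(3) that by blast
    ultimately show False using assms(4) \<tau>(2) leD by blast
  qed
  then have "{..<\<theta>} = insert \<tau> {..<\<tau>}" using \<tau>(1) by (auto simp: order.order_iff_strict)
  then have eq: "{..<\<theta>} = {..<osuc \<tau>}" using lessThan_osuc by simp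
  have inj: "inj_on h (insert \<tau> {..<\<tau>})" using coi_inj[OF h(2)] eq lessThan_osuc by simp
  have "X = insert \<beta> (h ` {..<\<tau>})" using h(3) \<tau>(2) eq lessThan_osuc by auto
  moreover have "\<beta> \<notin> h ` {..<\<tau>}" using inj \<tau>(2) by (auto dest!: inj_onD)
  ultimately have "h ` {..<\<tau>} = X - {\<beta>}" by blast
  then show ?thesis using that[of \<tau> h] h \<tau> eq less_trans by metis
qed

lemma not_small_kappa: "\<not> small {..<\<kappa>}"
  using small_iff[of "{..<\<kappa>}"] by auto

lemma ex_fresh: "small X \<Longrightarrow> \<exists>i<\<kappa>. i \<notin> X"
  using not_small_kappa small_subset[of X "{..<\<kappa>}"] by blast

text \<open>An atom \<open>(\<xi>, \<beta>, (i, k))\<close> says that \<xi> is the entry at place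
  \<open>k\<close> of the list number \<open>i\<close> attached to the level \<beta>. The last
  clause makes each list a partial function of the place.\<close>

definition select_ok :: "('i, 'i \<times> 'i) cond \<Rightarrow> bool" where
  "select_ok p \<longleftrightarrow> small (fst p) \<and> small (snd p) \<and>
     snd p \<subseteq> fst p \<times> fst p \<times> ({..<\<kappa>} \<times> {..<\<kappa>}) \<and>
     (\<forall>\<xi> \<beta> c. (\<xi>, \<beta>, c) \<in> snd p \<longrightarrow> \<xi> < \<beta>) \<and>
     (\<forall>\<xi> \<xi>' \<beta> c. (\<xi>, \<beta>, c) \<in> snd p \<longrightarrow> (\<xi>', \<beta>, c) \<in> snd p \<longrightarrow> \<xi> = \<xi>')"

lemma select_okD:
  assumes "select_ok p"
  shows "small (fst p)" "small (snd p)" "snd p \<subseteq> fst p \<times> fst p \<times> ({..<\<kappa>} \<times> {..<\<kappa>})"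
    "\<And>\<xi> \<beta> c. (\<xi>, \<beta>, c) \<in> snd p \<Longrightarrow> \<xi> < \<beta>"
    "\<And>\<xi> \<xi>' \<beta> c. (\<xi>, \<beta>, c) \<in> snd p \<Longrightarrow> (\<xi>', \<beta>, c) \<in> snd p \<Longrightarrow> \<xi> = \<xi>'"
  using assms unfolding select_ok_def by blast+

text \<open>Two entries can clash only at a common level \<beta>. If \<beta> is a level of
  \<open>r\<close>, the entries of \<open>u\<close> at \<beta> relate levels below \<sigma> and
  hence belong to \<open>r\<close> already.\<close>

lemma select_ok_Un:
  assumes u: "select_ok u" and r: "select_ok r" "fst r \<subseteq> {..<\<sigma>}" "cut u {..<\<sigma>} \<sqsubseteq> r"
    and y: "small y" "fst u \<subseteq> y" "fst r \<subseteq> y"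
  shows "select_ok (y, snd u \<union> snd r)"
proof -
  have low: "t \<in> snd r" if t: "t \<in> snd u" "t = (\<xi>, \<beta>, c)" "\<beta> \<in> fst r" for t \<xi> \<beta> c
  proof -
    have "\<beta> < \<sigma>" using that(3) r(2) by blast
    moreover have "\<xi> < \<beta>" using select_okD(4)[OF u] t by blast
    ultimately have "t \<in> snd (cut u {..<\<sigma>})" using t unfolding snd_cut by auto
    then show ?thesis using r(3) unfolding weaker_def by blast
  qed
  show ?thesis
    unfolding select_ok_def fst_conv snd_conv
  proof (intro conjI allI impI)
    show "small y" by fact
    show "small (snd u \<union> snd r)" using select_okD(2) u r(1) small_Un by blast
    show "snd u \<union> snd r \<subseteq> y \<times> y \<times> ({..<\<kappa>} \<times> {..<\<kappa>})"
      using select_okD(3)[OF u] select_okD(3)[OF r(1)] y(2,3) by blast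
    show "\<xi> < \<beta>" if "(\<xi>, \<beta>, c) \<in> snd u \<union> snd r" for \<xi> \<beta> c
      using that select_okD(4) u r(1) by blast
    fix \<xi> \<xi>' \<beta> c assume *: "(\<xi>, \<beta>, c) \<in> snd u \<union> snd r" "(\<xi>', \<beta>, c) \<in> snd u \<union> snd r"
    show "\<xi> = \<xi>'"
    proof (cases "\<beta> \<in> fst r")
      case True
      then have "(\<xi>, \<beta>, c) \<in> snd r" "(\<xi>', \<beta>, c) \<in> snd r" using * low by blast+
      then show ?thesis using select_okD(5)[OF r(1)] by blast
    next
      case False
      then have "(\<xi>, \<beta>, c) \<in> snd u" "(\<xi>', \<beta>, c) \<in> snd u" using * select_okD(3)[OF r(1)] by blast+
      then show ?thesis using select_okD(5)[OF u] by blast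
    qed
  qed
qed

lemma select_amalgamation_class: "amalgamation_class lam \<kappa> select_ok ({..<\<kappa>} \<times> {..<\<kappa>})"
proof unfold_locales
  show "{..<\<kappa>} \<times> {..<\<kappa>} \<lesssim> {..<\<kappa>}" by (intro times_lepoll_infinite infinite_kappa lepoll_refl)
  fix p :: "('i, 'i \<times> 'i) cond"
  assume p: "select_ok p"
  show "small (fst p) \<and> small (snd p)" using select_okD(1,2)[OF p] by blast
  show "snd p \<subseteq> fst p \<times> fst p \<times> ({..<\<kappa>} \<times> {..<\<kappa>})" using select_okD(3)[OF p] .
  show "select_ok (cut p Z)" for Z
    unfolding select_ok_def fst_cut snd_cut
  proof (intro conjI allI impI)
    show "small (fst p \<inter> Z)" by (rule small_subset[OF select_okD(1)[OF p]]) auto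
    show "small (snd p \<inter> Z \<times> Z \<times> UNIV)" by (rule small_subset[OF select_okD(2)[OF p]]) auto
  qed (use select_okD(3-5)[OF p] in blast)+
  show "select_ok (move j p)" if j: "strict_mono_on (fst p) j" for j
    unfolding select_ok_def
  proof (intro conjI allI impI)
    show "small (fst (move j p))" "small (snd (move j p))"
      using select_okD(1,2)[OF p] small_image by (simp_all add: snd_move)
    show "snd (move j p) \<subseteq> fst (move j p) \<times> fst (move j p) \<times> ({..<\<kappa>} \<times> {..<\<kappa>})"
    proof
      fix t assume "t \<in> snd (move j p)"
      then obtain a b c where "(a, b, c) \<in> snd p" "t = (j a, j b, c)" unfolding snd_move mv_def by auto
      then show "t \<in> fst (move j p) \<times> fst (move j p) \<times> ({..<\<kappa>} \<times> {..<\<kappa>})"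
        using select_okD(3)[OF p] by auto
    qed
    fix \<xi> \<beta> c assume "(\<xi>, \<beta>, c) \<in> snd (move j p)"
    then obtain a b where ab: "(a, b, c) \<in> snd p" "\<xi> = j a" "\<beta> = j b" unfolding snd_move mv_def by auto
    have abp: "a \<in> fst p" "b \<in> fst p" using ab(1) select_okD(3)[OF p] by blast+
    then show "\<xi> < \<beta>" using strict_mono_onD[OF j] select_okD(4)[OF p ab(1)] ab by blast
    fix \<xi>' assume "(\<xi>', \<beta>, c) \<in> snd (move j p)"
    then obtain a' b' where ab': "(a', b', c) \<in> snd p" "\<xi>' = j a'" "\<beta> = j b'" unfolding snd_move mv_def by auto
    have "b' \<in> fst p" using ab'(1) select_okD(3)[OF p] by blast
    then have "b' = b" using ab(3) ab'(3) abp(2) inj_onD[OF strict_mono_on_imp_inj_on[OF j]] by simp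
    then show "\<xi> = \<xi>'" using select_okD(5)[OF p] ab ab' by blast
  qed
next
  show "select_ok ({}, {})" unfolding select_ok_def by simp
next
  fix \<C> :: "('i, 'i \<times> 'i) cond set"
  assume ne: "\<C> \<noteq> {}" and sm: "small \<C>" and ok: "\<And>p. p \<in> \<C> \<Longrightarrow> select_ok p"
    and chain: "\<And>p q. p \<in> \<C> \<Longrightarrow> q \<in> \<C> \<Longrightarrow> p \<sqsubseteq> q \<or> q \<sqsubseteq> p"
  show "select_ok (join \<C>)"
    unfolding select_ok_def fst_join snd_join
  proof (intro conjI allI impI)
    show "small (\<Union> (fst ` \<C>))" "small (\<Union> (snd ` \<C>))"
      using sm ok select_okD(1,2) by (intro small_UN, blast, blast)+
    show "\<Union> (snd ` \<C>) \<subseteq> \<Union> (fst ` \<C>) \<times> \<Union> (fst ` \<C>) \<times> {..<\<kappa>} \<times> {..<\<kappa>}"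
    proof
      fix t assume "t \<in> \<Union> (snd ` \<C>)"
      then obtain p where p: "p \<in> \<C>" "t \<in> snd p" by blast
      then show "t \<in> \<Union> (fst ` \<C>) \<times> \<Union> (fst ` \<C>) \<times> {..<\<kappa>} \<times> {..<\<kappa>}"
        using select_okD(3)[OF ok[OF p(1)]] by blast
    qed
    fix \<xi> \<beta> c assume "(\<xi>, \<beta>, c) \<in> \<Union> (snd ` \<C>)"
    then obtain p where p: "p \<in> \<C>" "(\<xi>, \<beta>, c) \<in> snd p" by blast
    then show "\<xi> < \<beta>" using select_okD(4)[OF ok[OF p(1)]] by blast
    fix \<xi>' assume "(\<xi>', \<beta>, c) \<in> \<Union> (snd ` \<C>)"
    then obtain q where q: "q \<in> \<C>" "(\<xi>', \<beta>, c) \<in> snd q" by blast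
    then show "\<xi> = \<xi>'"
      using chain[OF p(1) q(1)] select_okD(5)[OF ok[OF p(1)]] select_okD(5)[OF ok[OF q(1)]] p q
      unfolding weaker_def by blast
  qed
next
  fix u r :: "('i, 'i \<times> 'i) cond" and \<sigma> y
  assume *: "select_ok u" "select_ok r" "fst r \<subseteq> {..<\<sigma>}" "cut u {..<\<sigma>} \<sqsubseteq> r" "small y"
    "fst u \<subseteq> y" "y \<inter> {..<\<sigma>} = fst r"
  show "\<exists>q. select_ok q \<and> fst q = y \<and> u \<sqsubseteq> q \<and> cut q {..<\<sigma>} = r"
  proof (intro exI[of _ "(y, snd u \<union> snd r)"] conjI)
    show "select_ok (y, snd u \<union> snd r)" using * by (intro select_ok_Un) auto
    show "u \<sqsubseteq> (y, snd u \<union> snd r)" using * unfolding weaker_def by simp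
    have "snd r \<inter> ({..<\<sigma>} \<times> {..<\<sigma>} \<times> UNIV) = snd r" using select_okD(3)[OF *(2)] *(3) by blast
    then show "cut (y, snd u \<union> snd r) {..<\<sigma>} = r"
      using *(4,7) unfolding cut_def weaker_def by (auto simp: prod_eq_iff)
  qed simp
next
  fix u s :: "('i, 'i \<times> 'i) cond" and \<alpha>
  assume *: "select_ok u" "select_ok s" "fst s \<subseteq> {..<\<alpha>}" "cut u {..<\<alpha>} \<sqsubseteq> s"
  show "\<exists>q. select_ok q \<and> u \<sqsubseteq> q \<and> s \<sqsubseteq> q"
  proof (intro exI[of _ "(fst u \<union> fst s, snd u \<union> snd s)"] conjI)
    have "small (fst u \<union> fst s)" using select_okD(1) * small_Un by blast
    then show "select_ok (fst u \<union> fst s, snd u \<union> snd s)" using * by (intro select_ok_Un) auto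
  qed (auto simp: weaker_def)
qed

lemma osuc_not_limit: "\<not> is_limit_of (osuc \<xi>) x"
  unfolding is_limit_of_iff using less_osuc_iff leD less_osuc by blast

lemma Pow_lepoll_kappa:
  assumes FA: "FA \<kappa>"
  shows "Pow {..<lam} \<lesssim> {..<\<kappa>}"
proof -
  interpret S: amalgamation_class lam \<kappa> select_ok "{..<\<kappa>} \<times> {..<\<kappa>}"
    by (rule select_amalgamation_class)
  \<comment> \<open>In pulled back form: some list at the top level has the \<open>k\<close>-th
    lower level as its entry at place \<open>k\<close>, for every \<open>k < \<tau>\<close>.\<close>
  define \<Psi> where "\<Psi> \<tau> R \<longleftrightarrow> (\<exists>i<\<kappa>. \<forall>k<\<tau>. (k, \<tau>, (i, k)) \<in> R)"
    for \<tau> :: 'i and R :: "('i \<times> 'i \<times> 'i \<times> 'i) set"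
  have dense: "S.dense_property (osuc \<tau>) (\<Psi> \<tau>)" if \<tau>: "\<tau> < \<kappa>" for \<tau>
    unfolding S.dense_property_def
  proof (intro conjI allI impI)
    show "osuc \<tau> < \<kappa>" using osuc_less_kappa[OF \<tau>] .
    fix x A h assume a: "S.Wc (x, A) \<and> coi {..<osuc \<tau>} h \<and> h ` {..<osuc \<tau>} \<subseteq> x"
    have ok: "select_ok (x, A)" using a S.Wc_W by blast
    have "small ((\<lambda>(a, b, i, k). i) ` A)" using select_okD(2)[OF ok] small_image by simp
    \<comment> \<open>A list number that does not occur in \<open>A\<close> leaves all places
      free.\<close>
    then obtain i where i: "i < \<kappa>" "i \<notin> (\<lambda>(a, b, i, k). i) ` A" using ex_fresh by blast
    then have fresh: "(a, b, i, k) \<notin> A" for a b k by force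
    define A' where "A' = A \<union> (\<lambda>k. (h k, h \<tau>, i, k)) ` {..<\<tau>}"
    have hl: "h k < h \<tau>" if "k < \<tau>" for k
      using coi_less_iff[of "{..<osuc \<tau>}" h k \<tau>] a that by (simp add: less_osuc_iff less_imp_le)
    have hx: "h k \<in> x" if "k \<le> \<tau>" for k
      using a that by (auto simp: less_osuc_iff)
    have "select_ok (x, A')"
      unfolding select_ok_def fst_conv snd_conv
    proof (intro conjI allI impI)
      show "small x" using select_okD(1)[OF ok] by simp
      show "small A'" unfolding A'_def
        using select_okD(2)[OF ok] by (intro small_Un small_image small_lessThan \<tau>) simp
      show "A' \<subseteq> x \<times> x \<times> {..<\<kappa>} \<times> {..<\<kappa>}"
        using select_okD(3)[OF ok] hx i(1) \<tau> unfolding A'_def by (auto intro: less_imp_le less_trans)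
      show "\<xi> < \<beta>" if "(\<xi>, \<beta>, c) \<in> A'" for \<xi> \<beta> c
        using that select_okD(4)[OF ok] hl unfolding A'_def by (cases c) auto
      show "\<xi> = \<xi>'" if "(\<xi>, \<beta>, c) \<in> A'" "(\<xi>', \<beta>, c) \<in> A'" for \<xi> \<xi>' \<beta> c
        using that select_okD(5)[OF ok, of \<xi> \<beta> c \<xi>'] fresh unfolding A'_def by (cases c) auto
    qed
    moreover have "\<Psi> \<tau> (pull (osuc \<tau>) h A')"
      unfolding \<Psi>_def pull_def A'_def using i(1) by (auto simp: less_osuc_iff intro: less_imp_le)
    moreover have "A \<subseteq> A'" unfolding A'_def by blast
    ultimately show "\<exists>A'. A \<subseteq> A' \<and> select_ok (x, A') \<and> \<Psi> \<tau> (pull (osuc \<tau>) h A')" by blast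
  qed
  have \<Delta>: "(\<lambda>\<tau>. (osuc \<tau>, \<Psi> \<tau>)) ` {..<\<kappa>} \<lesssim> {..<\<kappa>}" by (rule image_lepoll)
  obtain \<G> where G: "\<And>p. p \<in> \<G> \<Longrightarrow> S.PP p"
    "\<And>p q. p \<in> \<G> \<Longrightarrow> q \<in> \<G> \<Longrightarrow> \<exists>r\<in>\<G>. p \<sqsubseteq> r \<and> q \<sqsubseteq> r"
    "\<And>\<theta> \<Psi>' h. (\<theta>, \<Psi>') \<in> (\<lambda>\<tau>. (osuc \<tau>, \<Psi> \<tau>)) ` {..<\<kappa>} \<Longrightarrow> coi {..<\<theta>} h \<Longrightarrow>
        \<exists>p\<in>\<G>. \<Psi>' (pull \<theta> h (snd p))"
    by (rule S.ex_generic[OF FA \<Delta>]) (use dense in auto)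
  \<comment> \<open>Images of c.o.i.'s are closed, hence the closure. It adds limit points but no
    successors, so \<open>S\<close> can be read off. The lists at the level \<lambda> + 1 are used
    because \<lambda> itself is a limit point when \<open>S\<close> is cofinal in it.\<close>
  define X where "X S = cl (insert (osuc lam) (osuc ` S))" for S :: "'i set"
  \<comment> \<open>The code of \<open>S\<close> consists of the order type of \<open>X S\<close>
    without its top and of the number of a list at \<lambda> + 1 that enumerates it.\<close>
  have code: "\<exists>\<tau>i. \<tau>i \<in> {..<\<kappa>} \<times> {..<\<kappa>} \<and> (\<exists>p\<in>\<G>. \<exists>h. h ` {..<fst \<tau>i} = X S - {osuc lam} \<and>
      (\<forall>k<fst \<tau>i. (h k, osuc lam, (snd \<tau>i, k)) \<in> snd p))" if S: "S \<subseteq> {..<lam}" for S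
  proof -
    have "small S" using S subset_imp_lepoll unfolding small_def by blast
    then have s: "small (insert (osuc lam) (osuc ` S))" by (intro small_insert small_image)
    note bnd = small_bounded[OF s]
    have le: "\<xi> \<le> osuc lam" if \<xi>: "\<xi> \<in> X S" for \<xi>
    proof -
      obtain b where "b \<in> insert (osuc lam) (osuc ` S)" "\<xi> \<le> b"
        using cl_le[OF bnd \<xi>[unfolded X_def]] by blast
      moreover have "osuc s \<le> osuc lam" if "s \<in> S" for s
      proof -
        have "s < lam" using that S by blast
        then show ?thesis using less_osuc[of lam] by (simp add: osuc_le_iff less_osuc_iff)
      qed
      ultimately show ?thesis by (auto intro: order_trans)
    qed
    have mem: "osuc lam \<in> X S" using cl_superset unfolding X_def by blast
    have smX: "small (X S)" unfolding X_def by (rule small_cl[OF s])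
    have clX: "closed_in_sup (X S)" unfolding X_def by (rule closed_cl[OF bnd])
    obtain \<tau> h where h: "\<tau> < \<kappa>" "coi {..<osuc \<tau>} h" "h ` {..<\<tau>} = X S - {osuc lam}" "h \<tau> = osuc lam"
      using coi_enumeration_max[OF smX clX mem le] by blast
    have "(osuc \<tau>, \<Psi> \<tau>) \<in> (\<lambda>\<tau>. (osuc \<tau>, \<Psi> \<tau>)) ` {..<\<kappa>}" using h(1) by blast
    then obtain p where p: "p \<in> \<G>" "\<Psi> \<tau> (pull (osuc \<tau>) h (snd p))" using G(3) h(2) by blast
    then obtain i where "i < \<kappa>" "\<forall>k<\<tau>. (h k, h \<tau>, i, k) \<in> snd p" unfolding \<Psi>_def pull_def by auto
    then show ?thesis using h p(1) by (intro exI[of _ "(\<tau>, i)"]) auto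
  qed
  then obtain f where f: "\<And>S. S \<subseteq> {..<lam} \<Longrightarrow> f S \<in> {..<\<kappa>} \<times> {..<\<kappa>}"
    "\<And>S. S \<subseteq> {..<lam} \<Longrightarrow> \<exists>p\<in>\<G>. \<exists>h. h ` {..<fst (f S)} = X S - {osuc lam} \<and>
      (\<forall>k<fst (f S). (h k, osuc lam, (snd (f S), k)) \<in> snd p)" by metis
  have mem_X: "osuc \<xi> \<in> X S \<longleftrightarrow> \<xi> \<in> S" if S: "S \<subseteq> {..<lam}" and \<xi>: "\<xi> < lam" for S \<xi>
  proof -
    have "small S" using S subset_imp_lepoll unfolding small_def by blast
    then have s: "small (insert (osuc lam) (osuc ` S))" by (intro small_insert small_image)
    have inj: "osuc a = osuc b \<longleftrightarrow> a = b" for a b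
      by (metis less_osuc_iff order_refl antisym)
    show ?thesis
      unfolding X_def mem_cl_iff[OF small_bounded[OF s]] using osuc_not_limit inj \<xi> by auto
  qed
  have "inj_on f (Pow {..<lam})"
  proof (rule inj_onI)
    fix S T assume "S \<in> Pow {..<lam}" "T \<in> Pow {..<lam}" and eq: "f S = f T"
    then have S: "S \<subseteq> {..<lam}" and T: "T \<subseteq> {..<lam}" by auto
    obtain p h where p: "p \<in> \<G>" "h ` {..<fst (f S)} = X S - {osuc lam}"
      "\<forall>k<fst (f S). (h k, osuc lam, (snd (f S), k)) \<in> snd p" using f(2)[OF S] by blast
    obtain q g where q: "q \<in> \<G>" "g ` {..<fst (f S)} = X T - {osuc lam}"
      "\<forall>k<fst (f S). (g k, osuc lam, (snd (f S), k)) \<in> snd q" using f(2)[OF T] unfolding eq by blast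
    obtain r where r: "r \<in> \<G>" "p \<sqsubseteq> r" "q \<sqsubseteq> r" using G(2) p(1) q(1) by blast
    obtain w where w: "select_ok w" "r \<sqsubseteq> w" using S.PP_W[OF G(1)[OF r(1)]] by blast
    \<comment> \<open>Both lists are part of one member \<open>w\<close> of the class, where an
      entry is determined by its level, list number and place; so equal codes mean equal
      lists.\<close>
    have "h k = g k" if "k < fst (f S)" for k
    proof (rule select_okD(5)[OF w(1)])
      show "(h k, osuc lam, (snd (f S), k)) \<in> snd w" "(g k, osuc lam, (snd (f S), k)) \<in> snd w"
        using p(3) q(3) r(2,3) w(2) that unfolding weaker_def by blast+
    qed
    then have "h ` {..<fst (f S)} = g ` {..<fst (f S)}" by (intro image_cong) auto
    then have "X S - {osuc lam} = X T - {osuc lam}" using p(2) q(2) by simp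
    moreover have "osuc lam \<in> X S" "osuc lam \<in> X T" unfolding X_def using cl_superset by blast+
    ultimately have XX: "X S = X T" by (metis insert_Diff)
    show "S = T"
    proof (rule set_eqI)
      fix \<xi>
      show "\<xi> \<in> S \<longleftrightarrow> \<xi> \<in> T"
      proof (cases "\<xi> < lam")
        case True
        then show ?thesis using mem_X[OF S True] mem_X[OF T True] XX by simp
      qed (use S T in auto)
    qed
  qed
  moreover have "f ` Pow {..<lam} \<subseteq> {..<\<kappa>} \<times> {..<\<kappa>}" using f(1) by blast
  ultimately have "Pow {..<lam} \<lesssim> {..<\<kappa>} \<times> {..<\<kappa>}" unfolding lepoll_def by blast
  then show ?thesis
    by (rule lepoll_trans) (intro times_lepoll_infinite infinite_kappa lepoll_refl)
qed

section \<open>Counting functions from small sets to \<kappa>\<close>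

lemma Pow_lepoll_mono: "A \<lesssim> B \<Longrightarrow> Pow A \<lesssim> Pow B"
proof -
  assume "A \<lesssim> B"
  then obtain f where f: "inj_on f A" "f ` A \<subseteq> B" unfolding lepoll_def by blast
  have "inj_on (image f) (Pow A)" using f(1) by (rule inj_on_image_Pow)
  moreover have "image f ` Pow A \<subseteq> Pow B" using f(2) by blast
  ultimately show ?thesis unfolding lepoll_def by blast
qed

text \<open>By regularity a function from \<lambda> to \<kappa> is bounded by some
  \<open>\<mu> < \<kappa>\<close>, and for each of these \<kappa> many bounds there are at most
  \<open>\<lambda>^\<lambda> \<le> 2^\<lambda> \<le> \<kappa>\<close> functions.\<close>

lemma functions_lepoll_kappa:
  assumes FA: "FA \<kappa>" and X: "small X"
  shows "X \<rightarrow>\<^sub>E {..<\<kappa>} \<lesssim> {..<\<kappa>}"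
proof -
  have lamlam: "{..<lam} \<times> {..<lam} \<lesssim> {..<lam}"
    by (intro times_lepoll_infinite infinite_lam lepoll_refl)
  have "{..<lam} \<rightarrow>\<^sub>E {..<lam} \<lesssim> Pow ({..<lam} \<times> {..<lam})"
  proof -
    define g where "g f = (\<lambda>x. (x, f x)) ` {..<lam}" for f :: "'i \<Rightarrow> 'i"
    have "inj_on g ({..<lam} \<rightarrow>\<^sub>E {..<lam})"
    proof (rule inj_onI)
      fix f f' assume f: "f \<in> {..<lam} \<rightarrow>\<^sub>E {..<lam}" "f' \<in> {..<lam} \<rightarrow>\<^sub>E {..<lam}" and eq: "g f = g f'"
      show "f = f'"
      proof (rule PiE_ext[OF f])
        fix x assume "x \<in> {..<lam}"
        then have "(x, f x) \<in> g f'" using eq unfolding g_def by blast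
        then show "f x = f' x" unfolding g_def by auto
      qed
    qed
    moreover have "g ` ({..<lam} \<rightarrow>\<^sub>E {..<lam}) \<subseteq> Pow ({..<lam} \<times> {..<lam})" unfolding g_def by auto
    ultimately show ?thesis unfolding lepoll_def by blast
  qed
  also have "\<dots> \<lesssim> Pow {..<lam}" by (rule Pow_lepoll_mono[OF lamlam])
  also have "\<dots> \<lesssim> {..<\<kappa>}" by (rule Pow_lepoll_kappa[OF FA])
  finally have ll: "{..<lam} \<rightarrow>\<^sub>E {..<lam} \<lesssim> {..<\<kappa>}" .
  have "{..<lam} \<rightarrow>\<^sub>E {..<\<kappa>} \<subseteq> (\<Union>\<mu>\<in>{..<\<kappa>}. {..<lam} \<rightarrow>\<^sub>E {..<\<mu>})"
  proof
    fix f assume f: "f \<in> {..<lam} \<rightarrow>\<^sub>E {..<\<kappa>}"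
    have "small (f ` {..<lam})" using small_image small_lessThan[OF lam_less_kappa] by blast
    moreover have "f ` {..<lam} \<subseteq> {..<\<kappa>}" using f by auto
    ultimately obtain \<mu> where "\<mu> < \<kappa>" "\<forall>\<xi>\<in>f ` {..<lam}. \<xi> < \<mu>" using small_bounded_kappa by blast
    then have "f \<in> {..<lam} \<rightarrow>\<^sub>E {..<\<mu>}" using f by (auto simp: PiE_iff)
    then show "f \<in> (\<Union>\<mu>\<in>{..<\<kappa>}. {..<lam} \<rightarrow>\<^sub>E {..<\<mu>})" using \<open>\<mu> < \<kappa>\<close> by blast
  qed
  moreover have "(\<Union>\<mu>\<in>{..<\<kappa>}. {..<lam} \<rightarrow>\<^sub>E {..<\<mu>}) \<lesssim> {..<\<kappa>}"
  proof (rule UN_lepoll_infinite[OF infinite_kappa lepoll_refl])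
    fix \<mu> assume "\<mu> \<in> {..<\<kappa>}"
    then have "{..<\<mu>} \<lesssim> {..<lam}" using small_lessThan unfolding small_def by blast
    then have "{..<lam} \<rightarrow>\<^sub>E {..<\<mu>} \<lesssim> {..<lam} \<rightarrow>\<^sub>E {..<lam}" by (rule lepoll_funcset_right)
    then show "{..<lam} \<rightarrow>\<^sub>E {..<\<mu>} \<lesssim> {..<\<kappa>}" using ll by (rule lepoll_trans)
  qed
  ultimately have lk: "{..<lam} \<rightarrow>\<^sub>E {..<\<kappa>} \<lesssim> {..<\<kappa>}" using lepoll_trans subset_imp_lepoll by metis
  have "X \<rightarrow>\<^sub>E {..<\<kappa>} \<lesssim> {..<lam} \<rightarrow>\<^sub>E {..<\<kappa>}"
    using X lam_less_kappa unfolding small_def by (intro lepoll_funcset_left) auto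
  then show ?thesis using lk by (rule lepoll_trans)
qed

end

section \<open>The tree forcing\<close>

text \<open>\<open>e\<close> lists the injections \<open>\<lambda> \<rightarrow> \<kappa>\<close>.  The node \<open>n\<close> of level \<open>\<beta>\<close> is \<open>(\<beta>, n)\<close>,
  so that the elements of \<open>T\<^sup>\<lambda>\<close> at level \<open>\<beta>\<close> are named by the pairs \<open>(\<beta>, j)\<close>.\<close>

locale tree_index = successor_cardinals lam \<kappa> for lam \<kappa> :: "'i::wellorder" +
  fixes e :: "'i \<Rightarrow> 'i \<Rightarrow> 'i"
  assumes e_inj: "j < \<kappa> \<Longrightarrow> inj_on (e j) {..<lam}"
    and e_less: "j < \<kappa> \<Longrightarrow> i < lam \<Longrightarrow> e j i < \<kappa>"
    and e_surj: "inj_on f {..<lam} \<Longrightarrow> (\<And>i. i < lam \<Longrightarrow> f i < \<kappa>) \<Longrightarrow> \<exists>j<\<kappa>. \<forall>i<lam. e j i = f i"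
begin

definition name_of :: "('i \<Rightarrow> 'i) \<Rightarrow> 'i" where
  "name_of f = (LEAST j. j < \<kappa> \<and> (\<forall>i<lam. e j i = f i))"

lemma name_of:
  assumes "inj_on f {..<lam}" "\<And>i. i < lam \<Longrightarrow> f i < \<kappa>"
  shows "name_of f < \<kappa>" "i < lam \<Longrightarrow> e (name_of f) i = f i"
  using LeastI_ex[of "\<lambda>j. j < \<kappa> \<and> (\<forall>i<lam. e j i = f i)"] e_surj[OF assms]
  unfolding name_of_def by blast+

definition many :: "('i \<Rightarrow> bool) \<Rightarrow> bool" where
  "many P \<longleftrightarrow> {..<lam} \<lesssim> {i. i < lam \<and> P i}"

lemma many_mono: "many P \<Longrightarrow> (\<And>i. i < lam \<Longrightarrow> P i \<Longrightarrow> Q i) \<Longrightarrow> many Q"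
  unfolding many_def by (erule lepoll_trans) (auto intro!: subset_imp_lepoll)

lemma many_all: "(\<And>i. i < lam \<Longrightarrow> P i) \<Longrightarrow> many P"
  unfolding many_def by (rule subset_imp_lepoll) auto

lemma many_ex:
  assumes "many P"
  shows "\<exists>i<lam. P i"
proof (rule ccontr)
  assume "\<not> (\<exists>i<lam. P i)"
  then have "{i. i < lam \<and> P i} = {}" by blast
  then have "{..<lam} = {}" using assms lepoll_empty_iff_empty unfolding many_def by metis
  then show False using infinite_lam by simp
qed

end

text \<open>\<open>L \<xi> n \<beta> k\<close> says that the node \<open>(\<xi>, n)\<close> is below or equal to \<open>(\<beta>, k)\<close>; the nodes present are
  those with \<open>L \<beta> k \<beta> k\<close>.  \<open>C \<alpha> \<delta> \<beta> j\<close> says that the vector named \<open>(\<beta>, j)\<close> has the colour \<open>\<delta>\<close> over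
  the level \<open>\<alpha>\<close>; two such vectors are comparable at \<open>\<lambda>\<close> many coordinates rather than
  just one, which leaves room for meeting all future requirements.\<close>

locale tree_rel = tree_index lam \<kappa> e for lam \<kappa> :: "'i::wellorder" and e +
  fixes x :: "'i set" and L C :: "'i \<Rightarrow> 'i \<Rightarrow> 'i \<Rightarrow> 'i \<Rightarrow> bool"
  assumes L_levels: "L \<xi> n \<beta> k \<Longrightarrow> \<xi> \<in> x \<and> \<beta> \<in> x"
    and C_levels: "C \<alpha> \<delta> \<beta> j \<Longrightarrow> \<alpha> \<in> x \<and> \<beta> \<in> x \<and> j < \<kappa> \<and> \<alpha> \<le> \<beta>"
    and L_le: "L \<xi> n \<beta> k \<Longrightarrow> \<xi> \<le> \<beta>"
    and L_nodes: "L \<xi> n \<beta> k \<Longrightarrow> L \<xi> n \<xi> n \<and> L \<beta> k \<beta> k"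
    and L_level_eq: "L \<beta> n \<beta> k \<Longrightarrow> n = k"
    and L_trans: "L \<xi> n \<beta> k \<Longrightarrow> L \<beta> k \<gamma> l \<Longrightarrow> L \<xi> n \<gamma> l"
    and L_below: "L \<xi> n \<beta> k \<Longrightarrow> L \<xi>' n' \<beta> k \<Longrightarrow> \<xi> \<le> \<xi>' \<Longrightarrow> L \<xi> n \<xi>' n'"
    and L_full: "L \<beta> k \<beta> k \<Longrightarrow> \<xi> \<in> x \<Longrightarrow> \<xi> \<le> \<beta> \<Longrightarrow> \<exists>n. L \<xi> n \<beta> k"
    and C_nodes: "C \<alpha> \<delta> \<beta> j \<Longrightarrow> i < lam \<Longrightarrow> L \<beta> (e j i) \<beta> (e j i)"
    and C_down: "C \<alpha> \<delta> \<beta> j \<Longrightarrow> \<xi> \<in> x \<Longrightarrow> \<alpha> \<le> \<xi> \<Longrightarrow> \<xi> \<le> \<beta> \<Longrightarrow>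
      \<exists>j'. C \<alpha> \<delta> \<xi> j' \<and> (\<forall>i<lam. L \<xi> (e j' i) \<beta> (e j i))"
    and C_many: "C \<alpha> \<delta> \<beta> j \<Longrightarrow> C \<alpha> \<delta> \<beta>' j' \<Longrightarrow> \<beta> \<le> \<beta>' \<Longrightarrow> many (\<lambda>i. L \<beta> (e j i) \<beta>' (e j' i))"
begin

lemma L_unique: "L \<xi> n \<beta> k \<Longrightarrow> L \<xi> n' \<beta> k \<Longrightarrow> n = n'"
  using L_below[of \<xi> n \<beta> k \<xi> n'] L_level_eq by blast

end

context tree_index
begin

section \<open>Restriction, unions and amalgamation of tree relations\<close>

abbreviation T_rel :: "'i set \<Rightarrow> ('i \<Rightarrow> 'i \<Rightarrow> 'i \<Rightarrow> 'i \<Rightarrow> bool) \<Rightarrow> ('i \<Rightarrow> 'i \<Rightarrow> 'i \<Rightarrow> 'i \<Rightarrow> bool) \<Rightarrow> bool" where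
  "T_rel \<equiv> tree_rel lam \<kappa> e"

text \<open>Serves both for restriction, with \<open>g\<close> the identity, and for moving along an
  order isomorphism, with \<open>g\<close> its inverse. Names of nodes, vectors and colours stay the
  same.\<close>

lemma tree_rel_pullback:
  assumes "T_rel x L C" and g: "\<And>\<xi>. \<xi> \<in> x' \<Longrightarrow> g \<xi> \<in> x" "strict_mono_on x' g"
  shows "T_rel x' (\<lambda>\<xi> n \<beta> k. \<xi> \<in> x' \<and> \<beta> \<in> x' \<and> L (g \<xi>) n (g \<beta>) k)
    (\<lambda>\<alpha> \<delta> \<beta> j. \<alpha> \<in> x' \<and> \<beta> \<in> x' \<and> C (g \<alpha>) \<delta> (g \<beta>) j)"
proof -
  interpret tree_rel lam \<kappa> e x L C by fact
  have le: "g a \<le> g b \<longleftrightarrow> a \<le> b" if "a \<in> x'" "b \<in> x'" for a b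
    using strict_mono_onD[OF g(2), of a b] strict_mono_onD[OF g(2), of b a] that
    by (cases a b rule: linorder_cases) auto
  show ?thesis
  proof unfold_locales
    fix \<alpha> \<delta> \<beta> j \<xi> assume *: "\<alpha> \<in> x' \<and> \<beta> \<in> x' \<and> C (g \<alpha>) \<delta> (g \<beta>) j" "\<xi> \<in> x'" "\<alpha> \<le> \<xi>" "\<xi> \<le> \<beta>"
    then obtain j' where "C (g \<alpha>) \<delta> (g \<xi>) j' \<and> (\<forall>i<lam. L (g \<xi>) (e j' i) (g \<beta>) (e j i))"
      using C_down[of "g \<alpha>" \<delta> "g \<beta>" j "g \<xi>"] g(1) le by blast
    then show "\<exists>j'. (\<alpha> \<in> x' \<and> \<xi> \<in> x' \<and> C (g \<alpha>) \<delta> (g \<xi>) j') \<and>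
      (\<forall>i<lam. \<xi> \<in> x' \<and> \<beta> \<in> x' \<and> L (g \<xi>) (e j' i) (g \<beta>) (e j i))" using * by blast
  next
    fix \<alpha> \<delta> \<beta> j \<beta>' j'
    assume *: "\<alpha> \<in> x' \<and> \<beta> \<in> x' \<and> C (g \<alpha>) \<delta> (g \<beta>) j" "\<alpha> \<in> x' \<and> \<beta>' \<in> x' \<and> C (g \<alpha>) \<delta> (g \<beta>') j'" "\<beta> \<le> \<beta>'"
    then have "many (\<lambda>i. L (g \<beta>) (e j i) (g \<beta>') (e j' i))" using C_many le by blast
    then show "many (\<lambda>i. \<beta> \<in> x' \<and> \<beta>' \<in> x' \<and> L (g \<beta>) (e j i) (g \<beta>') (e j' i))" using * by simp
  next
    fix \<beta> k \<xi> assume *: "\<beta> \<in> x' \<and> \<beta> \<in> x' \<and> L (g \<beta>) k (g \<beta>) k" "\<xi> \<in> x'" "\<xi> \<le> \<beta>"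
    then show "\<exists>n. \<xi> \<in> x' \<and> \<beta> \<in> x' \<and> L (g \<xi>) n (g \<beta>) k" using L_full[of "g \<beta>" k "g \<xi>"] g(1) le by blast
  next
    fix \<xi> n \<beta> k assume *: "\<xi> \<in> x' \<and> \<beta> \<in> x' \<and> L (g \<xi>) n (g \<beta>) k"
    then show "\<xi> \<in> x' \<and> \<beta> \<in> x'" by blast
    show "\<xi> \<le> \<beta>" using * L_le le by blast
    show "(\<xi> \<in> x' \<and> \<xi> \<in> x' \<and> L (g \<xi>) n (g \<xi>) n) \<and> (\<beta> \<in> x' \<and> \<beta> \<in> x' \<and> L (g \<beta>) k (g \<beta>) k)"
      using * L_nodes by blast
    fix \<gamma> l assume "\<beta> \<in> x' \<and> \<gamma> \<in> x' \<and> L (g \<beta>) k (g \<gamma>) l"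
    then show "\<xi> \<in> x' \<and> \<gamma> \<in> x' \<and> L (g \<xi>) n (g \<gamma>) l" using * L_trans by blast
  next
    fix \<beta> n k assume "\<beta> \<in> x' \<and> \<beta> \<in> x' \<and> L (g \<beta>) n (g \<beta>) k"
    then show "n = k" using L_level_eq by blast
  next
    fix \<xi> n \<beta> k \<xi>' n' assume "\<xi> \<in> x' \<and> \<beta> \<in> x' \<and> L (g \<xi>) n (g \<beta>) k"
      "\<xi>' \<in> x' \<and> \<beta> \<in> x' \<and> L (g \<xi>') n' (g \<beta>) k" "\<xi> \<le> \<xi>'"
    then show "\<xi> \<in> x' \<and> \<xi>' \<in> x' \<and> L (g \<xi>) n (g \<xi>') n'" using L_below le by blast
  next
    fix \<alpha> \<delta> \<beta> j assume *: "\<alpha> \<in> x' \<and> \<beta> \<in> x' \<and> C (g \<alpha>) \<delta> (g \<beta>) j"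
    then show "\<alpha> \<in> x' \<and> \<beta> \<in> x' \<and> j < \<kappa> \<and> \<alpha> \<le> \<beta>" using C_levels le by blast
    fix i assume "i < lam"
    then show "\<beta> \<in> x' \<and> \<beta> \<in> x' \<and> L (g \<beta>) (e j i) (g \<beta>) (e j i)" using * C_nodes by blast
  qed
qed

lemma tree_rel_empty: "T_rel {} (\<lambda>_ _ _ _. False) (\<lambda>_ _ _ _. False)"
  by unfold_locales auto

text \<open>Each clause has finitely many premises, which hold together in one member of the chain;
  the links at \<lambda> many coordinates that \<open>C_down\<close> and \<open>C_many\<close> ask
  for are then found in that same member.\<close>

lemma tree_rel_Union:
  fixes X :: "'p \<Rightarrow> 'i set"
  assumes rel: "\<And>p. p \<in> P \<Longrightarrow> T_rel (X p) (L p) (C p)"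
    and chain: "\<And>p q. p \<in> P \<Longrightarrow> q \<in> P \<Longrightarrow> (X p \<subseteq> X q \<and> L p \<le> L q \<and> C p \<le> C q) \<or> (X q \<subseteq> X p \<and> L q \<le> L p \<and> C q \<le> C p)"
  shows "T_rel (\<Union>p\<in>P. X p) (\<lambda>\<xi> n \<beta> k. \<exists>p\<in>P. L p \<xi> n \<beta> k) (\<lambda>\<alpha> \<delta> \<beta> j. \<exists>p\<in>P. C p \<alpha> \<delta> \<beta> j)"
proof -
  note R = rel[THEN tree_rel.L_levels] rel[THEN tree_rel.C_levels] rel[THEN tree_rel.L_le]
    rel[THEN tree_rel.L_nodes] rel[THEN tree_rel.L_level_eq] rel[THEN tree_rel.C_nodes]
  have two: "\<exists>r\<in>P. L p \<le> L r \<and> L q \<le> L r \<and> C p \<le> C r \<and> C q \<le> C r \<and> X p \<subseteq> X r \<and> X q \<subseteq> X r"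
    if "p \<in> P" "q \<in> P" for p q
    using chain[OF that] that by blast
  show ?thesis
  proof unfold_locales
    fix \<xi> n \<beta> k \<gamma> l assume "\<exists>p\<in>P. L p \<xi> n \<beta> k" "\<exists>p\<in>P. L p \<beta> k \<gamma> l"
    then obtain p q where pq: "p \<in> P" "q \<in> P" "L p \<xi> n \<beta> k" "L q \<beta> k \<gamma> l" by blast
    then obtain r where r: "r \<in> P" "L r \<xi> n \<beta> k" "L r \<beta> k \<gamma> l" using two[OF pq(1,2)] by (auto simp: le_fun_def)
    then show "\<exists>p\<in>P. L p \<xi> n \<gamma> l" using tree_rel.L_trans[OF rel[OF r(1)] r(2,3)] by blast
  next
    fix \<xi> n \<beta> k \<xi>' n' assume "\<exists>p\<in>P. L p \<xi> n \<beta> k" "\<exists>p\<in>P. L p \<xi>' n' \<beta> k" and le: "\<xi> \<le> \<xi>'"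
    then obtain p q where pq: "p \<in> P" "q \<in> P" "L p \<xi> n \<beta> k" "L q \<xi>' n' \<beta> k" by blast
    then obtain r where r: "r \<in> P" "L r \<xi> n \<beta> k" "L r \<xi>' n' \<beta> k" using two[OF pq(1,2)] by (auto simp: le_fun_def)
    then show "\<exists>p\<in>P. L p \<xi> n \<xi>' n'" using tree_rel.L_below[OF rel[OF r(1)] r(2,3) le] by blast
  next
    fix \<beta> k \<xi> assume "\<exists>p\<in>P. L p \<beta> k \<beta> k" "\<xi> \<in> (\<Union>p\<in>P. X p)" and le: "\<xi> \<le> \<beta>"
    then obtain p q where pq: "p \<in> P" "q \<in> P" "L p \<beta> k \<beta> k" "\<xi> \<in> X q" by blast
    then obtain r where r: "r \<in> P" "L r \<beta> k \<beta> k" "\<xi> \<in> X r" using two[OF pq(1,2)] by (auto simp: le_fun_def)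
    then show "\<exists>n. \<exists>p\<in>P. L p \<xi> n \<beta> k" using tree_rel.L_full[OF rel[OF r(1)] r(2,3) le] by blast
  next
    fix \<alpha> \<delta> \<beta> j \<xi> assume "\<exists>p\<in>P. C p \<alpha> \<delta> \<beta> j" "\<xi> \<in> (\<Union>p\<in>P. X p)" and le: "\<alpha> \<le> \<xi>" "\<xi> \<le> \<beta>"
    then obtain p q where pq: "p \<in> P" "q \<in> P" "C p \<alpha> \<delta> \<beta> j" "\<xi> \<in> X q" by blast
    then obtain r where r: "r \<in> P" "C r \<alpha> \<delta> \<beta> j" "\<xi> \<in> X r" using two[OF pq(1,2)] by (auto simp: le_fun_def)
    then show "\<exists>j'. (\<exists>p\<in>P. C p \<alpha> \<delta> \<xi> j') \<and> (\<forall>i<lam. \<exists>p\<in>P. L p \<xi> (e j' i) \<beta> (e j i))"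
      using tree_rel.C_down[OF rel[OF r(1)] r(2,3) le] by blast
  next
    fix \<alpha> \<delta> \<beta> j \<beta>' j' assume "\<exists>p\<in>P. C p \<alpha> \<delta> \<beta> j" "\<exists>p\<in>P. C p \<alpha> \<delta> \<beta>' j'" and le: "\<beta> \<le> \<beta>'"
    then obtain p q where pq: "p \<in> P" "q \<in> P" "C p \<alpha> \<delta> \<beta> j" "C q \<alpha> \<delta> \<beta>' j'" by blast
    then obtain r where r: "r \<in> P" "C r \<alpha> \<delta> \<beta> j" "C r \<alpha> \<delta> \<beta>' j'" using two[OF pq(1,2)] by (auto simp: le_fun_def)
    show "many (\<lambda>i. \<exists>p\<in>P. L p \<beta> (e j i) \<beta>' (e j' i))"
      by (rule many_mono[OF tree_rel.C_many[OF rel[OF r(1)] r(2,3) le]]) (use r(1) in blast)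
  next
    fix \<xi> n \<beta> k assume "\<exists>p\<in>P. L p \<xi> n \<beta> k"
    then obtain p where p: "p \<in> P" "L p \<xi> n \<beta> k" by blast
    note l = R(1,3,4)[OF p]
    show "\<xi> \<in> (\<Union>p\<in>P. X p) \<and> \<beta> \<in> (\<Union>p\<in>P. X p)" using l(1) p(1) by blast
    show "\<xi> \<le> \<beta>" by (rule l(2))
    show "(\<exists>p\<in>P. L p \<xi> n \<xi> n) \<and> (\<exists>p\<in>P. L p \<beta> k \<beta> k)" using l(3) p(1) by blast
  next
    fix \<beta> n k assume "\<exists>p\<in>P. L p \<beta> n \<beta> k"
    then show "n = k" using R(5) by blast
  next
    fix \<alpha> \<delta> \<beta> j assume "\<exists>p\<in>P. C p \<alpha> \<delta> \<beta> j"
    then obtain p where p: "p \<in> P" "C p \<alpha> \<delta> \<beta> j" by blast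
    show "\<alpha> \<in> (\<Union>p\<in>P. X p) \<and> \<beta> \<in> (\<Union>p\<in>P. X p) \<and> j < \<kappa> \<and> \<alpha> \<le> \<beta>" using R(2)[OF p] p(1) by blast
    fix i assume "i < lam"
    then show "\<exists>p\<in>P. L p \<beta> (e j i) \<beta> (e j i)" using R(6)[OF p] p(1) by blast
  qed
qed

text \<open>A new level \<eta> from \<sigma> on copies the next level \<open>\<rho> \<eta>\<close>
  of \<open>u\<close>, nodes and colours alike; levels past the end of \<open>u\<close> stay empty.
  A level \<xi> of \<open>r\<close> is linked to levels from \<sigma> on through
  \<open>\<rho> \<xi>\<close>, which by the cofinality assumption is below \<sigma> and so belongs
  to both structures. The last two conjuncts say that no new names arise; they keep the set of atoms
  small.\<close>

lemma tree_rel_amalgam: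
  assumes u: "T_rel xu Lu Cu" and r: "T_rel xr Lr Cr"
    and xr: "xr \<subseteq> {..<\<sigma>}" "xu \<inter> {..<\<sigma>} \<subseteq> xr"
    and Lur: "\<And>\<xi> n \<beta> k. Lu \<xi> n \<beta> k \<Longrightarrow> \<xi> < \<sigma> \<Longrightarrow> \<beta> < \<sigma> \<Longrightarrow> Lr \<xi> n \<beta> k"
    and Cur: "\<And>\<alpha> \<delta> \<beta> j. Cu \<alpha> \<delta> \<beta> j \<Longrightarrow> \<alpha> < \<sigma> \<Longrightarrow> \<beta> < \<sigma> \<Longrightarrow> Cr \<alpha> \<delta> \<beta> j"
    and gap: "\<And>\<xi>. \<xi> \<in> xr \<Longrightarrow> \<exists>\<eta>\<in>xu. \<eta> < \<sigma> \<and> \<xi> \<le> \<eta>"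
    and y: "xu \<subseteq> y" "y \<inter> {..<\<sigma>} = xr"
  shows "\<exists>L C. T_rel y L C \<and> Lu \<le> L \<and> Cu \<le> C \<and>
    (\<forall>\<xi> n \<beta> k. \<xi> < \<sigma> \<and> \<beta> < \<sigma> \<longrightarrow> L \<xi> n \<beta> k = Lr \<xi> n \<beta> k) \<and>
    (\<forall>\<alpha> \<delta> \<beta> j. \<alpha> < \<sigma> \<and> \<beta> < \<sigma> \<longrightarrow> C \<alpha> \<delta> \<beta> j = Cr \<alpha> \<delta> \<beta> j) \<and>
    (\<forall>\<xi> n \<beta> k. L \<xi> n \<beta> k \<longrightarrow> (\<exists>\<xi>' n' \<beta>'. Lu \<xi>' n' \<beta>' k \<or> Lr \<xi>' n' \<beta>' k) \<and> (\<exists>\<xi>' k' \<beta>'. Lu \<xi>' n \<beta>' k' \<or> Lr \<xi>' n \<beta>' k')) \<and>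
    (\<forall>\<alpha> \<delta> \<beta> j. C \<alpha> \<delta> \<beta> j \<longrightarrow> (\<exists>\<alpha>' \<beta>'. Cu \<alpha>' \<delta> \<beta>' j \<or> Cr \<alpha>' \<delta> \<beta>' j))"
proof -
  interpret u: tree_rel lam \<kappa> e xu Lu Cu by fact
  interpret r: tree_rel lam \<kappa> e xr Lr Cr by fact
  \<comment> \<open>Fails exactly for the levels past the end of \<open>u\<close>, where
    \<open>\<rho>\<close> has no meaning.\<close>
  define dm where "dm \<eta> \<longleftrightarrow> (\<exists>\<beta>\<in>xu. \<eta> \<le> \<beta>)" for \<eta>
  define \<rho> where "\<rho> \<eta> = (LEAST \<beta>. \<beta> \<in> xu \<and> \<eta> \<le> \<beta>)" for \<eta>
  have \<rho>: "\<rho> \<eta> \<in> xu" "\<eta> \<le> \<rho> \<eta>" if "dm \<eta>" for \<eta>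
    using LeastI_ex[of "\<lambda>\<beta>. \<beta> \<in> xu \<and> \<eta> \<le> \<beta>"] that unfolding dm_def \<rho>_def by blast+
  have \<rho>_le: "\<rho> \<eta> \<le> \<beta>" if "\<beta> \<in> xu" "\<eta> \<le> \<beta>" for \<eta> \<beta>
    unfolding \<rho>_def using that by (auto intro: Least_le)
  have \<rho>_id: "\<rho> \<eta> = \<eta>" "dm \<eta>" if "\<eta> \<in> xu" for \<eta>
  proof -
    show "dm \<eta>" using that unfolding dm_def by blast
    then show "\<rho> \<eta> = \<eta>" using \<rho>(2)[of \<eta>] \<rho>_le[OF that order_refl] by simp
  qed
  have dm_mono: "dm \<xi>" if "dm \<beta>" "\<xi> \<le> \<beta>" for \<xi> \<beta> using that unfolding dm_def by (meson order_trans)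
  have \<rho>_mono: "\<rho> \<xi> \<le> \<rho> \<beta>" if "dm \<beta>" "\<xi> \<le> \<beta>" for \<xi> \<beta>
    using \<rho>_le[OF \<rho>(1)[OF that(1)], of \<xi>] \<rho>(2)[OF that(1)] that(2) by simp
  have \<rho>r: "dm \<xi>" "\<rho> \<xi> < \<sigma>" "\<rho> \<xi> \<in> xu" "\<rho> \<xi> \<in> xr" "\<xi> \<le> \<rho> \<xi>" if \<xi>: "\<xi> \<in> xr" for \<xi>
  proof -
    obtain \<eta> where \<eta>: "\<eta> \<in> xu" "\<eta> < \<sigma>" "\<xi> \<le> \<eta>" using gap[OF \<xi>] by blast
    then show d: "dm \<xi>" unfolding dm_def by blast
    show lt: "\<rho> \<xi> < \<sigma>" using \<rho>_le[OF \<eta>(1,3)] \<eta>(2) by simp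
    show "\<rho> \<xi> \<in> xu" "\<xi> \<le> \<rho> \<xi>" using \<rho>[OF d] by auto
    then show "\<rho> \<xi> \<in> xr" using lt xr(2) by blast
  qed
  have \<rho>\<sigma>: "\<sigma> \<le> \<rho> \<beta>" if "dm \<beta>" "\<sigma> \<le> \<beta>" for \<beta> using \<rho>(2)[OF that(1)] that(2) by simp
  have xr_lt: "\<xi> < \<sigma>" if "\<xi> \<in> xr" for \<xi> using that xr(1) by blast
  define L where "L \<xi> n \<beta> k \<longleftrightarrow> Lr \<xi> n \<beta> k \<or> (\<beta> \<in> y \<and> \<sigma> \<le> \<beta> \<and> dm \<beta> \<and>
    ((\<xi> \<in> y \<and> \<sigma> \<le> \<xi> \<and> \<xi> \<le> \<beta> \<and> Lu (\<rho> \<xi>) n (\<rho> \<beta>) k) \<or>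
     (\<xi> \<in> xr \<and> (\<exists>n'. Lr \<xi> n (\<rho> \<xi>) n' \<and> Lu (\<rho> \<xi>) n' (\<rho> \<beta>) k))))" for \<xi> n \<beta> k
  \<comment> \<open>The clause \<open>\<alpha> \<le> \<beta>\<close> removes only the case
    \<open>\<alpha> = \<rho> \<beta> > \<beta>\<close>, in which the copy would be coloured over a
    level above itself.\<close>
  define C where "C \<alpha> \<delta> \<beta> j \<longleftrightarrow> Cr \<alpha> \<delta> \<beta> j \<or> (\<beta> \<in> y \<and> \<sigma> \<le> \<beta> \<and> dm \<beta> \<and> \<alpha> \<le> \<beta> \<and> Cu \<alpha> \<delta> (\<rho> \<beta>) j)" for \<alpha> \<delta> \<beta> j
  have LrI: "Lr \<xi> n \<beta> k \<Longrightarrow> L \<xi> n \<beta> k" for \<xi> n \<beta> k unfolding L_def by blast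
  have L_low: "L \<xi> n \<beta> k \<longleftrightarrow> Lr \<xi> n \<beta> k" if "\<beta> < \<sigma>" for \<xi> n \<beta> k
    using that unfolding L_def by auto
  have L_high: "L \<xi> n \<beta> k \<longleftrightarrow> \<beta> \<in> y \<and> dm \<beta> \<and> \<xi> \<in> y \<and> \<xi> \<le> \<beta> \<and> Lu (\<rho> \<xi>) n (\<rho> \<beta>) k"
    if "\<sigma> \<le> \<xi>" for \<xi> n \<beta> k
    using that xr_lt r.L_levels unfolding L_def by (auto simp: not_le dest: leD)
  have L_mix: "L \<xi> n \<beta> k \<longleftrightarrow> \<beta> \<in> y \<and> dm \<beta> \<and> \<xi> \<in> xr \<and> (\<exists>n'. Lr \<xi> n (\<rho> \<xi>) n' \<and> Lu (\<rho> \<xi>) n' (\<rho> \<beta>) k)"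
    if "\<xi> < \<sigma>" "\<sigma> \<le> \<beta>" for \<xi> n \<beta> k
    using that xr_lt r.L_levels unfolding L_def by (auto simp: not_le dest: leD)
  have C_low: "C \<alpha> \<delta> \<beta> j \<longleftrightarrow> Cr \<alpha> \<delta> \<beta> j" if "\<beta> < \<sigma>" for \<alpha> \<delta> \<beta> j using that unfolding C_def by auto
  have C_high: "C \<alpha> \<delta> \<beta> j \<longleftrightarrow> \<beta> \<in> y \<and> dm \<beta> \<and> \<alpha> \<le> \<beta> \<and> Cu \<alpha> \<delta> (\<rho> \<beta>) j" if "\<sigma> \<le> \<beta>" for \<alpha> \<delta> \<beta> j
    using that xr_lt r.C_levels unfolding C_def by (auto dest: leD)
  have node_high: "L \<beta> k \<beta> k" if "\<sigma> \<le> \<beta>" "\<beta> \<in> y" "dm \<beta>" "Lu (\<rho> \<beta>) k (\<rho> \<beta>) k" for \<beta> k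
    using that L_high by simp
  have Lu_low: "Lr \<xi> n \<beta> k" if "Lu \<xi> n \<beta> k" "\<beta> < \<sigma>" for \<xi> n \<beta> k
    using Lur[OF that(1) _ that(2)] u.L_le[OF that(1)] that(2) by simp
  have T: "T_rel y L C"
  proof unfold_locales
    fix \<xi> n \<beta> k assume l: "L \<xi> n \<beta> k"
    show "\<xi> \<in> y \<and> \<beta> \<in> y" using l r.L_levels[of \<xi> n \<beta> k] y(2) unfolding L_def by blast
    show "\<xi> \<le> \<beta>" using l r.L_le[of \<xi> n \<beta> k] xr_lt unfolding L_def by (auto intro: less_imp_le less_le_trans)
    show "L \<xi> n \<xi> n \<and> L \<beta> k \<beta> k"
    proof (cases "\<beta> < \<sigma>")
      case True
      then have "Lr \<xi> n \<beta> k" using l L_low by simp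
      then show ?thesis using r.L_nodes LrI by blast
    next
      case False
      then have b: "\<sigma> \<le> \<beta>" by simp
      show ?thesis
      proof (cases "\<xi> < \<sigma>")
        case True
        then obtain n' where n': "\<beta> \<in> y" "dm \<beta>" "Lr \<xi> n (\<rho> \<xi>) n'" "Lu (\<rho> \<xi>) n' (\<rho> \<beta>) k"
          using l L_mix[OF True b] by blast
        then show ?thesis using r.L_nodes[OF n'(3)] u.L_nodes[OF n'(4)] LrI node_high[OF b] by blast
      next
        case False
        then have x: "\<sigma> \<le> \<xi>" by simp
        then have *: "\<beta> \<in> y" "dm \<beta>" "\<xi> \<in> y" "\<xi> \<le> \<beta>" "Lu (\<rho> \<xi>) n (\<rho> \<beta>) k" using l L_high[OF x] by blast+
        then show ?thesis using u.L_nodes[OF *(5)] node_high[OF b] node_high[OF x] dm_mono by blast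
      qed
    qed
  next
    fix \<beta> n k assume l: "L \<beta> n \<beta> k"
    show "n = k"
    proof (cases "\<beta> < \<sigma>")
      case True
      then show ?thesis using l L_low r.L_level_eq by blast
    next
      case False
      then show ?thesis using l L_high[of \<beta>] u.L_level_eq by (auto simp: not_less)
    qed
  next
    fix \<xi> n \<beta> k \<gamma> l assume 1: "L \<xi> n \<beta> k" and 2: "L \<beta> k \<gamma> l"
    consider "\<gamma> < \<sigma>" | "\<sigma> \<le> \<beta>" | "\<beta> < \<sigma>" "\<sigma> \<le> \<gamma>" by (meson not_le)
    then show "L \<xi> n \<gamma> l"
    proof cases
      case 1
      then have g: "Lr \<beta> k \<gamma> l" using 2 L_low by simp
      then have "\<beta> < \<sigma>" using r.L_levels xr_lt by blast
      then have "Lr \<xi> n \<beta> k" using \<open>L \<xi> n \<beta> k\<close> L_low by simp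
      then show ?thesis using g r.L_trans LrI by blast
    next
      case b: 2
      have g: "\<gamma> \<in> y" "dm \<gamma>" "\<beta> \<le> \<gamma>" "Lu (\<rho> \<beta>) k (\<rho> \<gamma>) l" using 2 L_high[OF b] by blast+
      then have "\<sigma> \<le> \<gamma>" using b by simp
      show ?thesis
      proof (cases "\<xi> < \<sigma>")
        case True
        then show ?thesis using 1 L_mix[OF True b] L_mix[OF True \<open>\<sigma> \<le> \<gamma>\<close>] g u.L_trans by blast
      next
        case False
        then have x: "\<sigma> \<le> \<xi>" by simp
        have p: "\<xi> \<in> y" "\<xi> \<le> \<beta>" "Lu (\<rho> \<xi>) n (\<rho> \<beta>) k" using 1 L_high[OF x] by blast+
        have "\<xi> \<le> \<gamma>" using p(2) g(3) by simp
        then show ?thesis using L_high[OF x] p(1) g u.L_trans[OF p(3) g(4)] by blast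
      qed
    next
      case 3
      then have x: "Lr \<xi> n \<beta> k" using 1 L_low by simp
      then have xx: "\<xi> \<in> xr" "\<beta> \<in> xr" "\<xi> \<le> \<beta>" "\<xi> < \<sigma>" using r.L_levels r.L_le xr_lt by blast+
      obtain k' where k': "\<gamma> \<in> y" "dm \<gamma>" "Lr \<beta> k (\<rho> \<beta>) k'" "Lu (\<rho> \<beta>) k' (\<rho> \<gamma>) l" using 2 L_mix[OF 3] by blast
      \<comment> \<open>Below the node \<open>k'\<close> of the level \<open>\<rho> \<beta>\<close>,
        the given node of \<xi> and a node \<open>n'\<close> of \<open>\<rho> \<xi>\<close> lie on
        one branch of \<open>r\<close>; this is the link from \<xi> to \<open>\<rho> \<xi>\<close>
        that \<open>L_mix\<close> calls for.\<close>
      have \<rho>\<xi>: "\<rho> \<xi> \<le> \<rho> \<beta>" using \<rho>_mono[OF \<rho>r(1)[OF xx(2)] xx(3)] .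
      obtain n' where n': "Lu (\<rho> \<xi>) n' (\<rho> \<beta>) k'"
        using u.L_full[OF _ \<rho>r(3)[OF xx(1)] \<rho>\<xi>] u.L_nodes[OF k'(4)] by blast
      have "Lr \<xi> n (\<rho> \<beta>) k'" using r.L_trans[OF x k'(3)] .
      moreover have "Lr (\<rho> \<xi>) n' (\<rho> \<beta>) k'" using Lu_low[OF n' \<rho>r(2)[OF xx(2)]] .
      ultimately have "Lr \<xi> n (\<rho> \<xi>) n'" using r.L_below \<rho>r(5)[OF xx(1)] by blast
      then show ?thesis using L_mix[OF xx(4) 3(2)] k' n' u.L_trans xx(1) by blast
    qed
  next
    fix \<xi> n \<beta> k \<xi>' n' assume 1: "L \<xi> n \<beta> k" and 2: "L \<xi>' n' \<beta> k" and le: "\<xi> \<le> \<xi>'"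
    consider "\<beta> < \<sigma>" | "\<sigma> \<le> \<xi>" "\<sigma> \<le> \<xi>'" | "\<xi> < \<sigma>" "\<sigma> \<le> \<xi>'" "\<sigma> \<le> \<beta>" | "\<xi> < \<sigma>" "\<xi>' < \<sigma>" "\<sigma> \<le> \<beta>"
      using le by (meson not_le order_trans)
    then show "L \<xi> n \<xi>' n'"
    proof cases
      case c: 1
      then have "Lr \<xi> n \<beta> k" "Lr \<xi>' n' \<beta> k" using 1 2 L_low by blast+
      then show ?thesis using r.L_below[OF _ _ le] LrI by blast
    next
      case c: 2
      have p: "\<xi> \<in> y" "dm \<beta>" "Lu (\<rho> \<xi>) n (\<rho> \<beta>) k" using 1 L_high[OF c(1)] by blast+
      have p': "\<xi>' \<in> y" "\<xi>' \<le> \<beta>" "Lu (\<rho> \<xi>') n' (\<rho> \<beta>) k" using 2 L_high[OF c(2)] by blast+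
      have d: "dm \<xi>'" using dm_mono[OF p(2) p'(2)] .
      show ?thesis using L_high[OF c(1)] p(1) p'(1) d le u.L_below[OF p(3) p'(3) \<rho>_mono[OF d le]] by blast
    next
      case c: 3
      have p: "\<beta> \<in> y" "dm \<beta>" "\<xi>' \<in> y" "\<xi>' \<le> \<beta>" "Lu (\<rho> \<xi>') n' (\<rho> \<beta>) k" using 2 L_high[OF c(2)] by blast+
      obtain m where m: "\<xi> \<in> xr" "Lr \<xi> n (\<rho> \<xi>) m" "Lu (\<rho> \<xi>) m (\<rho> \<beta>) k" using 1 L_mix[OF c(1,3)] by blast
      have d: "dm \<xi>'" using dm_mono[OF p(2,4)] .
      have "Lu (\<rho> \<xi>) m (\<rho> \<xi>') n'" using u.L_below[OF m(3) p(5) \<rho>_mono[OF d le]] .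
      then show ?thesis using L_mix[OF c(1,2)] m p d by blast
    next
      case c: 4
      obtain m where m: "\<xi> \<in> xr" "Lr \<xi> n (\<rho> \<xi>) m" "Lu (\<rho> \<xi>) m (\<rho> \<beta>) k" using 1 L_mix[OF c(1,3)] by blast
      obtain m' where m': "\<xi>' \<in> xr" "Lr \<xi>' n' (\<rho> \<xi>') m'" "Lu (\<rho> \<xi>') m' (\<rho> \<beta>) k" using 2 L_mix[OF c(2,3)] by blast
      have "Lu (\<rho> \<xi>) m (\<rho> \<xi>') m'" using u.L_below[OF m(3) m'(3) \<rho>_mono[OF \<rho>r(1)[OF m'(1)] le]] .
      then have "Lr (\<rho> \<xi>) m (\<rho> \<xi>') m'" using Lu_low \<rho>r(2)[OF m'(1)] by blast
      then have "Lr \<xi> n (\<rho> \<xi>') m'" using r.L_trans m(2) by blast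
      then show ?thesis using r.L_below[OF _ m'(2) le] LrI by blast
    qed
  next
    fix \<beta> k \<xi> assume l: "L \<beta> k \<beta> k" and \<xi>: "\<xi> \<in> y" "\<xi> \<le> \<beta>"
    show "\<exists>n. L \<xi> n \<beta> k"
    proof (cases "\<beta> < \<sigma>")
      case True
      then have "\<xi> \<in> xr" using \<xi> y(2) by auto
      then show ?thesis using l L_low[OF True] r.L_full \<xi>(2) by blast
    next
      case False
      then have b: "\<sigma> \<le> \<beta>" by simp
      then have bb: "\<beta> \<in> y" "dm \<beta>" "Lu (\<rho> \<beta>) k (\<rho> \<beta>) k" using l L_high[OF b] by blast+
      have d: "dm \<xi>" using dm_mono[OF bb(2) \<xi>(2)] .
      obtain n' where n': "Lu (\<rho> \<xi>) n' (\<rho> \<beta>) k" using u.L_full[OF bb(3) \<rho>(1)[OF d] \<rho>_mono[OF bb(2) \<xi>(2)]] by blast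
      show ?thesis
      proof (cases "\<xi> < \<sigma>")
        case True
        then have x: "\<xi> \<in> xr" using \<xi> y(2) by auto
        have "Lu (\<rho> \<xi>) n' (\<rho> \<xi>) n'" using u.L_nodes[OF n'] by blast
        then have "Lr (\<rho> \<xi>) n' (\<rho> \<xi>) n'" using Lu_low \<rho>r(2)[OF x] by blast
        then obtain n where "Lr \<xi> n (\<rho> \<xi>) n'" using r.L_full[OF _ x \<rho>r(5)[OF x]] by blast
        then show ?thesis using L_mix[OF True b] bb n' x by blast
      next
        case False
        then show ?thesis using L_high[of \<xi>] bb n' \<xi> by (auto simp: not_less)
      qed
    qed
  next
    fix \<alpha> \<delta> \<beta> j assume c: "C \<alpha> \<delta> \<beta> j"
    show "\<alpha> \<in> y \<and> \<beta> \<in> y \<and> j < \<kappa> \<and> \<alpha> \<le> \<beta>"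
      using c r.C_levels[of \<alpha> \<delta> \<beta> j] u.C_levels[of \<alpha> \<delta> "\<rho> \<beta>" j] y unfolding C_def by blast
    fix i assume i: "i < lam"
    show "L \<beta> (e j i) \<beta> (e j i)"
    proof (cases "\<beta> < \<sigma>")
      case True
      then show ?thesis using c C_low r.C_nodes i LrI by blast
    next
      case False
      then have b: "\<sigma> \<le> \<beta>" by simp
      then show ?thesis using c C_high[OF b] u.C_nodes i node_high[OF b] by blast
    qed
  next
    fix \<alpha> \<delta> \<beta> j \<xi> assume c: "C \<alpha> \<delta> \<beta> j" and \<xi>: "\<xi> \<in> y" "\<alpha> \<le> \<xi>" "\<xi> \<le> \<beta>"
    show "\<exists>j'. C \<alpha> \<delta> \<xi> j' \<and> (\<forall>i<lam. L \<xi> (e j' i) \<beta> (e j i))"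
    proof (cases "\<beta> < \<sigma>")
      case True
      then have "\<xi> \<in> xr" using \<xi> y(2) by auto
      then obtain j' where "Cr \<alpha> \<delta> \<xi> j'" "\<forall>i<lam. Lr \<xi> (e j' i) \<beta> (e j i)"
        using r.C_down[of \<alpha> \<delta> \<beta> j \<xi>] c C_low[OF True] \<xi> by blast
      then show ?thesis using LrI unfolding C_def by blast
    next
      case False
      then have b: "\<sigma> \<le> \<beta>" by simp
      have bb: "\<beta> \<in> y" "dm \<beta>" "\<alpha> \<le> \<beta>" "Cu \<alpha> \<delta> (\<rho> \<beta>) j" using c C_high[OF b] by blast+
      have d: "dm \<xi>" using dm_mono[OF bb(2) \<xi>(3)] .
      have "\<alpha> \<le> \<rho> \<xi>" using \<xi>(2) \<rho>(2)[OF d] by simp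
      then obtain j1 where j1: "Cu \<alpha> \<delta> (\<rho> \<xi>) j1" "\<forall>i<lam. Lu (\<rho> \<xi>) (e j1 i) (\<rho> \<beta>) (e j i)"
        using u.C_down[OF bb(4) \<rho>(1)[OF d] _ \<rho>_mono[OF bb(2) \<xi>(3)]] by blast
      show ?thesis
      proof (cases "\<xi> < \<sigma>")
        case True
        then have x: "\<xi> \<in> xr" using \<xi> y(2) by auto
        have "\<alpha> < \<sigma>" using \<xi>(2) True by simp
        then have "Cr \<alpha> \<delta> (\<rho> \<xi>) j1" using Cur[OF j1(1)] \<rho>r(2)[OF x] by blast
        then obtain j2 where j2: "Cr \<alpha> \<delta> \<xi> j2" "\<forall>i<lam. Lr \<xi> (e j2 i) (\<rho> \<xi>) (e j1 i)"
          using r.C_down[OF _ x \<xi>(2) \<rho>r(5)[OF x]] by blast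
        have "\<forall>i<lam. L \<xi> (e j2 i) \<beta> (e j i)" using L_mix[OF True b] bb x j1(2) j2(2) by blast
        then show ?thesis using j2(1) unfolding C_def by blast
      next
        case False
        then have xx: "\<sigma> \<le> \<xi>" by simp
        then have "\<forall>i<lam. L \<xi> (e j1 i) \<beta> (e j i)" using L_high[OF xx] bb \<xi> j1(2) by blast
        then show ?thesis using C_high[OF xx] \<xi> d j1(1) by blast
      qed
    qed
  next
    fix \<alpha> \<delta> \<beta> j \<beta>' j' assume c: "C \<alpha> \<delta> \<beta> j" "C \<alpha> \<delta> \<beta>' j'" and le: "\<beta> \<le> \<beta>'"
    consider "\<beta>' < \<sigma>" "\<beta> < \<sigma>" | "\<sigma> \<le> \<beta>" "\<sigma> \<le> \<beta>'" | "\<beta> < \<sigma>" "\<sigma> \<le> \<beta>'" using le by (meson not_le order_trans)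
    then show "many (\<lambda>i. L \<beta> (e j i) \<beta>' (e j' i))"
    proof cases
      case 1
      then have "many (\<lambda>i. Lr \<beta> (e j i) \<beta>' (e j' i))" using c C_low r.C_many le by blast
      then show ?thesis using LrI by (rule many_mono)
    next
      case 2
      have p: "\<beta> \<in> y" "Cu \<alpha> \<delta> (\<rho> \<beta>) j" using c(1) C_high[OF 2(1)] by blast+
      have p': "\<beta>' \<in> y" "dm \<beta>'" "Cu \<alpha> \<delta> (\<rho> \<beta>') j'" using c(2) C_high[OF 2(2)] by blast+
      have "many (\<lambda>i. Lu (\<rho> \<beta>) (e j i) (\<rho> \<beta>') (e j' i))"
        using u.C_many[OF p(2) p'(3) \<rho>_mono[OF p'(2) le]] .
      then show ?thesis by (rule many_mono) (use L_high[OF 2(1)] p p' le in blast)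
    next
      case 3
      \<comment> \<open>The comparison takes place at \<open>\<rho> \<beta>\<close>, a level of both
        structures: \<open>u\<close> projects the upper vector to it, and \<open>r\<close> compares
        the lower vector with the projection.\<close>
      have p: "Cr \<alpha> \<delta> \<beta> j" using c(1) C_low[OF 3(1)] by blast
      then have x: "\<beta> \<in> xr" "\<alpha> \<le> \<beta>" using r.C_levels by blast+
      have p': "\<beta>' \<in> y" "dm \<beta>'" "Cu \<alpha> \<delta> (\<rho> \<beta>') j'" using c(2) C_high[OF 3(2)] by blast+
      have "\<alpha> \<le> \<rho> \<beta>" using x(2) \<rho>r(5)[OF x(1)] by simp
      then obtain j1 where j1: "Cu \<alpha> \<delta> (\<rho> \<beta>) j1" "\<forall>i<lam. Lu (\<rho> \<beta>) (e j1 i) (\<rho> \<beta>') (e j' i)"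
        using u.C_down[OF p'(3) \<rho>r(3)[OF x(1)] _ \<rho>_mono[OF p'(2) le]] by blast
      have "\<alpha> < \<sigma>" using x(2) 3(1) by (rule le_less_trans)
      then have "Cr \<alpha> \<delta> (\<rho> \<beta>) j1" using Cur[OF j1(1)] \<rho>r(2)[OF x(1)] by blast
      then have "many (\<lambda>i. Lr \<beta> (e j i) (\<rho> \<beta>) (e j1 i))" using r.C_many[OF p] \<rho>r(5)[OF x(1)] by blast
      then show ?thesis by (rule many_mono) (use L_mix[OF 3] p' x j1(2) in blast)
    qed
  qed
  have up_L: "L \<xi> n \<beta> k" if l: "Lu \<xi> n \<beta> k" for \<xi> n \<beta> k
  proof (cases "\<beta> < \<sigma>")
    case True
    then show ?thesis using Lu_low[OF l] LrI by blast
  next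
    case False
    then have b: "\<sigma> \<le> \<beta>" by simp
    have x: "\<xi> \<in> xu" "\<beta> \<in> xu" "\<xi> \<le> \<beta>" using u.L_levels[OF l] u.L_le[OF l] by blast+
    show ?thesis
    proof (cases "\<xi> < \<sigma>")
      case True
      have "Lr \<xi> n \<xi> n" using Lu_low[of \<xi> n \<xi> n] u.L_nodes[OF l] True by blast
      then show ?thesis using L_mix[OF True b] l x \<rho>_id[OF x(1)] \<rho>_id[OF x(2)] y(1) r.L_levels by auto
    next
      case False
      then have xx: "\<sigma> \<le> \<xi>" by simp
      then show ?thesis using L_high[OF xx] l x \<rho>_id[OF x(1)] \<rho>_id[OF x(2)] y(1) by auto
    qed
  qed
  have up_C: "C \<alpha> \<delta> \<beta> j" if c: "Cu \<alpha> \<delta> \<beta> j" for \<alpha> \<delta> \<beta> j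
  proof (cases "\<beta> < \<sigma>")
    case True
    moreover have "\<alpha> < \<sigma>" using True u.C_levels[OF c] by (meson le_less_trans)
    ultimately show ?thesis using Cur[OF c] unfolding C_def by blast
  next
    case False
    then have b: "\<sigma> \<le> \<beta>" by simp
    have x: "\<beta> \<in> xu" "\<alpha> \<le> \<beta>" using u.C_levels[OF c] by blast+
    then show ?thesis using C_high[OF b] c \<rho>_id[OF x(1)] y(1) by auto
  qed
  show ?thesis
  proof (rule exI[of _ L], rule exI[of _ C], intro conjI allI impI)
    show "T_rel y L C" by fact
    show "Lu \<le> L" "Cu \<le> C" using up_L up_C by (auto simp: le_fun_def)
    show "L \<xi> n \<beta> k = Lr \<xi> n \<beta> k" if "\<xi> < \<sigma> \<and> \<beta> < \<sigma>" for \<xi> n \<beta> k using that L_low by blast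
    show "C \<xi> n \<beta> k = Cr \<xi> n \<beta> k" if "\<xi> < \<sigma> \<and> \<beta> < \<sigma>" for \<xi> n \<beta> k using that C_low by blast
    show "\<exists>\<xi>' n' \<beta>'. Lu \<xi>' n' \<beta>' k \<or> Lr \<xi>' n' \<beta>' k" if "L \<xi> n \<beta> k" for \<xi> n \<beta> k
      using that unfolding L_def by blast
    show "\<exists>\<xi>' k' \<beta>'. Lu \<xi>' n \<beta>' k' \<or> Lr \<xi>' n \<beta>' k'" if "L \<xi> n \<beta> k" for \<xi> n \<beta> k
      using that unfolding L_def by blast
    show "\<exists>\<alpha>' \<beta>'. Cu \<alpha>' \<delta> \<beta>' j \<or> Cr \<alpha>' \<delta> \<beta>' j" if "C \<alpha> \<delta> \<beta> j" for \<alpha> \<delta> \<beta> j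
      using that unfolding C_def by blast
  qed
qed

text \<open>The branch \<open>t\<close> follows the old nodes in \<open>B t\<close> as far as these
  go and continues with new nodes \<open>f t \<eta>\<close> at the levels in \<open>E t\<close>. As
  no coloured vector contains a new node, the colours need no change. The same construction
  completes branches in a gap, creates missing nodes, splits a node and tops a chain.\<close>

lemma tree_rel_add_branches:
  fixes B :: "'j \<Rightarrow> ('i \<times> 'i) set"
  assumes "T_rel x L C"
    and E: "\<And>t. t \<in> J \<Longrightarrow> E t \<subseteq> x"
    and B_node: "\<And>t \<xi> n. t \<in> J \<Longrightarrow> (\<xi>, n) \<in> B t \<Longrightarrow> L \<xi> n \<xi> n"
    and B_E: "\<And>t \<xi> n \<eta>. t \<in> J \<Longrightarrow> (\<xi>, n) \<in> B t \<Longrightarrow> \<eta> \<in> E t \<Longrightarrow> \<xi> < \<eta>"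
    and B_chain: "\<And>t \<xi> n \<xi>' n'. t \<in> J \<Longrightarrow> (\<xi>, n) \<in> B t \<Longrightarrow> (\<xi>', n') \<in> B t \<Longrightarrow> \<xi> \<le> \<xi>' \<Longrightarrow> L \<xi> n \<xi>' n'"
    and B_full: "\<And>t \<xi> \<eta>. t \<in> J \<Longrightarrow> \<xi> \<in> x \<Longrightarrow> \<eta> \<in> E t \<Longrightarrow> \<xi> \<le> \<eta> \<Longrightarrow> (\<exists>n. (\<xi>, n) \<in> B t) \<or> \<xi> \<in> E t"
    and f_fresh: "\<And>t \<eta>. t \<in> J \<Longrightarrow> \<eta> \<in> E t \<Longrightarrow> \<not> L \<eta> (f t \<eta>) \<eta> (f t \<eta>)"
    and f_inj: "\<And>t t' \<eta>. t \<in> J \<Longrightarrow> t' \<in> J \<Longrightarrow> \<eta> \<in> E t \<Longrightarrow> \<eta> \<in> E t' \<Longrightarrow> f t \<eta> = f t' \<eta> \<Longrightarrow> t = t'"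
  shows "T_rel x (\<lambda>\<xi> n \<beta> k. L \<xi> n \<beta> k \<or>
    (\<exists>t\<in>J. \<beta> \<in> E t \<and> k = f t \<beta> \<and> ((\<xi>, n) \<in> B t \<or> (\<xi> \<in> E t \<and> \<xi> \<le> \<beta> \<and> n = f t \<xi>)))) C"
proof -
  interpret tree_rel lam \<kappa> e x L C by fact
  define N where "N t \<xi> n \<beta> k \<longleftrightarrow> \<beta> \<in> E t \<and> k = f t \<beta> \<and> ((\<xi>, n) \<in> B t \<or> (\<xi> \<in> E t \<and> \<xi> \<le> \<beta> \<and> n = f t \<xi>))"
    for t \<xi> n \<beta> k
  define L' where "L' \<xi> n \<beta> k \<longleftrightarrow> L \<xi> n \<beta> k \<or> (\<exists>t\<in>J. N t \<xi> n \<beta> k)" for \<xi> n \<beta> k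
  have N_not: "\<not> L \<beta> k \<beta> k" if "t \<in> J" "N t \<xi> n \<beta> k" for t \<xi> n \<beta> k
    using that f_fresh unfolding N_def by blast
  have N_top: "N t \<beta> k \<beta> k" if "N t \<xi> n \<beta> k" for t \<xi> n \<beta> k using that unfolding N_def by blast
  have N_same: "t = t'" if "t \<in> J" "t' \<in> J" "N t \<xi> n \<beta> k" "N t' \<xi>' n' \<beta> k" for t t' \<xi> n \<xi>' n' \<beta> k
    using that f_inj[of t t' \<beta>] unfolding N_def by simp
  \<comment> \<open>\<open>B t\<close> is closed downward: being full below \<open>E t\<close> it
    has some node at the level \<xi>, and the predecessor of a node at a given level is
    unique.\<close>
  have B_down: "(\<xi>, n) \<in> B t" if t: "t \<in> J" "\<eta> \<in> E t" and b: "(\<xi>', m) \<in> B t" "L \<xi> n \<xi>' m" for t \<eta> \<xi> n \<xi>' m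
  proof -
    have le: "\<xi> \<le> \<xi>'" "\<xi> \<in> x" using L_le[OF b(2)] L_levels[OF b(2)] by blast+
    have "\<xi>' < \<eta>" using B_E[OF t(1) b(1) t(2)] .
    then have "\<xi> \<le> \<eta>" using le by simp
    moreover have "\<xi> \<notin> E t" using B_E[OF t(1) b(1), of \<xi>] le(1) by auto
    ultimately obtain n' where n': "(\<xi>, n') \<in> B t" using B_full[OF t(1) le(2) t(2)] by blast
    then have "n = n'" using B_chain[OF t(1) n' b(1) le(1)] L_unique[OF b(2)] by blast
    then show ?thesis using n' by simp
  qed
  have "T_rel x L' C"
  proof unfold_locales
    fix \<xi> n \<beta> k assume l: "L' \<xi> n \<beta> k"
    have "\<xi> \<in> x \<and> \<beta> \<in> x \<and> \<xi> \<le> \<beta> \<and> L' \<xi> n \<xi> n \<and> L' \<beta> k \<beta> k"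
    proof (cases "L \<xi> n \<beta> k")
      case True
      then show ?thesis using L_levels L_le L_nodes unfolding L'_def by blast
    next
      case False
      then obtain t where t: "t \<in> J" "N t \<xi> n \<beta> k" using l unfolding L'_def by blast
      have "\<beta> \<in> x" "L' \<beta> k \<beta> k" using t E N_top[OF t(2)] unfolding L'_def N_def by blast+
      moreover consider "(\<xi>, n) \<in> B t" | "\<xi> \<in> E t" "\<xi> \<le> \<beta>" "n = f t \<xi>" using t(2) unfolding N_def by blast
      then have "\<xi> \<in> x \<and> \<xi> \<le> \<beta> \<and> L' \<xi> n \<xi> n"
      proof cases
        case 1
        then have "L \<xi> n \<xi> n" "\<xi> < \<beta>" using B_node t B_E unfolding N_def by blast+
        then show ?thesis using L_levels unfolding L'_def by auto
      next
        case 2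
        then have "N t \<xi> n \<xi> n" unfolding N_def by simp
        then show ?thesis using 2 E t(1) unfolding L'_def by blast
      qed
      ultimately show ?thesis by blast
    qed
    then show "\<xi> \<in> x \<and> \<beta> \<in> x" "\<xi> \<le> \<beta>" "L' \<xi> n \<xi> n \<and> L' \<beta> k \<beta> k" by blast+
  next
    fix \<beta> n k assume l: "L' \<beta> n \<beta> k"
    show "n = k"
    proof (cases "L \<beta> n \<beta> k")
      case True
      then show ?thesis by (rule L_level_eq)
    next
      case False
      then obtain t where t: "t \<in> J" "N t \<beta> n \<beta> k" using l unfolding L'_def by blast
      moreover have "(\<beta>, n) \<notin> B t" using B_E[OF t(1), of \<beta> n \<beta>] t(2) unfolding N_def by blast
      ultimately show ?thesis unfolding N_def by blast
    qed
  next
    fix \<xi> n \<beta> k \<gamma> l assume 1: "L' \<xi> n \<beta> k" and 2: "L' \<beta> k \<gamma> l"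
    consider "L \<xi> n \<beta> k" "L \<beta> k \<gamma> l" | t where "t \<in> J" "N t \<beta> k \<gamma> l" | t where "t \<in> J" "N t \<xi> n \<beta> k" "L \<beta> k \<gamma> l"
      using 1 2 unfolding L'_def by blast
    then show "L' \<xi> n \<gamma> l"
    proof cases
      case 1
      then show ?thesis using L_trans unfolding L'_def by blast
    next
      case (2 t)
      consider "L \<xi> n \<beta> k" | t' where "t' \<in> J" "N t' \<xi> n \<beta> k" using 1 unfolding L'_def by blast
      then show ?thesis
      proof cases
        case 1
        then have "L \<beta> k \<beta> k" using L_nodes by blast
        then have "(\<beta>, k) \<in> B t" using 2 f_fresh[OF 2(1), of \<beta>] unfolding N_def by auto
        then have "(\<xi>, n) \<in> B t" using B_down[OF 2(1) _ _ 1] 2(2) unfolding N_def by blast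
        then show ?thesis using 2 unfolding L'_def N_def by blast
      next
        case (2 t')
        have "(\<beta>, k) \<notin> B t" using N_not[OF 2] B_node[OF \<open>t \<in> J\<close>] by blast
        then have b: "\<beta> \<in> E t" "\<beta> \<le> \<gamma>" "k = f t \<beta>" "\<gamma> \<in> E t" "l = f t \<gamma>"
          using \<open>N t \<beta> k \<gamma> l\<close> unfolding N_def by blast+
        then have "N t \<beta> k \<beta> k" unfolding N_def by simp
        then have "t' = t" using N_same[OF 2(1) \<open>t \<in> J\<close> 2(2)] by blast
        then have "N t \<xi> n \<gamma> l" using 2(2) b order_trans[of \<xi> \<beta> \<gamma>] unfolding N_def by blast
        then show ?thesis using \<open>t \<in> J\<close> unfolding L'_def by blast
      qed
    next
      case (3 t)
      then show ?thesis using N_not[OF 3(1,2)] L_nodes[OF 3(3)] by blast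
    qed
  next
    fix \<xi> n \<beta> k \<xi>' n' assume 1: "L' \<xi> n \<beta> k" and 2: "L' \<xi>' n' \<beta> k" and le: "\<xi> \<le> \<xi>'"
    show "L' \<xi> n \<xi>' n'"
    proof (cases "L \<beta> k \<beta> k")
      case True
      then have "L \<xi> n \<beta> k" "L \<xi>' n' \<beta> k" using 1 2 N_not unfolding L'_def by blast+
      then show ?thesis using L_below le unfolding L'_def by blast
    next
      case False
      then have "\<not> L \<xi> n \<beta> k" "\<not> L \<xi>' n' \<beta> k" using L_nodes by blast+
      then obtain t t' where t: "t \<in> J" "N t \<xi> n \<beta> k" "t' \<in> J" "N t' \<xi>' n' \<beta> k"
        using 1 2 unfolding L'_def by blast
      then have "t' = t" using N_same by blast
      then have 3: "N t \<xi>' n' \<beta> k" using t by simp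
      have B: "\<beta> \<in> E t" using t unfolding N_def by blast
      consider "(\<xi>', n') \<in> B t" | "\<xi>' \<in> E t" "\<xi>' \<le> \<beta>" "n' = f t \<xi>'" using 3 unfolding N_def by blast
      then show ?thesis
      proof cases
        case c: 1
        have "\<xi> \<notin> E t" using B_E[OF t(1) c, of \<xi>] le by auto
        then have "(\<xi>, n) \<in> B t" using t(2) unfolding N_def by blast
        then show ?thesis using B_chain[OF t(1) _ c le] unfolding L'_def by blast
      next
        case c: 2
        then have "N t \<xi> n \<xi>' n'" using t(2) le unfolding N_def by blast
        then show ?thesis using t(1) unfolding L'_def by blast
      qed
    qed
  next
    fix \<beta> k \<xi> assume 1: "L' \<beta> k \<beta> k" and \<xi>: "\<xi> \<in> x" "\<xi> \<le> \<beta>"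
    show "\<exists>n. L' \<xi> n \<beta> k"
    proof (cases "L \<beta> k \<beta> k")
      case True
      then show ?thesis using L_full \<xi> unfolding L'_def by blast
    next
      case False
      then obtain t where t: "t \<in> J" "N t \<beta> k \<beta> k" using 1 unfolding L'_def by blast
      then have "\<beta> \<in> E t" "k = f t \<beta>" unfolding N_def by blast+
      then have "\<exists>n. N t \<xi> n \<beta> k" using B_full[OF t(1) \<xi>(1) _ \<xi>(2)] \<xi>(2) unfolding N_def by blast
      then show ?thesis using t(1) unfolding L'_def by blast
    qed
  next
    fix \<alpha> \<delta> \<beta> j assume c: "C \<alpha> \<delta> \<beta> j"
    show "\<alpha> \<in> x \<and> \<beta> \<in> x \<and> j < \<kappa> \<and> \<alpha> \<le> \<beta>" using C_levels[OF c] .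
    show "L' \<beta> (e j i) \<beta> (e j i)" if "i < lam" for i using C_nodes[OF c that] unfolding L'_def by blast
    show "\<exists>j'. C \<alpha> \<delta> \<xi> j' \<and> (\<forall>i<lam. L' \<xi> (e j' i) \<beta> (e j i))" if "\<xi> \<in> x" "\<alpha> \<le> \<xi>" "\<xi> \<le> \<beta>" for \<xi>
      using C_down[OF c that] unfolding L'_def by blast
    fix \<beta>' j' assume c': "C \<alpha> \<delta> \<beta>' j'" and le: "\<beta> \<le> \<beta>'"
    show "many (\<lambda>i. L' \<beta> (e j i) \<beta>' (e j' i))"
      by (rule many_mono[OF C_many[OF c c' le]]) (auto simp: L'_def)
  qed
  then show ?thesis unfolding L'_def N_def .
qed

text \<open>Puts a level \<open>\<beta>0\<close> with the nodes \<open>N\<close> on top, the node \<open>t\<close> sitting above the branch \<open>B t\<close>;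
  \<open>D\<close> colours the vectors at the new level.\<close>

lemma tree_rel_top:
  fixes N :: "'i set" and B :: "'i \<Rightarrow> ('i \<times> 'i) set" and D :: "'i \<Rightarrow> 'i \<Rightarrow> 'i \<Rightarrow> bool"
  assumes "T_rel x L C" and \<beta>0: "\<And>\<xi>. \<xi> \<in> x \<Longrightarrow> \<xi> < \<beta>0"
    and B_node: "\<And>t \<xi> n. t \<in> N \<Longrightarrow> (\<xi>, n) \<in> B t \<Longrightarrow> L \<xi> n \<xi> n"
    and B_chain: "\<And>t \<xi> n \<xi>' n'. t \<in> N \<Longrightarrow> (\<xi>, n) \<in> B t \<Longrightarrow> (\<xi>', n') \<in> B t \<Longrightarrow> \<xi> \<le> \<xi>' \<Longrightarrow> L \<xi> n \<xi>' n'"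
    and B_full: "\<And>t \<xi>. t \<in> N \<Longrightarrow> \<xi> \<in> x \<Longrightarrow> \<exists>n. (\<xi>, n) \<in> B t"
    and L_less: "\<And>\<xi> n. L \<xi> n \<xi> n \<Longrightarrow> n < \<kappa>"
    and D: "\<And>\<alpha> \<delta> j. D \<alpha> \<delta> j \<Longrightarrow> j < \<kappa> \<and> \<alpha> \<in> insert \<beta>0 x \<and> (\<forall>i<lam. e j i \<in> N)"
    and D_inj: "\<And>\<alpha> \<delta> j i i' n. D \<alpha> \<delta> j \<Longrightarrow> \<alpha> \<in> x \<Longrightarrow> i < lam \<Longrightarrow> i' < lam \<Longrightarrow>
        (\<alpha>, n) \<in> B (e j i) \<Longrightarrow> (\<alpha>, n) \<in> B (e j i') \<Longrightarrow> i = i'"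
    and D_many: "\<And>\<alpha> \<delta> j j'. D \<alpha> \<delta> j \<Longrightarrow> D \<alpha> \<delta> j' \<Longrightarrow> many (\<lambda>i. e j i = e j' i)"
    and D_C: "\<And>\<alpha> \<delta> j \<zeta> j'. D \<alpha> \<delta> j \<Longrightarrow> C \<alpha> \<delta> \<zeta> j' \<Longrightarrow> many (\<lambda>i. (\<zeta>, e j' i) \<in> B (e j i))"
  shows "T_rel (insert \<beta>0 x)
    (\<lambda>\<xi> n \<beta> k. L \<xi> n \<beta> k \<or> (\<beta> = \<beta>0 \<and> k \<in> N \<and> ((\<xi>, n) \<in> B k \<or> (\<xi> = \<beta>0 \<and> n = k))))
    (\<lambda>\<alpha> \<delta> \<beta> j. C \<alpha> \<delta> \<beta> j \<or> (\<beta> = \<beta>0 \<and> D \<alpha> \<delta> j) \<or>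
       (\<exists>v. D \<alpha> \<delta> v \<and> \<alpha> \<in> x \<and> \<beta> \<in> x \<and> \<alpha> \<le> \<beta> \<and> j = name_of (\<lambda>i. THE n. (\<beta>, n) \<in> B (e v i))))"
proof -
  interpret tree_rel lam \<kappa> e x L C by fact
  define L' where "L' \<xi> n \<beta> k \<longleftrightarrow> L \<xi> n \<beta> k \<or> (\<beta> = \<beta>0 \<and> k \<in> N \<and> ((\<xi>, n) \<in> B k \<or> (\<xi> = \<beta>0 \<and> n = k)))"
    for \<xi> n \<beta> k
  \<comment> \<open>The projection of a new vector to an old level. By \<open>C_down\<close> it has
    to inherit the colours, so colouring the top level alone would not be enough.\<close>
  define pr where "pr v \<beta> = name_of (\<lambda>i. THE n. (\<beta>, n) \<in> B (e v i))" for v \<beta>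
  define C' where "C' \<alpha> \<delta> \<beta> j \<longleftrightarrow> C \<alpha> \<delta> \<beta> j \<or> (\<beta> = \<beta>0 \<and> D \<alpha> \<delta> j) \<or>
    (\<exists>v. D \<alpha> \<delta> v \<and> \<alpha> \<in> x \<and> \<beta> \<in> x \<and> \<alpha> \<le> \<beta> \<and> j = pr v \<beta>)" for \<alpha> \<delta> \<beta> j
  have x0: "\<beta>0 \<notin> x" using \<beta>0 by blast
  have not0: "\<xi> \<noteq> \<beta>0" "\<beta> \<noteq> \<beta>0" if "L \<xi> n \<beta> k" for \<xi> n \<beta> k using L_levels[OF that] x0 by blast+
  have B_x: "\<xi> \<in> x" if "t \<in> N" "(\<xi>, n) \<in> B t" for t \<xi> n using B_node[OF that] L_levels by blast
  have B_unique: "n = n'" if "t \<in> N" "(\<xi>, n) \<in> B t" "(\<xi>, n') \<in> B t" for t \<xi> n n'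
    using B_chain[OF that order_refl] L_level_eq by blast
  have B_down: "(\<xi>, n) \<in> B t" if t: "t \<in> N" and b: "(\<xi>', m) \<in> B t" "L \<xi> n \<xi>' m" for t \<xi> n \<xi>' m
  proof -
    obtain n' where n': "(\<xi>, n') \<in> B t" using B_full[OF t] L_levels[OF b(2)] by blast
    then have "n = n'" using B_chain[OF t n' b(1) L_le[OF b(2)]] L_unique[OF b(2)] by blast
    then show ?thesis using n' by simp
  qed
  have the: "(\<beta>, THE n. (\<beta>, n) \<in> B t) \<in> B t" if t: "t \<in> N" "\<beta> \<in> x" for t \<beta>
  proof -
    obtain n where n: "(\<beta>, n) \<in> B t" using B_full[OF t] by blast
    show ?thesis by (rule theI[of "\<lambda>n. (\<beta>, n) \<in> B t", OF n]) (use B_unique[OF t(1) n] in blast)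
  qed
  have pr: "pr v \<beta> < \<kappa>" "i < lam \<Longrightarrow> (\<beta>, e (pr v \<beta>) i) \<in> B (e v i)"
    if v: "D \<alpha> \<delta> v" "\<alpha> \<in> x" "\<beta> \<in> x" "\<alpha> \<le> \<beta>" for \<alpha> \<delta> v \<beta> i
  proof -
    define g where "g i = (THE n. (\<beta>, n) \<in> B (e v i))" for i
    have vN: "e v i \<in> N" if "i < lam" for i using D[OF v(1)] that by blast
    have g: "(\<beta>, g i) \<in> B (e v i)" if "i < lam" for i unfolding g_def using the vN[OF that] v(3) by blast
    \<comment> \<open>Coordinates that are distinct at \<alpha> stay distinct at the levels above
      it, so the projection is injective and has a name.\<close>
    have inj: "inj_on g {..<lam}"
    proof (rule inj_onI)
      fix a b assume ab: "a \<in> {..<lam}" "b \<in> {..<lam}" "g a = g b"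
      then have a: "a < lam" "b < lam" by simp_all
      obtain n where n: "(\<alpha>, n) \<in> B (e v a)" using B_full[OF vN[OF a(1)] v(2)] by blast
      then have "L \<alpha> n \<beta> (g a)" using B_chain[OF vN[OF a(1)] n g[OF a(1)] v(4)] by blast
      moreover have "(\<beta>, g a) \<in> B (e v b)" using g[OF a(2)] ab(3) by simp
      ultimately have "(\<alpha>, n) \<in> B (e v b)" using B_down[OF vN[OF a(2)]] by blast
      then show "a = b" using D_inj[OF v(1,2) a n] by blast
    qed
    have lt: "g i < \<kappa>" if "i < lam" for i using L_less[OF B_node[OF vN[OF that] g[OF that]]] .
    show "pr v \<beta> < \<kappa>" "i < lam \<Longrightarrow> (\<beta>, e (pr v \<beta>) i) \<in> B (e v i)"
      using name_of[OF inj lt] g[of i] unfolding pr_def g_def by auto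
  qed
  have L'B: "L' \<xi> n \<beta> k" if "t \<in> N" "(\<xi>, n) \<in> B t" "(\<beta>, k) \<in> B t" "\<xi> \<le> \<beta>" for t \<xi> n \<beta> k
    using B_chain[OF that] unfolding L'_def by blast
  have "T_rel (insert \<beta>0 x) L' C'"
  proof unfold_locales
    fix \<xi> n \<beta> k assume l: "L' \<xi> n \<beta> k"
    show "\<xi> \<in> insert \<beta>0 x \<and> \<beta> \<in> insert \<beta>0 x" using l L_levels[of \<xi> n \<beta> k] B_x unfolding L'_def by blast
    show "\<xi> \<le> \<beta>" using l L_le[of \<xi> n \<beta> k] B_x \<beta>0 unfolding L'_def by (auto intro: less_imp_le)
    show "L' \<xi> n \<xi> n \<and> L' \<beta> k \<beta> k" using l L_nodes[of \<xi> n \<beta> k] B_node unfolding L'_def by blast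
  next
    fix \<beta> n k assume "L' \<beta> n \<beta> k"
    then show "n = k" using L_level_eq B_x x0 unfolding L'_def by blast
  next
    fix \<xi> n \<beta> k \<gamma> l assume 1: "L' \<xi> n \<beta> k" and 2: "L' \<beta> k \<gamma> l"
    consider "L \<beta> k \<gamma> l" | "\<gamma> = \<beta>0" "l \<in> N" "(\<beta>, k) \<in> B l" | "\<gamma> = \<beta>0" "\<beta> = \<beta>0" "k = l"
      using 2 unfolding L'_def by blast
    then show "L' \<xi> n \<gamma> l"
    proof cases
      case c: 1
      then have "L \<xi> n \<beta> k" using 1 not0[OF c] unfolding L'_def by blast
      then show ?thesis using L_trans c unfolding L'_def by blast
    next
      case c: 2
      then have "\<beta> \<noteq> \<beta>0" using B_x x0 by blast
      then have "L \<xi> n \<beta> k" using 1 unfolding L'_def by blast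
      then show ?thesis using B_down[OF c(2,3)] c unfolding L'_def by blast
    next
      case 3
      then show ?thesis using 1 by simp
    qed
  next
    fix \<xi> n \<beta> k \<xi>' n' assume 1: "L' \<xi> n \<beta> k" and 2: "L' \<xi>' n' \<beta> k" and le: "\<xi> \<le> \<xi>'"
    show "L' \<xi> n \<xi>' n'"
    proof (cases "\<beta> = \<beta>0")
      case False
      then have "L \<xi> n \<beta> k" "L \<xi>' n' \<beta> k" using 1 2 unfolding L'_def by blast+
      then show ?thesis using L_below le unfolding L'_def by blast
    next
      case True
      then have kN: "k \<in> N" using 1 not0 unfolding L'_def by blast
      consider "\<xi>' = \<beta>0" "n' = k" | "(\<xi>', n') \<in> B k" using 2 True not0 unfolding L'_def by blast
      then show ?thesis
      proof cases
        case c: 1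
        then show ?thesis using 1 True by simp
      next
        case c: 2
        then have "\<xi>' < \<beta>0" using B_x[OF kN] \<beta>0 by blast
        then have "\<xi> \<noteq> \<beta>0" using le by auto
        then have "(\<xi>, n) \<in> B k" using 1 True not0 unfolding L'_def by blast
        then show ?thesis using L'B[OF kN _ c le] by blast
      qed
    qed
  next
    fix \<beta> k \<xi> assume 1: "L' \<beta> k \<beta> k" and \<xi>: "\<xi> \<in> insert \<beta>0 x" "\<xi> \<le> \<beta>"
    show "\<exists>n. L' \<xi> n \<beta> k"
    proof (cases "\<beta> = \<beta>0")
      case True
      then have "k \<in> N" using 1 not0 unfolding L'_def by blast
      then show ?thesis using B_full[of k \<xi>] \<xi>(1) True unfolding L'_def by blast
    next
      case False
      then have l: "L \<beta> k \<beta> k" using 1 unfolding L'_def by blast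
      then have "\<beta> \<in> x" using L_levels by blast
      then have "\<beta> < \<beta>0" using \<beta>0 by blast
      then have "\<xi> \<in> x" using \<xi> by auto
      then show ?thesis using L_full[OF l _ \<xi>(2)] unfolding L'_def by blast
    qed
  next
    fix \<alpha> \<delta> \<beta> j assume c: "C' \<alpha> \<delta> \<beta> j"
    consider "C \<alpha> \<delta> \<beta> j" | "\<beta> = \<beta>0" "D \<alpha> \<delta> j" | v where "D \<alpha> \<delta> v" "\<alpha> \<in> x" "\<beta> \<in> x" "\<alpha> \<le> \<beta>" "j = pr v \<beta>"
      using c unfolding C'_def by blast
    note cs = this
    show "\<alpha> \<in> insert \<beta>0 x \<and> \<beta> \<in> insert \<beta>0 x \<and> j < \<kappa> \<and> \<alpha> \<le> \<beta>"
      using cs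
    proof cases
      case 1
      then show ?thesis using C_levels by blast
    next
      case 2
      then show ?thesis using D[OF 2(2)] \<beta>0 by (auto intro: less_imp_le)
    next
      case (3 v)
      then show ?thesis using pr(1)[OF 3(1-4)] by blast
    qed
    show "L' \<beta> (e j i) \<beta> (e j i)" if i: "i < lam" for i
      using cs
    proof cases
      case 1
      then show ?thesis using C_nodes[OF _ i] unfolding L'_def by blast
    next
      case 2
      then show ?thesis using D[OF 2(2)] i unfolding L'_def by blast
    next
      case (3 v)
      then show ?thesis using pr(2)[OF 3(1-4) i] B_node D[OF 3(1)] i unfolding L'_def by blast
    qed
    show "\<exists>j'. C' \<alpha> \<delta> \<xi> j' \<and> (\<forall>i<lam. L' \<xi> (e j' i) \<beta> (e j i))"
      if \<xi>: "\<xi> \<in> insert \<beta>0 x" "\<alpha> \<le> \<xi>" "\<xi> \<le> \<beta>" for \<xi>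
      using cs
    proof cases
      case 1
      then have "\<beta> < \<beta>0" using C_levels \<beta>0 by blast
      then have "\<xi> \<in> x" using \<xi> by auto
      then show ?thesis using C_down[OF 1 _ \<xi>(2,3)] unfolding L'_def C'_def by blast
    next
      case 2
      have vN: "e j i \<in> N" if "i < lam" for i using D[OF 2(2)] that by blast
      show ?thesis
      proof (cases "\<xi> = \<beta>0")
        case True
        then show ?thesis using 2 vN unfolding L'_def C'_def by blast
      next
        case False
        then have x: "\<xi> \<in> x" using \<xi>(1) by blast
        then have "\<alpha> \<noteq> \<beta>0" using \<xi>(2) \<beta>0 leD by blast
        then have a: "\<alpha> \<in> x" using D[OF 2(2)] by blast
        have "C' \<alpha> \<delta> \<xi> (pr j \<xi>)" using 2(2) a x \<xi>(2) unfolding C'_def by blast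
        moreover have "\<forall>i<lam. L' \<xi> (e (pr j \<xi>) i) \<beta> (e j i)"
          using pr(2)[OF 2(2) a x \<xi>(2)] vN 2(1) unfolding L'_def by blast
        ultimately show ?thesis by blast
      qed
    next
      case (3 v)
      have vN: "e v i \<in> N" if "i < lam" for i using D[OF 3(1)] that by blast
      have "\<beta> < \<beta>0" using 3(3) \<beta>0 by blast
      then have x: "\<xi> \<in> x" using \<xi> by auto
      have "C' \<alpha> \<delta> \<xi> (pr v \<xi>)" using 3(1,2) x \<xi>(2) unfolding C'_def by blast
      moreover have "\<forall>i<lam. L' \<xi> (e (pr v \<xi>) i) \<beta> (e j i)"
        using L'B[OF vN pr(2)[OF 3(1,2) x \<xi>(2)] pr(2)[OF 3(1-4)] \<xi>(3)] 3(5) by blast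
      ultimately show ?thesis by blast
    qed
    fix \<beta>' j' assume c': "C' \<alpha> \<delta> \<beta>' j'" and le: "\<beta> \<le> \<beta>'"
    consider "C \<alpha> \<delta> \<beta>' j'" | "\<beta>' = \<beta>0" "D \<alpha> \<delta> j'" | v where "D \<alpha> \<delta> v" "\<alpha> \<in> x" "\<beta>' \<in> x" "\<alpha> \<le> \<beta>'" "j' = pr v \<beta>'"
      using c' unfolding C'_def by blast
    note cs' = this
    have D_node: "\<beta>1 < \<beta>0 \<Longrightarrow> (\<beta>1, e j1 i) \<in> B (e v i)"
      if "D \<alpha> \<delta> v" "\<alpha> \<in> x" "\<beta>1 \<in> x" "\<alpha> \<le> \<beta>1" "j1 = pr v \<beta>1" "i < lam" for v \<beta>1 j1 i
      using pr(2)[OF that(1-4,6)] that(5) by simp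
    have vN: "e v i \<in> N" if "D \<alpha> \<delta> v" "i < lam" for v i using D[OF that(1)] that(2) by blast
    show "many (\<lambda>i. L' \<beta> (e j i) \<beta>' (e j' i))"
      using cs
    proof cases
      case 1
      note c1 = 1
      show ?thesis using cs'
      proof cases
        case 1
        show ?thesis by (rule many_mono[OF C_many[OF c1 1 le]]) (simp add: L'_def)
      next
        case 2
        show ?thesis by (rule many_mono[OF D_C[OF 2(2) c1]]) (use vN[OF 2(2)] 2(1) in \<open>simp add: L'_def\<close>)
      next
        case (3 v)
        show ?thesis
          by (rule many_mono[OF D_C[OF 3(1) c1]]) (use L'B[OF vN[OF 3(1)] _ _ le] pr(2)[OF 3(1-4)] 3(5) in blast)
      qed
    next
      case 2
      note c2 = 2
      then have "\<beta>' = \<beta>0" using le c' C_levels \<beta>0 unfolding C'_def by (meson leD)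
      then have "D \<alpha> \<delta> j'" using cs' C_levels x0 by blast
      then show ?thesis
        by (intro many_mono[OF D_many[OF c2(2)]]) (use vN c2(1) \<open>\<beta>' = \<beta>0\<close> in \<open>auto simp: L'_def\<close>)
    next
      case (3 v)
      note c3 = 3
      show ?thesis using cs'
      proof cases
        case 1
        have "many (\<lambda>i. (\<beta>', e j' i) \<in> B (e v i))" using D_C[OF c3(1) 1] .
        then show ?thesis
          by (rule many_mono) (use L'B[OF vN[OF c3(1)] _ _ le] pr(2)[OF c3(1-4)] c3(5) in blast)
      next
        case 2
        show ?thesis
        proof (rule many_mono[OF D_many[OF c3(1) 2(2)]])
          fix i assume i: "i < lam" "e v i = e j' i"
          have "(\<beta>, e j i) \<in> B (e j' i)" using pr(2)[OF c3(1-4) i(1)] c3(5) i(2) by simp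
          then show "L' \<beta> (e j i) \<beta>' (e j' i)" using vN[OF 2(2) i(1)] 2(1) unfolding L'_def by blast
        qed
      next
        case (3 v')
        show ?thesis
        proof (rule many_mono[OF D_many[OF c3(1) 3(1)]])
          fix i assume i: "i < lam" "e v i = e v' i"
          have "(\<beta>, e j i) \<in> B (e v i)" using pr(2)[OF c3(1-4) i(1)] c3(5) by simp
          moreover have "(\<beta>', e j' i) \<in> B (e v i)" using pr(2)[OF 3(1-4) i(1)] 3(5) i(2) by simp
          ultimately show "L' \<beta> (e j i) \<beta>' (e j' i)" using L'B[OF vN[OF c3(1) i(1)] _ _ le] by blast
        qed
      qed
    qed
  qed
  then show ?thesis unfolding L'_def C'_def pr_def .
qed

lemma disjoint_refinement:
  fixes Y :: "'d \<Rightarrow> 'y set"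
  assumes K: "small K" and Y: "\<And>d. d \<in> K \<Longrightarrow> {..<lam} \<lesssim> Y d"
  obtains Z where "\<And>d. d \<in> K \<Longrightarrow> Z d \<subseteq> Y d" "\<And>d. d \<in> K \<Longrightarrow> {..<lam} \<lesssim> Z d"
    "\<And>d d'. d \<in> K \<Longrightarrow> d' \<in> K \<Longrightarrow> Z d \<inter> Z d' \<noteq> {} \<Longrightarrow> d = d'"
proof -
  have "K \<times> {..<lam} \<lesssim> {..<lam}"
    using K unfolding small_def by (intro times_lepoll_infinite infinite_lam lepoll_refl)
  then obtain c where c: "inj_on c (K \<times> {..<lam})" "c ` (K \<times> {..<lam}) \<subseteq> {..<lam}"
    unfolding lepoll_def by blast
  define P where "P h \<nu> r \<longleftrightarrow> (\<forall>d k. d \<in> K \<and> k < lam \<and> c (d, k) = \<nu> \<longrightarrow> r \<in> Y d \<and> r \<notin> h ` {..<\<nu>})"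
    for h :: "'i \<Rightarrow> 'y" and \<nu> r
  have "\<exists>h. \<forall>\<nu>. P h \<nu> (h \<nu>)"
  proof (rule dependent_wellorder_choice)
    fix r and f g :: "'i \<Rightarrow> 'y" and x assume "\<And>y. y < x \<Longrightarrow> f y = g y"
    then have "f ` {..<x} = g ` {..<x}" by (intro image_cong) auto
    then show "P f x r = P g x r" unfolding P_def by simp
  next
    fix \<nu> and h :: "'i \<Rightarrow> 'y"
    show "\<exists>r. P h \<nu> r"
    proof (cases "\<exists>d k. d \<in> K \<and> k < lam \<and> c (d, k) = \<nu>")
      case True
      then obtain d k where dk: "d \<in> K" "k < lam" "c (d, k) = \<nu>" by blast
      then have "c (d, k) \<in> c ` (K \<times> {..<lam})" by (intro imageI) simp
      then have "\<nu> < lam" using c(2) dk(3) by auto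
      have "\<not> Y d \<subseteq> h ` {..<\<nu>}"
      proof
        assume "Y d \<subseteq> h ` {..<\<nu>}"
        then have "Y d \<lesssim> {..<\<nu>}" by (rule subset_image_lepoll)
        then have "{..<lam} \<lesssim> {..<\<nu>}" using Y[OF dk(1)] by (rule lepoll_trans[rotated])
        then show False using less_lam[OF \<open>\<nu> < lam\<close>] not_lepoll_iff_lesspoll by blast
      qed
      then obtain r where r: "r \<in> Y d" "r \<notin> h ` {..<\<nu>}" by blast
      have "d' = d" if "d' \<in> K" "k' < lam" "c (d', k') = \<nu>" for d' k'
        using inj_onD[OF c(1), of "(d', k')" "(d, k)"] that dk by simp
      then show ?thesis using r unfolding P_def by blast
    qed (auto simp: P_def)
  qed
  then obtain h where h: "\<And>\<nu>. P h \<nu> (h \<nu>)" by blast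
  have cl: "c (d, k) < lam" if "d \<in> K" "k < lam" for d k
  proof -
    have "c (d, k) \<in> c ` (K \<times> {..<lam})" using that by (intro imageI) simp
    then show ?thesis using c(2) by auto
  qed
  have inj: "d = d' \<and> k = k'" if a: "d \<in> K" "k < lam" "d' \<in> K" "k' < lam" and eq: "h (c (d, k)) = h (c (d', k'))"
    for d k d' k'
  proof -
    have "\<not> c (d, k) < c (d', k')" using h[of "c (d', k')"] a eq unfolding P_def by (metis imageI lessThan_iff)
    moreover have "\<not> c (d', k') < c (d, k)" using h[of "c (d, k)"] a eq unfolding P_def by (metis imageI lessThan_iff)
    ultimately have "c (d, k) = c (d', k')" by simp
    then show ?thesis using inj_onD[OF c(1), of "(d, k)" "(d', k')"] a by simp
  qed
  show ?thesis
  proof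
    show "(\<lambda>k. h (c (d, k))) ` {..<lam} \<subseteq> Y d" if "d \<in> K" for d
      using h that unfolding P_def by blast
    show "{..<lam} \<lesssim> (\<lambda>k. h (c (d, k))) ` {..<lam}" if "d \<in> K" for d
    proof -
      have "inj_on (\<lambda>k. h (c (d, k))) {..<lam}" using inj that by (intro inj_onI) auto
      then show ?thesis unfolding lepoll_def by blast
    qed
    show "d = d'" if "d \<in> K" "d' \<in> K"
      "(\<lambda>k. h (c (d, k))) ` {..<lam} \<inter> (\<lambda>k. h (c (d', k))) ` {..<lam} \<noteq> {}" for d d'
      using inj that by blast
  qed
qed

end

context successor_cardinals
begin

lemma ex_fresh_inj:
  assumes X: "small X" and N: "small N"
  shows "\<exists>g. inj_on g N \<and> g ` N \<subseteq> {..<\<kappa>} - X"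
proof -
  have "\<not> small ({..<\<kappa>} - X)"
  proof
    assume "small ({..<\<kappa>} - X)"
    then have "small (({..<\<kappa>} - X) \<union> X)" using X by (rule small_Un)
    then show False using not_small_kappa small_subset[of "({..<\<kappa>} - X) \<union> X" "{..<\<kappa>}"] by auto
  qed
  then have "{..<lam} \<lesssim> {..<\<kappa>} - X" using lepoll_linear unfolding small_def by blast
  then have "N \<lesssim> {..<\<kappa>} - X" using N unfolding small_def by (rule lepoll_trans[rotated])
  then show ?thesis unfolding lepoll_def by blast
qed

end

section \<open>Tree relations as sets of atoms\<close>

context tree_index
begin

text \<open>The boolean tag tells the tree order from the colours, so that one set of atoms carries
  both relations.\<close>

definition rL :: "('i \<times> 'i \<times> bool \<times> 'i \<times> 'i) set \<Rightarrow> 'i \<Rightarrow> 'i \<Rightarrow> 'i \<Rightarrow> 'i \<Rightarrow> bool" where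
  "rL A \<xi> n \<beta> k \<longleftrightarrow> (\<xi>, \<beta>, True, n, k) \<in> A"

definition rC :: "('i \<times> 'i \<times> bool \<times> 'i \<times> 'i) set \<Rightarrow> 'i \<Rightarrow> 'i \<Rightarrow> 'i \<Rightarrow> 'i \<Rightarrow> bool" where
  "rC A \<alpha> \<delta> \<beta> j \<longleftrightarrow> (\<alpha>, \<beta>, False, \<delta>, j) \<in> A"

definition atoms :: "('i \<Rightarrow> 'i \<Rightarrow> 'i \<Rightarrow> 'i \<Rightarrow> bool) \<Rightarrow> ('i \<Rightarrow> 'i \<Rightarrow> 'i \<Rightarrow> 'i \<Rightarrow> bool) \<Rightarrow> ('i \<times> 'i \<times> bool \<times> 'i \<times> 'i) set" where
  "atoms L C = {(a, b, t, n, k). if t then L a n b k else C a n b k}"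

lemma rL_atoms [simp]: "rL (atoms L C) = L"
  and rC_atoms [simp]: "rC (atoms L C) = C"
  by (intro ext; simp add: rL_def rC_def atoms_def)+

lemma subset_atoms:
  assumes "\<And>a n b k. rL A a n b k \<Longrightarrow> a \<in> Z \<Longrightarrow> b \<in> Z \<Longrightarrow> L a n b k"
    and "\<And>a n b k. rC A a n b k \<Longrightarrow> a \<in> Z \<Longrightarrow> b \<in> Z \<Longrightarrow> C a n b k"
  shows "A \<inter> (Z \<times> Z \<times> UNIV) \<subseteq> atoms L C"
proof
  fix t assume t: "t \<in> A \<inter> (Z \<times> Z \<times> UNIV)"
  obtain a b c n k where abc: "t = (a, b, c, n, k)" by (cases t)
  show "t \<in> atoms L C"
    using t assms[of a n b k] unfolding abc by (cases c) (auto simp: atoms_def rL_def rC_def)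
qed

text \<open>All names of nodes, vectors and colours in \<open>A\<close>, of whichever kind; a name
  outside this set is fresh for every purpose.\<close>

definition idx :: "('i \<times> 'i \<times> bool \<times> 'i \<times> 'i) set \<Rightarrow> 'i set" where
  "idx A = (\<lambda>(a, b, t, n, k). n) ` A \<union> (\<lambda>(a, b, t, n, k). k) ` A"

lemma small_idx: "small A \<Longrightarrow> small (idx A)"
  unfolding idx_def by (intro small_Un small_image)

lemma idx_rL: "rL A \<xi> n \<beta> k \<Longrightarrow> n \<in> idx A \<and> k \<in> idx A"
  and idx_rC: "rC A \<xi> n \<beta> k \<Longrightarrow> n \<in> idx A \<and> k \<in> idx A"
  unfolding rL_def rC_def idx_def by force+

abbreviation tree_indices :: "(bool \<times> 'i \<times> 'i) set" where
  "tree_indices \<equiv> UNIV \<times> {..<\<kappa>} \<times> {..<\<kappa>}"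

definition tree_ok :: "('i, bool \<times> 'i \<times> 'i) cond \<Rightarrow> bool" where
  "tree_ok p \<longleftrightarrow> small (fst p) \<and> small (snd p) \<and> snd p \<subseteq> fst p \<times> fst p \<times> tree_indices \<and>
     T_rel (fst p) (rL (snd p)) (rC (snd p))"

lemma tree_okD:
  assumes "tree_ok p"
  shows "small (fst p)" "small (snd p)" "snd p \<subseteq> fst p \<times> fst p \<times> tree_indices"
    "T_rel (fst p) (rL (snd p)) (rC (snd p))"
  using assms unfolding tree_ok_def by blast+

lemma tree_ok_idx: "tree_ok p \<Longrightarrow> idx (snd p) \<subseteq> {..<\<kappa>}"
  using tree_okD(3)[of p] unfolding idx_def by fastforce

text \<open>The atoms combine levels from the small set \<open>x\<close> with names from the small
  set \<open>I\<close>, so there are at most \<lambda> of them.\<close>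

lemma tree_okI:
  assumes x: "small x" and T: "T_rel x L C" and I: "small I"
    and LI: "\<And>\<xi> n \<beta> k. L \<xi> n \<beta> k \<Longrightarrow> n \<in> I \<and> k \<in> I \<and> n < \<kappa> \<and> k < \<kappa>"
    and CI: "\<And>\<xi> n \<beta> k. C \<xi> n \<beta> k \<Longrightarrow> n \<in> I \<and> k \<in> I \<and> n < \<kappa>"
  shows "tree_ok (x, atoms L C)"
proof -
  interpret tree_rel lam \<kappa> e x L C by fact
  have sub: "atoms L C \<subseteq> x \<times> x \<times> UNIV \<times> (I \<inter> {..<\<kappa>}) \<times> (I \<inter> {..<\<kappa>})"
    using L_levels C_levels LI CI unfolding atoms_def by (auto split: if_splits)
  have "small (I \<inter> {..<\<kappa>})" by (rule small_subset[OF I]) auto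
  moreover have "small (UNIV :: bool set)" by (rule small_finite) simp
  ultimately have "small (x \<times> x \<times> (UNIV :: bool set) \<times> (I \<inter> {..<\<kappa>}) \<times> (I \<inter> {..<\<kappa>}))"
    using x by (intro small_times)
  then have "small (atoms L C)" using sub by (rule small_subset)
  moreover have "atoms L C \<subseteq> x \<times> x \<times> tree_indices" using sub by blast
  ultimately show ?thesis unfolding tree_ok_def using x T by simp
qed

lemma tree_ok_cut:
  assumes p: "tree_ok p"
  shows "tree_ok (cut p Z)"
proof -
  interpret tree_rel lam \<kappa> e "fst p" "rL (snd p)" "rC (snd p)" using tree_okD(4)[OF p] .
  have T: "T_rel (fst p \<inter> Z) (\<lambda>\<xi> n \<beta> k. \<xi> \<in> fst p \<inter> Z \<and> \<beta> \<in> fst p \<inter> Z \<and> rL (snd p) \<xi> n \<beta> k)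
      (\<lambda>\<alpha> \<delta> \<beta> j. \<alpha> \<in> fst p \<inter> Z \<and> \<beta> \<in> fst p \<inter> Z \<and> rC (snd p) \<alpha> \<delta> \<beta> j)"
    using tree_rel_pullback[OF tree_okD(4)[OF p], of "fst p \<inter> Z" "\<lambda>a. a"] by (simp add: strict_mono_on_ident)
  have L: "rL (snd (cut p Z)) = (\<lambda>\<xi> n \<beta> k. \<xi> \<in> fst p \<inter> Z \<and> \<beta> \<in> fst p \<inter> Z \<and> rL (snd p) \<xi> n \<beta> k)"
    using L_levels unfolding fun_eq_iff rL_def snd_cut by blast
  have C: "rC (snd (cut p Z)) = (\<lambda>\<xi> n \<beta> k. \<xi> \<in> fst p \<inter> Z \<and> \<beta> \<in> fst p \<inter> Z \<and> rC (snd p) \<xi> n \<beta> k)"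
    using C_levels unfolding fun_eq_iff rC_def snd_cut by blast
  have "small (fst p \<inter> Z)" "small (snd (cut p Z))"
    by (rule small_subset[OF tree_okD(1)[OF p]], blast) (rule small_subset[OF tree_okD(2)[OF p]], auto simp: snd_cut)
  moreover have "snd (cut p Z) \<subseteq> (fst p \<inter> Z) \<times> (fst p \<inter> Z) \<times> tree_indices"
    using tree_okD(3)[OF p] unfolding snd_cut by blast
  ultimately show ?thesis unfolding tree_ok_def using T unfolding L C by simp
qed

lemma tree_ok_move:
  assumes p: "tree_ok p" and j: "strict_mono_on (fst p) j"
  shows "tree_ok (move j p)"
proof -
  interpret tree_rel lam \<kappa> e "fst p" "rL (snd p)" "rC (snd p)" using tree_okD(4)[OF p] .
  define g where "g = inv_into (fst p) j"
  have inj: "inj_on j (fst p)" using strict_mono_on_imp_inj_on[OF j] .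
  have gj: "g (j a) = a" if "a \<in> fst p" for a unfolding g_def using inv_into_f_f[OF inj that] .
  have g_in: "g b \<in> fst p" if "b \<in> j ` fst p" for b unfolding g_def using inv_into_into[OF that] .
  have "strict_mono_on (j ` fst p) g"
  proof (rule strict_mono_onI)
    fix r s assume "r \<in> j ` fst p" "s \<in> j ` fst p" "r < s"
    then obtain a b where ab: "a \<in> fst p" "b \<in> fst p" "r = j a" "s = j b" by blast
    then have "\<not> b \<le> a" using strict_mono_onD[OF j, of b a] \<open>r < s\<close> by (auto simp: order.order_iff_strict)
    then show "g r < g s" using ab gj by simp
  qed
  note T = tree_rel_pullback[OF tree_okD(4)[OF p] g_in this]
  have mem: "(\<xi>, \<beta>, c) \<in> snd (move j p) \<longleftrightarrow> \<xi> \<in> j ` fst p \<and> \<beta> \<in> j ` fst p \<and> (g \<xi>, g \<beta>, c) \<in> snd p"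
    for \<xi> \<beta> and c :: "bool \<times> 'i \<times> 'i"
  proof
    assume "(\<xi>, \<beta>, c) \<in> snd (move j p)"
    then obtain a b where "(a, b, c) \<in> snd p" "\<xi> = j a" "\<beta> = j b" unfolding snd_move mv_def by auto
    moreover then have "a \<in> fst p" "b \<in> fst p" using tree_okD(3)[OF p] by blast+
    ultimately show "\<xi> \<in> j ` fst p \<and> \<beta> \<in> j ` fst p \<and> (g \<xi>, g \<beta>, c) \<in> snd p" using gj by simp
  next
    assume *: "\<xi> \<in> j ` fst p \<and> \<beta> \<in> j ` fst p \<and> (g \<xi>, g \<beta>, c) \<in> snd p"
    then have "j (g \<xi>) = \<xi>" "j (g \<beta>) = \<beta>" using gj by auto
    then have "(\<xi>, \<beta>, c) = mv j (g \<xi>, g \<beta>, c)" unfolding mv_def by simp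
    then show "(\<xi>, \<beta>, c) \<in> snd (move j p)" unfolding snd_move using * by blast
  qed
  have L: "rL (snd (move j p)) = (\<lambda>\<xi> n \<beta> k. \<xi> \<in> j ` fst p \<and> \<beta> \<in> j ` fst p \<and> rL (snd p) (g \<xi>) n (g \<beta>) k)"
    unfolding fun_eq_iff rL_def mem by blast
  have C: "rC (snd (move j p)) = (\<lambda>\<xi> n \<beta> k. \<xi> \<in> j ` fst p \<and> \<beta> \<in> j ` fst p \<and> rC (snd p) (g \<xi>) n (g \<beta>) k)"
    unfolding fun_eq_iff rC_def mem by blast
  have "small (fst (move j p))" "small (snd (move j p))"
    using tree_okD(1,2)[OF p] small_image by (simp_all add: snd_move)
  moreover have "snd (move j p) \<subseteq> fst (move j p) \<times> fst (move j p) \<times> tree_indices"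
  proof
    fix t assume t: "t \<in> snd (move j p)"
    obtain a b c where "t = (a, b, c)" by (cases t)
    then show "t \<in> fst (move j p) \<times> fst (move j p) \<times> tree_indices"
      using t mem[of a b c] tree_okD(3)[OF p] by auto
  qed
  ultimately show ?thesis unfolding tree_ok_def L C using T by simp
qed

lemma tree_ok_join:
  assumes sm: "small \<C>" and ok: "\<And>p. p \<in> \<C> \<Longrightarrow> tree_ok p"
    and chain: "\<And>p q. p \<in> \<C> \<Longrightarrow> q \<in> \<C> \<Longrightarrow> p \<sqsubseteq> q \<or> q \<sqsubseteq> p"
  shows "tree_ok (join \<C>)"
proof -
  have mono: "fst p \<subseteq> fst q \<and> rL (snd p) \<le> rL (snd q) \<and> rC (snd p) \<le> rC (snd q)" if "p \<sqsubseteq> q" for p q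
    using that unfolding weaker_def le_fun_def rL_def rC_def le_bool_def by blast
  have T: "T_rel (\<Union>p\<in>\<C>. fst p) (\<lambda>\<xi> n \<beta> k. \<exists>p\<in>\<C>. rL (snd p) \<xi> n \<beta> k) (\<lambda>\<alpha> \<delta> \<beta> j. \<exists>p\<in>\<C>. rC (snd p) \<alpha> \<delta> \<beta> j)"
  proof (rule tree_rel_Union)
    show "T_rel (fst p) (rL (snd p)) (rC (snd p))" if "p \<in> \<C>" for p using tree_okD(4)[OF ok[OF that]] .
    show "(fst p \<subseteq> fst q \<and> rL (snd p) \<le> rL (snd q) \<and> rC (snd p) \<le> rC (snd q)) \<or>
      (fst q \<subseteq> fst p \<and> rL (snd q) \<le> rL (snd p) \<and> rC (snd q) \<le> rC (snd p))" if "p \<in> \<C>" "q \<in> \<C>" for p q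
      using chain[OF that] mono[of p q] mono[of q p] by blast
  qed
  have L: "rL (snd (join \<C>)) = (\<lambda>\<xi> n \<beta> k. \<exists>p\<in>\<C>. rL (snd p) \<xi> n \<beta> k)"
    and C: "rC (snd (join \<C>)) = (\<lambda>\<xi> n \<beta> k. \<exists>p\<in>\<C>. rC (snd p) \<xi> n \<beta> k)"
    unfolding fun_eq_iff rL_def rC_def snd_join by blast+
  have "small (\<Union> (fst ` \<C>))" "small (\<Union> (snd ` \<C>))"
    using sm ok tree_okD(1,2) by (intro small_UN, blast, blast)+
  moreover have "snd (join \<C>) \<subseteq> fst (join \<C>) \<times> fst (join \<C>) \<times> tree_indices"
  proof
    fix t assume "t \<in> snd (join \<C>)"
    then obtain p where p: "p \<in> \<C>" "t \<in> snd p" unfolding snd_join by blast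
    then show "t \<in> fst (join \<C>) \<times> fst (join \<C>) \<times> tree_indices"
      using tree_okD(3)[OF ok[OF p(1)]] unfolding fst_join by blast
  qed
  ultimately show ?thesis unfolding tree_ok_def L C using T by (simp add: fst_join snd_join)
qed

lemma tree_ok_amalgam:
  assumes u: "tree_ok u" and r: "tree_ok r" "fst r \<subseteq> {..<\<sigma>}" and ur: "cut u {..<\<sigma>} \<sqsubseteq> r"
    and gap: "\<And>\<xi>. \<xi> \<in> fst r \<Longrightarrow> \<exists>\<eta>\<in>fst u. \<eta> < \<sigma> \<and> \<xi> \<le> \<eta>"
    and y: "small y" "fst u \<subseteq> y" "y \<inter> {..<\<sigma>} = fst r"
  shows "\<exists>q. tree_ok q \<and> fst q = y \<and> u \<sqsubseteq> q \<and> cut q {..<\<sigma>} = r"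
proof -
  have sub: "fst u \<inter> {..<\<sigma>} \<subseteq> fst r" using ur unfolding weaker_def by simp
  have low: "(\<xi>, \<beta>, c) \<in> snd r" if "(\<xi>, \<beta>, c) \<in> snd u" "\<xi> < \<sigma>" "\<beta> < \<sigma>" for \<xi> \<beta> c
  proof -
    have "(\<xi>, \<beta>, c) \<in> snd (cut u {..<\<sigma>})" using that unfolding snd_cut by simp
    then show ?thesis using ur unfolding weaker_def by blast
  qed
  have Lur: "rL (snd r) \<xi> n \<beta> k" if "rL (snd u) \<xi> n \<beta> k" "\<xi> < \<sigma>" "\<beta> < \<sigma>" for \<xi> n \<beta> k
    using low that unfolding rL_def by blast
  have Cur: "rC (snd r) \<xi> n \<beta> k" if "rC (snd u) \<xi> n \<beta> k" "\<xi> < \<sigma>" "\<beta> < \<sigma>" for \<xi> n \<beta> k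
    using low that unfolding rC_def by blast
  have ex: "\<exists>L C. T_rel y L C \<and> rL (snd u) \<le> L \<and> rC (snd u) \<le> C \<and>
    (\<forall>\<xi> n \<beta> k. \<xi> < \<sigma> \<and> \<beta> < \<sigma> \<longrightarrow> L \<xi> n \<beta> k = rL (snd r) \<xi> n \<beta> k) \<and>
    (\<forall>\<xi> n \<beta> k. \<xi> < \<sigma> \<and> \<beta> < \<sigma> \<longrightarrow> C \<xi> n \<beta> k = rC (snd r) \<xi> n \<beta> k) \<and>
    (\<forall>\<xi> n \<beta> k. L \<xi> n \<beta> k \<longrightarrow> (\<exists>\<xi>' n' \<beta>'. rL (snd u) \<xi>' n' \<beta>' k \<or> rL (snd r) \<xi>' n' \<beta>' k) \<and>
      (\<exists>\<xi>' k' \<beta>'. rL (snd u) \<xi>' n \<beta>' k' \<or> rL (snd r) \<xi>' n \<beta>' k')) \<and>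
    (\<forall>\<xi> n \<beta> k. C \<xi> n \<beta> k \<longrightarrow> (\<exists>\<alpha>' \<beta>'. rC (snd u) \<alpha>' n \<beta>' k \<or> rC (snd r) \<alpha>' n \<beta>' k))"
    by (rule tree_rel_amalgam[OF tree_okD(4)[OF u] tree_okD(4)[OF r(1)] r(2) sub])
      (use Lur Cur gap y(2,3) in blast)+
  obtain L C where T: "T_rel y L C" and LC: "rL (snd u) \<le> L" "rC (snd u) \<le> C"
    and eq: "\<And>\<xi> n \<beta> k. \<xi> < \<sigma> \<Longrightarrow> \<beta> < \<sigma> \<Longrightarrow> L \<xi> n \<beta> k = rL (snd r) \<xi> n \<beta> k"
      "\<And>\<xi> n \<beta> k. \<xi> < \<sigma> \<Longrightarrow> \<beta> < \<sigma> \<Longrightarrow> C \<xi> n \<beta> k = rC (snd r) \<xi> n \<beta> k"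
    and iL: "\<And>\<xi> n \<beta> k. L \<xi> n \<beta> k \<Longrightarrow>
        (\<exists>\<xi>' n' \<beta>'. rL (snd u) \<xi>' n' \<beta>' k \<or> rL (snd r) \<xi>' n' \<beta>' k) \<and> (\<exists>\<xi>' k' \<beta>'. rL (snd u) \<xi>' n \<beta>' k' \<or> rL (snd r) \<xi>' n \<beta>' k')"
    and iC: "\<And>\<xi> n \<beta> k. C \<xi> n \<beta> k \<Longrightarrow> (\<exists>\<alpha>' \<beta>'. rC (snd u) \<alpha>' n \<beta>' k \<or> rC (snd r) \<alpha>' n \<beta>' k)"
    using ex by (elim exE conjE) (rule that, assumption, assumption, assumption, blast+)
  define I where "I = idx (snd u) \<union> idx (snd r)"
  have I: "small I" "I \<subseteq> {..<\<kappa>}"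
    unfolding I_def using small_Un[OF small_idx[OF tree_okD(2)[OF u]] small_idx[OF tree_okD(2)[OF r(1)]]]
      tree_ok_idx[OF u] tree_ok_idx[OF r(1)] by blast+
  have "tree_ok (y, atoms L C)"
  proof (rule tree_okI[OF y(1) T I(1)])
    fix \<xi> n \<beta> k
    show "n \<in> I \<and> k \<in> I \<and> n < \<kappa> \<and> k < \<kappa>" if "L \<xi> n \<beta> k"
    proof -
      have "n \<in> I" "k \<in> I" unfolding I_def using iL[OF that] idx_rL by blast+
      then show ?thesis using I(2) by auto
    qed
    show "n \<in> I \<and> k \<in> I \<and> n < \<kappa>" if "C \<xi> n \<beta> k"
    proof -
      have "n \<in> I" "k \<in> I" unfolding I_def using iC[OF that] idx_rC by blast+
      then show ?thesis using I(2) by auto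
    qed
  qed
  moreover have "u \<sqsubseteq> (y, atoms L C)"
  proof -
    have "snd u \<inter> (UNIV \<times> UNIV \<times> UNIV) \<subseteq> atoms L C"
      using LC by (intro subset_atoms) (auto simp: le_fun_def)
    then show ?thesis using y(2) unfolding weaker_def by simp
  qed
  moreover have "cut (y, atoms L C) {..<\<sigma>} = r"
  proof -
    have mem: "(a, b, c, n, k) \<in> atoms L C \<inter> ({..<\<sigma>} \<times> {..<\<sigma>} \<times> UNIV) \<longleftrightarrow> (a, b, c, n, k) \<in> snd r" for a b c n k
    proof (cases "a < \<sigma> \<and> b < \<sigma>")
      case True
      then show ?thesis using eq[of a b n k] by (cases c) (auto simp: atoms_def rL_def rC_def)
    next
      case False
      then show ?thesis using tree_okD(3)[OF r(1)] r(2) by auto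
    qed
    have "atoms L C \<inter> ({..<\<sigma>} \<times> {..<\<sigma>} \<times> UNIV) = snd r"
      by (intro set_eqI) (metis mem prod_cases5)
    then show ?thesis using y(3) unfolding cut_def by (simp add: prod_eq_iff)
  qed
  ultimately show ?thesis by (metis fst_conv)
qed

text \<open>Here \<open>s\<close> has levels between the old levels below \<alpha> and the next old
  level \<open>\<beta>0\<close>, and every node \<open>t\<close> at \<open>\<beta>0\<close> needs a
  branch through \<open>s\<close>. The branch must contain \<open>bs t\<close>, which is dictated by
  \<open>u\<close>. Moreover, if a vector at \<open>\<beta>0\<close> and a vector of
  \<open>s\<close> in the gap share a colour over some level, then many coordinates of the former
  must pass above the latter. Comparability at the last old level provides \<lambda> many candidates
  for each such demand, and a disjoint refinement gives each demand nodes of its own.\<close>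

lemma tree_ok_gap_step:
  assumes u: "tree_ok u" and cl: "closed_in_sup (fst u)" and s: "tree_ok s" "fst s \<subseteq> {..<\<alpha>}"
    and us: "cut u {..<\<alpha>} \<sqsubseteq> s"
    and \<beta>0: "\<beta>0 \<in> fst u" "\<alpha> \<le> \<beta>0" "\<And>\<beta>. \<beta> \<in> fst u \<Longrightarrow> \<alpha> \<le> \<beta> \<Longrightarrow> \<beta>0 \<le> \<beta>"
    and \<zeta>0: "\<zeta>0 \<in> fst s" "\<And>\<eta>. \<eta> \<in> fst u \<Longrightarrow> \<eta> < \<alpha> \<Longrightarrow> \<eta> < \<zeta>0"
  shows "\<exists>s'. tree_ok s' \<and> fst s' = insert \<beta>0 (fst s) \<and> s \<sqsubseteq> s' \<and> cut u {..<osuc \<beta>0} \<sqsubseteq> s'"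
proof -
  define xu xs Lu Ls Cu Cs where defs: "xu = fst u" "xs = fst s" "Lu = rL (snd u)" "Ls = rL (snd s)"
    "Cu = rC (snd u)" "Cs = rC (snd s)"
  interpret u: tree_rel lam \<kappa> e xu Lu Cu using tree_okD(4)[OF u] unfolding defs .
  interpret s: tree_rel lam \<kappa> e xs Ls Cs using tree_okD(4)[OF s(1)] unfolding defs .
  have xs_lt: "\<xi> < \<alpha>" if "\<xi> \<in> xs" for \<xi> using that s(2) unfolding defs by blast
  have xus: "\<xi> \<in> xs" if "\<xi> \<in> xu" "\<xi> < \<alpha>" for \<xi> using us that unfolding defs weaker_def by auto
  have low: "(\<xi>, \<beta>, c) \<in> snd s" if "(\<xi>, \<beta>, c) \<in> snd u" "\<xi> < \<alpha>" "\<beta> < \<alpha>" for \<xi> \<beta> c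
  proof -
    have "(\<xi>, \<beta>, c) \<in> snd (cut u {..<\<alpha>})" using that unfolding snd_cut by simp
    then show ?thesis using us unfolding weaker_def by blast
  qed
  have Lus: "Ls \<xi> n \<beta> k" if "Lu \<xi> n \<beta> k" "\<beta> < \<alpha>" for \<xi> n \<beta> k
    using low[of \<xi> \<beta>] u.L_le[OF that(1)] that unfolding defs rL_def by (meson le_less_trans)
  have Cus: "Cs \<xi> n \<beta> k" if "Cu \<xi> n \<beta> k" "\<beta> < \<alpha>" for \<xi> n \<beta> k
    using low[of \<xi> \<beta>] u.C_levels[OF that(1)] that unfolding defs rC_def by (meson le_less_trans)
  have \<beta>0u: "\<beta>0 \<in> xu" using \<beta>0 unfolding defs by blast
  have lt\<beta>0: "\<xi> < \<beta>0" if "\<xi> < \<alpha>" for \<xi> using that \<beta>0(2) by simp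
  \<comment> \<open>The only use of closedness: the supremum of the old levels below \<alpha> is at
    most \<open>\<zeta>0\<close>, hence below \<alpha>; if it were not attained, it would be a limit
    point missing from \<open>u\<close>.\<close>
  have ex_max: "\<exists>m\<in>xu. m < \<alpha> \<and> (\<forall>\<eta>\<in>xu. \<eta> < \<alpha> \<longrightarrow> \<eta> \<le> m)" if ne: "\<eta>0 \<in> xu" "\<eta>0 < \<alpha>" for \<eta>0
  proof -
    define \<mu> where "\<mu> = osup (xu \<inter> {..<\<alpha>})"
    have ub: "\<exists>\<beta>. \<forall>\<xi>\<in>xu \<inter> {..<\<alpha>}. \<xi> \<le> \<beta>" by (auto intro: less_imp_le)
    have le: "\<eta> \<le> \<mu>" if "\<eta> \<in> xu" "\<eta> < \<alpha>" for \<eta> unfolding \<mu>_def using that by (intro osup_ub[OF ub]) simp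
    have "\<mu> \<le> \<zeta>0" unfolding \<mu>_def using \<zeta>0(2) unfolding defs by (intro osup_le) (auto intro: less_imp_le)
    moreover have "\<zeta>0 < \<alpha>" using xs_lt \<zeta>0(1) unfolding defs by blast
    ultimately have "\<mu> < \<alpha>" by simp
    have "\<mu> \<in> xu"
    proof (rule ccontr)
      assume n: "\<mu> \<notin> xu"
      then have lt: "\<eta> < \<mu>" if "\<eta> \<in> xu" "\<eta> < \<alpha>" for \<eta>
        using le[OF that] that(1) by (auto simp: order.order_iff_strict)
      have "is_limit_of \<mu> xu" unfolding is_limit_of_iff
      proof (intro conjI allI impI)
        show "\<exists>\<beta>. \<beta> < \<mu>" using lt[OF ne] by blast
        fix \<gamma> assume "\<gamma> < \<mu>"
        then obtain \<xi> where "\<xi> \<in> xu \<inter> {..<\<alpha>}" "\<gamma> < \<xi>" unfolding \<mu>_def using less_osup by blast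
        then show "\<exists>\<xi>\<in>xu. \<gamma> < \<xi> \<and> \<xi> < \<mu>" using lt by blast
      qed
      then have "\<mu> \<in> xu" using cl \<beta>0u lt\<beta>0[OF \<open>\<mu> < \<alpha>\<close>] unfolding closed_in_sup_def defs by blast
      then show False using n by blast
    qed
    then show ?thesis using \<open>\<mu> < \<alpha>\<close> le by blast
  qed
  define N where "N = {k. Lu \<beta>0 k \<beta>0 k}"
  have "N \<subseteq> idx (snd u)" unfolding N_def defs using idx_rL by blast
  then have smN: "small N" using small_subset[OF small_idx[OF tree_okD(2)[OF u]]] by blast
  \<comment> \<open>All that \<open>u\<close> and \<open>s\<close> together already say about the
    branch below \<open>t\<close>: the nodes of \<open>s\<close> below the old predecessors of
    \<open>t\<close>.\<close>
  define bs where "bs t = {(\<xi>, n). \<exists>\<mu>\<in>xu. \<mu> < \<alpha> \<and> (\<exists>m. Ls \<xi> n \<mu> m \<and> Lu \<mu> m \<beta>0 t)}" for t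
  have bs_node: "Ls \<xi> n \<xi> n" if "(\<xi>, n) \<in> bs t" for \<xi> n t using that s.L_nodes unfolding bs_def by blast
  have bs_chain: "Ls \<xi> n \<xi>' n'" if b: "(\<xi>, n) \<in> bs t" "(\<xi>', n') \<in> bs t" and le: "\<xi> \<le> \<xi>'" for \<xi> n \<xi>' n' t
  proof -
    obtain \<mu> m where m: "\<mu> \<in> xu" "\<mu> < \<alpha>" "Ls \<xi> n \<mu> m" "Lu \<mu> m \<beta>0 t" using b(1) unfolding bs_def by blast
    obtain \<mu>' m' where m': "\<mu>' \<in> xu" "\<mu>' < \<alpha>" "Ls \<xi>' n' \<mu>' m'" "Lu \<mu>' m' \<beta>0 t" using b(2) unfolding bs_def by blast
    show ?thesis
    proof (cases "\<mu> \<le> \<mu>'")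
      case True
      then have "Ls \<mu> m \<mu>' m'" using Lus[OF u.L_below[OF m(4) m'(4)] m'(2)] by blast
      then show ?thesis using s.L_below[OF s.L_trans[OF m(3)] m'(3) le] by blast
    next
      case False
      then have "\<mu>' \<le> \<mu>" by simp
      then have "Ls \<mu>' m' \<mu> m" using Lus[OF u.L_below[OF m'(4) m(4)] m(2)] by blast
      then show ?thesis using s.L_below[OF m(3) s.L_trans[OF m'(3)] le] by blast
    qed
  qed
  \<comment> \<open>A demand: a vector \<open>j\<close> at \<open>\<beta>0\<close> and a vector
    \<open>j1\<close> at a level \<open>\<zeta>\<close> in the gap, with the same colour over the
    same level. If \<open>\<zeta>\<close> is not above all old levels, the comparison will be
    inherited from an old level above it.\<close>
  define Dm where "Dm = {(\<alpha>', \<delta>, j, \<zeta>, j1). Cu \<alpha>' \<delta> \<beta>0 j \<and> Cs \<alpha>' \<delta> \<zeta> j1 \<and> (\<forall>\<eta>\<in>xu. \<eta> < \<alpha> \<longrightarrow> \<eta> < \<zeta>)}"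
  have "Dm \<subseteq> (\<lambda>((a, b, c, \<delta>, j), (a', \<zeta>, c', \<delta>', j1)). (a, \<delta>, j, \<zeta>, j1)) ` (snd u \<times> snd s)"
    unfolding Dm_def defs rC_def by force
  moreover have "small (snd u \<times> snd s)" using tree_okD(2) u s(1) small_times by blast
  ultimately have smD: "small Dm" using small_subset[OF small_image] by blast
  \<comment> \<open>The nodes of the vector \<open>j\<close> whose branch can pass through the
    corresponding node of \<open>j1\<close> without contradicting \<open>bs\<close>.\<close>
  define Y where "Y d = (case d of (\<alpha>', \<delta>, j, \<zeta>, j1) \<Rightarrow>
    e j ` {i. i < lam \<and> (\<forall>\<xi> n. (\<xi>, n) \<in> bs (e j i) \<longrightarrow> Ls \<xi> n \<zeta> (e j1 i))})" for d :: "'i \<times> 'i \<times> 'i \<times> 'i \<times> 'i"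
  have Y: "{..<lam} \<lesssim> Y d" if d: "d \<in> Dm" for d
  proof -
    obtain \<alpha>' \<delta> j \<zeta> j1 where dd: "d = (\<alpha>', \<delta>, j, \<zeta>, j1)" by (cases d)
    then have c: "Cu \<alpha>' \<delta> \<beta>0 j" "Cs \<alpha>' \<delta> \<zeta> j1" "\<And>\<eta>. \<eta> \<in> xu \<Longrightarrow> \<eta> < \<alpha> \<Longrightarrow> \<eta> < \<zeta>" using d unfolding Dm_def by blast+
    have a: "\<alpha>' \<in> xu" "\<alpha>' < \<alpha>" "j < \<kappa>" using u.C_levels[OF c(1)] s.C_levels[OF c(2)] xs_lt by blast+
    obtain m where m: "m \<in> xu" "m < \<alpha>" "\<And>\<eta>. \<eta> \<in> xu \<Longrightarrow> \<eta> < \<alpha> \<Longrightarrow> \<eta> \<le> m" using ex_max[OF a(1,2)] by blast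
    \<comment> \<open>The projection of \<open>j\<close> to the last old level has the same colour
      as \<open>j1\<close>, and both are vectors of \<open>s\<close>; so \<open>s\<close> compares
      them at many coordinates.\<close>
    obtain jm where jm: "Cu \<alpha>' \<delta> m jm" "\<forall>i<lam. Lu m (e jm i) \<beta>0 (e j i)"
      using u.C_down[OF c(1) m(1) m(3)[OF a(1,2)] less_imp_le[OF lt\<beta>0[OF m(2)]]] by blast
    have "many (\<lambda>i. Ls m (e jm i) \<zeta> (e j1 i))"
      using s.C_many[OF Cus[OF jm(1) m(2)] c(2) less_imp_le[OF c(3)[OF m(1,2)]]] .
    then have "many (\<lambda>i. \<forall>\<xi> n. (\<xi>, n) \<in> bs (e j i) \<longrightarrow> Ls \<xi> n \<zeta> (e j1 i))"
    proof (rule many_mono)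
      fix i assume i: "i < lam" "Ls m (e jm i) \<zeta> (e j1 i)"
      show "\<forall>\<xi> n. (\<xi>, n) \<in> bs (e j i) \<longrightarrow> Ls \<xi> n \<zeta> (e j1 i)"
      proof (intro allI impI)
        fix \<xi> n assume "(\<xi>, n) \<in> bs (e j i)"
        then obtain \<mu> k where k: "\<mu> \<in> xu" "\<mu> < \<alpha>" "Ls \<xi> n \<mu> k" "Lu \<mu> k \<beta>0 (e j i)" unfolding bs_def by blast
        have "Lu \<mu> k m (e jm i)" using u.L_below[OF k(4) _ m(3)[OF k(1,2)]] jm(2) i(1) by blast
        then have "Ls \<mu> k m (e jm i)" using Lus m(2) by blast
        then show "Ls \<xi> n \<zeta> (e j1 i)" using s.L_trans[OF s.L_trans[OF k(3)] i(2)] by blast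
      qed
    qed
    then have l: "{..<lam} \<lesssim> {i. i < lam \<and> (\<forall>\<xi> n. (\<xi>, n) \<in> bs (e j i) \<longrightarrow> Ls \<xi> n \<zeta> (e j1 i))}"
      (is "_ \<lesssim> ?S") unfolding many_def .
    have "?S \<subseteq> {..<lam}" by auto
    then have "inj_on (e j) ?S" using inj_on_subset[OF e_inj[OF a(3)]] by blast
    then have "?S \<lesssim> e j ` ?S" unfolding lepoll_def by blast
    then show ?thesis using lepoll_trans[OF l] unfolding Y_def dd by simp
  qed
  obtain Z where Z: "\<And>d. d \<in> Dm \<Longrightarrow> Z d \<subseteq> Y d" "\<And>d. d \<in> Dm \<Longrightarrow> {..<lam} \<lesssim> Z d"
    "\<And>d d'. d \<in> Dm \<Longrightarrow> d' \<in> Dm \<Longrightarrow> Z d \<inter> Z d' \<noteq> {} \<Longrightarrow> d = d'"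
  proof (rule disjoint_refinement[OF smD, of Y])
    show "{..<lam} \<lesssim> Y d" if "d \<in> Dm" for d using Y[OF that] .
  qed blast
  \<comment> \<open>A branch of \<open>s\<close>, closed downward, that contains \<open>bs t\<close>
    and meets the demand, if any, to which \<open>t\<close> has been allotted. It may end before the
    top of \<open>s\<close>.\<close>
  define good where "good t B \<longleftrightarrow> (\<forall>\<xi> n. (\<xi>, n) \<in> B \<longrightarrow> Ls \<xi> n \<xi> n) \<and>
    (\<forall>\<xi> n \<xi>' n'. (\<xi>, n) \<in> B \<longrightarrow> (\<xi>', n') \<in> B \<longrightarrow> \<xi> \<le> \<xi>' \<longrightarrow> Ls \<xi> n \<xi>' n') \<and>
    (\<forall>\<xi> \<xi>' n'. (\<xi>', n') \<in> B \<longrightarrow> \<xi> \<in> xs \<longrightarrow> \<xi> \<le> \<xi>' \<longrightarrow> (\<exists>n. (\<xi>, n) \<in> B)) \<and> bs t \<subseteq> B \<and>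
    (\<forall>\<alpha>' \<delta> j \<zeta> j1 i. (\<alpha>', \<delta>, j, \<zeta>, j1) \<in> Dm \<longrightarrow> i < lam \<longrightarrow> e j i = t \<longrightarrow> t \<in> Z (\<alpha>', \<delta>, j, \<zeta>, j1) \<longrightarrow>
      (\<zeta>, e j1 i) \<in> B)" for t B
  have ex_good: "\<exists>B. good t B" for t
  proof (cases "\<exists>d\<in>Dm. t \<in> Z d")
    case True
    then obtain \<alpha>' \<delta> j \<zeta> j1 where d: "(\<alpha>', \<delta>, j, \<zeta>, j1) \<in> Dm" "t \<in> Z (\<alpha>', \<delta>, j, \<zeta>, j1)" by auto
    then have "t \<in> Y (\<alpha>', \<delta>, j, \<zeta>, j1)" using Z(1) by blast
    then obtain i where i: "i < lam" "t = e j i" "\<And>\<xi> n. (\<xi>, n) \<in> bs t \<Longrightarrow> Ls \<xi> n \<zeta> (e j1 i)"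
      unfolding Y_def by auto
    have c: "Cu \<alpha>' \<delta> \<beta>0 j" "Cs \<alpha>' \<delta> \<zeta> j1" using d(1) unfolding Dm_def by blast+
    have jk: "j < \<kappa>" using u.C_levels[OF c(1)] by blast
    have "good t {(\<xi>, n). Ls \<xi> n \<zeta> (e j1 i)}"
      unfolding good_def
    proof (intro conjI allI impI)
      show "bs t \<subseteq> {(\<xi>, n). Ls \<xi> n \<zeta> (e j1 i)}" using i(3) by auto
      fix \<xi> n assume "(\<xi>, n) \<in> {(\<xi>, n). Ls \<xi> n \<zeta> (e j1 i)}"
      then have l: "Ls \<xi> n \<zeta> (e j1 i)" by simp
      then show "Ls \<xi> n \<xi> n" using s.L_nodes by blast
      show "Ls \<xi> n \<xi>' n'" if "(\<xi>', n') \<in> {(\<xi>, n). Ls \<xi> n \<zeta> (e j1 i)}" "\<xi> \<le> \<xi>'" for \<xi>' n'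
        using s.L_below[OF l] that by blast
      show "\<exists>n. (\<xi>', n) \<in> {(\<xi>, n). Ls \<xi> n \<zeta> (e j1 i)}" if "\<xi>' \<in> xs" "\<xi>' \<le> \<xi>" for \<xi>'
      proof -
        have "Ls \<xi> n \<xi> n" using s.L_nodes[OF l] by blast
        then obtain n' where "Ls \<xi>' n' \<xi> n" using s.L_full \<open>\<xi>' \<in> xs\<close> \<open>\<xi>' \<le> \<xi>\<close> by blast
        then show ?thesis using s.L_trans[OF _ l] by blast
      qed
    next
      \<comment> \<open>By disjointness \<open>t\<close> serves one demand only, and by injectivity
        it is a single coordinate of its vector; hence no second requirement arises.\<close>
      fix \<alpha>2 \<delta>2 j2 \<zeta>2 j12 i2
      assume d2: "(\<alpha>2, \<delta>2, j2, \<zeta>2, j12) \<in> Dm" "i2 < lam" "e j2 i2 = t" "t \<in> Z (\<alpha>2, \<delta>2, j2, \<zeta>2, j12)"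
      then have "(\<alpha>2, \<delta>2, j2, \<zeta>2, j12) = (\<alpha>', \<delta>, j, \<zeta>, j1)" using Z(3)[OF d2(1) d(1)] d(2) by blast
      then have eq: "j2 = j" "\<zeta>2 = \<zeta>" "j12 = j1" by simp_all
      have "i2 = i" using inj_onD[OF e_inj[OF jk], of i2 i] d2 i eq by simp
      then show "(\<zeta>2, e j12 i2) \<in> {(\<xi>, n). Ls \<xi> n \<zeta> (e j1 i)}" using eq s.C_nodes[OF c(2) i(1)] by simp
    qed
    then show ?thesis by blast
  next
    case False
    have "good t (bs t)"
      unfolding good_def
    proof (intro conjI allI impI order_refl)
      fix \<xi> n assume b: "(\<xi>, n) \<in> bs t"
      show "Ls \<xi> n \<xi> n" using bs_node[OF b] .
      show "Ls \<xi> n \<xi>' n'" if "(\<xi>', n') \<in> bs t" "\<xi> \<le> \<xi>'" for \<xi>' n' using bs_chain[OF b that] .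
      show "\<exists>n. (\<xi>', n) \<in> bs t" if x: "\<xi>' \<in> xs" "\<xi>' \<le> \<xi>" for \<xi>'
      proof -
        obtain n' where "Ls \<xi>' n' \<xi> n" using s.L_full[OF bs_node[OF b] x] by blast
        then show ?thesis using b s.L_trans unfolding bs_def by blast
      qed
    qed (use False in blast)
    then show ?thesis by blast
  qed
  define B0 where "B0 t = (SOME B. good t B)" for t
  have good_B0: "good t (B0 t)" for t unfolding B0_def using someI_ex[OF ex_good] .
  note B0_good = good_B0[unfolded good_def]
  have B0: "(\<xi>, n) \<in> B0 t \<Longrightarrow> Ls \<xi> n \<xi> n"
    "(\<xi>, n) \<in> B0 t \<Longrightarrow> (\<xi>', n') \<in> B0 t \<Longrightarrow> \<xi> \<le> \<xi>' \<Longrightarrow> Ls \<xi> n \<xi>' n'"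
    "(\<xi>', n') \<in> B0 t \<Longrightarrow> \<xi> \<in> xs \<Longrightarrow> \<xi> \<le> \<xi>' \<Longrightarrow> \<exists>n. (\<xi>, n) \<in> B0 t"
    "bs t \<subseteq> B0 t" for t \<xi> n \<xi>' n'
    using B0_good[of t, THEN conjunct1] B0_good[of t, THEN conjunct2, THEN conjunct1]
      B0_good[of t, THEN conjunct2, THEN conjunct2, THEN conjunct1]
      B0_good[of t, THEN conjunct2, THEN conjunct2, THEN conjunct2, THEN conjunct1] by metis+
  have B0_Dm: "(\<zeta>, e j1 i) \<in> B0 (e j i)"
    if "(\<alpha>', \<delta>, j, \<zeta>, j1) \<in> Dm" "i < lam" "e j i \<in> Z (\<alpha>', \<delta>, j, \<zeta>, j1)" for \<alpha>' \<delta> j \<zeta> j1 i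
    using B0_good[of "e j i", THEN conjunct2, THEN conjunct2, THEN conjunct2, THEN conjunct2] that by metis
  \<comment> \<open>The levels of \<open>s\<close> that the branch does not reach. It is continued
    there by new nodes, all of them named \<open>g t\<close>.\<close>
  define E where "E t = {\<eta> \<in> xs. \<forall>\<xi> n. (\<xi>, n) \<in> B0 t \<longrightarrow> \<xi> < \<eta>}" for t
  have smI: "small (idx (snd s))" using small_idx[OF tree_okD(2)[OF s(1)]] .
  obtain g where g: "inj_on g N" "g ` N \<subseteq> {..<\<kappa>} - idx (snd s)" using ex_fresh_inj[OF smI smN] by blast
  have gk: "g t < \<kappa>" "g t \<notin> idx (snd s)" if "t \<in> N" for t using g(2) that by blast+
  have E_full: "(\<exists>n. (\<xi>, n) \<in> B0 t) \<or> \<xi> \<in> E t" if x: "\<xi> \<in> xs" for \<xi> t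
  proof (cases "\<exists>\<xi>' n'. (\<xi>', n') \<in> B0 t \<and> \<xi> \<le> \<xi>'")
    case True
    then show ?thesis using B0(3)[OF _ x] by blast
  next
    case False
    then have "\<xi>' < \<xi>" if "(\<xi>', n') \<in> B0 t" for \<xi>' n' using that by (meson not_le)
    then show ?thesis using x unfolding E_def by blast
  qed
  define L2 where "L2 \<xi> n \<beta> k \<longleftrightarrow> Ls \<xi> n \<beta> k \<or>
    (\<exists>t\<in>N. \<beta> \<in> E t \<and> k = g t \<and> ((\<xi>, n) \<in> B0 t \<or> (\<xi> \<in> E t \<and> \<xi> \<le> \<beta> \<and> n = g t)))" for \<xi> n \<beta> k
  have T2: "T_rel xs L2 Cs"
    unfolding L2_def
  proof (rule tree_rel_add_branches[where f = "\<lambda>t _. g t"])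
    show "T_rel xs Ls Cs" by (rule s.tree_rel_axioms)
    show "E t \<subseteq> xs" for t unfolding E_def by blast
    show "Ls \<xi> n \<xi> n" if "(\<xi>, n) \<in> B0 t" for t \<xi> n using B0(1)[OF that] .
    show "\<xi> < \<eta>" if "(\<xi>, n) \<in> B0 t" "\<eta> \<in> E t" for t \<xi> n \<eta> using that unfolding E_def by blast
    show "Ls \<xi> n \<xi>' n'" if "(\<xi>, n) \<in> B0 t" "(\<xi>', n') \<in> B0 t" "\<xi> \<le> \<xi>'" for t \<xi> n \<xi>' n' using B0(2)[OF that] .
    show "(\<exists>n. (\<xi>, n) \<in> B0 t) \<or> \<xi> \<in> E t" if "\<xi> \<in> xs" for t \<xi> using E_full[OF that] .
    show "\<not> Ls \<eta> (g t) \<eta> (g t)" if "t \<in> N" for t \<eta> using gk(2)[OF that] idx_rL unfolding defs by blast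
    show "t = t'" if "t \<in> N" "t' \<in> N" "g t = g t'" for t t' using inj_onD[OF g(1) that(3,1,2)] .
  qed
  interpret s2: tree_rel lam \<kappa> e xs L2 Cs by (rule T2)
  define B where "B t = B0 t \<union> {(\<eta>, n). \<eta> \<in> E t \<and> n = g t}" for t
  have B0B: "B0 t \<subseteq> B t" for t unfolding B_def by blast
  have B_node: "L2 \<xi> n \<xi> n" if "t \<in> N" "(\<xi>, n) \<in> B t" for t \<xi> n
    using that B0(1) unfolding B_def L2_def by blast
  have B_chain: "L2 \<xi> n \<xi>' n'" if t: "t \<in> N" and b: "(\<xi>, n) \<in> B t" "(\<xi>', n') \<in> B t" and le: "\<xi> \<le> \<xi>'" for t \<xi> n \<xi>' n'
  proof -
    consider "(\<xi>', n') \<in> B0 t" | "\<xi>' \<in> E t" "n' = g t" using b(2) unfolding B_def by blast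
    then show ?thesis
    proof cases
      case 1
      then have "\<xi> \<notin> E t" using le unfolding E_def by (auto dest: leD)
      then have "(\<xi>, n) \<in> B0 t" using b(1) unfolding B_def by blast
      then show ?thesis using B0(2) 1 le unfolding L2_def by blast
    next
      case 2
      then show ?thesis using b(1) t le unfolding B_def L2_def by blast
    qed
  qed
  have B_full: "\<exists>n. (\<xi>, n) \<in> B t" if "\<xi> \<in> xs" for \<xi> t using E_full[OF that] unfolding B_def by blast
  have D_N: "e j i \<in> N" if "Cu \<alpha>' \<delta> \<beta>0 j" "i < lam" for \<alpha>' \<delta> j i
    using u.C_nodes[OF that] unfolding N_def by blast
  define pr where "pr v \<beta> = name_of (\<lambda>i. THE n. (\<beta>, n) \<in> B (e v i))" for v \<beta>
  define L3 where "L3 \<xi> n \<beta> k \<longleftrightarrow> L2 \<xi> n \<beta> k \<or> (\<beta> = \<beta>0 \<and> k \<in> N \<and> ((\<xi>, n) \<in> B k \<or> (\<xi> = \<beta>0 \<and> n = k)))" for \<xi> n \<beta> k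
  define C3 where "C3 \<alpha>' \<delta> \<beta> j \<longleftrightarrow> Cs \<alpha>' \<delta> \<beta> j \<or> (\<beta> = \<beta>0 \<and> Cu \<alpha>' \<delta> \<beta>0 j) \<or>
    (\<exists>v. Cu \<alpha>' \<delta> \<beta>0 v \<and> \<alpha>' \<in> xs \<and> \<beta> \<in> xs \<and> \<alpha>' \<le> \<beta> \<and> j = pr v \<beta>)" for \<alpha>' \<delta> \<beta> j
  have L2_less: "n < \<kappa> \<and> n \<in> idx (snd s) \<union> g ` N" if "L2 \<xi> n \<xi> n" for \<xi> n
  proof -
    consider "Ls \<xi> n \<xi> n" | t where "t \<in> N" "n = g t" using \<open>L2 \<xi> n \<xi> n\<close> unfolding L2_def by blast
    then show ?thesis
    proof cases
      case 1
      then have "n \<in> idx (snd s)" using idx_rL unfolding defs by blast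
      then show ?thesis using tree_ok_idx[OF s(1)] by auto
    next
      case (2 t)
      then show ?thesis using gk by blast
    qed
  qed
  have T3: "T_rel (insert \<beta>0 xs) L3 C3"
    unfolding L3_def C3_def pr_def
  proof (rule tree_rel_top[OF T2, where D = "\<lambda>\<alpha>' \<delta> j. Cu \<alpha>' \<delta> \<beta>0 j"])
    show "\<xi> < \<beta>0" if "\<xi> \<in> xs" for \<xi> using lt\<beta>0[OF xs_lt[OF that]] .
    show "L2 \<xi> n \<xi> n" if "t \<in> N" "(\<xi>, n) \<in> B t" for t \<xi> n using B_node[OF that] .
    show "L2 \<xi> n \<xi>' n'" if "t \<in> N" "(\<xi>, n) \<in> B t" "(\<xi>', n') \<in> B t" "\<xi> \<le> \<xi>'" for t \<xi> n \<xi>' n'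
      using B_chain[OF that] .
    show "\<exists>n. (\<xi>, n) \<in> B t" if "\<xi> \<in> xs" for \<xi> t using B_full[OF that] .
    show "n < \<kappa>" if "L2 \<xi> n \<xi> n" for \<xi> n using L2_less[OF that] by blast
    show "j < \<kappa> \<and> \<alpha>' \<in> insert \<beta>0 xs \<and> (\<forall>i<lam. e j i \<in> N)" if c: "Cu \<alpha>' \<delta> \<beta>0 j" for \<alpha>' \<delta> j
    proof -
      have *: "\<alpha>' \<in> xu" "j < \<kappa>" "\<alpha>' \<le> \<beta>0" using u.C_levels[OF c] by blast+
      have "\<alpha>' \<in> insert \<beta>0 xs"
      proof (cases "\<alpha>' < \<alpha>")
        case True
        then show ?thesis using xus * by blast
      next
        case False
        then have "\<beta>0 \<le> \<alpha>'" using \<beta>0(3) *(1) unfolding defs by simp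
        then show ?thesis using *(3) by simp
      qed
      then show ?thesis using * D_N[OF c] by blast
    qed
    \<comment> \<open>The level \<open>\<alpha>'\<close> is an old one, so the nodes of the branches
      there are dictated by \<open>u\<close>, where the projection of the vector \<open>j\<close> is
      injective.\<close>
    show "i = i'" if c: "Cu \<alpha>' \<delta> \<beta>0 j" "\<alpha>' \<in> xs" and i: "i < lam" "i' < lam"
      and b: "(\<alpha>', n) \<in> B (e j i)" "(\<alpha>', n) \<in> B (e j i')" for \<alpha>' \<delta> j i i' n
    proof -
      have a: "\<alpha>' \<in> xu" "\<alpha>' < \<alpha>" using u.C_levels[OF c(1)] xs_lt[OF c(2)] by blast+
      obtain j0 where j0: "Cu \<alpha>' \<delta> \<alpha>' j0" "\<forall>i<lam. Lu \<alpha>' (e j0 i) \<beta>0 (e j i)"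
        using u.C_down[OF c(1) a(1) order_refl less_imp_le[OF lt\<beta>0[OF a(2)]]] by blast
      have eq: "n = e j0 k" if k: "k < lam" "(\<alpha>', n) \<in> B (e j k)" for k
      proof -
        have l: "Lu \<alpha>' (e j0 k) \<beta>0 (e j k)" using j0(2) k(1) by blast
        have "Ls \<alpha>' (e j0 k) \<alpha>' (e j0 k)" using Lus[OF _ a(2)] u.L_nodes[OF l] by blast
        then have "(\<alpha>', e j0 k) \<in> bs (e j k)" using l a unfolding bs_def by blast
        then have "(\<alpha>', e j0 k) \<in> B (e j k)" using B0(4) B0B by blast
        then show ?thesis using B_chain[OF D_N[OF c(1) k(1)] k(2) _ order_refl] s2.L_level_eq by blast
      qed
      have "e j0 i = e j0 i'" using eq[OF i(1) b(1)] eq[OF i(2) b(2)] by simp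
      moreover have "j0 < \<kappa>" using u.C_levels[OF j0(1)] by blast
      ultimately show ?thesis using inj_onD[OF e_inj, of j0 i i'] i by simp
    qed
    show "many (\<lambda>i. e j i = e j' i)" if c: "Cu \<alpha>' \<delta> \<beta>0 j" "Cu \<alpha>' \<delta> \<beta>0 j'" for \<alpha>' \<delta> j j'
      by (rule many_mono[OF u.C_many[OF c order_refl]]) (use u.L_level_eq in blast)
    \<comment> \<open>For a level \<open>\<zeta>\<close> in the gap the coordinates allotted to the
      demand suffice. For a level at or below some old \<open>\<eta>\<close>, the vectors are
      compared at \<open>\<eta>\<close> inside \<open>s\<close>, and \<open>bs\<close> carries the
      result to \<open>\<beta>0\<close>.\<close>
    show "many (\<lambda>i. (\<zeta>, e j1 i) \<in> B (e j i))" if c: "Cu \<alpha>' \<delta> \<beta>0 j" "Cs \<alpha>' \<delta> \<zeta> j1" for \<alpha>' \<delta> j \<zeta> j1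
    proof (cases "\<forall>\<eta>\<in>xu. \<eta> < \<alpha> \<longrightarrow> \<eta> < \<zeta>")
      case True
      then have d: "(\<alpha>', \<delta>, j, \<zeta>, j1) \<in> Dm" using c unfolding Dm_def by blast
      have "Z (\<alpha>', \<delta>, j, \<zeta>, j1) \<subseteq> e j ` {i. i < lam \<and> e j i \<in> Z (\<alpha>', \<delta>, j, \<zeta>, j1)}"
      proof
        fix t assume t: "t \<in> Z (\<alpha>', \<delta>, j, \<zeta>, j1)"
        then obtain i where "i < lam" "t = e j i" using Z(1)[OF d] unfolding Y_def by auto
        then show "t \<in> e j ` {i. i < lam \<and> e j i \<in> Z (\<alpha>', \<delta>, j, \<zeta>, j1)}" using t by blast
      qed
      then have "Z (\<alpha>', \<delta>, j, \<zeta>, j1) \<lesssim> {i. i < lam \<and> e j i \<in> Z (\<alpha>', \<delta>, j, \<zeta>, j1)}"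
        by (rule subset_image_lepoll)
      then have "many (\<lambda>i. e j i \<in> Z (\<alpha>', \<delta>, j, \<zeta>, j1))"
        unfolding many_def using lepoll_trans[OF Z(2)[OF d]] by blast
      then show ?thesis by (rule many_mono) (use B0_Dm[OF d] B0B in blast)
    next
      case False
      then obtain \<eta> where \<eta>: "\<eta> \<in> xu" "\<eta> < \<alpha>" "\<zeta> \<le> \<eta>" by (meson not_le)
      have "\<alpha>' \<le> \<eta>" using s.C_levels[OF c(2)] \<eta>(3) by auto
      then obtain j\<eta> where j\<eta>: "Cu \<alpha>' \<delta> \<eta> j\<eta>" "\<forall>i<lam. Lu \<eta> (e j\<eta> i) \<beta>0 (e j i)"
        using u.C_down[OF c(1) \<eta>(1) _ less_imp_le[OF lt\<beta>0[OF \<eta>(2)]]] by blast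
      have "many (\<lambda>i. Ls \<zeta> (e j1 i) \<eta> (e j\<eta> i))" using s.C_many[OF c(2) Cus[OF j\<eta>(1) \<eta>(2)] \<eta>(3)] .
      then show ?thesis
      proof (rule many_mono)
        fix i assume i: "i < lam" "Ls \<zeta> (e j1 i) \<eta> (e j\<eta> i)"
        then have "(\<zeta>, e j1 i) \<in> bs (e j i)" using \<eta> j\<eta>(2) unfolding bs_def by blast
        then show "(\<zeta>, e j1 i) \<in> B (e j i)" using B0(4) B0B by blast
      qed
    qed
  qed
  interpret s3: tree_rel lam \<kappa> e "insert \<beta>0 xs" L3 C3 by (rule T3)
  \<comment> \<open>Besides the old and the fresh names, the names of the projections that
    \<open>tree_rel_top\<close> colours have to be counted.\<close>
  define I where "I = idx (snd s) \<union> g ` N \<union> idx (snd u) \<union> (\<lambda>(v, \<beta>). pr v \<beta>) ` (idx (snd u) \<times> xs)"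
  have smxs: "small xs" using tree_okD(1)[OF s(1)] unfolding defs .
  have smI: "small I" unfolding I_def
    using smI smN small_idx[OF tree_okD(2)[OF u]] smxs by (intro small_Un small_image small_times)
  have iu: "n < \<kappa> \<and> n \<in> I" if "n \<in> idx (snd u) \<union> idx (snd s)" for n
    using that tree_ok_idx[OF u] tree_ok_idx[OF s(1)] unfolding I_def by auto
  have L3_I: "n < \<kappa> \<and> n \<in> I" if "L3 \<xi> n \<xi> n" for \<xi> n
  proof (cases "L2 \<xi> n \<xi> n")
    case True
    then show ?thesis using L2_less unfolding I_def by blast
  next
    case False
    then have "\<xi> = \<beta>0" "n \<in> N" using that unfolding L3_def by blast+
    then have "Lu \<beta>0 n \<beta>0 n" unfolding N_def by blast
    then show ?thesis using iu idx_rL unfolding defs by blast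
  qed
  have ok: "tree_ok (insert \<beta>0 xs, atoms L3 C3)"
  proof (rule tree_okI[OF small_insert[OF smxs] T3 smI])
    show "n \<in> I \<and> k \<in> I \<and> n < \<kappa> \<and> k < \<kappa>" if "L3 \<xi> n \<beta> k" for \<xi> n \<beta> k
      using L3_I s3.L_nodes[OF that] by blast
    show "n \<in> I \<and> k \<in> I \<and> n < \<kappa>" if c: "C3 \<xi> n \<beta> k" for \<xi> n \<beta> k
    proof -
      consider "Cs \<xi> n \<beta> k" | "Cu \<xi> n \<beta>0 k" | v where "Cu \<xi> n \<beta>0 v" "\<beta> \<in> xs" "k = pr v \<beta>"
        using c unfolding C3_def by blast
      then show ?thesis
      proof cases
        case (3 v)
        then have "n \<in> idx (snd u)" "v \<in> idx (snd u)" using idx_rC unfolding defs by blast+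
        moreover have "k \<in> I" using \<open>v \<in> idx (snd u)\<close> 3 unfolding I_def by blast
        ultimately show ?thesis using iu by blast
      next
        case 1
        then have "n \<in> idx (snd s)" "k \<in> idx (snd s)" using idx_rC unfolding defs by blast+
        then show ?thesis using iu by blast
      next
        case 2
        then have "n \<in> idx (snd u)" "k \<in> idx (snd u)" using idx_rC unfolding defs by blast+
        then show ?thesis using iu by blast
      qed
    qed
  qed
  have "s \<sqsubseteq> (insert \<beta>0 xs, atoms L3 C3)"
  proof -
    have "snd s \<inter> (UNIV \<times> UNIV \<times> UNIV) \<subseteq> atoms L3 C3"
      by (rule subset_atoms) (auto simp: L3_def L2_def C3_def defs)
    then show ?thesis unfolding weaker_def defs by auto
  qed
  moreover have "cut u {..<osuc \<beta>0} \<sqsubseteq> (insert \<beta>0 xs, atoms L3 C3)"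
  proof -
    have cases: "\<beta> = \<beta>0 \<or> \<beta> < \<alpha>" if "\<beta> \<in> xu" "\<beta> < osuc \<beta>0" for \<beta>
      using \<beta>0(3)[of \<beta>] that unfolding defs less_osuc_iff by (meson antisym not_le)
    have "snd u \<inter> ({..<osuc \<beta>0} \<times> {..<osuc \<beta>0} \<times> UNIV) \<subseteq> atoms L3 C3"
    proof (rule subset_atoms)
      fix a n b k assume l: "rL (snd u) a n b k" and b: "b \<in> {..<osuc \<beta>0}"
      then have l': "Lu a n b k" unfolding defs by blast
      have lv: "a \<in> xu" "b \<in> xu" "a \<le> b" using u.L_levels[OF l'] u.L_le[OF l'] by blast+
      show "L3 a n b k"
      proof (cases "b < \<alpha>")
        case True
        then show ?thesis using Lus[OF l'] unfolding L3_def L2_def by blast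
      next
        case False
        then have b0: "b = \<beta>0" using cases lv(2) b by blast
        then have kN: "k \<in> N" using u.L_nodes[OF l'] unfolding N_def by blast
        show ?thesis
        proof (cases "a < \<alpha>")
          case True
          have "Ls a n a n" using Lus[OF _ True] u.L_nodes[OF l'] by blast
          then have "(a, n) \<in> bs k" using l' b0 lv(1) True unfolding bs_def by blast
          then have "(a, n) \<in> B k" using B0(4) B0B by blast
          then show ?thesis using b0 kN unfolding L3_def by blast
        next
          case False
          have "a < osuc \<beta>0" using lv(3) b by simp
          then have "a = \<beta>0" using cases[OF lv(1)] False by blast
          then show ?thesis using b0 kN u.L_level_eq[of \<beta>0 n k] l' unfolding L3_def by blast
        qed
      qed
    next
      fix a n b k assume c: "rC (snd u) a n b k" and b: "b \<in> {..<osuc \<beta>0}"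
      then have c': "Cu a n b k" unfolding defs by blast
      then have "b \<in> xu" using u.C_levels by blast
      then consider "b = \<beta>0" | "b < \<alpha>" using cases b by blast
      then show "C3 a n b k"
      proof cases
        case 1
        then show ?thesis using c' unfolding C3_def by simp
      next
        case 2
        then show ?thesis using Cus[OF c'] unfolding C3_def by simp
      qed
    qed
    moreover have "fst u \<inter> {..<osuc \<beta>0} \<subseteq> insert \<beta>0 xs"
      using cases xus unfolding defs by auto
    ultimately show ?thesis unfolding weaker_def snd_cut by simp
  qed
  ultimately show ?thesis using ok unfolding defs by (intro exI[of _ "(insert \<beta>0 (fst s), atoms L3 C3)"]) (simp add: defs)
qed

text \<open>Once \<open>\<beta>0\<close> has been placed on top of the extension, it is an old level
  at or above all others there. So \<open>tree_ok_amalgam\<close> at the bound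
  \<open>osuc \<beta>0\<close> can attach the remaining levels of \<open>u\<close>.\<close>

lemma tree_ok_gap:
  assumes u: "tree_ok u" and cl: "closed_in_sup (fst u)" and s: "tree_ok s" "fst s \<subseteq> {..<\<alpha>}"
    and us: "cut u {..<\<alpha>} \<sqsubseteq> s"
  shows "\<exists>q. tree_ok q \<and> u \<sqsubseteq> q \<and> s \<sqsubseteq> q"
proof -
  have sy: "small (fst u \<union> fst s)" using tree_okD(1) u s(1) small_Un by blast
  have sub: "fst u \<inter> {..<\<alpha>} \<subseteq> fst s" using us unfolding weaker_def by simp
  consider (top) "fst u \<subseteq> {..<\<alpha>}"
    | (nogap) "\<And>\<xi>. \<xi> \<in> fst s \<Longrightarrow> \<exists>\<eta>\<in>fst u. \<eta> < \<alpha> \<and> \<xi> \<le> \<eta>"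
    | (gap) \<beta> \<zeta>0 where "\<beta> \<in> fst u" "\<alpha> \<le> \<beta>" "\<zeta>0 \<in> fst s" "\<And>\<eta>. \<eta> \<in> fst u \<Longrightarrow> \<eta> < \<alpha> \<Longrightarrow> \<eta> < \<zeta>0"
    by (meson lessThan_iff not_le subsetI)
  then show ?thesis
  proof cases
    case top
    have "supported u" using tree_okD(3)[OF u] unfolding supported_def by blast
    then have "u \<sqsubseteq> s" using us cut_id[OF _ top] by simp
    then show ?thesis using s(1) weaker_refl by blast
  next
    case nogap
    obtain q where q: "tree_ok q" "u \<sqsubseteq> q" "cut q {..<\<alpha>} = s"
      using tree_ok_amalgam[OF u s us nogap sy] sub s(2) by blast
    then have "s \<sqsubseteq> q" using cut_weaker by metis
    then show ?thesis using q by blast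
  next
    case gap
    define \<beta>0 where "\<beta>0 = (LEAST \<beta>. \<beta> \<in> fst u \<and> \<alpha> \<le> \<beta>)"
    have \<beta>0: "\<beta>0 \<in> fst u" "\<alpha> \<le> \<beta>0" "\<And>\<beta>. \<beta> \<in> fst u \<Longrightarrow> \<alpha> \<le> \<beta> \<Longrightarrow> \<beta>0 \<le> \<beta>"
      unfolding \<beta>0_def using LeastI[of "\<lambda>\<beta>. \<beta> \<in> fst u \<and> \<alpha> \<le> \<beta>" \<beta>] gap(1,2) by (auto intro: Least_le)
    obtain s' where s': "tree_ok s'" "fst s' = insert \<beta>0 (fst s)" "s \<sqsubseteq> s'" "cut u {..<osuc \<beta>0} \<sqsubseteq> s'"
      using tree_ok_gap_step[OF u cl s us \<beta>0 gap(3,4)] by blast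
    have lt: "\<xi> \<le> \<beta>0" if "\<xi> \<in> fst s'" for \<xi>
    proof -
      have "\<xi> = \<beta>0 \<or> \<xi> < \<alpha>" using that s'(2) s(2) by auto
      then show ?thesis using \<beta>0(2) by auto
    qed
    have *: "fst u \<inter> {..<osuc \<beta>0} \<subseteq> fst s'" using s'(4) unfolding weaker_def by simp
    have "\<exists>q. tree_ok q \<and> fst q = fst u \<union> fst s' \<and> u \<sqsubseteq> q \<and> cut q {..<osuc \<beta>0} = s'"
    proof (rule tree_ok_amalgam[OF u s'(1) _ s'(4)])
      show "fst s' \<subseteq> {..<osuc \<beta>0}" using lt by (auto simp: less_osuc_iff)
      show "\<exists>\<eta>\<in>fst u. \<eta> < osuc \<beta>0 \<and> \<xi> \<le> \<eta>" if "\<xi> \<in> fst s'" for \<xi>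
        using lt[OF that] \<beta>0(1) less_osuc by blast
      show "small (fst u \<union> fst s')" using tree_okD(1) u s'(1) small_Un by blast
      show "(fst u \<union> fst s') \<inter> {..<osuc \<beta>0} = fst s'" using * lt by (auto simp: less_osuc_iff)
    qed simp
    then obtain q where q: "tree_ok q" "u \<sqsubseteq> q" "cut q {..<osuc \<beta>0} = s'" by blast
    then have "s' \<sqsubseteq> q" using cut_weaker by metis
    then show ?thesis using q s'(3) weaker_trans by blast
  qed
qed

lemma tree_amalgamation_class: "amalgamation_class lam \<kappa> tree_ok tree_indices"
proof unfold_locales
  have "(UNIV :: bool set) \<lesssim> {..<\<kappa>}" by (rule finite_lepoll_infinite[OF infinite_kappa]) simp
  then show "tree_indices \<lesssim> {..<\<kappa>}" by (intro times_lepoll_infinite infinite_kappa lepoll_refl)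
  show "small (fst p) \<and> small (snd p)" if "tree_ok p" for p using tree_okD(1,2)[OF that] by blast
  show "snd p \<subseteq> fst p \<times> fst p \<times> tree_indices" if "tree_ok p" for p using tree_okD(3)[OF that] .
  show "tree_ok ({}, {})"
    unfolding tree_ok_def using tree_rel_empty by (simp add: rL_def[abs_def] rC_def[abs_def])
  show "tree_ok (move j p)" if "tree_ok p" "strict_mono_on (fst p) j" for p j using tree_ok_move[OF that] .
  show "tree_ok (cut p Z)" if "tree_ok p" for p Z using tree_ok_cut[OF that] .
  show "tree_ok (join \<C>)"
    if "small \<C>" "\<And>p. p \<in> \<C> \<Longrightarrow> tree_ok p" "\<And>p q. p \<in> \<C> \<Longrightarrow> q \<in> \<C> \<Longrightarrow> p \<sqsubseteq> q \<or> q \<sqsubseteq> p" for \<C>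
    using tree_ok_join[OF that] .
  show "\<exists>q. tree_ok q \<and> fst q = y \<and> u \<sqsubseteq> q \<and> cut q {..<\<sigma>} = r"
    if "tree_ok u" "tree_ok r" "fst r \<subseteq> {..<\<sigma>}" "cut u {..<\<sigma>} \<sqsubseteq> r"
      "\<And>\<xi>. \<xi> \<in> fst r \<Longrightarrow> \<exists>\<eta>\<in>fst u. \<eta> < \<sigma> \<and> \<xi> \<le> \<eta>" "small y" "fst u \<subseteq> y" "y \<inter> {..<\<sigma>} = fst r"
    for u r \<sigma> y using tree_ok_amalgam[OF that] .
  show "\<exists>q. tree_ok q \<and> u \<sqsubseteq> q \<and> s \<sqsubseteq> q"
    if "tree_ok u" "closed_in_sup (fst u)" "tree_ok s" "fst s \<subseteq> {..<\<alpha>}" "cut u {..<\<alpha>} \<sqsubseteq> s" for u s \<alpha>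
    using tree_ok_gap[OF that] .
qed

end

section \<open>Density\<close>

context tree_index
begin

sublocale amalgamation_class lam \<kappa> tree_ok tree_indices
  by (rule tree_amalgamation_class)

text \<open>The ordinals 1 and 2: requirements about a pair of levels are stated over the domain
  \<open>o2\<close>, whose elements are \<open>ozero\<close> and \<open>o1\<close>.\<close>

abbreviation o1 :: 'i where "o1 \<equiv> osuc ozero"
abbreviation o2 :: 'i where "o2 \<equiv> osuc o1"

lemma o2_simps: "ozero < o1" "ozero < o2" "o1 < o2" "{..<o2} = {o1, ozero}"
  using less_trans[OF less_osuc[of ozero] less_osuc[of o1]] by (auto simp: lessThan_osuc)

lemma o2_less_kappa: "o2 < \<kappa>"
proof -
  have "ozero < \<kappa>" using lam_less_kappa ozero_le[of lam] by (rule le_less_trans[rotated])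
  then show ?thesis using osuc_less_kappa by blast
qed

section \<open>Adding nodes and colours to a tree condition\<close>

lemma rL_mono: "A \<subseteq> A' \<Longrightarrow> rL A a n b k \<Longrightarrow> rL A' a n b k"
  unfolding rL_def by blast

lemma pull_rL: "a < \<theta> \<Longrightarrow> b < \<theta> \<Longrightarrow> (a, b, True, n, k) \<in> pull \<theta> h A \<longleftrightarrow> rL A (h a) n (h b) k"
  and pull_rC: "a < \<theta> \<Longrightarrow> b < \<theta> \<Longrightarrow> (a, b, False, n, k) \<in> pull \<theta> h A \<longleftrightarrow> rC A (h a) n (h b) k"
  unfolding pull_def rL_def rC_def by simp_all

lemma tree_ok_add_branches:
  fixes B :: "'j \<Rightarrow> ('i \<times> 'i) set"
  assumes p: "tree_ok (x, A)" and J: "small J"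
    and E: "\<And>t. t \<in> J \<Longrightarrow> E t \<subseteq> x"
    and B_node: "\<And>t \<xi> n. t \<in> J \<Longrightarrow> (\<xi>, n) \<in> B t \<Longrightarrow> rL A \<xi> n \<xi> n"
    and B_E: "\<And>t \<xi> n \<eta>. t \<in> J \<Longrightarrow> (\<xi>, n) \<in> B t \<Longrightarrow> \<eta> \<in> E t \<Longrightarrow> \<xi> < \<eta>"
    and B_chain: "\<And>t \<xi> n \<xi>' n'. t \<in> J \<Longrightarrow> (\<xi>, n) \<in> B t \<Longrightarrow> (\<xi>', n') \<in> B t \<Longrightarrow> \<xi> \<le> \<xi>' \<Longrightarrow> rL A \<xi> n \<xi>' n'"
    and B_full: "\<And>t \<xi> \<eta>. t \<in> J \<Longrightarrow> \<xi> \<in> x \<Longrightarrow> \<eta> \<in> E t \<Longrightarrow> \<xi> \<le> \<eta> \<Longrightarrow> (\<exists>n. (\<xi>, n) \<in> B t) \<or> \<xi> \<in> E t"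
    and f_fresh: "\<And>t \<eta>. t \<in> J \<Longrightarrow> \<eta> \<in> E t \<Longrightarrow> \<not> rL A \<eta> (f t \<eta>) \<eta> (f t \<eta>)"
    and f_inj: "\<And>t t' \<eta>. t \<in> J \<Longrightarrow> t' \<in> J \<Longrightarrow> \<eta> \<in> E t \<Longrightarrow> \<eta> \<in> E t' \<Longrightarrow> f t \<eta> = f t' \<eta> \<Longrightarrow> t = t'"
    and f_less: "\<And>t \<eta>. t \<in> J \<Longrightarrow> \<eta> \<in> E t \<Longrightarrow> f t \<eta> < \<kappa>"
  shows "\<exists>A'. A \<subseteq> A' \<and> tree_ok (x, A') \<and> (\<forall>t\<in>J. \<forall>\<beta>\<in>E t. \<forall>\<xi> n.
    (\<xi>, n) \<in> B t \<or> (\<xi> \<in> E t \<and> \<xi> \<le> \<beta> \<and> n = f t \<xi>) \<longrightarrow> rL A' \<xi> n \<beta> (f t \<beta>))"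
proof -
  define L where "L \<xi> n \<beta> k \<longleftrightarrow> rL A \<xi> n \<beta> k \<or>
    (\<exists>t\<in>J. \<beta> \<in> E t \<and> k = f t \<beta> \<and> ((\<xi>, n) \<in> B t \<or> (\<xi> \<in> E t \<and> \<xi> \<le> \<beta> \<and> n = f t \<xi>)))" for \<xi> n \<beta> k
  have pA: "T_rel x (rL A) (rC A)" "small x" "small A" using tree_okD[OF p] by simp_all
  have T: "T_rel x L (rC A)"
    unfolding L_def
    by (rule tree_rel_add_branches[OF pA(1) E B_node B_E B_chain B_full f_fresh f_inj])
  define I where "I = idx A \<union> (\<lambda>(t, \<eta>). f t \<eta>) ` (J \<times> x)"
  have I: "small I"
    unfolding I_def by (intro small_Un small_idx small_image small_times pA J)
  have iA: "n \<in> I \<and> n < \<kappa>" if "n \<in> idx A" for n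
    using that tree_ok_idx[OF p] unfolding I_def by auto
  have iE: "f t \<eta> \<in> I \<and> f t \<eta> < \<kappa>" if t: "t \<in> J" "\<eta> \<in> E t" for t \<eta>
  proof -
    have "(t, \<eta>) \<in> J \<times> x" using t E by blast
    then have "(\<lambda>(t, \<eta>). f t \<eta>) (t, \<eta>) \<in> (\<lambda>(t, \<eta>). f t \<eta>) ` (J \<times> x)" by (rule imageI)
    then show ?thesis using f_less[OF t] unfolding I_def by simp
  qed
  have "tree_ok (x, atoms L (rC A))"
  proof (rule tree_okI[OF pA(2) T I])
    show "n \<in> I \<and> k \<in> I \<and> n < \<kappa> \<and> k < \<kappa>" if l: "L \<xi> n \<beta> k" for \<xi> n \<beta> k
    proof (cases "rL A \<xi> n \<beta> k")
      case True
      then show ?thesis using iA idx_rL by blast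
    next
      case False
      obtain t where t: "t \<in> J" "\<beta> \<in> E t" "k = f t \<beta>" "(\<xi>, n) \<in> B t \<or> (\<xi> \<in> E t \<and> n = f t \<xi>)"
        using l False unfolding L_def by blast
      have "n \<in> I \<and> n < \<kappa>" using t(4)
      proof
        assume "(\<xi>, n) \<in> B t"
        then show ?thesis using iA idx_rL[OF B_node[OF t(1)]] by blast
      qed (use iE[OF t(1)] in blast)
      then show ?thesis using iE[OF t(1,2)] t(3) by blast
    qed
    show "n \<in> I \<and> k \<in> I \<and> n < \<kappa>" if "rC A \<xi> n \<beta> k" for \<xi> n \<beta> k
      using idx_rC[OF that] iA by blast
  qed
  moreover have "A \<subseteq> atoms L (rC A)"
    using subset_atoms[of A UNIV L "rC A"] by (simp add: L_def)
  moreover have "\<forall>t\<in>J. \<forall>\<beta>\<in>E t. \<forall>\<xi> n. (\<xi>, n) \<in> B t \<or> (\<xi> \<in> E t \<and> \<xi> \<le> \<beta> \<and> n = f t \<xi>) \<longrightarrow>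
      rL (atoms L (rC A)) \<xi> n \<beta> (f t \<beta>)"
    unfolding rL_atoms L_def by blast
  ultimately show ?thesis by blast
qed

text \<open>Each missing node becomes part of a branch of its own from the bottom up, with no old
  nodes in it: the prescribed name at the prescribed level, a fresh name at all levels
  below.\<close>

lemma force_nodes:
  assumes p: "tree_ok (x, A)" and S: "small S" "\<And>\<beta> n. (\<beta>, n) \<in> S \<Longrightarrow> \<beta> \<in> x \<and> n < \<kappa>"
  shows "\<exists>A'. A \<subseteq> A' \<and> tree_ok (x, A') \<and> (\<forall>\<beta> n. (\<beta>, n) \<in> S \<longrightarrow> rL A' \<beta> n \<beta> n)"
proof -
  define J where "J = {t \<in> S. \<not> rL A (fst t) (snd t) (fst t) (snd t)}"
  have J: "small J" unfolding J_def by (rule small_subset[OF S(1)]) blast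
  have "small (idx A \<union> snd ` S)"
    using small_idx tree_okD(2)[OF p] S(1) by (intro small_Un small_image) auto
  \<comment> \<open>The fresh names avoid the prescribed ones too; otherwise two of the new branches
    could meet.\<close>
  then obtain g where g: "inj_on g J" "g ` J \<subseteq> {..<\<kappa>} - (idx A \<union> snd ` S)"
    using ex_fresh_inj[OF _ J] by blast
  have gt: "g t < \<kappa>" "g t \<notin> idx A" "\<And>t'. t' \<in> J \<Longrightarrow> g t \<noteq> snd t'" if "t \<in> J" for t
    using g(2) that unfolding J_def by blast+
  define E where "E t = {\<eta> \<in> x. \<eta> \<le> fst t}" for t :: "'i \<times> 'i"
  define f where "f t \<eta> = (if \<eta> = fst t then snd t else g t)" for t \<eta>
  have ex: "\<exists>A'. A \<subseteq> A' \<and> tree_ok (x, A') \<and> (\<forall>t\<in>J. \<forall>\<beta>\<in>E t. \<forall>\<xi> n.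
    (\<xi>, n) \<in> {} \<or> (\<xi> \<in> E t \<and> \<xi> \<le> \<beta> \<and> n = f t \<xi>) \<longrightarrow> rL A' \<xi> n \<beta> (f t \<beta>))"
  proof (rule tree_ok_add_branches[OF p J])
    show "\<not> rL A \<eta> (f t \<eta>) \<eta> (f t \<eta>)" if "t \<in> J" for t \<eta>
    proof (cases "\<eta> = fst t")
      case True
      then show ?thesis using that unfolding f_def J_def by simp
    next
      case False
      then show ?thesis using gt(2)[OF that] idx_rL unfolding f_def by auto
    qed
    show "t = t'" if t: "t \<in> J" "t' \<in> J" "f t \<eta> = f t' \<eta>" for t t' \<eta>
    proof (cases "\<eta> = fst t")
      case True
      then have "\<eta> = fst t'" using t gt(3)[OF t(2,1)] unfolding f_def by (auto split: if_splits)
      then show ?thesis using True t(3) unfolding f_def by (simp add: prod_eq_iff)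
    next
      case False
      then have "\<eta> \<noteq> fst t'" using t gt(3)[OF t(1,2)] unfolding f_def by (auto split: if_splits)
      then show ?thesis using False t(3) inj_onD[OF g(1) _ t(1,2)] unfolding f_def by simp
    qed
    show "f t \<eta> < \<kappa>" if "t \<in> J" for t \<eta>
    proof -
      have "t \<in> S" using that unfolding J_def by blast
      then have "snd t < \<kappa>" using S(2)[of "fst t" "snd t"] by simp
      then show ?thesis using gt(1)[OF that] unfolding f_def by simp
    qed
  qed (auto simp: E_def)
  from ex obtain A' where *: "A \<subseteq> A' \<and> tree_ok (x, A') \<and> (\<forall>t\<in>J. \<forall>\<beta>\<in>E t. \<forall>\<xi> n.
    (\<xi>, n) \<in> {} \<or> (\<xi> \<in> E t \<and> \<xi> \<le> \<beta> \<and> n = f t \<xi>) \<longrightarrow> rL A' \<xi> n \<beta> (f t \<beta>))" ..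
  have A': "A \<subseteq> A'" "tree_ok (x, A')" using * by auto
  have node: "rL A' \<beta> (f t \<beta>) \<beta> (f t \<beta>)" if "t \<in> J" "\<beta> \<in> E t" for t \<beta> using * that by blast
  have "rL A' \<beta> n \<beta> n" if "(\<beta>, n) \<in> S" for \<beta> n
  proof (cases "rL A \<beta> n \<beta> n")
    case True
    then show ?thesis using rL_mono[OF A'(1)] by blast
  next
    case False
    then have "(\<beta>, n) \<in> J" using that unfolding J_def by simp
    moreover have "\<beta> \<in> E (\<beta>, n)" using S(2)[OF that] unfolding E_def by simp
    ultimately show ?thesis using node[of "(\<beta>, n)" \<beta>] unfolding f_def by simp
  qed
  then show ?thesis using A'(1,2) by blast
qed

text \<open>With a fresh colour, the only vectors to be compared are the projections
  \<open>v b\<close> of a single vector to the levels between \<alpha> and \<beta>, and these are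
  comparable at all coordinates. Distinctness of the coordinates at \<alpha> makes every projection
  injective.\<close>

lemma add_color:
  assumes p: "tree_ok (x, A)" and x: "\<alpha> \<in> x" "\<beta> \<in> x" "\<alpha> \<le> \<beta>" and j: "j < \<kappa>" "j' < \<kappa>"
    and l: "\<And>i. i < lam \<Longrightarrow> rL A \<alpha> (e j i) \<beta> (e j' i)"
  shows "\<exists>A' \<delta>. A \<subseteq> A' \<and> tree_ok (x, A') \<and> \<delta> < \<kappa> \<and> rC A' \<alpha> \<delta> \<beta> j'"
proof -
  have pA: "T_rel x (rL A) (rC A)" "small x" "small A" using tree_okD[OF p] by simp_all
  interpret tree_rel lam \<kappa> e x "rL A" "rC A" by (rule pA(1))
  have iA: "n < \<kappa>" if "n \<in> idx A" for n using that tree_ok_idx[OF p] by auto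
  obtain \<delta> where \<delta>: "\<delta> < \<kappa>" "\<delta> \<notin> idx A" using ex_fresh[OF small_idx[OF pA(3)]] by blast
  have "\<exists>v. v < \<kappa> \<and> (\<forall>i<lam. rL A b (e v i) \<beta> (e j' i)) \<and> (b = \<beta> \<longrightarrow> v = j')"
    if b: "b \<in> x" "\<alpha> \<le> b" "b \<le> \<beta>" for b
  proof (cases "b = \<beta>")
    case True
    then show ?thesis using j(2) l L_nodes by blast
  next
    case False
    define g where "g i = (SOME n. rL A b n \<beta> (e j' i))" for i
    have g: "rL A b (g i) \<beta> (e j' i)" if i: "i < lam" for i
    proof -
      have "rL A \<beta> (e j' i) \<beta> (e j' i)" using L_nodes[OF l[OF i]] by blast
      then have "\<exists>n. rL A b n \<beta> (e j' i)" using L_full b by blast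
      then show ?thesis unfolding g_def by (rule someI_ex)
    qed
    have "inj_on g {..<lam}"
    proof (rule inj_onI)
      fix i i' assume i: "i \<in> {..<lam}" "i' \<in> {..<lam}" "g i = g i'"
      then have lt: "i < lam" "i' < lam" by simp_all
      have "rL A \<alpha> (e j i) b (g i)" "rL A \<alpha> (e j i') b (g i')"
        using L_below[OF l[OF lt(1)] g[OF lt(1)] b(2)] L_below[OF l[OF lt(2)] g[OF lt(2)] b(2)] .
      then have "e j i = e j i'" using L_unique i(3) by metis
      then show "i = i'" using inj_onD[OF e_inj[OF j(1)]] i(1,2) by blast
    qed
    moreover have "g i < \<kappa>" if "i < lam" for i using iA idx_rL[OF g[OF that]] by blast
    ultimately have "name_of g < \<kappa>" "\<And>i. i < lam \<Longrightarrow> e (name_of g) i = g i" using name_of by blast+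
    then show ?thesis using g False by (intro exI[of _ "name_of g"]) simp
  qed
  then obtain v where v: "\<And>b. b \<in> x \<Longrightarrow> \<alpha> \<le> b \<Longrightarrow> b \<le> \<beta> \<Longrightarrow>
    v b < \<kappa> \<and> (\<forall>i<lam. rL A b (e (v b) i) \<beta> (e j' i)) \<and> (b = \<beta> \<longrightarrow> v b = j')" by metis
  have vl: "rL A b (e (v b) i) b' (e (v b') i)"
    if "b \<in> x" "\<alpha> \<le> b" "b \<le> b'" "b' \<in> x" "b' \<le> \<beta>" "i < lam" for b b' i
  proof -
    have "b \<le> \<beta>" "\<alpha> \<le> b'" using that by auto
    then have "rL A b (e (v b) i) \<beta> (e j' i)" "rL A b' (e (v b') i) \<beta> (e j' i)" using v that by blast+
    then show ?thesis using L_below that(3) by blast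
  qed
  define N where "N a d b k \<longleftrightarrow> a = \<alpha> \<and> d = \<delta> \<and> b \<in> x \<and> \<alpha> \<le> b \<and> b \<le> \<beta> \<and> k = v b" for a d b k
  define C where "C a d b k \<longleftrightarrow> rC A a d b k \<or> N a d b k" for a d b k
  have old: "\<not> rC A a \<delta> b k" for a b k using \<delta>(2) idx_rC by blast
  have T: "T_rel x (rL A) C"
  proof unfold_locales
    fix a d b k assume c: "C a d b k"
    show "a \<in> x \<and> b \<in> x \<and> k < \<kappa> \<and> a \<le> b" using c C_levels v x unfolding C_def N_def by blast
    show "rL A b (e k i) b (e k i)" if "i < lam" for i
      using c C_nodes[OF _ that] vl[OF _ _ order_refl _ _ that] unfolding C_def N_def by blast
    show "\<exists>k'. C a d \<xi> k' \<and> (\<forall>i<lam. rL A \<xi> (e k' i) b (e k i))" if \<xi>: "\<xi> \<in> x" "a \<le> \<xi>" "\<xi> \<le> b" for \<xi>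
      using c unfolding C_def
    proof
      assume "rC A a d b k"
      then show "\<exists>k'. (rC A a d \<xi> k' \<or> N a d \<xi> k') \<and> (\<forall>i<lam. rL A \<xi> (e k' i) b (e k i))"
        using C_down \<xi> by blast
    next
      assume n: "N a d b k"
      then have *: "\<xi> \<le> \<beta>" "\<alpha> \<le> \<xi>" using \<xi> unfolding N_def by auto
      then have "N a d \<xi> (v \<xi>)" using n \<xi> unfolding N_def by blast
      moreover have "\<forall>i<lam. rL A \<xi> (e (v \<xi>) i) b (e k i)" using vl[OF \<xi>(1) *(2) \<xi>(3)] n unfolding N_def by blast
      ultimately show "\<exists>k'. (rC A a d \<xi> k' \<or> N a d \<xi> k') \<and> (\<forall>i<lam. rL A \<xi> (e k' i) b (e k i))" by blast
    qed
    fix b' k' assume c': "C a d b' k'" and le: "b \<le> b'"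
    show "many (\<lambda>i. rL A b (e k i) b' (e k' i))"
    proof (cases "d = \<delta>")
      case True
      then have n: "N a d b k" "N a d b' k'" using c c' old unfolding C_def by blast+
      then show ?thesis by (intro many_all) (use vl[OF _ _ le] in \<open>unfold N_def, blast\<close>)
    next
      case False
      then have "rC A a d b k" "rC A a d b' k'" using c c' unfolding C_def N_def by blast+
      then show ?thesis using C_many le by blast
    qed
  qed (erule L_levels L_le L_nodes L_level_eq L_trans L_below L_full; assumption)+
  define I where "I = insert \<delta> (idx A \<union> v ` x)"
  have "small I" unfolding I_def by (intro small_insert small_Un small_image small_idx pA)
  then have "tree_ok (x, atoms (rL A) C)"
  proof (rule tree_okI[OF pA(2) T])
    show "n \<in> I \<and> k \<in> I \<and> n < \<kappa> \<and> k < \<kappa>" if "rL A \<xi> n b k" for \<xi> n b k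
      using idx_rL[OF that] iA unfolding I_def by blast
    show "n \<in> I \<and> k \<in> I \<and> n < \<kappa>" if "C \<xi> n b k" for \<xi> n b k
      using that unfolding C_def
    proof
      assume "rC A \<xi> n b k"
      then show ?thesis using idx_rC iA unfolding I_def by blast
    next
      assume "N \<xi> n b k"
      then show ?thesis using \<delta>(1) unfolding N_def I_def by blast
    qed
  qed
  moreover have "A \<subseteq> atoms (rL A) C"
    using subset_atoms[of A UNIV "rL A" C] by (simp add: C_def)
  moreover have "rC (atoms (rL A) C) \<alpha> \<delta> \<beta> j'"
    using v[OF x(2,3) order_refl] x unfolding rC_atoms C_def N_def by simp
  ultimately show ?thesis using \<delta>(1) by blast
qed

section \<open>Requirements and their density\<close>

definition pred_at :: "'i \<Rightarrow> ('i \<times> 'i \<times> bool \<times> 'i \<times> 'i) set \<Rightarrow> bool" where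
  "pred_at n R \<longleftrightarrow> (\<exists>k. (ozero, o1, True, k, n) \<in> R)"

definition split_at :: "'i \<Rightarrow> ('i \<times> 'i \<times> bool \<times> 'i \<times> 'i) set \<Rightarrow> bool" where
  "split_at n R \<longleftrightarrow> (\<exists>k k'. k \<noteq> k' \<and> (ozero, o1, True, n, k) \<in> R \<and> (ozero, o1, True, n, k') \<in> R)"

text \<open>The first clause settles the predecessors of all coordinates. Without it the hypothesis
  of the second clause might fail in the condition and still hold in the generic tree.\<close>

definition color_at :: "'i \<Rightarrow> 'i \<Rightarrow> ('i \<times> 'i \<times> bool \<times> 'i \<times> 'i) set \<Rightarrow> bool" where
  "color_at j j' R \<longleftrightarrow> (\<forall>i<lam. \<exists>k. (ozero, o1, True, k, e j' i) \<in> R) \<and>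
     ((\<forall>i<lam. (ozero, o1, True, e j i, e j' i) \<in> R) \<longrightarrow> (\<exists>\<delta><\<kappa>. (ozero, o1, False, \<delta>, j') \<in> R))"

text \<open>As in \<open>color_at\<close>, the predecessors are settled first. Then either the nodes
  \<open>b\<close> fail for good to form a chain, or the condition has a node above all of
  them.\<close>

definition top_at :: "'i \<Rightarrow> ('i \<Rightarrow> 'i) \<Rightarrow> ('i \<times> 'i \<times> bool \<times> 'i \<times> 'i) set \<Rightarrow> bool" where
  "top_at \<tau> b R \<longleftrightarrow> (\<forall>\<xi>'<\<tau>. \<forall>\<xi><\<xi>'. \<exists>k. (\<xi>, \<xi>', True, k, b \<xi>') \<in> R) \<and>
     ((\<forall>\<xi>'<\<tau>. \<forall>\<xi><\<xi>'. (\<xi>, \<xi>', True, b \<xi>, b \<xi>') \<in> R) \<longrightarrow> (\<exists>k<\<kappa>. \<forall>\<xi><\<tau>. (\<xi>, \<tau>, True, b \<xi>, k) \<in> R))"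

lemma dense_two:
  assumes "\<And>x A h. tree_ok (x, A) \<Longrightarrow> h ozero \<in> x \<Longrightarrow> h o1 \<in> x \<Longrightarrow> h ozero < h o1 \<Longrightarrow>
    \<exists>A'. A \<subseteq> A' \<and> tree_ok (x, A') \<and> \<Psi> (pull o2 h A')"
  shows "dense_property o2 \<Psi>"
  unfolding dense_property_def
proof (intro conjI allI impI)
  show "o2 < \<kappa>" by (rule o2_less_kappa)
  fix x A h assume *: "Wc (x, A) \<and> coi {..<o2} h \<and> h ` {..<o2} \<subseteq> x"
  then have "tree_ok (x, A)" "h ozero \<in> x" "h o1 \<in> x" unfolding Wc_def by (auto simp: o2_simps)
  moreover have "h ozero < h o1" using coi_less_iff[of "{..<o2}" h ozero o1] * o2_simps(1-3) by simp
  ultimately show "\<exists>A'. A \<subseteq> A' \<and> tree_ok (x, A') \<and> \<Psi> (pull o2 h A')" by (rule assms)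
qed

lemma dense_pred:
  assumes n: "n < \<kappa>"
  shows "dense_property o2 (pred_at n)"
proof (rule dense_two)
  fix x A and h :: "'i \<Rightarrow> 'i" assume p: "tree_ok (x, A)" and h: "h ozero \<in> x" "h o1 \<in> x" "h ozero < h o1"
  have "small {(h o1, n)}" by (rule small_finite) simp
  then obtain A' where A': "A \<subseteq> A'" "tree_ok (x, A')" "rL A' (h o1) n (h o1) n"
    using force_nodes[OF p, of "{(h o1, n)}"] h(2) n by auto
  interpret tree_rel lam \<kappa> e x "rL A'" "rC A'" using tree_okD(4)[OF A'(2)] by simp
  show "\<exists>A'. A \<subseteq> A' \<and> tree_ok (x, A') \<and> pred_at n (pull o2 h A')"
    unfolding pred_at_def using A' L_full[OF A'(3) h(1)] h(3) by (auto simp: pull_rL o2_simps(1-3))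
qed

lemma dense_split:
  assumes n: "n < \<kappa>"
  shows "dense_property o2 (split_at n)"
proof (rule dense_two)
  fix x A and h :: "'i \<Rightarrow> 'i" assume p: "tree_ok (x, A)" and h: "h ozero \<in> x" "h o1 \<in> x" "h ozero < h o1"
  have "small {(h ozero, n)}" by (rule small_finite) simp
  then obtain A1 where A1: "A \<subseteq> A1" "tree_ok (x, A1)" "rL A1 (h ozero) n (h ozero) n"
    using force_nodes[OF p, of "{(h ozero, n)}"] h(1) n by auto
  interpret tree_rel lam \<kappa> e x "rL A1" "rC A1" using tree_okD(4)[OF A1(2)] by simp
  have bool: "small (UNIV :: bool set)" by (rule small_finite) simp
  have "small A1" using tree_okD(2)[OF A1(2)] by simp
  then obtain g :: "bool \<Rightarrow> 'i" where g: "inj g" "range g \<subseteq> {..<\<kappa>} - idx A1"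
    using ex_fresh_inj[OF small_idx bool] by blast
  have gt: "g t < \<kappa>" "g t \<notin> idx A1" for t using g(2) by blast+
  \<comment> \<open>One branch, up to the node to be split, is continued twice: the booleans index
    two continuations with different fresh names.\<close>
  define B where "B = {(\<xi>, m). rL A1 \<xi> m (h ozero) n}"
  define E where "E = {\<eta> \<in> x. h ozero < \<eta> \<and> \<eta> \<le> h o1}"
  have ex: "\<exists>A'. A1 \<subseteq> A' \<and> tree_ok (x, A') \<and> (\<forall>t\<in>(UNIV :: bool set). \<forall>\<beta>\<in>E. \<forall>\<xi> m.
    (\<xi>, m) \<in> B \<or> (\<xi> \<in> E \<and> \<xi> \<le> \<beta> \<and> m = g t) \<longrightarrow> rL A' \<xi> m \<beta> (g t))"
  proof (rule tree_ok_add_branches[OF A1(2) bool])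
    show "E \<subseteq> x" unfolding E_def by blast
    show "rL A1 \<xi> m \<xi> m" if "(\<xi>, m) \<in> B" for \<xi> m using that L_nodes unfolding B_def by blast
    show "\<xi> < \<eta>" if "(\<xi>, m) \<in> B" "\<eta> \<in> E" for \<xi> m \<eta>
      using that L_le[of \<xi> m "h ozero" n] unfolding B_def E_def by auto
    show "rL A1 \<xi> m \<xi>' m'" if "(\<xi>, m) \<in> B" "(\<xi>', m') \<in> B" "\<xi> \<le> \<xi>'" for \<xi> m \<xi>' m'
      using that L_below unfolding B_def by blast
    show "(\<exists>n. (\<xi>, n) \<in> B) \<or> \<xi> \<in> E" if "\<xi> \<in> x" "\<eta> \<in> E" "\<xi> \<le> \<eta>" for \<xi> \<eta>
    proof (cases "\<xi> \<le> h ozero")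
      case True
      then show ?thesis using L_full[OF A1(3) that(1)] unfolding B_def by blast
    next
      case False
      then show ?thesis using that unfolding E_def by auto
    qed
    show "\<not> rL A1 \<eta> (g t) \<eta> (g t)" for \<eta> t using gt(2)[of t] idx_rL by blast
    show "t = t'" if "g t = g t'" for t t' using injD[OF g(1) that] .
    show "g t < \<kappa>" for t by (rule gt)
  qed
  from ex obtain A' where *: "A1 \<subseteq> A' \<and> tree_ok (x, A') \<and> (\<forall>t\<in>(UNIV :: bool set). \<forall>\<beta>\<in>E. \<forall>\<xi> m.
    (\<xi>, m) \<in> B \<or> (\<xi> \<in> E \<and> \<xi> \<le> \<beta> \<and> m = g t) \<longrightarrow> rL A' \<xi> m \<beta> (g t))" ..
  have A': "A1 \<subseteq> A'" "tree_ok (x, A')" using * by auto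
  have "(h ozero, n) \<in> B" "h o1 \<in> E" using A1(3) h unfolding B_def E_def by auto
  then have "rL A' (h ozero) n (h o1) (g t)" for t using * by blast
  moreover have "g True \<noteq> g False" using injD[OF g(1), of True False] by blast
  ultimately have "split_at n (pull o2 h A')" unfolding split_at_def by (auto simp: pull_rL o2_simps(1-3))
  then show "\<exists>A'. A \<subseteq> A' \<and> tree_ok (x, A') \<and> split_at n (pull o2 h A')" using A'(1,2) A1(1) by blast
qed

lemma dense_color:
  assumes j: "j < \<kappa>" "j' < \<kappa>"
  shows "dense_property o2 (color_at j j')"
proof (rule dense_two)
  fix x A and h :: "'i \<Rightarrow> 'i" assume p: "tree_ok (x, A)" and h: "h ozero \<in> x" "h o1 \<in> x" "h ozero < h o1"
  define S where "S = (\<lambda>i. (h o1, e j' i)) ` {..<lam}"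
  have S: "small S" unfolding S_def by (intro small_image small_lessThan lam_less_kappa)
  have "\<beta> \<in> x \<and> n < \<kappa>" if "(\<beta>, n) \<in> S" for \<beta> n using that h(2) e_less[OF j(2)] unfolding S_def by blast
  then obtain A1 where A1: "A \<subseteq> A1" "tree_ok (x, A1)" "\<And>\<beta> n. (\<beta>, n) \<in> S \<Longrightarrow> rL A1 \<beta> n \<beta> n"
    using force_nodes[OF p S] by blast
  interpret tree_rel lam \<kappa> e x "rL A1" "rC A1" using tree_okD(4)[OF A1(2)] by simp
  have pr: "\<exists>k. rL A1 (h ozero) k (h o1) (e j' i)" if "i < lam" for i
  proof -
    have "rL A1 (h o1) (e j' i) (h o1) (e j' i)" using A1(3) that unfolding S_def by blast
    then show ?thesis using L_full h(1,3) by (meson less_imp_le)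
  qed
  show "\<exists>A'. A \<subseteq> A' \<and> tree_ok (x, A') \<and> color_at j j' (pull o2 h A')"
  proof (cases "\<forall>i<lam. rL A1 (h ozero) (e j i) (h o1) (e j' i)")
    case True
    then obtain A' \<delta> where A': "A1 \<subseteq> A'" "tree_ok (x, A')" "\<delta> < \<kappa>" "rC A' (h ozero) \<delta> (h o1) j'"
      using add_color[OF A1(2) h(1,2) less_imp_le[OF h(3)] j] by blast
    have "\<exists>k. rL A' (h ozero) k (h o1) (e j' i)" if "i < lam" for i using pr[OF that] rL_mono[OF A'(1)] by blast
    then have "color_at j j' (pull o2 h A')"
      unfolding color_at_def using A'(3,4) by (auto simp: pull_rL pull_rC o2_simps(1-3))
    then show ?thesis using A'(1,2) A1(1) by blast
  next
    case False
    then have "color_at j j' (pull o2 h A1)"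
      unfolding color_at_def using pr by (auto simp: pull_rL pull_rC o2_simps(1-3))
    then show ?thesis using A1(1,2) by blast
  qed
qed

lemma dense_top:
  assumes \<tau>: "\<tau> < \<kappa>" and b: "\<And>\<xi>. \<xi> < \<tau> \<Longrightarrow> b \<xi> < \<kappa>"
  shows "dense_property (osuc \<tau>) (top_at \<tau> b)"
  unfolding dense_property_def
proof (intro conjI allI impI)
  show "osuc \<tau> < \<kappa>" using \<tau> by (rule osuc_less_kappa)
  fix x A h assume *: "Wc (x, A) \<and> coi {..<osuc \<tau>} h \<and> h ` {..<osuc \<tau>} \<subseteq> x"
  then have p: "tree_ok (x, A)" and h: "coi {..<osuc \<tau>} h" unfolding Wc_def by blast+
  have lt: "\<xi> < osuc \<tau>" if "\<xi> < \<tau>" for \<xi> using that by (simp add: less_osuc_iff)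
  have hx: "h \<xi> \<in> x" if "\<xi> < \<tau>" for \<xi> using * lt[OF that] by blast
  have h\<tau>: "h \<tau> \<in> x" using * less_osuc[of \<tau>] by blast
  have mono: "h \<xi> < h \<xi>'" if "\<xi> < \<xi>'" "\<xi>' < osuc \<tau>" for \<xi> \<xi>'
    using coi_less_iff[OF h, of \<xi> \<xi>'] that by auto
  \<comment> \<open>All the nodes \<open>b \<xi>\<close> are made to exist first, so that each of
    them has a settled predecessor at every lower level.\<close>
  define S where "S = (\<lambda>\<xi>. (h \<xi>, b \<xi>)) ` {..<\<tau>}"
  have S: "small S" unfolding S_def by (intro small_image small_lessThan \<tau>)
  have "\<beta> \<in> x \<and> n < \<kappa>" if "(\<beta>, n) \<in> S" for \<beta> n using that hx b unfolding S_def by blast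
  then obtain A1 where A1: "A \<subseteq> A1" "tree_ok (x, A1)" "\<And>\<beta> n. (\<beta>, n) \<in> S \<Longrightarrow> rL A1 \<beta> n \<beta> n"
    using force_nodes[OF p S] by blast
  interpret tree_rel lam \<kappa> e x "rL A1" "rC A1" using tree_okD(4)[OF A1(2)] by simp
  have node: "rL A1 (h \<xi>) (b \<xi>) (h \<xi>) (b \<xi>)" if "\<xi> < \<tau>" for \<xi> using A1(3) that unfolding S_def by blast
  have pr: "\<exists>k. rL A1 (h \<xi>) k (h \<xi>') (b \<xi>')" if "\<xi>' < \<tau>" "\<xi> < \<xi>'" for \<xi> \<xi>'
    using L_full[OF node[OF that(1)], of "h \<xi>"] hx[of \<xi>] mono[OF that(2) lt[OF that(1)]] that by auto
  show "\<exists>A'. A \<subseteq> A' \<and> tree_ok (x, A') \<and> top_at \<tau> b (pull (osuc \<tau>) h A')"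
  proof (cases "\<forall>\<xi>'<\<tau>. \<forall>\<xi><\<xi>'. rL A1 (h \<xi>) (b \<xi>) (h \<xi>') (b \<xi>')")
    case False
    then have "top_at \<tau> b (pull (osuc \<tau>) h A1)"
      unfolding top_at_def using pr less_trans by (auto simp: pull_rL lt)
    then show ?thesis using A1(1,2) by blast
  next
    case True
    have coh: "rL A1 (h \<xi>) (b \<xi>) (h \<xi>') (b \<xi>')" if "\<xi>' < \<tau>" "\<xi> \<le> \<xi>'" for \<xi> \<xi>'
      using True that node by (cases "\<xi> = \<xi>'") auto
    have "small A1" using tree_okD(2)[OF A1(2)] by simp
    then obtain k where k: "k < \<kappa>" "k \<notin> idx A1" using ex_fresh[OF small_idx] by blast
    \<comment> \<open>The downward closure of the chain. One fresh name \<open>k\<close> continues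
      it through all levels beyond the chain up to \<open>h \<tau>\<close>.\<close>
    define B where "B = {(\<eta>, m). \<exists>\<xi><\<tau>. rL A1 \<eta> m (h \<xi>) (b \<xi>)}"
    define E where "E = {\<eta> \<in> x. \<eta> \<le> h \<tau> \<and> (\<forall>\<xi><\<tau>. h \<xi> < \<eta>)}"
    have one: "small {()}" by (rule small_finite) simp
    have ex: "\<exists>A'. A1 \<subseteq> A' \<and> tree_ok (x, A') \<and> (\<forall>t\<in>{()}. \<forall>\<beta>\<in>E. \<forall>\<xi> m.
      (\<xi>, m) \<in> B \<or> (\<xi> \<in> E \<and> \<xi> \<le> \<beta> \<and> m = k) \<longrightarrow> rL A' \<xi> m \<beta> k)"
    proof (rule tree_ok_add_branches[OF A1(2) one])
      show "E \<subseteq> x" unfolding E_def by blast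
      show "rL A1 \<xi> m \<xi> m" if "(\<xi>, m) \<in> B" for \<xi> m using that L_nodes unfolding B_def by blast
      show "\<eta> < \<eta>'" if "(\<eta>, m) \<in> B" "\<eta>' \<in> E" for \<eta> m \<eta>'
      proof -
        obtain \<xi> where "\<xi> < \<tau>" "rL A1 \<eta> m (h \<xi>) (b \<xi>)" using \<open>(\<eta>, m) \<in> B\<close> unfolding B_def by blast
        then have "\<eta> \<le> h \<xi>" "h \<xi> < \<eta>'" using L_le that(2) unfolding E_def by blast+
        then show ?thesis by simp
      qed
      show "rL A1 \<eta> m \<eta>' m'" if hB: "(\<eta>, m) \<in> B" "(\<eta>', m') \<in> B" and le: "\<eta> \<le> \<eta>'" for \<eta> m \<eta>' m'
      proof -
        obtain \<xi> \<xi>' where \<xi>: "\<xi> < \<tau>" "rL A1 \<eta> m (h \<xi>) (b \<xi>)" "\<xi>' < \<tau>" "rL A1 \<eta>' m' (h \<xi>') (b \<xi>')"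
          using hB unfolding B_def by blast
        show ?thesis
        proof (cases "\<xi> \<le> \<xi>'")
          case True
          then have "rL A1 \<eta> m (h \<xi>') (b \<xi>')" using L_trans[OF \<xi>(2) coh[OF \<xi>(3)]] by blast
          then show ?thesis using L_below \<xi>(4) le by blast
        next
          case False
          then have "rL A1 \<eta>' m' (h \<xi>) (b \<xi>)" using L_trans[OF \<xi>(4) coh[OF \<xi>(1)]] by auto
          then show ?thesis using L_below \<xi>(2) le by blast
        qed
      qed
      show "(\<exists>n. (\<eta>, n) \<in> B) \<or> \<eta> \<in> E" if \<eta>: "\<eta> \<in> x" "\<eta>' \<in> E" "\<eta> \<le> \<eta>'" for \<eta> \<eta>'
      proof (cases "\<exists>\<xi><\<tau>. \<eta> \<le> h \<xi>")
        case True
        then show ?thesis using L_full[OF node \<eta>(1)] unfolding B_def by blast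
      next
        case False
        then show ?thesis using \<eta> unfolding E_def by auto
      qed
      show "\<not> rL A1 \<eta> k \<eta> k" for \<eta> using k(2) idx_rL by blast
    qed (use k(1) in auto)
    from ex obtain A' where *: "A1 \<subseteq> A' \<and> tree_ok (x, A') \<and> (\<forall>t\<in>{()}. \<forall>\<beta>\<in>E. \<forall>\<xi> m.
      (\<xi>, m) \<in> B \<or> (\<xi> \<in> E \<and> \<xi> \<le> \<beta> \<and> m = k) \<longrightarrow> rL A' \<xi> m \<beta> k)" ..
    have A': "A1 \<subseteq> A'" "tree_ok (x, A')" using * by auto
    have "h \<tau> \<in> E" using h\<tau> mono[OF _ less_osuc] unfolding E_def by blast
    moreover have "(h \<xi>, b \<xi>) \<in> B" if "\<xi> < \<tau>" for \<xi> using node[OF that] that unfolding B_def by blast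
    ultimately have top: "rL A' (h \<xi>) (b \<xi>) (h \<tau>) k" if "\<xi> < \<tau>" for \<xi> using * that by blast
    have "\<exists>k. rL A' (h \<xi>) k (h \<xi>') (b \<xi>')" if "\<xi>' < \<tau>" "\<xi> < \<xi>'" for \<xi> \<xi>'
      using pr[OF that] rL_mono[OF A'(1)] by blast
    then have "top_at \<tau> b (pull (osuc \<tau>) h A')"
      unfolding top_at_def using top k(1) less_trans by (auto simp: pull_rL lt)
    then show ?thesis using A'(1,2) A1(1) by blast
  qed
qed

end

section \<open>The generic tree\<close>

text \<open>What genericity leaves behind, without reference to conditions. \<open>L\<close> is the
  strict order, and \<open>(\<beta>, k)\<close> is a node for every level \<beta> and every
  \<open>k < \<kappa>\<close>. Of the comparability at many coordinates only a single coordinate is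
  kept, in \<open>K_less\<close> and \<open>K_eq\<close>, since the tree needs no more.\<close>

locale generic_tree = tree_index lam \<kappa> e for lam \<kappa> :: "'i::wellorder" and e +
  fixes L K :: "'i \<Rightarrow> 'i \<Rightarrow> 'i \<Rightarrow> 'i \<Rightarrow> bool"
  assumes L_less: "L \<xi> n \<beta> k \<Longrightarrow> \<xi> < \<beta> \<and> n < \<kappa> \<and> k < \<kappa>"
    and L_unique: "L \<xi> n \<beta> k \<Longrightarrow> L \<xi> n' \<beta> k \<Longrightarrow> n = n'"
    and L_pred: "\<xi> < \<beta> \<Longrightarrow> k < \<kappa> \<Longrightarrow> \<exists>n. L \<xi> n \<beta> k"
    and L_trans: "L \<xi> n \<beta> k \<Longrightarrow> L \<beta> k \<gamma> l \<Longrightarrow> L \<xi> n \<gamma> l"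
    and L_below: "L \<xi> n \<beta> k \<Longrightarrow> L \<xi>' n' \<beta> k \<Longrightarrow> \<xi> < \<xi>' \<Longrightarrow> L \<xi> n \<xi>' n'"
    and L_split: "\<xi> < \<beta> \<Longrightarrow> n < \<kappa> \<Longrightarrow> \<exists>k k'. k \<noteq> k' \<and> L \<xi> n \<beta> k \<and> L \<xi> n \<beta> k'"
    and L_complete: "small X \<Longrightarrow> (\<And>\<xi>. \<xi> \<in> X \<Longrightarrow> b \<xi> < \<kappa>) \<Longrightarrow>
      (\<And>\<xi> \<xi>'. \<xi> \<in> X \<Longrightarrow> \<xi>' \<in> X \<Longrightarrow> \<xi> < \<xi>' \<Longrightarrow> L \<xi> (b \<xi>) \<xi>' (b \<xi>')) \<Longrightarrow>
      \<exists>\<beta> k. k < \<kappa> \<and> (\<forall>\<xi>\<in>X. L \<xi> (b \<xi>) \<beta> k)"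
    and K_ex: "j < \<kappa> \<Longrightarrow> j' < \<kappa> \<Longrightarrow> \<alpha> < \<beta> \<Longrightarrow> (\<And>i. i < lam \<Longrightarrow> L \<alpha> (e j i) \<beta> (e j' i)) \<Longrightarrow>
      \<exists>\<delta><\<kappa>. K \<alpha> \<delta> \<beta> j'"
    and K_less: "K \<alpha> \<delta> \<beta> j \<Longrightarrow> K \<alpha> \<delta> \<gamma> j' \<Longrightarrow> \<beta> < \<gamma> \<Longrightarrow> \<exists>i<lam. L \<beta> (e j i) \<gamma> (e j' i)"
    and K_eq: "K \<alpha> \<delta> \<beta> j \<Longrightarrow> K \<alpha> \<delta> \<beta> j' \<Longrightarrow> \<exists>i<lam. e j i = e j' i"

section \<open>From the forcing axiom to the generic tree\<close>

context successor_cardinals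
begin

lemma ex_tree_index:
  assumes FA: "FA \<kappa>"
  shows "\<exists>e. tree_index lam \<kappa> e"
proof -
  define F where "F = {f \<in> {..<lam} \<rightarrow>\<^sub>E {..<\<kappa>}. inj_on f {..<lam}}"
  have "F \<lesssim> {..<lam} \<rightarrow>\<^sub>E {..<\<kappa>}" unfolding F_def by (rule subset_imp_lepoll) blast
  also have "\<dots> \<lesssim> {..<\<kappa>}" using functions_lepoll_kappa[OF FA small_lessThan[OF lam_less_kappa]] .
  finally obtain c where c: "inj_on c F" "c ` F \<subseteq> {..<\<kappa>}" unfolding lepoll_def by blast
  \<comment> \<open>The inclusion of \<lambda> in \<kappa> is the default for indices that number no
    injection.\<close>
  define f0 where "f0 = restrict (\<lambda>i. i) {..<lam}"
  have f0: "f0 \<in> F" using lam_less_kappa unfolding F_def f0_def by (auto simp: inj_on_def)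
  define e where "e j = (if j \<in> c ` F then inv_into F c j else f0)" for j
  have eF: "e j \<in> F" for j unfolding e_def using f0 inv_into_into[of j c F] by simp
  have "tree_index lam \<kappa> e"
  proof unfold_locales
    fix j show "inj_on (e j) {..<lam}" using eF[of j] unfolding F_def by blast
    show "e j i < \<kappa>" if "i < lam" for i using eF[of j] that unfolding F_def by (auto dest: PiE_mem)
  next
    fix f :: "'i \<Rightarrow> 'i" assume f: "inj_on f {..<lam}" "\<And>i. i < lam \<Longrightarrow> f i < \<kappa>"
    define g where "g = restrict f {..<lam}"
    have "g \<in> F" using f unfolding F_def g_def by (auto simp: inj_on_def)
    then have "c g < \<kappa>" "e (c g) = g" using c unfolding e_def by auto
    then show "\<exists>j<\<kappa>. \<forall>i<lam. e j i = f i" unfolding g_def by (intro exI[of _ "c g"]) (simp add: g_def)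
  qed
  then show ?thesis by (rule exI[of "\<lambda>e. tree_index lam \<kappa> e"])
qed

end

context tree_index
begin

text \<open>A domain of two points has no limit points, so continuity is void and any increasing
  pair of levels is listed by a c.o.i.\<close>

lemma coi_two: "\<alpha> < \<beta> \<Longrightarrow> coi {..<o2} (\<lambda>\<xi>. if \<xi> = ozero then \<alpha> else \<beta>)"
proof -
  assume "\<alpha> < \<beta>"
  have "\<not> is_limit_of ozero x" for x :: "'i set" unfolding is_limit_of_iff by (simp add: not_less)
  then have "\<not> is_limit_of \<gamma> {..<o2}" if "\<gamma> < o2" for \<gamma>
    using that osuc_not_limit o2_simps(4) by (metis insertE lessThan_iff singletonD)
  moreover have "strict_mono_on {..<o2} (\<lambda>\<xi>. if \<xi> = ozero then \<alpha> else \<beta>)"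
  proof (rule strict_mono_onI)
    fix r s assume rs: "r \<in> {..<o2}" "s \<in> {..<o2}" "r < s"
    then have "s \<le> o1" by (simp add: less_osuc_iff)
    then have "r < o1" using rs(3) by (rule less_le_trans[rotated])
    then have "r \<le> ozero" by (simp only: less_osuc_iff)
    then have "r = ozero" by (intro antisym ozero_le)
    then show "(if r = ozero then \<alpha> else \<beta>) < (if s = ozero then \<alpha> else \<beta>)"
      using rs(3) \<open>\<alpha> < \<beta>\<close> by auto
  qed
  ultimately show ?thesis unfolding coi_def by (simp add: closed_lessThan)
qed

definition requirements :: "('i \<times> (('i \<times> 'i \<times> bool \<times> 'i \<times> 'i) set \<Rightarrow> bool)) set" where
  "requirements = ((\<lambda>n. (o2, pred_at n)) ` {..<\<kappa>} \<union> (\<lambda>n. (o2, split_at n)) ` {..<\<kappa>}) \<union>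
     ((\<lambda>(j, j'). (o2, color_at j j')) ` ({..<\<kappa>} \<times> {..<\<kappa>}) \<union>
      (\<lambda>(\<tau>, b). (osuc \<tau>, top_at \<tau> b)) ` (SIGMA \<tau>:{..<\<kappa>}. {..<\<tau>} \<rightarrow>\<^sub>E {..<\<kappa>}))"

text \<open>The critical kind is the last one: its sequences of length below \<kappa> with entries
  below \<kappa> are only \<kappa> many by \<open>functions_lepoll_kappa\<close>, that is, by the
  first application of the forcing axiom.\<close>

lemma requirements_lepoll:
  assumes FA: "FA \<kappa>"
  shows "requirements \<lesssim> {..<\<kappa>}"
proof -
  have im: "f ` X \<lesssim> {..<\<kappa>}" if "X \<lesssim> {..<\<kappa>}" for X :: "'x set" and f :: "'x \<Rightarrow> 'y"
    using lepoll_trans[OF image_lepoll that] .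
  have "{..<\<kappa>} \<times> {..<\<kappa>} \<lesssim> {..<\<kappa>}" by (intro times_lepoll_infinite infinite_kappa lepoll_refl)
  moreover have "(SIGMA \<tau>:{..<\<kappa>}. {..<\<tau>} \<rightarrow>\<^sub>E {..<\<kappa>}) \<lesssim> {..<\<kappa>}"
    by (intro Sigma_lepoll_infinite infinite_kappa lepoll_refl)
      (simp add: functions_lepoll_kappa[OF FA] small_lessThan)
  ultimately show ?thesis
    unfolding requirements_def
    by (intro Un_lepoll_infinite infinite_kappa lepoll_trans[OF image_lepoll]) simp_all
qed

lemma requirements_dense:
  assumes "(\<theta>, \<Psi>) \<in> requirements"
  shows "dense_property \<theta> \<Psi>"
proof -
  have top: "dense_property (osuc \<tau>) (top_at \<tau> b)" if "\<tau> < \<kappa>" "b \<in> {..<\<tau>} \<rightarrow>\<^sub>E {..<\<kappa>}" for \<tau> b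
    by (rule dense_top[OF that(1)]) (use PiE_mem[OF that(2)] in simp)
  show ?thesis
    using assms unfolding requirements_def
    by (elim UnE imageE SigmaE) (simp_all add: dense_pred dense_split dense_color top)
qed

lemma ex_generic_tree:
  assumes FA: "FA \<kappa>"
  shows "\<exists>L K. generic_tree lam \<kappa> e L K"
proof (rule ex_generic[OF FA requirements_lepoll[OF FA]])
  show "dense_property \<theta> \<Psi>" if "(\<theta>, \<Psi>) \<in> requirements" for \<theta> \<Psi> using requirements_dense[OF that] .
  fix \<G> :: "('i, bool \<times> 'i \<times> 'i) cond set"
  assume PP: "\<And>p. p \<in> \<G> \<Longrightarrow> PP p"
    and dir: "\<And>p q. p \<in> \<G> \<Longrightarrow> q \<in> \<G> \<Longrightarrow> \<exists>r\<in>\<G>. p \<sqsubseteq> r \<and> q \<sqsubseteq> r"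
    and gen: "\<And>\<theta> \<Psi> h. (\<theta>, \<Psi>) \<in> requirements \<Longrightarrow> coi {..<\<theta>} h \<Longrightarrow> \<exists>p\<in>\<G>. \<Psi> (pull \<theta> h (snd p))"
  define L where "L \<xi> n \<beta> k \<longleftrightarrow> \<xi> < \<beta> \<and> (\<exists>p\<in>\<G>. rL (snd p) \<xi> n \<beta> k)" for \<xi> n \<beta> k
  define K where "K \<alpha> \<delta> \<beta> j \<longleftrightarrow> (\<exists>p\<in>\<G>. rC (snd p) \<alpha> \<delta> \<beta> j)" for \<alpha> \<delta> \<beta> j
  \<comment> \<open>The bound \<open>r\<close> satisfies all clauses of \<open>tree_rel\<close> but
    need not come from the filter. A fact found in \<open>r\<close> therefore counts only when some
    condition in the filter decides the matter and uniqueness of predecessors, applied in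
    \<open>r\<close>, shows that it decides it the same way.\<close>
  have up: "\<exists>r. tree_ok r \<and> snd p \<subseteq> snd r \<and> snd q \<subseteq> snd r \<and> snd s \<subseteq> snd r" if pqs: "p \<in> \<G>" "q \<in> \<G>" "s \<in> \<G>" for p q s
  proof -
    obtain t where t: "t \<in> \<G>" "p \<sqsubseteq> t" "q \<sqsubseteq> t" using dir[OF pqs(1,2)] by blast
    obtain t' where t': "t' \<in> \<G>" "t \<sqsubseteq> t'" "s \<sqsubseteq> t'" using dir[OF t(1) pqs(3)] by blast
    obtain r where r: "tree_ok r" "t' \<sqsubseteq> r" using PP_W[OF PP[OF t'(1)]] by blast
    have "t \<sqsubseteq> r" using weaker_trans[OF t'(2) r(2)] .
    then have "p \<sqsubseteq> r" "q \<sqsubseteq> r" "s \<sqsubseteq> r"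
      using weaker_trans[OF t(2)] weaker_trans[OF t(3)] weaker_trans[OF t'(3) r(2)] by simp_all
    then show ?thesis using r(1) by (intro exI[of _ r]) (simp add: weaker_def)
  qed
  have L_less: "\<xi> < \<beta> \<and> n < \<kappa> \<and> k < \<kappa>" if "L \<xi> n \<beta> k" for \<xi> n \<beta> k
  proof -
    obtain p where p: "p \<in> \<G>" "rL (snd p) \<xi> n \<beta> k" "\<xi> < \<beta>" using \<open>L \<xi> n \<beta> k\<close> unfolding L_def by blast
    then obtain r where r: "tree_ok r" "snd p \<subseteq> snd r" using up[of p p p] by blast
    then have "n \<in> idx (snd r)" "k \<in> idx (snd r)" using rL_mono[OF r(2) p(2)] idx_rL by blast+
    then show ?thesis using tree_ok_idx[OF r(1)] p(3) by blast
  qed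
  have L_unique: "n = n'" if "L \<xi> n \<beta> k" "L \<xi> n' \<beta> k" for \<xi> n \<beta> k n'
  proof -
    obtain p q where pq: "p \<in> \<G>" "q \<in> \<G>" "rL (snd p) \<xi> n \<beta> k" "rL (snd q) \<xi> n' \<beta> k"
      using \<open>L \<xi> n \<beta> k\<close> \<open>L \<xi> n' \<beta> k\<close> unfolding L_def by blast
    then obtain r where r: "tree_ok r" "snd p \<subseteq> snd r" "snd q \<subseteq> snd r" using up[of p q q] by blast
    interpret r: tree_rel lam \<kappa> e "fst r" "rL (snd r)" "rC (snd r)" using tree_okD(4)[OF r(1)] .
    show ?thesis using r.L_unique rL_mono[OF r(2) pq(3)] rL_mono[OF r(3) pq(4)] by blast
  qed
  have L_pred: "\<exists>n. L \<xi> n \<beta> k" if lt: "\<xi> < \<beta>" and k: "k < \<kappa>" for \<xi> \<beta> k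
  proof -
    define h where "h = (\<lambda>\<zeta>::'i. if \<zeta> = ozero then \<xi> else \<beta>)"
    have "(o2, pred_at k) \<in> requirements" using k unfolding requirements_def by blast
    then obtain p where p: "p \<in> \<G>" "pred_at k (pull o2 h (snd p))" using gen coi_two[OF lt] unfolding h_def by blast
    then obtain n where "rL (snd p) (h ozero) n (h o1) k" unfolding pred_at_def by (auto simp: pull_rL o2_simps(1-3))
    then have "rL (snd p) \<xi> n \<beta> k" using less_imp_neq[OF o2_simps(1)] unfolding h_def by (simp split: if_splits)
    then show ?thesis using p(1) lt unfolding L_def by blast
  qed
  have L_trans: "L \<xi> n \<gamma> l" if l: "L \<xi> n \<beta> k" "L \<beta> k \<gamma> l" for \<xi> n \<beta> k \<gamma> l
  proof -
    have less: "\<xi> < \<gamma>" "l < \<kappa>" using L_less[OF l(1)] L_less[OF l(2)] by auto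
    \<comment> \<open>The filter decides on some predecessor \<open>m\<close>; the common bound then
      shows that it is \<open>n\<close>.\<close>
    obtain m where m: "L \<xi> m \<gamma> l" using L_pred[OF less] by blast
    obtain p q s where p: "p \<in> \<G>" "q \<in> \<G>" "s \<in> \<G>" "rL (snd p) \<xi> n \<beta> k" "rL (snd q) \<beta> k \<gamma> l" "rL (snd s) \<xi> m \<gamma> l"
      using l m unfolding L_def by blast
    obtain r where r: "tree_ok r" "snd p \<subseteq> snd r" "snd q \<subseteq> snd r" "snd s \<subseteq> snd r" using up[OF p(1-3)] by blast
    interpret r: tree_rel lam \<kappa> e "fst r" "rL (snd r)" "rC (snd r)" using tree_okD(4)[OF r(1)] .
    have "rL (snd r) \<xi> n \<gamma> l" using r.L_trans rL_mono[OF r(2) p(4)] rL_mono[OF r(3) p(5)] by blast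
    then have "n = m" using r.L_unique rL_mono[OF r(4) p(6)] by blast
    then show ?thesis using m by simp
  qed
  have L_below: "L \<xi> n \<xi>' n'" if l: "L \<xi> n \<beta> k" "L \<xi>' n' \<beta> k" "\<xi> < \<xi>'" for \<xi> n \<beta> k \<xi>' n'
  proof -
    obtain m where m: "L \<xi> m \<xi>' n'" using L_pred[OF l(3)] L_less[OF l(2)] by blast
    then have "L \<xi> m \<beta> k" using L_trans l(2) by blast
    then show ?thesis using m L_unique[OF l(1)] by blast
  qed
  have L_split: "\<exists>k k'. k \<noteq> k' \<and> L \<xi> n \<beta> k \<and> L \<xi> n \<beta> k'" if lt: "\<xi> < \<beta>" and n: "n < \<kappa>" for \<xi> \<beta> n
  proof -
    define h where "h = (\<lambda>\<zeta>::'i. if \<zeta> = ozero then \<xi> else \<beta>)"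
    have "(o2, split_at n) \<in> requirements" using n unfolding requirements_def by blast
    then obtain p where p: "p \<in> \<G>" "split_at n (pull o2 h (snd p))" using gen coi_two[OF lt] unfolding h_def by blast
    then obtain k k' where "k \<noteq> k'" "rL (snd p) (h ozero) n (h o1) k" "rL (snd p) (h ozero) n (h o1) k'"
      unfolding split_at_def by (auto simp: pull_rL o2_simps(1-3))
    then have "k \<noteq> k'" "rL (snd p) \<xi> n \<beta> k" "rL (snd p) \<xi> n \<beta> k'"
      using less_imp_neq[OF o2_simps(1)] unfolding h_def by (simp_all split: if_splits)
    then show ?thesis using p(1) lt unfolding L_def by blast
  qed
  \<comment> \<open>A single condition settles the predecessors of all \<lambda> coordinates at
    once, which directedness of the filter alone would not give.\<close>
  have color: "\<exists>p\<in>\<G>. (\<forall>i<lam. \<exists>k. rL (snd p) \<alpha> k \<beta> (e j' i)) \<and>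
      ((\<forall>i<lam. rL (snd p) \<alpha> (e j i) \<beta> (e j' i)) \<longrightarrow> (\<exists>\<delta><\<kappa>. rC (snd p) \<alpha> \<delta> \<beta> j'))"
    if lt: "\<alpha> < \<beta>" and j: "j < \<kappa>" "j' < \<kappa>" for \<alpha> \<beta> j j'
  proof -
    define h where "h = (\<lambda>\<zeta>::'i. if \<zeta> = ozero then \<alpha> else \<beta>)"
    have h: "h ozero = \<alpha>" "h o1 = \<beta>" using less_imp_neq[OF o2_simps(1)] unfolding h_def by auto
    have "(\<lambda>(j, j'). (o2, color_at j j')) (j, j') \<in> requirements"
      unfolding requirements_def by (rule UnI2, rule UnI1, rule imageI) (use j in simp)
    then have "(o2, color_at j j') \<in> requirements" by simp
    then obtain p where p: "p \<in> \<G>" "color_at j j' (pull o2 h (snd p))" using gen coi_two[OF lt] unfolding h_def by blast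
    then show ?thesis
      unfolding color_at_def pull_rL[OF o2_simps(2,3)] pull_rC[OF o2_simps(2,3)] h by blast
  qed
  have K_ex: "\<exists>\<delta><\<kappa>. K \<alpha> \<delta> \<beta> j'" if j: "j < \<kappa>" "j' < \<kappa>" "\<alpha> < \<beta>" and l: "\<And>i. i < lam \<Longrightarrow> L \<alpha> (e j i) \<beta> (e j' i)"
    for j j' \<alpha> \<beta>
  proof -
    obtain p where p: "p \<in> \<G>" "\<And>i. i < lam \<Longrightarrow> \<exists>k. rL (snd p) \<alpha> k \<beta> (e j' i)"
      "(\<forall>i<lam. rL (snd p) \<alpha> (e j i) \<beta> (e j' i)) \<Longrightarrow> \<exists>\<delta><\<kappa>. rC (snd p) \<alpha> \<delta> \<beta> j'"
      using color[OF j(3,1,2)] by blast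
    have "rL (snd p) \<alpha> (e j i) \<beta> (e j' i)" if i: "i < lam" for i
    proof -
      obtain k where k: "rL (snd p) \<alpha> k \<beta> (e j' i)" using p(2)[OF i] by blast
      then have "L \<alpha> k \<beta> (e j' i)" using p(1) j(3) unfolding L_def by blast
      then show ?thesis using k L_unique[OF l[OF i]] by blast
    qed
    then show ?thesis using p(1,3) unfolding K_def by blast
  qed
  have K_less: "\<exists>i<lam. L \<beta> (e j i) \<gamma> (e j' i)" if "K \<alpha> \<delta> \<beta> j" "K \<alpha> \<delta> \<gamma> j'" and less: "\<beta> < \<gamma>" for \<alpha> \<delta> \<beta> j \<gamma> j'
  proof -
    obtain p q where p: "p \<in> \<G>" "q \<in> \<G>" "rC (snd p) \<alpha> \<delta> \<beta> j" "rC (snd q) \<alpha> \<delta> \<gamma> j'"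
      using \<open>K \<alpha> \<delta> \<beta> j\<close> \<open>K \<alpha> \<delta> \<gamma> j'\<close> unfolding K_def by blast
    have "j' < \<kappa>"
    proof -
      obtain r where r: "tree_ok r" "snd q \<subseteq> snd r" using up[of q q q] p(2) by blast
      interpret r: tree_rel lam \<kappa> e "fst r" "rL (snd r)" "rC (snd r)" using tree_okD(4)[OF r(1)] .
      have "rC (snd r) \<alpha> \<delta> \<gamma> j'" using p(4) r(2) unfolding rC_def by blast
      then show ?thesis using r.C_levels by blast
    qed
    \<comment> \<open>Only the first clause of \<open>color_at\<close> is wanted here, so
      \<open>j'\<close> also fills the place of the lower vector.\<close>
    then obtain s where s: "s \<in> \<G>" "\<And>i. i < lam \<Longrightarrow> \<exists>k. rL (snd s) \<beta> k \<gamma> (e j' i)"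
      using color[OF less, of j' j'] by blast
    obtain r where r: "tree_ok r" "snd p \<subseteq> snd r" "snd q \<subseteq> snd r" "snd s \<subseteq> snd r" using up[OF p(1,2) s(1)] by blast
    interpret r: tree_rel lam \<kappa> e "fst r" "rL (snd r)" "rC (snd r)" using tree_okD(4)[OF r(1)] .
    have "rC (snd r) \<alpha> \<delta> \<beta> j" "rC (snd r) \<alpha> \<delta> \<gamma> j'" using p(3,4) r(2,3) unfolding rC_def by blast+
    then obtain i where i: "i < lam" "rL (snd r) \<beta> (e j i) \<gamma> (e j' i)"
      using many_ex[OF r.C_many[OF _ _ less_imp_le[OF less]]] by blast
    obtain k where k: "rL (snd s) \<beta> k \<gamma> (e j' i)" using s(2)[OF i(1)] by blast
    then have "k = e j i" using r.L_unique[OF rL_mono[OF r(4)] i(2)] by blast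
    then show ?thesis using k i(1) s(1) less unfolding L_def by blast
  qed
  have K_eq: "\<exists>i<lam. e j i = e j' i" if "K \<alpha> \<delta> \<beta> j" "K \<alpha> \<delta> \<beta> j'" for \<alpha> \<delta> \<beta> j j'
  proof -
    obtain p q where p: "p \<in> \<G>" "q \<in> \<G>" "rC (snd p) \<alpha> \<delta> \<beta> j" "rC (snd q) \<alpha> \<delta> \<beta> j'"
      using \<open>K \<alpha> \<delta> \<beta> j\<close> \<open>K \<alpha> \<delta> \<beta> j'\<close> unfolding K_def by blast
    obtain r where r: "tree_ok r" "snd p \<subseteq> snd r" "snd q \<subseteq> snd r" using up[OF p(1,2,2)] by blast
    interpret r: tree_rel lam \<kappa> e "fst r" "rL (snd r)" "rC (snd r)" using tree_okD(4)[OF r(1)] .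
    have "rC (snd r) \<alpha> \<delta> \<beta> j" "rC (snd r) \<alpha> \<delta> \<beta> j'" using p(3,4) r(2,3) unfolding rC_def by blast+
    then obtain i where "i < lam" "rL (snd r) \<beta> (e j i) \<beta> (e j' i)"
      using many_ex[OF r.C_many[OF _ _ order_refl]] by blast
    then show ?thesis using r.L_level_eq by blast
  qed
  have L_complete: "\<exists>\<beta> k. k < \<kappa> \<and> (\<forall>\<xi>\<in>X. L \<xi> (b \<xi>) \<beta> k)"
    if X: "small X" and b: "\<And>\<xi>. \<xi> \<in> X \<Longrightarrow> b \<xi> < \<kappa>"
      and coh: "\<And>\<xi> \<xi>'. \<xi> \<in> X \<Longrightarrow> \<xi>' \<in> X \<Longrightarrow> \<xi> < \<xi>' \<Longrightarrow> L \<xi> (b \<xi>) \<xi>' (b \<xi>')" for X b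
  proof -
    \<comment> \<open>\<open>X\<close> need not be closed, so the chain is first extended to the
      closed set \<open>Y\<close>, whose top \<open>s\<close> is to carry the node above the
      chain.\<close>
    define s where "s = ssup X"
    define Y where "Y = cl (insert s X)"
    note bX = small_bounded[OF X]
    have Xs: "\<xi> < s" if "\<xi> \<in> X" for \<xi> unfolding s_def using less_ssup[OF bX that] .
    have sm: "small (insert s X)" using X by (rule small_insert)
    have Y: "small Y" "closed_in_sup Y" "s \<in> Y"
      unfolding Y_def using small_cl[OF sm] closed_cl[OF small_bounded[OF sm]] cl_superset[of "insert s X"] by blast+
    have XY: "X \<subseteq> Y" unfolding Y_def using cl_superset[of "insert s X"] by blast
    have Y_le: "y \<le> s" if y: "y \<in> Y" for y
    proof -
      obtain \<beta> where "\<beta> \<in> insert s X" "y \<le> \<beta>" using cl_le[OF small_bounded[OF sm]] y unfolding Y_def by blast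
      then show ?thesis using Xs by fastforce
    qed
    obtain \<tau> h where h: "\<tau> < \<kappa>" "coi {..<osuc \<tau>} h" "h ` {..<\<tau>} = Y - {s}" "h \<tau> = s"
      by (rule coi_enumeration_max[OF Y Y_le])
    define LE where "LE \<xi> n \<beta> k \<longleftrightarrow> L \<xi> n \<beta> k \<or> (\<xi> = \<beta> \<and> n = k)" for \<xi> n \<beta> k
    have LE_trans: "LE \<xi> n \<gamma> l" if "LE \<xi> n \<beta> k" "LE \<beta> k \<gamma> l" for \<xi> n \<beta> k \<gamma> l
      using that L_trans unfolding LE_def by blast
    have LE_below: "L \<xi> n \<xi>' n'" if l: "LE \<xi> n \<beta> k" "LE \<xi>' n' \<beta> k" and lt: "\<xi> < \<xi>'" for \<xi> n \<beta> k \<xi>' n'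
    proof -
      have "\<xi>' \<le> \<beta>" using l(2) L_less[of \<xi>' n' \<beta> k] unfolding LE_def by auto
      then have "L \<xi> n \<beta> k" using l(1) lt unfolding LE_def by auto
      then show ?thesis using l(2) lt L_below unfolding LE_def by blast
    qed
    have cohE: "LE x (b x) x' (b x')" if "x \<in> X" "x' \<in> X" "x \<le> x'" for x x'
      using coh[of x x'] that unfolding LE_def by (cases "x = x'") auto
    \<comment> \<open>The node at the level \<open>y\<close> on the branch generated by the chain;
      coherence makes the element of \<open>X\<close> above \<open>y\<close> irrelevant.\<close>
    define c where "c y = (SOME n. \<exists>x\<in>X. LE y n x (b x))" for y
    have c: "\<exists>x\<in>X. LE y (c y) x (b x)" if y: "y \<in> Y - {s}" for y
    proof -
      have "y < s" using Y_le[of y] y by (auto simp: order.order_iff_strict)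
      then obtain x where x: "x \<in> X" "y \<le> x" unfolding s_def less_ssup_iff[OF bX] by blast
      have "\<exists>n. LE y n x (b x)"
        using L_pred[of y x "b x"] x b[OF x(1)] unfolding LE_def by (cases "y = x") auto
      then have "\<exists>n. \<exists>x\<in>X. LE y n x (b x)" using x(1) by blast
      then show ?thesis unfolding c_def by (rule someI_ex)
    qed
    have c_coh: "L y (c y) y' (c y')" if y: "y \<in> Y - {s}" "y' \<in> Y - {s}" "y < y'" for y y'
    proof -
      obtain x x' where x: "x \<in> X" "LE y (c y) x (b x)" "x' \<in> X" "LE y' (c y') x' (b x')"
        using c[OF y(1)] c[OF y(2)] by blast
      show ?thesis
      proof (cases "x \<le> x'")
        case True
        then show ?thesis using LE_below[OF LE_trans[OF x(2) cohE[OF x(1,3)]] x(4) y(3)] by blast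
      next
        case False
        then show ?thesis using LE_below[OF x(2) LE_trans[OF x(4) cohE[OF x(3,1)]] y(3)] by simp
      qed
    qed
    have XYs: "x \<in> Y - {s}" if "x \<in> X" for x using XY Xs[OF that] that by blast
    have cb: "c x = b x" if x: "x \<in> X" for x
    proof -
      obtain x' where x': "x' \<in> X" "LE x (c x) x' (b x')" using c[OF XYs[OF x]] by blast
      show ?thesis
      proof (cases "x = x'")
        case True
        then show ?thesis using x'(2) L_less[of x "c x" x "b x"] unfolding LE_def by auto
      next
        case False
        then have l: "L x (c x) x' (b x')" using x'(2) unfolding LE_def by blast
        then show ?thesis using L_unique[OF l coh[OF x x'(1)]] L_less[OF l] by blast
      qed
    qed
    have c_less: "c y < \<kappa>" if y: "y \<in> Y - {s}" for y
    proof -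
      obtain x where "x \<in> X" "LE y (c y) x (b x)" using c[OF y] by blast
      then show ?thesis using L_less[of y "c y" x "b x"] b unfolding LE_def by auto
    qed
    have hY: "h \<zeta> \<in> Y - {s}" if "\<zeta> < \<tau>" for \<zeta> using h(3) that by blast
    define b' where "b' = restrict (\<lambda>\<zeta>. c (h \<zeta>)) {..<\<tau>}"
    have "b' \<in> {..<\<tau>} \<rightarrow>\<^sub>E {..<\<kappa>}" unfolding b'_def using c_less[OF hY] by auto
    then have "(\<tau>, b') \<in> (SIGMA \<tau>:{..<\<kappa>}. {..<\<tau>} \<rightarrow>\<^sub>E {..<\<kappa>})" using h(1) by blast
    then have "(\<lambda>(\<tau>, b). (osuc \<tau>, top_at \<tau> b)) (\<tau>, b') \<in> requirements"
      unfolding requirements_def by (intro UnI2 imageI)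
    then have "(osuc \<tau>, top_at \<tau> b') \<in> requirements" by simp
    then obtain p where p: "p \<in> \<G>" "top_at \<tau> b' (pull (osuc \<tau>) h (snd p))" using gen h(2) by blast
    have lt: "\<zeta> < osuc \<tau>" if "\<zeta> < \<tau>" for \<zeta> using that by (simp add: less_osuc_iff)
    have h_mono: "h \<zeta> < h \<zeta>'" if "\<zeta>' < \<tau>" "\<zeta> < \<zeta>'" for \<zeta> \<zeta>'
      using coi_less_iff[OF h(2), of \<zeta> \<zeta>'] lt less_trans[OF that(2,1)] that by auto
    have b'_c: "b' \<zeta> = c (h \<zeta>)" if "\<zeta> < \<tau>" for \<zeta> unfolding b'_def using that by simp
    \<comment> \<open>The first clause of \<open>top_at\<close> gives some predecessor inside
      \<open>p\<close>, and uniqueness in the generic tree identifies it with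
      \<open>b' \<zeta>\<close>. Thus \<open>p\<close> itself knows that \<open>b'\<close> is a
      chain and must provide the node on top.\<close>
    have "rL (snd p) (h \<zeta>) (b' \<zeta>) (h \<zeta>') (b' \<zeta>')" if z: "\<zeta>' < \<tau>" "\<zeta> < \<zeta>'" for \<zeta> \<zeta>'
    proof -
      have "\<zeta> < \<tau>" using less_trans[OF z(2,1)] .
      have "\<exists>k. (\<zeta>, \<zeta>', True, k, b' \<zeta>') \<in> pull (osuc \<tau>) h (snd p)" using p(2) z unfolding top_at_def by blast
      then obtain k where k: "rL (snd p) (h \<zeta>) k (h \<zeta>') (b' \<zeta>')" using pull_rL[OF lt lt] z(1) \<open>\<zeta> < \<tau>\<close> by blast
      then have "L (h \<zeta>) k (h \<zeta>') (b' \<zeta>')" using p(1) h_mono[OF z] unfolding L_def by blast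
      moreover have "L (h \<zeta>) (b' \<zeta>) (h \<zeta>') (b' \<zeta>')"
        using c_coh[OF hY[OF \<open>\<zeta> < \<tau>\<close>] hY[OF z(1)] h_mono[OF z]] b'_c[OF z(1)] b'_c[OF \<open>\<zeta> < \<tau>\<close>] by simp
      ultimately show ?thesis using k L_unique by blast
    qed
    then have "\<forall>\<xi>'<\<tau>. \<forall>\<xi><\<xi>'. (\<xi>, \<xi>', True, b' \<xi>, b' \<xi>') \<in> pull (osuc \<tau>) h (snd p)"
      using pull_rL[OF lt lt] less_trans by blast
    then obtain k where k: "k < \<kappa>" "\<And>\<zeta>. \<zeta> < \<tau> \<Longrightarrow> (\<zeta>, \<tau>, True, b' \<zeta>, k) \<in> pull (osuc \<tau>) h (snd p)"
      using p(2) unfolding top_at_def by blast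
    have "L x (b x) s k" if x: "x \<in> X" for x
    proof -
      have "x \<in> h ` {..<\<tau>}" using XYs[OF x] h(3) by simp
      then obtain \<zeta> where \<zeta>: "\<zeta> < \<tau>" "x = h \<zeta>" by blast
      have "rL (snd p) (h \<zeta>) (b' \<zeta>) (h \<tau>) k" using k(2)[OF \<zeta>(1)] pull_rL[OF lt[OF \<zeta>(1)] less_osuc] by blast
      then have "rL (snd p) x (b x) s k" using b'_c[OF \<zeta>(1)] cb[OF x] \<zeta>(2) h(4) by simp
      then show ?thesis using p(1) Xs[OF x] unfolding L_def by blast
    qed
    then show ?thesis using k(1) by blast
  qed
  have "generic_tree lam \<kappa> e L K"
  proof unfold_locales
    show "\<exists>\<beta> k. k < \<kappa> \<and> (\<forall>\<xi>\<in>X. L \<xi> (b \<xi>) \<beta> k)" if "small X" "\<And>\<xi>. \<xi> \<in> X \<Longrightarrow> b \<xi> < \<kappa>"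
      "\<And>\<xi> \<xi>'. \<xi> \<in> X \<Longrightarrow> \<xi>' \<in> X \<Longrightarrow> \<xi> < \<xi>' \<Longrightarrow> L \<xi> (b \<xi>) \<xi>' (b \<xi>')" for X b using L_complete[OF that] .
    show "\<exists>\<delta><\<kappa>. K \<alpha> \<delta> \<beta> j'" if "j < \<kappa>" "j' < \<kappa>" "\<alpha> < \<beta>" "\<And>i. i < lam \<Longrightarrow> L \<alpha> (e j i) \<beta> (e j' i)" for j j' \<alpha> \<beta>
      using K_ex[OF that] .
    show "\<xi> < \<beta> \<and> n < \<kappa> \<and> k < \<kappa>" if "L \<xi> n \<beta> k" for \<xi> n \<beta> k using L_less[OF that] .
    show "n = n'" if "L \<xi> n \<beta> k" "L \<xi> n' \<beta> k" for \<xi> n \<beta> k n' using L_unique[OF that] .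
    show "\<exists>n. L \<xi> n \<beta> k" if "\<xi> < \<beta>" "k < \<kappa>" for \<xi> \<beta> k using L_pred[OF that] .
    show "L \<xi> n \<gamma> l" if "L \<xi> n \<beta> k" "L \<beta> k \<gamma> l" for \<xi> n \<beta> k \<gamma> l using L_trans[OF that] .
    show "L \<xi> n \<xi>' n'" if "L \<xi> n \<beta> k" "L \<xi>' n' \<beta> k" "\<xi> < \<xi>'" for \<xi> n \<beta> k \<xi>' n' using L_below[OF that] .
    show "\<exists>k k'. k \<noteq> k' \<and> L \<xi> n \<beta> k \<and> L \<xi> n \<beta> k'" if "\<xi> < \<beta>" "n < \<kappa>" for \<xi> \<beta> n using L_split[OF that] .
    show "\<exists>i<lam. L \<beta> (e j i) \<gamma> (e j' i)" if "K \<alpha> \<delta> \<beta> j" "K \<alpha> \<delta> \<gamma> j'" "\<beta> < \<gamma>" for \<alpha> \<delta> \<beta> j \<gamma> j' using K_less[OF that] .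
    show "\<exists>i<lam. e j i = e j' i" if "K \<alpha> \<delta> \<beta> j" "K \<alpha> \<delta> \<beta> j'" for \<alpha> \<delta> \<beta> j j' using K_eq[OF that] .
  qed
  then show ?thesis by blast
qed

end

text \<open>Rigidity of well-orders. It pins down the level of a node although
  \<open>level_of\<close> allows an arbitrary isomorphism onto the segment.\<close>

lemma initial_segments_isomorphic_imp_eq:
  fixes A S :: "'i::wellorder set"
  assumes A: "\<And>a b. b \<in> A \<Longrightarrow> a < b \<Longrightarrow> a \<in> A" and S: "\<And>a b. b \<in> S \<Longrightarrow> a < b \<Longrightarrow> a \<in> S"
    and g: "bij_betw g A S" and mono: "\<And>a b. a \<in> A \<Longrightarrow> b \<in> A \<Longrightarrow> a < b \<Longrightarrow> g a < g b"
  shows "A = S"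
proof -
  have "g a = a" if "a \<in> A" for a
    using that
  proof (induction a rule: less_induct)
    case (less a)
    have gS: "g a \<in> S" using g less.prems unfolding bij_betw_def by blast
    show ?case
    proof (cases "g a" a rule: linorder_cases)
      case less': less
      then have "g a \<in> A" using A less.prems by blast
      then show ?thesis using less.IH[OF less'] mono[OF _ less.prems less'] less' by simp
    next
      case greater
      then have "a \<in> S" using S gS by blast
      then obtain c where c: "c \<in> A" "g c = a" using g unfolding bij_betw_def by blast
      show ?thesis
      proof (cases c a rule: linorder_cases)
        case less': less
        then show ?thesis using less.IH[OF less' c(1)] c(2) by simp
      next
        case greater': greater
        then show ?thesis using mono[OF less.prems c(1)] c(2) greater by simp
      qed (use c(2) in simp)
    qed
  qed
  then have "g ` A = A" by force
  then show ?thesis using g unfolding bij_betw_def by simp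
qed

section \<open>From the generic relations to a super-Souslin tree\<close>

context generic_tree
begin

text \<open>The nodes are kept abstract and are given by level and name, so that pairs may be
  replaced by any code for them; in the end they are coded as elements of the index type.\<close>

lemma super_souslin_complete:
  fixes T :: "'n set" and lv nm :: "'n \<Rightarrow> 'i"
  assumes bij: "bij_betw (\<lambda>u. (lv u, nm u)) T (UNIV \<times> {..<\<kappa>})"
    and lt_iff: "\<And>u v. lt u v \<longleftrightarrow> L (lv u) (nm u) (lv v) (nm v)"
  shows "super_souslin lam \<kappa> T lt \<and> complete_tree \<kappa> T lt"
proof -
  have nm: "nm u < \<kappa>" if "u \<in> T" for u using bij that unfolding bij_betw_def by blast
  have eqI: "u = v" if "u \<in> T" "v \<in> T" "lv u = lv v" "nm u = nm v" for u v
    using inj_onD[OF bij_betw_imp_inj_on[OF bij], of u v] that by simp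
  have node: "\<exists>u\<in>T. lv u = \<alpha> \<and> nm u = n" if "n < \<kappa>" for \<alpha> n
  proof -
    have "(\<alpha>, n) \<in> (\<lambda>u. (lv u, nm u)) ` T" using bij that unfolding bij_betw_def by blast
    then show ?thesis by blast
  qed
  have lt_lv: "lv u < lv v" if "lt u v" for u v using L_less that unfolding lt_iff by blast
  have lt_eq: "u = v" if "u \<in> T" "v \<in> T" "lt u w" "lt v w" "lv u = lv v" for u v w
    using eqI that L_unique unfolding lt_iff by metis
  have lt_below: "lt u v" if "lt u w" "lt v w" "lv u < lv v" for u v w
    using that L_below unfolding lt_iff by blast
  have zero_lam: "ozero < lam"
  proof (rule ccontr)
    assume "\<not> ozero < lam"
    then have "{..<lam} \<subseteq> {..<ozero}" by (intro lessThan_subset_iff[THEN iffD2]) simp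
    then show False using infinite_lam by simp
  qed
  then have zero_kappa: "ozero < \<kappa>" using lam_less_kappa by simp
  have tree: "is_tree T lt"
    unfolding is_tree_def
  proof (intro conjI ballI allI impI)
    show "irreflp_on T lt" using lt_lv by (intro irreflp_onI) blast
    show "transp_on T lt" using L_trans unfolding lt_iff by (intro transp_onI) blast
    fix u A assume "u \<in> T" and A: "A \<subseteq> cone T lt u \<and> A \<noteq> {}"
    then obtain a where a: "a \<in> A" by blast
    define \<mu> where "\<mu> = (LEAST \<alpha>. \<alpha> \<in> lv ` A)"
    have "\<mu> \<in> lv ` A" unfolding \<mu>_def using LeastI[of "\<lambda>\<alpha>. \<alpha> \<in> lv ` A" "lv a"] a by blast
    then obtain m where m: "m \<in> A" "lv m = \<mu>" by blast
    have "v = m \<or> lt m v" if v: "v \<in> A" for v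
    proof -
      have "\<mu> \<le> lv v" unfolding \<mu>_def by (rule Least_le) (rule imageI[OF v])
      have *: "v \<in> T" "lt v u" "m \<in> T" "lt m u" using A v m(1) unfolding cone_def by blast+
      show ?thesis
      proof (cases "lv v = \<mu>")
        case True
        then show ?thesis using lt_eq[OF *(1,3,2,4)] m(2) by simp
      next
        case False
        then have "lv m < lv v" using \<open>\<mu> \<le> lv v\<close> m(2) by simp
        then show ?thesis using lt_below[OF *(4,2)] by blast
      qed
    qed
    then show "\<exists>m\<in>A. \<forall>v\<in>A. v = m \<or> lt m v" using m(1) by blast
  qed
  have cone_bij: "bij_betw lv (cone T lt u) {..<lv u}" if u: "u \<in> T" for u
    unfolding bij_betw_def
  proof (intro conjI inj_onI equalityI subsetI)
    show "v = w" if "v \<in> cone T lt u" "w \<in> cone T lt u" "lv v = lv w" for v w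
      using that lt_eq unfolding cone_def by blast
    show "\<alpha> \<in> {..<lv u}" if "\<alpha> \<in> lv ` cone T lt u" for \<alpha> using that lt_lv unfolding cone_def by blast
    fix \<alpha> assume "\<alpha> \<in> {..<lv u}"
    then obtain n where n: "L \<alpha> n (lv u) (nm u)" using L_pred nm[OF u] by blast
    then obtain v where "v \<in> T" "lv v = \<alpha>" "nm v = n" using node L_less by blast
    then show "\<alpha> \<in> lv ` cone T lt u" using n unfolding cone_def lt_iff by blast
  qed
  have cone_lt: "lt v w \<longleftrightarrow> lv v < lv w" if "v \<in> cone T lt u" "w \<in> cone T lt u" for u v w
    using that lt_lv lt_below unfolding cone_def by blast
  have level_eq: "{..<lv u} = S"
    if u: "u \<in> level_of T lt S" and S: "\<And>a b. b \<in> S \<Longrightarrow> a < b \<Longrightarrow> a \<in> S" for u and S :: "'i set"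
  proof -
    obtain f where uT: "u \<in> T" and f: "bij_betw f (cone T lt u) S"
      "\<And>v w. v \<in> cone T lt u \<Longrightarrow> w \<in> cone T lt u \<Longrightarrow> lt v w \<longleftrightarrow> f v < f w"
      using u unfolding level_of_def by blast
    define g where "g = f \<circ> inv_into (cone T lt u) lv"
    have inv: "bij_betw (inv_into (cone T lt u) lv) {..<lv u} (cone T lt u)"
      using bij_betw_inv_into[OF cone_bij[OF uT]] .
    have li: "lv (inv_into (cone T lt u) lv a) = a" if "a < lv u" for a
      using bij_betw_inv_into_right[OF cone_bij[OF uT], of a] that by simp
    show ?thesis
    proof (rule initial_segments_isomorphic_imp_eq)
      show "bij_betw g {..<lv u} S" unfolding g_def using bij_betw_trans[OF inv f(1)] .
      fix a b assume ab: "a \<in> {..<lv u}" "b \<in> {..<lv u}" "a < b"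
      define a' b' where "a' = inv_into (cone T lt u) lv a" and "b' = inv_into (cone T lt u) lv b"
      have c: "a' \<in> cone T lt u" "b' \<in> cone T lt u" unfolding a'_def b'_def using inv ab(1,2) unfolding bij_betw_def by blast+
      have "lv a' < lv b'" unfolding a'_def b'_def using li ab by simp
      then show "g a < g b" using f(2)[OF c] cone_lt[OF c] unfolding g_def a'_def b'_def by simp
    qed (use S in auto)
  qed
  have level: "level T lt \<alpha> = {u \<in> T. lv u = \<alpha>}" for \<alpha>
  proof (intro equalityI subsetI)
    fix u assume u: "u \<in> level T lt \<alpha>"
    then have "{..<lv u} = {..<\<alpha>}" by (rule level_eq) auto
    then show "u \<in> {u \<in> T. lv u = \<alpha>}" using u unfolding level_of_def by (simp add: lessThan_eq_iff)
  next
    fix u assume "u \<in> {u \<in> T. lv u = \<alpha>}"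
    then show "u \<in> level T lt \<alpha>" using cone_bij cone_lt unfolding level_of_def by blast
  qed
  have "is_card_tree TYPE('i) T lt"
    unfolding is_card_tree_def
  proof (intro conjI allI)
    show "is_tree T lt" by (rule tree)
    show "level T lt \<alpha> \<noteq> {}" for \<alpha> :: 'i using node[OF zero_kappa, of \<alpha>] unfolding level by blast
    show "level T lt \<alpha> \<prec> (UNIV :: 'i set)" for \<alpha> :: 'i
    proof -
      have "inj_on nm (level T lt \<alpha>)"
      proof (rule inj_onI)
        fix u v assume "u \<in> level T lt \<alpha>" "v \<in> level T lt \<alpha>" "nm u = nm v"
        then show "u = v" using eqI[of u v] unfolding level by simp
      qed
      moreover have "nm ` level T lt \<alpha> \<subseteq> {..<\<kappa>}" using nm unfolding level by blast
      ultimately have "level T lt \<alpha> \<lesssim> {..<\<kappa>}" unfolding lepoll_def by blast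
      then show ?thesis using kappa_lesspoll_UNIV by (rule lesspoll_trans1)
    qed
    have "u \<notin> level_of T lt (UNIV :: 'i set)" for u
    proof
      assume "u \<in> level_of T lt (UNIV :: 'i set)"
      then have "{..<lv u} = UNIV" by (rule level_eq) simp
      then show False by (metis UNIV_I lessThan_iff less_irrefl)
    qed
    then show "level_of T lt (UNIV :: 'i set) = {}" by blast
  qed
  moreover have "normal_tree TYPE('i) T lt"
    unfolding normal_tree_def level
  proof (intro allI impI ballI)
    fix \<alpha> \<beta> :: 'i and u assume "\<alpha> < \<beta>" "u \<in> {u \<in> T. lv u = \<alpha>}"
    then obtain k where k: "L (lv u) (nm u) \<beta> k" using L_split nm by blast
    then obtain v where "v \<in> T" "lv v = \<beta>" "nm v = k" using node L_less by blast
    then show "\<exists>v\<in>{u \<in> T. lv u = \<beta>}. lt u v" using k unfolding lt_iff by blast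
  qed
  moreover have "splitting T lt"
    unfolding splitting_def
  proof
    fix u assume u: "u \<in> T"
    have imm: "\<not> (\<exists>z\<in>T. lt u z \<and> lt z v)" if "lv v = osuc (lv u)" for v
    proof
      assume "\<exists>z\<in>T. lt u z \<and> lt z v"
      then obtain z where "lv u < lv z" "lv z < lv v" using lt_lv by blast
      then show False using that less_osuc_iff by simp
    qed
    obtain k k' where k: "k \<noteq> k'" "L (lv u) (nm u) (osuc (lv u)) k" "L (lv u) (nm u) (osuc (lv u)) k'"
      using L_split[OF less_osuc nm[OF u]] by blast
    obtain v where v: "v \<in> T" "lv v = osuc (lv u)" "nm v = k" using node L_less[OF k(2)] by blast
    obtain w where w: "w \<in> T" "lv w = osuc (lv u)" "nm w = k'" using node L_less[OF k(3)] by blast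
    have "v \<noteq> w" "lt u v" "lt u w" using k v w unfolding lt_iff by auto
    then show "\<exists>v\<in>T. \<exists>w\<in>T. v \<noteq> w \<and> lt u v \<and> \<not> (\<exists>z\<in>T. lt u z \<and> lt z v) \<and> lt u w \<and> \<not> (\<exists>z\<in>T. lt u z \<and> lt z w)"
      using v(1) w(1) imm[OF v(2)] imm[OF w(2)] by blast
  qed
  moreover have "\<exists>f. (\<forall>a\<in>tree_pow lam T lt. \<forall>b\<in>tree_pow lam T lt. less_pow lam lt a b \<longrightarrow> f a b < \<kappa>) \<and>
      (\<forall>a\<in>tree_pow lam T lt. \<forall>b\<in>tree_pow lam T lt. \<forall>c\<in>tree_pow lam T lt.
         less_pow lam lt a b \<and> less_pow lam lt a c \<and> f a b = f a c \<longrightarrow>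
         (\<exists>i<lam. b i = c i \<or> lt (b i) (c i) \<or> lt (c i) (b i)))"
  proof -
    define jn where "jn a = name_of (\<lambda>i. nm (a i))" for a :: "'i \<Rightarrow> 'n"
    define lev where "lev a = lv (a ozero)" for a :: "'i \<Rightarrow> 'n"
    have pow: "jn a < \<kappa>" "\<And>i. i < lam \<Longrightarrow> e (jn a) i = nm (a i)" "\<And>i. i < lam \<Longrightarrow> lv (a i) = lev a"
      "\<And>i. i < lam \<Longrightarrow> a i \<in> T" if a: "a \<in> tree_pow lam T lt" for a
    proof -
      obtain \<alpha> :: 'i where \<alpha>: "a \<in> {..<lam} \<rightarrow>\<^sub>E level T lt \<alpha>" "inj_on a {..<lam}" using a unfolding tree_pow_def by blast
      have ai: "a i \<in> T" "lv (a i) = \<alpha>" if "i < lam" for i using PiE_mem[OF \<alpha>(1), of i] that unfolding level by simp_all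
      show "a i \<in> T" if "i < lam" for i using ai(1)[OF that] .
      show "lv (a i) = lev a" if "i < lam" for i unfolding lev_def using ai(2)[OF that] ai(2)[OF zero_lam] by simp
      have inj: "inj_on (\<lambda>i. nm (a i)) {..<lam}"
      proof (rule inj_onI)
        fix i i' assume i: "i \<in> {..<lam}" "i' \<in> {..<lam}" "nm (a i) = nm (a i')"
        then have "a i = a i'" using eqI[of "a i" "a i'"] ai by simp
        then show "i = i'" using inj_onD[OF \<alpha>(2)] i(1,2) by blast
      qed
      have less: "nm (a i) < \<kappa>" if "i < lam" for i using nm[OF ai(1)[OF that]] .
      show "jn a < \<kappa>" unfolding jn_def by (rule name_of(1)[OF inj less])
      show "e (jn a) i = nm (a i)" if "i < lam" for i unfolding jn_def by (rule name_of(2)[OF inj less that])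
    qed
    \<comment> \<open>A colour of \<open>b\<close> over the level of \<open>a\<close>. It depends on
      \<open>a\<close> only through that level, and \<open>K_ex\<close> guarantees that there is one
      whenever \<open>b\<close> is above \<open>a\<close>.\<close>
    define F where "F a b = (SOME \<delta>. \<delta> < \<kappa> \<and> K (lev a) \<delta> (lev b) (jn b))" for a b
    have F: "F a b < \<kappa> \<and> K (lev a) (F a b) (lev b) (jn b)"
      if a: "a \<in> tree_pow lam T lt" and b: "b \<in> tree_pow lam T lt" and ab: "less_pow lam lt a b" for a b
    proof -
      have l: "L (lev a) (e (jn a) i) (lev b) (e (jn b) i)" if "i < lam" for i
      proof -
        have "lt (a i) (b i)" using ab that unfolding less_pow_def by blast
        then show ?thesis unfolding lt_iff using pow(2,3)[OF a that] pow(2,3)[OF b that] by simp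
      qed
      have "lev a < lev b" using L_less[OF l[OF zero_lam]] by blast
      then have "\<exists>\<delta><\<kappa>. K (lev a) \<delta> (lev b) (jn b)" using K_ex[OF pow(1)[OF a] pow(1)[OF b]] l by blast
      then show ?thesis unfolding F_def by (rule someI_ex)
    qed
    have less: "\<exists>i<lam. lt (b i) (c i)"
      if b: "b \<in> tree_pow lam T lt" and c: "c \<in> tree_pow lam T lt" and lv: "lev b < lev c"
        and Ks: "K \<alpha> \<delta> (lev b) (jn b)" "K \<alpha> \<delta> (lev c) (jn c)" for b c \<alpha> \<delta>
    proof -
      obtain i where i: "i < lam" "L (lev b) (e (jn b) i) (lev c) (e (jn c) i)" using K_less[OF Ks lv] by blast
      then have "lt (b i) (c i)" unfolding lt_iff using pow(2,3)[OF b i(1)] pow(2,3)[OF c i(1)] by simp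
      then show ?thesis using i(1) by blast
    qed
    have comp: "\<exists>i<lam. b i = c i \<or> lt (b i) (c i) \<or> lt (c i) (b i)"
      if a: "a \<in> tree_pow lam T lt" and b: "b \<in> tree_pow lam T lt" and c: "c \<in> tree_pow lam T lt"
        and ab: "less_pow lam lt a b" and ac: "less_pow lam lt a c" and eq: "F a b = F a c" for a b c
    proof -
      have Kb: "K (lev a) (F a b) (lev b) (jn b)" using F[OF a b ab] by blast
      have Kc: "K (lev a) (F a b) (lev c) (jn c)" using F[OF a c ac] eq by simp
      show ?thesis
      proof (cases "lev b" "lev c" rule: linorder_cases)
        case equal
        then obtain i where i: "i < lam" "e (jn b) i = e (jn c) i" using K_eq Kb Kc by metis
        then have "b i = c i" using eqI[OF pow(4)[OF b i(1)] pow(4)[OF c i(1)]] pow(2,3)[OF b i(1)] pow(2,3)[OF c i(1)] equal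
          by simp
        then show ?thesis using i(1) by blast
      qed (use less[OF b c _ Kb Kc] less[OF c b _ Kc Kb] in blast)+
    qed
    show ?thesis using F comp by (intro exI[of _ F]) blast
  qed
  moreover have "complete_tree \<kappa> T lt"
    unfolding complete_tree_def
  proof (intro allI impI, elim conjE)
    fix C assume C: "C \<subseteq> T" "\<forall>u\<in>C. \<forall>v\<in>C. u = v \<or> lt u v \<or> lt v u" "C \<prec> {..<\<kappa>}"
    \<comment> \<open>Distinct members of a chain have distinct levels, so the chain is a function
      on its set of levels, the form in which \<open>L_complete\<close> takes it.\<close>
    define b where "b \<alpha> = nm (SOME u. u \<in> C \<and> lv u = \<alpha>)" for \<alpha>
    have b: "b (lv u) = nm u" if u: "u \<in> C" for u
    proof -
      have "(SOME v. v \<in> C \<and> lv v = lv u) = u"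
      proof (rule some_equality)
        show "v = u" if "v \<in> C \<and> lv v = lv u" for v using C(2) u that lt_lv by (metis less_irrefl)
      qed (use u in simp)
      then show ?thesis unfolding b_def by simp
    qed
    have "small (lv ` C)" using C(3) small_iff by (intro small_image) blast
    then have "\<exists>\<beta> k. k < \<kappa> \<and> (\<forall>\<xi>\<in>lv ` C. L \<xi> (b \<xi>) \<beta> k)"
    proof (rule L_complete)
      show "b \<xi> < \<kappa>" if "\<xi> \<in> lv ` C" for \<xi> using that b nm C(1) by auto
      fix \<xi> \<xi>' assume "\<xi> \<in> lv ` C" "\<xi>' \<in> lv ` C" "\<xi> < \<xi>'"
      then obtain u v where uv: "u \<in> C" "v \<in> C" "\<xi> = lv u" "\<xi>' = lv v" "lv u < lv v" by blast
      then have "lt u v" using C(2) lt_lv[of v u] by (metis less_asym less_irrefl)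
      then show "L \<xi> (b \<xi>) \<xi>' (b \<xi>')" using uv b unfolding lt_iff by simp
    qed
    then obtain \<beta> k where k: "k < \<kappa>" "\<And>\<xi>. \<xi> \<in> lv ` C \<Longrightarrow> L \<xi> (b \<xi>) \<beta> k" by blast
    then obtain x where x: "x \<in> T" "lv x = \<beta>" "nm x = k" using node by blast
    have "lt u x" if "u \<in> C" for u using k(2)[of "lv u"] b[OF that] that x unfolding lt_iff by simp
    then show "\<exists>x\<in>T. \<forall>u\<in>C. u = x \<or> lt u x" using x(1) by blast
  qed
  ultimately show ?thesis unfolding super_souslin_def by blast
qed

end

theorem theoremC:
  fixes lam \<kappa> :: "'i::wellorder"
  assumes "infinite_cardinal lam"
    and "card_succ {..<lam} {..<\<kappa>}"
    and "card_succ {..<\<kappa>} (UNIV :: 'i set)"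
    and "FA \<kappa>"
  shows "\<exists>(T :: 'i set) lt. super_souslin lam \<kappa> T lt \<and> complete_tree \<kappa> T lt"
proof -
  interpret successor_cardinals lam \<kappa> by unfold_locales (fact assms)+
  obtain e where "tree_index lam \<kappa> e" using ex_tree_index[OF assms(4)] by blast
  then interpret tree_index lam \<kappa> e .
  obtain L K where "generic_tree lam \<kappa> e L K" using ex_generic_tree[OF assms(4)] by blast
  then interpret generic_tree lam \<kappa> e L K .
  have "infinite (UNIV :: 'i set)" using infinite_kappa by (rule infinite_super[OF subset_UNIV])
  then have "(UNIV :: 'i set) \<times> (UNIV :: 'i set) \<lesssim> (UNIV :: 'i set)"
    by (intro times_lepoll_infinite lepoll_refl)
  \<comment> \<open>An injective pairing turns the nodes, which are pairs of a level and a name,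
    into elements of the index type.\<close>
  then obtain c :: "'i \<times> 'i \<Rightarrow> 'i" where c: "inj c" unfolding lepoll_def by auto
  define T where "T = c ` (UNIV \<times> {..<\<kappa>})"
  have "bij_betw (\<lambda>u. (fst (inv c u), snd (inv c u))) T (UNIV \<times> {..<\<kappa>})"
    by (rule bij_betw_byWitness[where f' = c]) (auto simp: T_def inv_f_f[OF c])
  from super_souslin_complete[OF this refl] show ?thesis by blast
qed

end
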